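(* Let $p\in[1,+\infty)$, $T>0$, and let $V:[0,T]\times\mathcal{P}_p(\mathbb{R}^d)\rightrightarrows C^0(\mathbb{R}^d,\mathbb{R}^d)$ be a set-valued map with convex images satisfying Hypotheses (CI) (listed in the context). Then there exists a subset $\mathcal{T}\subset(0,T)$ of full Lebesgue measure $\mathcal{L}^1$ such that for every $\tau\in\mathcal{T}$, all $\mu_\tau\in\mathcal{P}_p(\mathbb{R}^d)$, each solution $\mu(\cdot)\in AC([0,T],\mathcal{P}_p(\mathbb{R}^d))$ of $$\partial_t\mu(t)\in-\mathrm{div}_x\big(V(t,\mu(t))\mu(t)\big),\qquad \mu(\tau)=\mu_\tau,$$ any $\varepsilon>0$ and every sequence $h_i\to0$ of real numbers, there exists an element $v_\tau^\varepsilon\in V(\tau,\mu_\tau)$ such that $$W_p\Big(\mu(\tau+h_{i_k}^\varepsilon),(\mathrm{Id}+h_{i_k}^\varepsilon v_\tau^\varepsilon)_\sharp\mu_\tau\Big)\le\varepsilon|h_{i_k}^\varepsilon|$$ along a subsequence $h_{i_k}^\varepsilon\to0$ of $(h_i)$, which depends both on $v_\tau^\varepsilon\in V(\tau,\mu_\tau)$ and $\varepsilon>0$.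
   Context: $\mathcal{P}_p(\mathbb{R}^d)$ is the set of Borel probability measures on $\mathbb{R}^d$ with finite moment $\mathcal{M}_p(\mu)=(\int|x|^p\,d\mu(x))^{1/p}$, endowed with the Wasserstein distance $W_p$ of order $p$; $f_\sharp\mu$ is the image measure of $\mu$ through $f$. $C^0(\mathbb{R}^d,\mathbb{R}^d)$ is endowed with the separable Fréchet topology of locally uniform convergence, induced by $d_{cc}(v,w)=\sum_{k\ge1}2^{-k}\min\{1,\|v-w\|_{C^0(B(0,k),\mathbb{R}^d)}\}$. We write $d_{\sup}(v,w)=\sup_{x\in\mathbb{R}^d}|v(x)-w(x)|\in[0,+\infty]$, and $\mathrm{Lip}(v;\mathbb{R}^d)$ for the Lipschitz constant of $v$. A set-valued map $F:I\rightrightarrows X$ is $\mathcal{L}^1$-measurable if $\{t\in I: F(t)\cap O\neq\emptyset\}$ is $\mathcal{L}^1$-measurable for every open $O\subset X$. Hypotheses (CI): (i) for any $\mu\in\mathcal{P}_p(\mathbb{R}^d)$, the map $t\in[0,T]\rightrightarrows V(t,\mu)\subset C^0(\mathbb{R}^d,\mathbb{R}^d)$ is $\mathcal{L}^1$-measurable with closed nonempty images; (ii) there is $m(\cdot)\in L^1([0,T],\mathbb{R}_+)$ such that for $\mathcal{L}^1$-a.e. $t\in[0,T]$, any $\mu\in\mathcal{P}_p(\mathbb{R}^d)$, every $v\in V(t,\mu)$ and all $x\in\mathbb{R}^d$, $|v(x)|\le m(t)(1+|x|+\mathcal{M}_p(\mu))$; (iii) there is $l(\cdot)\in L^1([0,T],\mathbb{R}_+)$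 such that for $\mathcal{L}^1$-a.e. $t\in[0,T]$, any $\mu\in\mathcal{P}_p(\mathbb{R}^d)$ and every $v\in V(t,\mu)$, $\mathrm{Lip}(v;\mathbb{R}^d)\le l(t)$; (iv) there is $L(\cdot)\in L^1([0,T],\mathbb{R}_+)$ such that for $\mathcal{L}^1$-a.e. $t\in[0,T]$, any $\mu,\nu\in\mathcal{P}_p(\mathbb{R}^d)$ and each $v\in V(t,\mu)$, there is $w\in V(t,\nu)$ with $d_{\sup}(v,w)\le L(t)W_p(\mu,\nu)$. Solutions: an absolutely continuous curve $\mu(\cdot)\in AC([0,T],\mathcal{P}_p(\mathbb{R}^d))$ with $\mu(\tau)=\mu_\tau$ solves the continuity inclusion if there is an $\mathcal{L}^1$-measurable selection $t\in[0,T]\mapsto v(t)\in V(t,\mu(t))$ (belonging to $V(t,\mu(t))$ for a.e. $t$) such that $\partial_t\mu(t)+\mathrm{div}_x(v(t)\mu(t))=0$ in the sense of distributions: $\int_0^T\int_{\mathbb{R}^d}(\partial_t\varphi(t,x)+\langle\nabla_x\varphi(t,x),v(t,x)\rangle)\,d\mu(t)(x)\,dt=0$ for all $\varphi\in C_c^\infty((0,T)\times\mathbb{R}^d,\mathbb{R})$. *)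

theory Defs
  imports "HOL-Probability.Probability"
begin

text \<open>Throughout, the Euclidean space \<open>\<real>\<^sup>d\<close> is a type of class \<open>euclidean_space\<close>, and a
  set-valued map \<open>V : [0,T] \<times> P\<^sub>p(\<real>\<^sup>d) \<rightrightarrows> C\<^sup>0(\<real>\<^sup>d,\<real>\<^sup>d)\<close> is a total function
  into sets of functions, used only for \<open>t \<in> {0..T}\<close> and \<open>\<mu> \<in> Pp p\<close>.\<close>

section \<open>Wasserstein spaces\<close>

definition Pp :: "real \<Rightarrow> ('a::euclidean_space) measure set" where
  "Pp p = {\<mu>. sets \<mu> = sets borel \<and> prob_space \<mu> \<and> integrable \<mu> (\<lambda>x. norm x powr p)}"

definition moment :: "real \<Rightarrow> ('a::euclidean_space) measure \<Rightarrow> real" where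
  "moment p \<mu> = (LINT x|\<mu>. norm x powr p) powr (1 / p)"

definition couplings ::
    "('a::euclidean_space) measure \<Rightarrow> 'a measure \<Rightarrow> ('a \<times> 'a) measure set" where
  "couplings \<mu> \<nu> = {\<gamma>. sets \<gamma> = sets borel \<and> distr \<gamma> borel fst = \<mu> \<and> distr \<gamma> borel snd = \<nu>}"

definition transport_cost ::
    "real \<Rightarrow> ('a::euclidean_space) measure \<Rightarrow> 'a measure \<Rightarrow> ennreal" where
  "transport_cost p \<mu> \<nu> =
     (INF \<gamma>\<in>couplings \<mu> \<nu>. \<integral>\<^sup>+z. ennreal (dist (fst z) (snd z) powr p) \<partial>\<gamma>)"

text \<open>The distance is extended-real valued, so that an upper bound on it is never satisfied
  merely because the transport cost is infinite.\<close>

definition Wasserstein ::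
    "real \<Rightarrow> ('a::euclidean_space) measure \<Rightarrow> 'a measure \<Rightarrow> ennreal" where
  "Wasserstein p \<mu> \<nu> =
     (if transport_cost p \<mu> \<nu> = \<top> then \<top>
      else ennreal (enn2real (transport_cost p \<mu> \<nu>) powr (1 / p)))"

section \<open>Continuous vector fields\<close>

definition C0 :: "(('a::euclidean_space) \<Rightarrow> 'a) set" where
  "C0 = {v. continuous_on UNIV v}"

text \<open>The sup-norm on balls is taken in \<open>[0,+\<infinity>]\<close> before truncating at 1, which makes
  \<open>d_cc\<close> total: \<open>Metric_space\<close> asks for nonnegativity and symmetry off the carrier too.
  The sum over \<open>k \<ge> 1\<close> is shifted to start at 0.\<close>

definition sup_ball ::
    "nat \<Rightarrow> (('a::euclidean_space) \<Rightarrow> 'a) \<Rightarrow> ('a \<Rightarrow> 'a) \<Rightarrow> ennreal" where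
  "sup_ball k v w = (SUP x\<in>cball 0 (real k). ennreal (norm (v x - w x)))"

definition d_cc :: "(('a::euclidean_space) \<Rightarrow> 'a) \<Rightarrow> ('a \<Rightarrow> 'a) \<Rightarrow> real" where
  "d_cc v w = (\<Sum>k. (1 / 2) ^ Suc k * enn2real (min 1 (sup_ball (Suc k) v w)))"

definition d_sup :: "(('a::euclidean_space) \<Rightarrow> 'a) \<Rightarrow> ('a \<Rightarrow> 'a) \<Rightarrow> ennreal" where
  "d_sup v w = (SUP x. ennreal (norm (v x - w x)))"

lemma d_cc_term_bounds:
  "0 \<le> enn2real (min 1 (sup_ball k v w))" "enn2real (min 1 (sup_ball k v w)) \<le> 1"
proof -
  show "enn2real (min 1 (sup_ball k v w)) \<le> 1"
    by (rule enn2real_leI) auto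
qed simp

lemma d_cc_summable: "summable (\<lambda>k. (1 / 2) ^ Suc k * enn2real (min 1 (sup_ball (Suc k) v w)))"
proof (rule summable_comparison_test')
  show "summable (\<lambda>k. (1 / 2 :: real) ^ Suc k)"
    by (simp add: summable_mult summable_geometric)
  show "norm ((1 / 2) ^ Suc k * enn2real (min 1 (sup_ball (Suc k) v w))) \<le> (1 / 2) ^ Suc k" for k
    using d_cc_term_bounds[of "Suc k" v w]
    by (simp add: abs_mult mult_left_le del: power_Suc)
qed

lemma sup_ball_triangle: "sup_ball k u w \<le> sup_ball k u v + sup_ball k v w"
  unfolding sup_ball_def[of k u w]
proof (rule SUP_least)
  fix x :: 'a assume x: "x \<in> cball 0 (real k)"
  have "norm (u x - w x) \<le> norm (u x - v x) + norm (v x - w x)"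
    using norm_triangle_ineq[of "u x - v x" "v x - w x"] by simp
  then have "ennreal (norm (u x - w x)) \<le> ennreal (norm (u x - v x)) + ennreal (norm (v x - w x))"
    by (simp add: ennreal_plus[symmetric] ennreal_leI del: ennreal_plus)
  also have "\<dots> \<le> sup_ball k u v + sup_ball k v w"
    unfolding sup_ball_def by (intro add_mono SUP_upper x)
  finally show "ennreal (norm (u x - w x)) \<le> sup_ball k u v + sup_ball k v w" .
qed

lemma d_cc_term_triangle:
  "enn2real (min 1 (sup_ball k u w))
     \<le> enn2real (min 1 (sup_ball k u v)) + enn2real (min 1 (sup_ball k v w))"
proof -
  have aux: "min 1 c \<le> min 1 a + min 1 b" if "c \<le> a + b" for a b c :: ennreal
  proof (cases "1 \<le> a \<or> 1 \<le> b")
    case True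
    then show ?thesis
      by (metis add.commute add_increasing2 min.cobounded1 min.absorb1 zero_le order_trans)
  next
    case False
    then show ?thesis
      using that by (simp add: min.absorb2 not_le less_imp_le min.coboundedI2)
  qed
  have fin: "min 1 (sup_ball k f g) < \<top>" for f g :: "'a \<Rightarrow> 'a"
    by (rule le_less_trans[of _ 1]) auto
  have "enn2real (min 1 (sup_ball k u w))
      \<le> enn2real (min 1 (sup_ball k u v) + min 1 (sup_ball k v w))"
    by (rule enn2real_mono[OF aux[OF sup_ball_triangle]]) (use fin in simp)
  also have "\<dots> = enn2real (min 1 (sup_ball k u v)) + enn2real (min 1 (sup_ball k v w))"
    by (rule enn2real_plus) (use fin in auto)
  finally show ?thesis .
qed

lemma Metric_space_d_cc: "Metric_space (C0 :: (('a::euclidean_space) \<Rightarrow> 'a) set) d_cc"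
proof (rule Metric_space.intro)
  fix u v w :: "'a \<Rightarrow> 'a"
  let ?t = "\<lambda>v w k. (1 / 2) ^ Suc k * enn2real (min 1 (sup_ball (Suc k) v w))"
  show "0 \<le> d_cc v w"
    unfolding d_cc_def by (intro suminf_nonneg d_cc_summable) auto
  have "sup_ball k v w = sup_ball k w v" for k
    by (simp add: sup_ball_def norm_minus_commute)
  then show "d_cc v w = d_cc w v"
    by (simp add: d_cc_def)
  show "d_cc v w = 0 \<longleftrightarrow> v = w"
  proof
    assume "v = w"
    then have "sup_ball k v w = 0" for k
      by (simp add: sup_ball_def bot_ennreal)
    then show "d_cc v w = 0"
      by (simp add: d_cc_def)
  next
    assume "d_cc v w = 0"
    then have z: "?t v w k = 0" for k
      unfolding d_cc_def using suminf_eq_zero_iff[OF d_cc_summable, of v w] by simp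
    show "v = w"
    proof
      fix x :: 'a
      obtain k where k: "norm x \<le> real k"
        using real_arch_simple by blast
      have "min 1 (sup_ball (Suc k) v w) < \<top>"
        by (rule le_less_trans[of _ 1]) auto
      then have "min 1 (sup_ball (Suc k) v w) = 0"
        using z[of k] by (auto simp: enn2real_eq_0_iff)
      then have "sup_ball (Suc k) v w = 0"
        by (simp add: min_def split: if_splits)
      moreover have "ennreal (norm (v x - w x)) \<le> sup_ball (Suc k) v w"
        unfolding sup_ball_def by (rule SUP_upper) (use k in simp)
      ultimately show "v x = w x"
        by simp
    qed
  qed
  have "d_cc u w \<le> (\<Sum>k. ?t u v k + ?t v w k)"
    unfolding d_cc_def
  proof (rule suminf_le)
    show "?t u w k \<le> ?t u v k + ?t v w k" for k
      using d_cc_term_triangle[of "Suc k" u w v]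
      by (simp add: distrib_left[symmetric] del: power_Suc)
  qed (intro summable_add d_cc_summable)+
  also have "\<dots> = d_cc u v + d_cc v w"
    unfolding d_cc_def by (rule suminf_add[symmetric]) (rule d_cc_summable)+
  finally show "d_cc u w \<le> d_cc u v + d_cc v w" .
qed

definition cc_topology :: "(('a::euclidean_space) \<Rightarrow> 'a) topology" where
  "cc_topology = Metric_space.mtopology C0 d_cc"

definition convex_fields :: "(('a::euclidean_space) \<Rightarrow> 'a) set \<Rightarrow> bool" where
  "convex_fields F \<longleftrightarrow>
     (\<forall>v\<in>F. \<forall>w\<in>F. \<forall>s\<in>{0..1::real}. (\<lambda>x. (1 - s) *\<^sub>R v x + s *\<^sub>R w x) \<in> F)"

section \<open>Hypotheses (CI)\<close>

definition set_valued_measurable :: "real \<Rightarrow> (real \<Rightarrow> (('a::euclidean_space) \<Rightarrow> 'a) set) \<Rightarrow> bool" where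
  "set_valued_measurable T F \<longleftrightarrow>
     (\<forall>U. openin cc_topology U \<longrightarrow> {t\<in>{0..T}. F t \<inter> U \<noteq> {}} \<in> sets lebesgue)"

definition L1_nonneg :: "real \<Rightarrow> (real \<Rightarrow> real) \<Rightarrow> bool" where
  "L1_nonneg T g \<longleftrightarrow> set_integrable lebesgue {0..T} g \<and> (\<forall>t\<in>{0..T}. 0 \<le> g t)"

definition CI ::
    "real \<Rightarrow> real \<Rightarrow> (real \<Rightarrow> ('a::euclidean_space) measure \<Rightarrow> ('a \<Rightarrow> 'a) set) \<Rightarrow> bool" where
  "CI p T V \<longleftrightarrow>
     (\<forall>\<mu>\<in>Pp p. set_valued_measurable T (\<lambda>t. V t \<mu>) \<and>
        (\<forall>t\<in>{0..T}. closedin cc_topology (V t \<mu>) \<and> V t \<mu> \<noteq> {})) \<and>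
     (\<exists>m. L1_nonneg T m \<and>
        (AE t in lebesgue_on {0..T}. \<forall>\<mu>\<in>Pp p. \<forall>v\<in>V t \<mu>. \<forall>x.
           norm (v x) \<le> m t * (1 + norm x + moment p \<mu>))) \<and>
     (\<exists>l. L1_nonneg T l \<and>
        (AE t in lebesgue_on {0..T}. \<forall>\<mu>\<in>Pp p. \<forall>v\<in>V t \<mu>. (l t)-lipschitz_on UNIV v)) \<and>
     (\<exists>L. L1_nonneg T L \<and>
        (AE t in lebesgue_on {0..T}. \<forall>\<mu>\<in>Pp p. \<forall>\<nu>\<in>Pp p. \<forall>v\<in>V t \<mu>. \<exists>w\<in>V t \<nu>.
           d_sup v w \<le> ennreal (L t) * Wasserstein p \<mu> \<nu>))"

section \<open>Solutions of the continuity inclusion\<close>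

definition AC_curve :: "real \<Rightarrow> real \<Rightarrow> (real \<Rightarrow> ('a::euclidean_space) measure) \<Rightarrow> bool" where
  "AC_curve p T \<mu> \<longleftrightarrow>
     (\<forall>t\<in>{0..T}. \<mu> t \<in> Pp p) \<and>
     (\<exists>g. L1_nonneg T g \<and>
        (\<forall>s t. 0 \<le> s \<and> s \<le> t \<and> t \<le> T \<longrightarrow>
           Wasserstein p (\<mu> s) (\<mu> t) \<le> ennreal (set_lebesgue_integral lebesgue {s..t} g)))"

fun C_k :: "nat \<Rightarrow> (('b::euclidean_space) \<Rightarrow> real) \<Rightarrow> bool" where
  "C_k 0 f \<longleftrightarrow> continuous_on UNIV f"
| "C_k (Suc k) f \<longleftrightarrow>
     (\<forall>x. f differentiable at x) \<and> (\<forall>b\<in>Basis. C_k k (\<lambda>x. frechet_derivative f (at x) b))"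

text \<open>Elements of \<open>C\<^sub>c\<^sup>\<infinity>((0,T) \<times> \<real>\<^sup>d, \<real>)\<close>, extended by zero to \<open>\<real> \<times> \<real>\<^sup>d\<close>.\<close>

definition test_function :: "real \<Rightarrow> (real \<times> ('a::euclidean_space) \<Rightarrow> real) \<Rightarrow> bool" where
  "test_function T \<phi> \<longleftrightarrow>
     (\<forall>k. C_k k \<phi>) \<and>
     (\<exists>K. compact K \<and> K \<subseteq> {0<..<T} \<times> UNIV \<and> (\<forall>z. z \<notin> K \<longrightarrow> \<phi> z = 0))"

definition gradient :: "(('a::euclidean_space) \<Rightarrow> real) \<Rightarrow> 'a \<Rightarrow> 'a" where
  "gradient f x = (\<Sum>b\<in>Basis. frechet_derivative f (at x) b *\<^sub>R b)"

text \<open>A Bochner integral of a non-integrable function is 0 here, but both integrals below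
  converge whenever \<open>\<mu>\<close> is an absolutely continuous curve and \<open>v\<close> is a measurable selection of
  fields with the sublinear growth of \<open>CI\<close>, as \<open>\<phi>\<close> has compact support.\<close>

definition solves_continuity_equation ::
    "real \<Rightarrow> (real \<Rightarrow> ('a::euclidean_space) measure) \<Rightarrow> (real \<Rightarrow> 'a \<Rightarrow> 'a) \<Rightarrow> bool" where
  "solves_continuity_equation T \<mu> v \<longleftrightarrow>
     (\<forall>\<phi>. test_function T \<phi> \<longrightarrow>
        (LINT t|lebesgue_on {0..T}. (LINT x|\<mu> t.
           deriv (\<lambda>s. \<phi> (s, x)) t + gradient (\<lambda>y. \<phi> (t, y)) x \<bullet> v t x)) = 0)"

definition solves_continuity_inclusion ::
    "real \<Rightarrow> real \<Rightarrow> (real \<Rightarrow> ('a::euclidean_space) measure \<Rightarrow> ('a \<Rightarrow> 'a) set) \<Rightarrow>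
     (real \<Rightarrow> 'a measure) \<Rightarrow> bool" where
  "solves_continuity_inclusion p T V \<mu> \<longleftrightarrow>
     AC_curve p T \<mu> \<and>
     (\<exists>v. v \<in> lebesgue_on {0..T} \<rightarrow>\<^sub>M sigma C0 {U. openin cc_topology U} \<and>
        (AE t in lebesgue_on {0..T}. v t \<in> V t (\<mu> t)) \<and>
        solves_continuity_equation T \<mu> v)"

end

theory Submission
  imports Defs
begin

text \<open>Let \<open>\<mu>\<close> be a solution and \<open>u t \<in> V t (\<mu> t)\<close> its velocity. The fields \<open>u t\<close> are Lipschitz and
  grow linearly, with constants integrable in time, so they have a flow, and the solution is
  transported by it: \<open>\<mu> (\<tau> + h)\<close> is the image of \<open>\<mu> \<tau>\<close> under the flow map \<open>\<Phi> h\<close>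
  (\<open>curve_is_flow\<close>). The pair \<open>(\<Phi> h, id + h w)\<close> is then a coupling of the two measures to be
  compared, and it suffices that \<open>\<Phi> h x - x - h w x\<close> is small compared with \<open>h\<close> in
  \<open>L\<^sup>p(\<mu> \<tau>)\<close>. At a time where the averages of the growth and Lipschitz constants stay bounded,
  \<open>\<Phi> h x - x\<close> equals the time integral of \<open>u t x\<close> over the step up to \<open>O(h\<^sup>2)(1 + |x|)\<close>
  (\<open>flow_estimate\<close>). Far away, linear growth and the finite \<open>p\<close>-th moment of \<open>\<mu> \<tau>\<close> control the error.
  So the task is to find \<open>w \<in> V \<tau> (\<mu> \<tau>)\<close> which is uniformly close, on a large ball and along a
  subsequence of steps, to the time average of \<open>u\<close> (\<open>averages_accumulate\<close>).

  The averages are equi-Lipschitz, so closeness on a finite net of the ball is enough, and on the net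
  they accumulate at some point \<open>z\<close> of a finite-dimensional space. By convexity, \<open>z\<close> lies in the
  closure of the restrictions of \<open>V \<tau> (\<mu> \<tau>)\<close> to the net as soon as every linear functional is at most as
  large at \<open>z\<close> as its supremum over \<open>V \<tau> (\<mu> \<tau>)\<close> (\<open>convex_fields_separation\<close>). This bound
  comes from the continuity of \<open>V\<close> in the measure: \<open>u t\<close> is within \<open>L t * W\<^sub>p (\<mu> t, \<mu> \<tau>)\<close> of
  \<open>V t (\<mu> \<tau>)\<close>, so the average of a functional along \<open>u\<close> is at most the average of the support
  function of \<open>t \<mapsto> V t (\<mu> \<tau>)\<close>, up to a small error, and this average tends to the value at
  \<open>\<tau>\<close> when \<open>\<tau>\<close> is a Lebesgue point (\<open>average_ell_le\<close>).

  The set of good times must serve all solutions at once. It does, because countably many support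
  functions are enough: base points and coefficients are taken from a countable dense set,
  and the measure \<open>\<mu> \<tau>\<close> is replaced by a nearby element of a countable dense subset of the Wasserstein
  space (\<open>Pp_separable\<close>), which costs another error controlled by \<open>L\<close> (\<open>good_times\<close>).

  Negative steps are reduced to positive ones by reversing time around \<open>\<tau>\<close>: times are written as
  \<open>\<tau> + s * h\<close> with a sign \<open>s\<close> and \<open>h > 0\<close>.\<close>

section \<open>Smooth functions and mollification\<close>

abbreviation smooth :: "('b::euclidean_space \<Rightarrow> real) \<Rightarrow> bool" where
  "smooth f \<equiv> \<forall>k. C_k k f"

lemma C_k_SucI:
  assumes "\<And>x. (f has_derivative f' x) (at x)" "\<And>b. b \<in> Basis \<Longrightarrow> C_k k (\<lambda>x. f' x b)"
  shows "C_k (Suc k) f"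
proof -
  have "frechet_derivative f (at x) = f' x" for x
    by (rule frechet_derivative_at[OF assms(1), symmetric])
  then show ?thesis using assms by (auto simp: differentiable_def)
qed

lemma C_k_SucD: "C_k (Suc k) f \<Longrightarrow> C_k k f"
proof (induction k arbitrary: f)
  case 0
  then show ?case
    by (auto intro!: continuous_at_imp_continuous_on differentiable_imp_continuous_within)
next
  case (Suc k)
  then show ?case using C_k.simps(2) by blast
qed

lemma C_k_has_derivative:
  assumes "C_k (Suc k) f"
  shows "(f has_derivative frechet_derivative f (at x)) (at x)"
  using assms by (auto simp: frechet_derivative_works)

lemma C_k_const: "C_k k (\<lambda>x. c)"
proof (induction k arbitrary: c)
  case (Suc k)
  show ?case by (rule C_k_SucI[where f' = "\<lambda>x h. 0"]) (auto intro: Suc)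
qed auto

lemma C_k_add: "C_k k f \<Longrightarrow> C_k k g \<Longrightarrow> C_k k (\<lambda>x. f x + g x)"
proof (induction k arbitrary: f g)
  case 0 then show ?case by (auto intro: continuous_on_add)
next
  case (Suc k)
  show ?case
    by (rule C_k_SucI[OF has_derivative_add[OF C_k_has_derivative[OF Suc.prems(1)]
          C_k_has_derivative[OF Suc.prems(2)]]])
      (use Suc in auto)
qed

lemma C_k_mult: "C_k k f \<Longrightarrow> C_k k g \<Longrightarrow> C_k k (\<lambda>x. f x * g x)"
proof (induction k arbitrary: f g)
  case 0 then show ?case by (auto intro: continuous_on_mult)
next
  case (Suc k)
  show ?case
    by (rule C_k_SucI[OF has_derivative_mult[OF C_k_has_derivative[OF Suc.prems(1)]
          C_k_has_derivative[OF Suc.prems(2)]]])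
      (use Suc C_k_SucD[OF Suc.prems(1)] C_k_SucD[OF Suc.prems(2)] in \<open>auto intro!: C_k_add\<close>)
qed

lemma C_k_sum: "finite S \<Longrightarrow> (\<And>i. i \<in> S \<Longrightarrow> C_k k (f i)) \<Longrightarrow> C_k k (\<lambda>x. \<Sum>i\<in>S. f i x)"
  by (induction S rule: finite_induct) (auto intro: C_k_const C_k_add)

lemma C_k_prod: "finite S \<Longrightarrow> (\<And>i. i \<in> S \<Longrightarrow> C_k k (f i)) \<Longrightarrow> C_k k (\<lambda>x. \<Prod>i\<in>S. f i x)"
  by (induction S rule: finite_induct) (auto intro: C_k_const C_k_mult)

lemma C_k_compose_affine:
  fixes A :: "'b::euclidean_space \<Rightarrow> 'c::euclidean_space"
  assumes A: "bounded_linear A"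
  shows "C_k k f \<Longrightarrow> C_k k (\<lambda>z. f (A z + c))"
proof (induction k arbitrary: f)
  case 0
  then show ?case
    by (simp, intro continuous_on_compose2[of UNIV f UNIV "\<lambda>z. A z + c"])
      (auto intro!: continuous_intros linear_continuous_on[OF A])
next
  case (Suc k)
  let ?D = "\<lambda>z. frechet_derivative f (at z)"
  have f: "(f has_derivative ?D z) (at z)" for z by (rule C_k_has_derivative[OF Suc.prems])
  have "((\<lambda>z. A z + c) has_derivative A) (at z)" for z
    by (rule has_derivative_eq_rhs[OF has_derivative_add[OF bounded_linear_imp_has_derivative[OF A]
            has_derivative_const]]) simp
  then have 1: "((\<lambda>z. f (A z + c)) has_derivative (\<lambda>h. ?D (A z + c) (A h))) (at z)" for z
    using has_derivative_compose[of "\<lambda>z. A z + c" A z UNIV f "?D (A z + c)"] f by simp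
  show ?case
  proof (rule C_k_SucI[OF 1])
    fix b :: 'b assume "b \<in> Basis"
    have "?D (A z + c) (A b) = (\<Sum>i\<in>Basis. (A b \<bullet> i) * ?D (A z + c) i)" for z
    proof -
      have l: "linear (?D (A z + c))" using f has_derivative_linear by blast
      have "?D (A z + c) (A b) = ?D (A z + c) (\<Sum>i\<in>Basis. (A b \<bullet> i) *\<^sub>R i)"
        by (simp add: euclidean_representation)
      then show ?thesis by (simp add: linear_sum[OF l] linear_cmul[OF l])
    qed
    moreover have "C_k k (\<lambda>z. \<Sum>i\<in>Basis. (A b \<bullet> i) * ?D (A z + c) i)"
      using Suc by (intro C_k_sum C_k_mult C_k_const Suc.IH) auto
    ultimately show "C_k k (\<lambda>z. ?D (A z + c) (A b))" by simp
  qed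
qed

lemma C_k_real_SucI:
  fixes f :: "real \<Rightarrow> real"
  assumes "\<And>x. (f has_real_derivative f' x) (at x)" "C_k k f'"
  shows "C_k (Suc k) f"
  using assms by (intro C_k_SucI[of f "\<lambda>x h. f' x * h"]) (auto simp: has_field_derivative_def)

text \<open>The case \<open>n = 0\<close> is the classical smooth function that is flat at 0. The extra power of
  \<open>1 / x\<close> makes the family closed under differentiation, so that smoothness is one induction.\<close>

definition flat :: "nat \<Rightarrow> real \<Rightarrow> real" where
  "flat n x = (if 0 < x then inverse x ^ n * exp (- inverse x) else 0)"

lemma flat_tendsto_0: "(flat n \<longlongrightarrow> 0) (at_right 0)"
proof -
  have "((\<lambda>x. inverse x ^ n / exp (inverse x)) \<longlongrightarrow> (0::real)) (at_right 0)"
    by (rule filterlim_compose[OF tendsto_power_div_exp_0 filterlim_inverse_at_top_right])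
  then show ?thesis
    by (rule Lim_transform_eventually)
      (auto simp: eventually_at_filter flat_def exp_minus field_simps)
qed

lemma flat_has_derivative:
  "(flat n has_real_derivative flat (n + 2) x - real n * flat (n + 1) x) (at x)"
proof -
  consider "x < 0" | "x = 0" | "0 < x" by linarith
  then show ?thesis
  proof cases
    case 1
    have "((\<lambda>_. 0) has_real_derivative 0) (at x)" by simp
    then have "(flat n has_real_derivative 0) (at x)"
      by (rule has_field_derivative_transform_within_open[where S = "{..<0}"])
        (use 1 in \<open>auto simp: flat_def\<close>)
    then show ?thesis using 1 by (simp add: flat_def)
  next
    case 2
    have "((\<lambda>h. flat n h / h) \<longlongrightarrow> 0) (at_right 0)"
      by (rule Lim_transform_eventually[OF flat_tendsto_0[of "Suc n"]])
        (auto simp: eventually_at_filter flat_def field_simps)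
    moreover have "((\<lambda>h. flat n h / h) \<longlongrightarrow> 0) (at_left 0)"
      by (rule Lim_transform_eventually[OF tendsto_const])
        (auto simp: eventually_at_filter flat_def)
    ultimately have "((\<lambda>h. flat n h / h) \<longlongrightarrow> 0) (at 0)"
      using filterlim_split_at by blast
    then have "(flat n has_real_derivative 0) (at 0)"
      by (simp add: has_field_derivative_iff flat_def)
    then show ?thesis using 2 by (simp add: flat_def)
  next
    case 3
    have "((\<lambda>x. inverse x ^ n * exp (- inverse x)) has_real_derivative
        flat (n + 2) x - real n * flat (n + 1) x) (at x)"
    proof -
      have i: "(inverse has_real_derivative - (inverse x ^ 2)) (at x)"
        using DERIV_inverse[of x] 3 by (simp add: power_inverse numeral_2_eq_2)
      have e: "((\<lambda>x. exp (- inverse x)) has_real_derivative exp (- inverse x) * inverse x ^ 2) (at x)"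
        using DERIV_chain2[OF DERIV_exp DERIV_minus[OF i]] by simp
      have "real n * (- (inverse x ^ 2) * inverse x ^ (n - Suc 0)) = - (real n * inverse x ^ (n + 1))"
        by (cases n) (auto simp: power2_eq_square)
      then have p: "((\<lambda>x. inverse x ^ n) has_real_derivative - (real n * inverse x ^ (n + 1))) (at x)"
        using DERIV_power[OF i, of n] by (simp only:)
      show ?thesis
        using DERIV_mult[OF p e] 3 by (simp add: flat_def power2_eq_square algebra_simps)
    qed
    then show ?thesis
      by (rule has_field_derivative_transform_within_open[where S = "{0<..}"])
        (use 3 in \<open>auto simp: flat_def\<close>)
  qed
qed

lemma C_k_flat: "C_k k (flat n)"
proof (induction k arbitrary: n)
  case 0
  show ?case using flat_has_derivative
    by (auto intro!: continuous_at_imp_continuous_on DERIV_isCont)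
next
  case (Suc k)
  have "C_k k (\<lambda>x. flat (n + 2) x + (- real n) * flat (n + 1) x)"
    by (intro C_k_add C_k_mult C_k_const Suc)
  then show ?case
    by (intro C_k_real_SucI[OF flat_has_derivative]) simp
qed

definition bump :: "real \<Rightarrow> real" where
  "bump s = flat 0 (1 + s) * flat 0 (1 - s)"

lemma smooth_bump: "C_k k bump"
proof -
  have "C_k k (\<lambda>s. flat 0 (s + 1) * flat 0 (- s + 1))"
    by (intro C_k_mult C_k_compose_affine C_k_flat bounded_linear_ident bounded_linear_minus)
  then show ?thesis by (simp add: bump_def[abs_def] add.commute)
qed

lemma bump_nonneg: "0 \<le> bump s" and bump_pos: "\<bar>s\<bar> < 1 \<Longrightarrow> 0 < bump s"
  and bump_zero: "1 \<le> \<bar>s\<bar> \<Longrightarrow> bump s = 0"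
  by (auto simp: bump_def flat_def)

text \<open>The step is the normalised antiderivative of a bump.\<close>

lemma smooth_step_exists:
  obtains \<theta> \<theta>' :: "real \<Rightarrow> real" where "smooth \<theta>" "\<And>s. (\<theta> has_real_derivative \<theta>' s) (at s)"
    "\<And>s. 0 \<le> \<theta>' s" "\<And>s. 1 \<le> \<bar>s\<bar> \<Longrightarrow> \<theta>' s = 0" "continuous_on UNIV \<theta>'"
    "\<And>s. s \<le> -1 \<Longrightarrow> \<theta> s = 0" "\<And>s. 1 \<le> s \<Longrightarrow> \<theta> s = 1" "\<And>s. 0 \<le> \<theta> s" "\<And>s. \<theta> s \<le> 1"
proof -
  have cont: "continuous_on UNIV bump" using smooth_bump[of 0] by simp
  then have ic: "isCont bump s" for s using continuous_on_eq_continuous_at by blast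
  obtain B where B: "\<And>s. (B has_real_derivative bump s) (at s)"
    using einterval_antiderivative[of "-\<infinity>" "\<infinity>" bump] ic
    by (auto simp: has_real_derivative_iff_has_vector_derivative)
  define d where "d = B 1 - B (-1)"
  obtain z where z: "-1 < z" "z < 1" "d = 2 * bump z"
    using MVT2[of "-1" 1 B bump] B unfolding d_def by auto
  then have d: "0 < d" using bump_pos[of z] by simp
  have mono: "B s \<le> B t" if "s \<le> t" for s t
    using DERIV_nonneg_imp_nondecreasing[OF that] B bump_nonneg by blast
  have lo: "B s = B (-1)" if "s \<le> -1" for s
  proof -
    have "\<exists>y. DERIV B x :> y \<and> y \<le> 0" if "s \<le> x" "x \<le> -1" for x
      using B[of x] bump_zero[of x] that by force
    then have "B (-1) \<le> B s" using DERIV_nonpos_imp_nonincreasing[OF that] by blast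
    then show ?thesis using mono[OF that] by simp
  qed
  have hi: "B s = B 1" if "1 \<le> s" for s
  proof -
    have "\<exists>y. DERIV B x :> y \<and> y \<le> 0" if "x \<le> s" "1 \<le> x" for x
      using B[of x] bump_zero[of x] that by force
    then have "B s \<le> B 1" using DERIV_nonpos_imp_nonincreasing[OF that] by blast
    then show ?thesis using mono[OF that] by simp
  qed
  define \<theta> where "\<theta> s = (B s - B (-1)) / d" for s
  have D: "(\<theta> has_real_derivative bump s / d) (at s)" for s
    unfolding \<theta>_def using d by (auto intro!: derivative_eq_intros B)
  have "C_k k \<theta>" for k
  proof (cases k)
    case 0
    then show ?thesis using D by (auto intro!: continuous_at_imp_continuous_on DERIV_isCont)
  next
    case (Suc j)
    have "C_k j (\<lambda>s. (1 / d) * bump s)" by (intro C_k_mult C_k_const smooth_bump)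
    then show ?thesis unfolding Suc by (intro C_k_real_SucI[OF D]) simp
  qed
  moreover have "0 \<le> \<theta> s" "\<theta> s \<le> 1" for s
  proof -
    have "B (-1) \<le> B s" using lo[of s] mono[of "-1" s] by linarith
    then show "0 \<le> \<theta> s" unfolding \<theta>_def using d by (intro divide_nonneg_pos) auto
    have "B s \<le> B 1" using hi[of s] mono[of s 1] by linarith
    then show "\<theta> s \<le> 1" unfolding \<theta>_def using d by (simp add: d_def divide_le_eq)
  qed
  moreover have "\<theta> s = 0" if "s \<le> -1" for s using lo[OF that] by (simp add: \<theta>_def)
  moreover have "\<theta> s = 1" if "1 \<le> s" for s using hi[OF that] d by (simp add: \<theta>_def d_def)
  moreover have "continuous_on UNIV (\<lambda>s. bump s / d)" using cont d by (auto intro!: continuous_intros)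
  moreover have "0 \<le> bump s / d" for s by (rule divide_nonneg_pos[OF bump_nonneg d])
  moreover have "bump s / d = 0" if "1 \<le> \<bar>s\<bar>" for s using bump_zero[OF that] by simp
  ultimately show ?thesis
    using D by (intro that[of \<theta> "\<lambda>s. bump s / d"]) blast+
qed

lemma smooth_gradient:
  assumes "smooth f"
  shows "(f has_derivative (\<lambda>h. gradient f x \<bullet> h)) (at x)" "continuous_on UNIV (gradient f)"
    "continuous_on UNIV f" "\<And>b. b \<in> Basis \<Longrightarrow> smooth (\<lambda>x. gradient f x \<bullet> b)"
proof -
  have f: "(f has_derivative frechet_derivative f (at x)) (at x)" for x
    using assms C_k_has_derivative[of 0 f] by blast
  have g: "gradient f x \<bullet> b = frechet_derivative f (at x) b" if "b \<in> Basis" for x b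
    using that by (simp add: gradient_def inner_sum_left inner_Basis sum.delta' if_distrib cong: if_cong)
  have "frechet_derivative f (at x) h = gradient f x \<bullet> h" for h
  proof -
    have l: "linear (frechet_derivative f (at x))" using f has_derivative_linear by blast
    have "frechet_derivative f (at x) h = frechet_derivative f (at x) (\<Sum>i\<in>Basis. (h \<bullet> i) *\<^sub>R i)"
      by (simp add: euclidean_representation)
    then show ?thesis
      by (simp add: linear_sum[OF l] linear_cmul[OF l] gradient_def inner_sum_left inner_sum_right inner_commute
          mult.commute)
  qed
  then show "(f has_derivative (\<lambda>h. gradient f x \<bullet> h)) (at x)" using f[of x] by presburger
  have s: "C_k k (\<lambda>x. gradient f x \<bullet> b)" if "b \<in> Basis" for k b
    using assms[rule_format, of "Suc k"] that g[OF that] by simp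
  then show "\<And>b. b \<in> Basis \<Longrightarrow> smooth (\<lambda>x. gradient f x \<bullet> b)" by blast
  show "continuous_on UNIV (gradient f)"
    using s[of _ 0] by (auto intro: continuous_on_componentwise[THEN iffD2])
  show "continuous_on UNIV f" using assms[rule_format, of 0] by simp
qed

lemma has_derivative_gradient_unique:
  assumes "(f has_derivative (\<lambda>h. g \<bullet> h)) (at x)"
  shows "gradient f x = g"
proof -
  have "frechet_derivative f (at x) = (\<lambda>h. g \<bullet> h)" by (rule frechet_derivative_at[OF assms, symmetric])
  then have "gradient f x = (\<Sum>b\<in>Basis. (g \<bullet> b) *\<^sub>R b)" unfolding gradient_def by metis
  then show ?thesis by (metis euclidean_representation)
qed

lemma integrable_vanish:
  fixes f :: "'a::euclidean_space \<Rightarrow> 'b::{banach, second_countable_topology}"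
  assumes "continuous_on UNIV f" "\<And>x. Q < norm x \<Longrightarrow> f x = 0"
  shows "integrable lborel f"
proof -
  have "(\<lambda>x. indicator (cball 0 Q) x *\<^sub>R f x) = f"
    using assms(2) by (force simp: indicator_def)
  then show ?thesis
    using borel_integrable_compact[of "cball 0 Q" f] continuous_on_subset[OF assms(1)] by simp
qed

text \<open>A product of one-dimensional bumps along the coordinates, scaled so that its support, a cube,
  lies in the ball of radius \<open>\<epsilon>\<close>.\<close>

lemma mollifier_exists:
  assumes "0 < \<epsilon>"
  obtains \<kappa> :: "'a::euclidean_space \<Rightarrow> real" where "smooth \<kappa>" "\<And>x. 0 \<le> \<kappa> x"
    "\<And>x. \<epsilon> < norm x \<Longrightarrow> \<kappa> x = 0" "integrable lborel \<kappa>" "(LINT x|lborel. \<kappa> x) = 1"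
proof -
  define d where "d = \<epsilon> / real DIM('a)"
  have d: "0 < d" using assms by (simp add: d_def)
  define \<rho> where "\<rho> = (\<lambda>x::'a. \<Prod>b\<in>Basis. bump (x \<bullet> (b /\<^sub>R d) + 0))"
  have sm: "smooth \<rho>"
    unfolding \<rho>_def
    by (intro allI C_k_prod finite_Basis C_k_compose_affine[of "\<lambda>x. x \<bullet> _"] bounded_linear_inner_left
        smooth_bump)
  have nn: "0 \<le> \<rho> x" for x unfolding \<rho>_def by (intro prod_nonneg bump_nonneg ballI)
  have van: "\<rho> x = 0" if "\<epsilon> < norm x" for x
  proof -
    have "\<exists>b\<in>Basis. d \<le> \<bar>x \<bullet> b\<bar>"
    proof (rule ccontr)
      assume "\<not> ?thesis"
      then have "(\<Sum>b\<in>Basis. \<bar>x \<bullet> b\<bar>) \<le> (\<Sum>b\<in>(Basis::'a set). d)" by (intro sum_mono) auto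
      then show False using norm_le_l1[of x] that by (simp add: d_def)
    qed
    then obtain b where b: "b \<in> Basis" "d \<le> \<bar>x \<bullet> b\<bar>" by blast
    then have "bump (x \<bullet> (b /\<^sub>R d) + 0) = 0"
      using d by (intro bump_zero) (simp add: abs_mult field_simps)
    then show ?thesis unfolding \<rho>_def using b(1) by (intro prod_zero) auto
  qed
  have cont: "continuous_on UNIV \<rho>" using sm[rule_format, of 0] by simp
  have int: "integrable lborel \<rho>" by (rule integrable_vanish[OF cont van])
  have "0 < \<rho> 0" unfolding \<rho>_def by (intro prod_pos) (auto intro: bump_pos)
  then have "(LINT x|lborel. \<rho> x) \<noteq> 0"
    using integral_nonneg_eq_0_iff_AE[OF int] nn
  proof -
    define U where "U = \<rho> -` {0<..}"
    have "open U" unfolding U_def using cont by (intro open_vimage) auto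
    moreover have "0 \<in> U" using \<open>0 < \<rho> 0\<close> by (simp add: U_def)
    ultimately have "emeasure lborel U \<noteq> 0"
      using open_not_negligible[of U] negligible_iff_emeasure0[of U] by auto
    moreover have "emeasure lborel U = 0" if "AE x in lborel. \<rho> x = 0"
    proof (rule AE_iff_null_sets[of U lborel, THEN iffD2, THEN null_setsD1])
      show "AE x in lborel. x \<notin> U" using that by eventually_elim (auto simp: U_def)
    qed (use \<open>open U\<close> in auto)
    ultimately show ?thesis using integral_nonneg_eq_0_iff_AE[OF int] nn by auto
  qed
  then have pos: "0 < (LINT x|lborel. \<rho> x)" using nn by (simp add: less_le)
  define c where "c = 1 / (LINT x|lborel. \<rho> x)"
  show ?thesis
  proof (rule that[of "\<lambda>x. c * \<rho> x"])
    show "smooth (\<lambda>x. c * \<rho> x)" using sm by (auto intro: C_k_mult C_k_const)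
    show "0 \<le> c * \<rho> x" for x using pos nn by (simp add: c_def)
    show "c * \<rho> x = 0" if "\<epsilon> < norm x" for x using van[OF that] by simp
    show "integrable lborel (\<lambda>x. c * \<rho> x)" using int by simp
    show "(LINT x|lborel. c * \<rho> x) = 1" using pos int by (simp add: c_def)
  qed
qed

definition conv :: "('a::euclidean_space \<Rightarrow> real) \<Rightarrow> ('a \<Rightarrow> real) \<Rightarrow> 'a \<Rightarrow> real" where
  "conv \<eta> \<kappa> x = (LINT y|lborel. \<eta> y * \<kappa> (x - y))"

lemma conv_eq_integral_cbox:
  assumes \<eta>: "continuous_on UNIV \<eta>" "\<And>x. x \<notin> cbox a b \<Longrightarrow> \<eta> x = 0"
    and \<kappa>: "continuous_on UNIV \<kappa>"
  shows "conv \<eta> \<kappa> x = integral (cbox a b) (\<lambda>y. \<eta> y * \<kappa> (x - y))"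
proof -
  have c: "continuous_on (cbox a b) (\<lambda>y. \<eta> y * \<kappa> (x - y))"
    by (intro continuous_intros continuous_on_subset[OF \<eta>(1)] continuous_on_compose2[OF \<kappa>]) auto
  have "(LINT y : cbox a b | lborel. \<eta> y * \<kappa> (x - y)) = integral (cbox a b) (\<lambda>y. \<eta> y * \<kappa> (x - y))"
    by (rule set_borel_integral_eq_integral(2))
      (use borel_integrable_compact[OF compact_cbox c] in \<open>simp add: set_integrable_def\<close>)
  moreover have "(\<lambda>y. indicator (cbox a b) y *\<^sub>R (\<eta> y * \<kappa> (x - y))) = (\<lambda>y. \<eta> y * \<kappa> (x - y))"
    using \<eta>(2) by (force simp: indicator_def)
  ultimately show ?thesis by (simp add: conv_def set_lebesgue_integral_def)
qed

lemma conv_has_derivative: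
  assumes \<eta>: "continuous_on UNIV \<eta>" "\<And>x. x \<notin> cbox a b \<Longrightarrow> \<eta> x = 0" and \<kappa>: "smooth \<kappa>"
  defines "G \<equiv> \<lambda>x. integral (cbox a b) (\<lambda>y. \<eta> y *\<^sub>R gradient \<kappa> (x - y))"
  shows "(conv \<eta> \<kappa> has_derivative (\<lambda>h. G x \<bullet> h)) (at x)"
    and "(\<lambda>y. \<eta> y *\<^sub>R gradient \<kappa> (x - y)) integrable_on cbox a b"
proof -
  note k = smooth_gradient[OF \<kappa>]
  have i: "(\<lambda>y. \<eta> y *\<^sub>R gradient \<kappa> (x - y)) integrable_on cbox a b" for x
    by (intro integrable_continuous continuous_intros continuous_on_subset[OF \<eta>(1)]
        continuous_on_compose2[OF k(2)]) auto
  then show "(\<lambda>y. \<eta> y *\<^sub>R gradient \<kappa> (x - y)) integrable_on cbox a b" .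
  have "((\<lambda>x. integral (cbox a b) (\<lambda>y. \<eta> y * \<kappa> (x - y))) has_derivative
      integral (cbox a b) (\<lambda>y. blinfun_inner_right (\<eta> y *\<^sub>R gradient \<kappa> (x - y)))) (at x within UNIV)"
  proof (rule leibniz_rule)
    fix x y
    have "((\<lambda>x. \<kappa> (x - y)) has_derivative (\<lambda>h. gradient \<kappa> (x - y) \<bullet> h)) (at x)"
    proof -
      have "((\<lambda>x. x - y) has_derivative (\<lambda>h. h)) (at x)" by (auto intro!: derivative_eq_intros)
      from has_derivative_compose[OF this k(1)] show ?thesis .
    qed
    then have "((\<lambda>x. \<eta> y * \<kappa> (x - y)) has_derivative (\<lambda>h. \<eta> y * (gradient \<kappa> (x - y) \<bullet> h))) (at x)"
      by (rule has_derivative_mult_right)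
    then show "((\<lambda>x. \<eta> y * \<kappa> (x - y)) has_derivative
        blinfun_apply (blinfun_inner_right (\<eta> y *\<^sub>R gradient \<kappa> (x - y)))) (at x within UNIV)"
      by (simp add: inner_scaleR_left[abs_def])
  next
    show "(\<lambda>y. \<eta> y * \<kappa> (x - y)) integrable_on cbox a b" for x
      by (intro integrable_continuous continuous_intros continuous_on_subset[OF \<eta>(1)]
          continuous_on_compose2[OF k(3)]) auto
    have "continuous_on (UNIV \<times> cbox a b) (\<lambda>z. \<eta> (snd z) *\<^sub>R gradient \<kappa> (fst z - snd z))"
      by (intro continuous_intros continuous_on_compose2[OF \<eta>(1)] continuous_on_compose2[OF k(2)]) auto
    then show "continuous_on (UNIV \<times> cbox a b)
        (\<lambda>(x, y). blinfun_inner_right (\<eta> y *\<^sub>R gradient \<kappa> (x - y)))"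
      unfolding case_prod_beta
      by (rule bounded_linear.continuous_on[OF bounded_linear_blinfun_inner_right])
  qed auto
  moreover have "integral (cbox a b) (\<lambda>y. blinfun_inner_right (\<eta> y *\<^sub>R gradient \<kappa> (x - y)))
      = blinfun_inner_right (G x)"
    unfolding G_def using integral_linear[OF i bounded_linear_blinfun_inner_right, of x]
    by (simp add: o_def)
  moreover have "(\<lambda>x. integral (cbox a b) (\<lambda>y. \<eta> y * \<kappa> (x - y))) = conv \<eta> \<kappa>"
    using conv_eq_integral_cbox[OF \<eta> k(3)] by auto
  ultimately show "(conv \<eta> \<kappa> has_derivative (\<lambda>h. G x \<bullet> h)) (at x)" by simp
qed

lemma smooth_conv:
  assumes \<eta>: "continuous_on UNIV \<eta>" "\<And>x. Q < norm x \<Longrightarrow> \<eta> x = 0"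
  shows "smooth \<kappa> \<Longrightarrow> C_k k (conv \<eta> \<kappa>)"
proof -
  obtain a b where "cball 0 Q \<subseteq> cbox a (b::'a)"
    using bounded_subset_cbox_symmetric[OF bounded_cball] by metis
  then have \<eta>': "\<eta> x = 0" if "x \<notin> cbox a b" for x
    using \<eta>(2)[of x] that by (force simp: not_le)
  show "smooth \<kappa> \<Longrightarrow> C_k k (conv \<eta> \<kappa>)"
  proof (induction k arbitrary: \<kappa>)
    case 0
    show ?case using conv_has_derivative(1)[OF \<eta>(1) \<eta>' 0]
      by (auto intro!: continuous_at_imp_continuous_on has_derivative_continuous)
  next
    case (Suc k)
    show ?case
    proof (rule C_k_SucI[OF conv_has_derivative(1)[OF \<eta>(1) \<eta>' Suc.prems]])
      fix i :: 'a assume i: "i \<in> Basis"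
      have "integral (cbox a b) (\<lambda>y. \<eta> y *\<^sub>R gradient \<kappa> (x - y)) \<bullet> i
          = conv \<eta> (\<lambda>x. gradient \<kappa> x \<bullet> i) x" for x
      proof -
        have "integral (cbox a b) (\<lambda>y. \<eta> y *\<^sub>R gradient \<kappa> (x - y)) \<bullet> i
            = integral (cbox a b) (\<lambda>y. \<eta> y * (gradient \<kappa> (x - y) \<bullet> i))"
          using integral_linear[OF conv_has_derivative(2)[OF \<eta>(1) \<eta>' Suc.prems, where x = x]
              bounded_linear_inner_left[of i]] by (simp add: o_def)
        also have "\<dots> = conv \<eta> (\<lambda>x. gradient \<kappa> x \<bullet> i) x"
          by (rule conv_eq_integral_cbox[OF \<eta>(1) \<eta>', symmetric])
            (auto intro!: continuous_intros smooth_gradient(2)[OF Suc.prems])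
        finally show ?thesis .
      qed
      then show "C_k k (\<lambda>x. integral (cbox a b) (\<lambda>y. \<eta> y *\<^sub>R gradient \<kappa> (x - y)) \<bullet> i)"
        using Suc.IH[OF smooth_gradient(4)[OF Suc.prems i]] by simp
    qed
  qed
qed

lemma gradient_vanish:
  assumes "\<And>x. Q < norm x \<Longrightarrow> f x = 0" "Q < norm x"
  shows "gradient f x = (0::'a::euclidean_space)"
proof (rule has_derivative_gradient_unique)
  have "((\<lambda>_. 0) has_derivative (\<lambda>h. 0 \<bullet> h)) (at x)" by simp
  moreover have "open {x::'a. Q < norm x}" by (intro open_Collect_less continuous_intros)
  ultimately show "(f has_derivative (\<lambda>h. 0 \<bullet> h)) (at x)"
    by (rule has_derivative_transform_within_open) (use assms in auto)
qed

lemma smooth_vanish_bounded: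
  fixes f :: "'a::euclidean_space \<Rightarrow> real"
  assumes "smooth f" "\<And>x. Q < norm x \<Longrightarrow> f x = 0"
  obtains K where "0 \<le> K" "\<And>x. norm (f x) \<le> K" "\<And>x. norm (gradient f x) \<le> K"
proof -
  note g = smooth_gradient[OF assms(1)]
  have "compact (f ` cball 0 Q)" "compact (gradient f ` cball 0 Q)"
    by (auto intro!: compact_continuous_image intro: continuous_on_subset[OF g(2)] continuous_on_subset[OF g(3)])
  then obtain K1 K2 where K: "\<And>x. x \<in> cball 0 Q \<Longrightarrow> norm (f x) \<le> K1"
    "\<And>x. x \<in> cball 0 Q \<Longrightarrow> norm (gradient f x) \<le> K2"
    by (metis bounded_iff compact_imp_bounded imageI)
  show ?thesis
  proof (rule that[of "max 0 (max K1 K2)"])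
    show "norm (f x) \<le> max 0 (max K1 K2)" for x
      using K(1)[of x] assms(2)[of x] by (cases "Q < norm x") auto
    show "norm (gradient f x) \<le> max 0 (max K1 K2)" for x
      using K(2)[of x] gradient_vanish[where Q = Q and f = f and x = x] assms(2) by (cases "Q < norm x") auto
  qed simp
qed

lemma smooth_lipschitz:
  fixes f :: "'a::euclidean_space \<Rightarrow> real"
  assumes "smooth f" "\<And>x. norm (gradient f x) \<le> K"
  shows "\<bar>f x - f y\<bar> \<le> K * norm (x - y)"
proof -
  have "norm (f x - f y) \<le> K * norm (x - y)"
  proof (rule differentiable_bound[where S = UNIV and f' = "\<lambda>x h. gradient f x \<bullet> h"])
    fix x
    show "(f has_derivative (\<lambda>h. gradient f x \<bullet> h)) (at x within UNIV)"
      using smooth_gradient(1)[OF assms(1)] by simp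
    show "onorm (\<lambda>h. gradient f x \<bullet> h) \<le> K"
    proof (rule onorm_le)
      fix h
      have "norm (gradient f x \<bullet> h) \<le> norm (gradient f x) * norm h"
        using Cauchy_Schwarz_ineq2 by simp
      also have "\<dots> \<le> K * norm h" by (intro mult_right_mono assms(2)) auto
      finally show "norm (gradient f x \<bullet> h) \<le> K * norm h" .
    qed
  qed auto
  then show ?thesis by simp
qed

lemma gradient_lipschitz:
  fixes f :: "'a::euclidean_space \<Rightarrow> real"
  assumes "smooth f" "\<And>x. Q < norm x \<Longrightarrow> f x = 0"
  obtains K where "0 \<le> K" "\<And>x. norm (gradient f x) \<le> K"
    "\<And>x y. norm (gradient f x - gradient f y) \<le> K * norm (x - y)"
proof -
  note g = smooth_gradient[OF assms(1)]
  have "\<exists>K. 0 \<le> K \<and> (\<forall>x y. \<bar>gradient f x \<bullet> i - gradient f y \<bullet> i\<bar> \<le> K * norm (x - y))"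
    if i: "i \<in> Basis" for i
  proof -
    have v: "gradient f x \<bullet> i = 0" if "Q < norm x" for x
      using gradient_vanish[OF assms(2) that] by simp
    obtain K where "0 \<le> K" "\<And>x. norm (gradient (\<lambda>x. gradient f x \<bullet> i) x) \<le> K"
      using smooth_vanish_bounded[OF g(4)[OF i] v] by metis
    then show ?thesis using smooth_lipschitz[OF g(4)[OF i]] by blast
  qed
  then obtain K where K: "\<And>i. i \<in> Basis \<Longrightarrow> 0 \<le> K i"
    "\<And>i x y. i \<in> Basis \<Longrightarrow> \<bar>gradient f x \<bullet> i - gradient f y \<bullet> i\<bar> \<le> K i * norm (x - y)"
    by metis
  obtain K' where K': "0 \<le> K'" "\<And>x. norm (gradient f x) \<le> K'"
    using smooth_vanish_bounded[OF assms] by metis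
  have KK: "0 \<le> (\<Sum>i\<in>Basis. K i)" using K(1) by (rule sum_nonneg)
  show ?thesis
  proof (rule that[of "K' + (\<Sum>i\<in>Basis. K i)"])
    show "norm (gradient f x) \<le> K' + (\<Sum>i\<in>Basis. K i)" for x
      using K'(2)[of x] KK by linarith
    fix x y
    have "norm (gradient f x - gradient f y) \<le> (\<Sum>i\<in>Basis. \<bar>(gradient f x - gradient f y) \<bullet> i\<bar>)"
      by (rule norm_le_l1)
    also have "\<dots> \<le> (\<Sum>i\<in>Basis. K i * norm (x - y))"
      using K(2) by (intro sum_mono) (auto simp: inner_diff_left)
    also have "\<dots> \<le> (K' + (\<Sum>i\<in>Basis. K i)) * norm (x - y)"
      using K'(1) by (simp add: sum_distrib_right[symmetric] mult_right_mono)
    finally show "norm (gradient f x - gradient f y) \<le> (K' + (\<Sum>i\<in>Basis. K i)) * norm (x - y)" .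
  qed (use K' KK in auto)
qed

text \<open>All derivatives fall on \<open>\<kappa>\<close>. The constant depends on \<open>\<eta>\<close> only through the radius of its
  support and its bound, so it serves all the pulled-back test functions that occur along a
  partition at once, however fine the partition is.\<close>

lemma conv_gradient_bounds:
  fixes \<kappa> :: "'a::euclidean_space \<Rightarrow> real"
  assumes \<kappa>: "smooth \<kappa>" "\<And>x. 1 < norm x \<Longrightarrow> \<kappa> x = 0"
  obtains K where "0 \<le> K"
    "\<And>\<eta> M x y. continuous_on UNIV \<eta> \<Longrightarrow> (\<And>x. Q < norm x \<Longrightarrow> \<eta> x = 0) \<Longrightarrow> (\<And>x. \<bar>\<eta> x\<bar> \<le> M) \<Longrightarrow>
       norm (gradient (conv \<eta> \<kappa>) x) \<le> M * K \<and>
       norm (gradient (conv \<eta> \<kappa>) x - gradient (conv \<eta> \<kappa>) y) \<le> M * K * norm (x - y)"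
proof -
  obtain a b where ab: "cball 0 Q \<subseteq> cbox a (b::'a)"
    using bounded_subset_cbox_symmetric[OF bounded_cball] by metis
  obtain K where K: "0 \<le> K" "\<And>x. norm (gradient \<kappa> x) \<le> K"
    "\<And>x y. norm (gradient \<kappa> x - gradient \<kappa> y) \<le> K * norm (x - y)"
    using gradient_lipschitz[OF \<kappa>] by metis
  define c where "c = measure lborel (cbox a b)"
  show ?thesis
  proof (rule that[of "K * c"])
    show "0 \<le> K * c" using K by (simp add: c_def)
    fix \<eta> :: "'a \<Rightarrow> real" and M x y
    assume \<eta>: "continuous_on UNIV \<eta>" "\<And>x. Q < norm x \<Longrightarrow> \<eta> x = 0" and M: "\<And>x. \<bar>\<eta> x\<bar> \<le> M"
    have M0: "0 \<le> M" using M[of 0] by linarith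
    have \<eta>': "\<eta> x = 0" if "x \<notin> cbox a b" for x
      using \<eta>(2)[of x] that ab by (force simp: not_le)
    let ?G = "\<lambda>x. integral (cbox a b) (\<lambda>y. \<eta> y *\<^sub>R gradient \<kappa> (x - y))"
    have G: "gradient (conv \<eta> \<kappa>) x = ?G x" for x
      by (rule has_derivative_gradient_unique[OF conv_has_derivative(1)[OF \<eta>(1) \<eta>' \<kappa>(1)]])
    have i: "((\<lambda>y. \<eta> y *\<^sub>R gradient \<kappa> (x - y)) has_integral ?G x) (cbox a b)" for x
      by (rule integrable_integral[OF conv_has_derivative(2)[OF \<eta>(1) \<eta>' \<kappa>(1)]])
    have "norm (?G x) \<le> M * K * c"
      unfolding c_def by (rule has_integral_bound[OF _ i]) (auto intro!: mult_mono mult_nonneg_nonneg M K M0)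
    moreover have "norm (?G x - ?G y) \<le> M * (K * norm (x - y)) * c"
      unfolding c_def
    proof (rule has_integral_bound[OF _ has_integral_diff[OF i i]])
      show "norm (\<eta> z *\<^sub>R gradient \<kappa> (x - z) - \<eta> z *\<^sub>R gradient \<kappa> (y - z)) \<le> M * (K * norm (x - y))" for z
      proof -
        have "norm (\<eta> z *\<^sub>R gradient \<kappa> (x - z) - \<eta> z *\<^sub>R gradient \<kappa> (y - z))
            = \<bar>\<eta> z\<bar> * norm (gradient \<kappa> (x - z) - gradient \<kappa> (y - z))"
          by (simp add: scaleR_diff_right[symmetric])
        also have "\<dots> \<le> M * (K * norm ((x - z) - (y - z)))"
          using M0 by (intro mult_mono M K(3)) auto
        finally show ?thesis by simp
      qed
    qed (use M0 K in auto)
    ultimately show "norm (gradient (conv \<eta> \<kappa>) x) \<le> M * (K * c) \<and>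
       norm (gradient (conv \<eta> \<kappa>) x - gradient (conv \<eta> \<kappa>) y) \<le> M * (K * c) * norm (x - y)"
      unfolding G by (simp add: mult_ac)
  qed
qed

lemma lborel_integral_reflect:
  fixes f :: "'a::euclidean_space \<Rightarrow> real"
  assumes [measurable]: "f \<in> borel_measurable borel"
  shows "(LINT y|lborel. f (x - y)) = (LINT y|lborel. f y)"
proof -
  have "lborel = distr lborel borel (\<lambda>y::'a. x - y)"
    using lborel_affine[of "-1" x] by (simp add: density_1)
  then have "(LINT y|lborel. f y) = (LINT y|distr lborel borel (\<lambda>y. x - y). f y)" by simp
  also have "\<dots> = (LINT y|lborel. f (x - y))" by (rule integral_distr) measurable
  finally show ?thesis by simp
qed

lemma conv_flip:
  assumes "continuous_on UNIV \<eta>" "continuous_on UNIV \<kappa>"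
  shows "conv \<eta> \<kappa> x = (LINT z|lborel. \<eta> (x - z) * \<kappa> z)"
proof -
  have [measurable]: "\<eta> \<in> borel_measurable borel" "\<kappa> \<in> borel_measurable borel"
    using assms by (auto intro: borel_measurable_continuous_onI)
  show ?thesis
    using lborel_integral_reflect[of "\<lambda>y. \<eta> y * \<kappa> (x - y)" x] by (simp add: conv_def)
qed

lemma conv_vanish:
  assumes "\<And>x. Q < norm x \<Longrightarrow> \<eta> x = 0" "\<And>x. 1 < norm x \<Longrightarrow> \<kappa> x = 0" "Q + 1 < norm x"
  shows "conv \<eta> \<kappa> x = 0"
proof -
  have "\<eta> y * \<kappa> (x - y) = 0" for y
    using assms(1)[of y] assms(2)[of "x - y"] assms(3) norm_triangle_ineq[of y "x - y"] by fastforce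
  then have "(\<lambda>y. \<eta> y * \<kappa> (x - y)) = (\<lambda>_. 0)" by blast
  then show ?thesis by (simp only: conv_def) simp
qed

text \<open>Mollification nearly commutes with a substitution \<open>E\<close>: both sides are averages over the same
  shifts \<open>z\<close>, so a bound for each shift passes to the averages.\<close>

lemma conv_commutator:
  fixes \<eta> \<kappa> :: "'a::euclidean_space \<Rightarrow> real"
  assumes \<kappa>: "smooth \<kappa>" "\<And>x. 0 \<le> \<kappa> x" "\<And>x. \<epsilon> < norm x \<Longrightarrow> \<kappa> x = 0"
      "integrable lborel \<kappa>" "(LINT x|lborel. \<kappa> x) = 1"
    and \<eta>: "continuous_on UNIV \<eta>" and E: "continuous_on UNIV E"
    and le: "\<And>z. norm z \<le> \<epsilon> \<Longrightarrow> \<bar>\<eta> (x' - z) - \<eta> (E (x - z))\<bar> \<le> B" and B: "0 \<le> B"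
  shows "\<bar>conv \<eta> \<kappa> x' - conv (\<lambda>y. \<eta> (E y)) \<kappa> x\<bar> \<le> B"
proof -
  have k: "continuous_on UNIV \<kappa>" using smooth_gradient(3)[OF \<kappa>(1)] .
  have e: "continuous_on UNIV (\<lambda>y. \<eta> (E y))" by (rule continuous_on_compose2[OF \<eta> E]) auto
  have i1: "integrable lborel (\<lambda>z. \<eta> (x' - z) * \<kappa> z)"
    by (rule integrable_vanish[where Q = \<epsilon>])
      (auto intro!: continuous_intros k continuous_on_compose2[OF \<eta>] simp: \<kappa>(3))
  have i2: "integrable lborel (\<lambda>z. \<eta> (E (x - z)) * \<kappa> z)"
    by (rule integrable_vanish[where Q = \<epsilon>])
      (auto intro!: continuous_intros k continuous_on_compose2[OF e] simp: \<kappa>(3))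
  have "\<bar>conv \<eta> \<kappa> x' - conv (\<lambda>y. \<eta> (E y)) \<kappa> x\<bar>
      = \<bar>LINT z|lborel. (\<eta> (x' - z) * \<kappa> z - \<eta> (E (x - z)) * \<kappa> z)\<bar>"
    using i1 i2 by (simp add: conv_flip[OF \<eta> k] conv_flip[OF e k])
  also have "\<dots> \<le> (LINT z|lborel. \<bar>\<eta> (x' - z) * \<kappa> z - \<eta> (E (x - z)) * \<kappa> z\<bar>)"
    by (rule integral_abs_bound)
  also have "\<dots> \<le> (LINT z|lborel. B * \<kappa> z)"
  proof (rule integral_mono)
    fix z
    show "\<bar>\<eta> (x' - z) * \<kappa> z - \<eta> (E (x - z)) * \<kappa> z\<bar> \<le> B * \<kappa> z"
    proof (cases "norm z \<le> \<epsilon>")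
      case True
      then show ?thesis
        using le[of z] \<kappa>(2)[of z] by (simp add: left_diff_distrib[symmetric] abs_mult mult_right_mono)
    next
      case False
      then show ?thesis by (simp add: \<kappa>(3))
    qed
  qed (use i1 i2 \<kappa> in auto)
  also have "\<dots> = B" using \<kappa> by simp
  finally show ?thesis .
qed

lemma conv_close:
  fixes \<eta> \<kappa> :: "'a::euclidean_space \<Rightarrow> real"
  assumes \<kappa>: "smooth \<kappa>" "\<And>x. 0 \<le> \<kappa> x" "\<And>x. \<epsilon> < norm x \<Longrightarrow> \<kappa> x = 0"
      "integrable lborel \<kappa>" "(LINT x|lborel. \<kappa> x) = 1"
    and C: "C-lipschitz_on UNIV \<eta>" and "0 \<le> \<epsilon>"
  shows "\<bar>conv \<eta> \<kappa> x - \<eta> x\<bar> \<le> C * \<epsilon>"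
proof -
  have C0: "0 \<le> C" using C lipschitz_on_nonneg by blast
  have "conv (\<lambda>y. \<eta> ((\<lambda>_. x) y)) \<kappa> x = (LINT z|lborel. \<eta> x * \<kappa> z)"
    by (subst conv_flip) (auto intro!: smooth_gradient(3) \<kappa>)
  then have "conv (\<lambda>y. \<eta> ((\<lambda>_. x) y)) \<kappa> x = \<eta> x" using \<kappa> by simp
  moreover have "\<bar>conv \<eta> \<kappa> x - conv (\<lambda>y. \<eta> ((\<lambda>_. x) y)) \<kappa> x\<bar> \<le> C * \<epsilon>"
  proof (rule conv_commutator[OF \<kappa> lipschitz_on_continuous_on[OF C]])
    fix z :: 'a assume z: "norm z \<le> \<epsilon>"
    have "\<bar>\<eta> (x - z) - \<eta> x\<bar> \<le> C * norm z"
      using lipschitz_onD[OF C, of "x - z" x] by (simp add: dist_norm)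
    also have "\<dots> \<le> C * \<epsilon>" using z C0 by (intro mult_left_mono)
    finally show "\<bar>\<eta> (x - z) - \<eta> ((\<lambda>_. x) (x - z))\<bar> \<le> C * \<epsilon>" by simp
  qed (use C0 assms(7) in auto)
  ultimately show ?thesis by simp
qed

section \<open>Upper Lebesgue points\<close>

text \<open>The measure with density \<open>g\<close> does not charge the zero set of \<open>g\<close>, so that set has open
  neighbourhoods \<open>U\<close> of small mass. If the exceptional set \<open>Z\<close> is covered by bad intervals inside \<open>U\<close>, a
  disjoint subfamily covers it after fivefold enlargement, and the length of a bad interval is at most
  \<open>2 / \<eta>\<close> times its mass. Thus the length of the cover is at most \<open>10 / \<eta>\<close> times the mass of \<open>U\<close>.\<close>

lemma Vitali_density:
  fixes g :: "real \<Rightarrow> real"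
  assumes g: "integrable lebesgue g" and nn: "\<And>x. 0 \<le> g x" and \<eta>: "0 < \<eta>"
  shows "negligible {x. g x = 0 \<and> (\<forall>d>0. \<exists>r. 0 < r \<and> r < d \<and> \<eta> * r < (LINT y:cball x r|lebesgue. g y))}"
    (is "negligible ?Z")
proof -
  define \<nu> where "\<nu> = density lebesgue (\<lambda>x. ennreal (g x))"
  have [measurable]: "g \<in> borel_measurable lebesgue" using g by auto
  define Z0 where "Z0 = {x. g x = 0}"
  have Z0: "Z0 \<in> sets lebesgue" unfolding Z0_def using borel_measurable_eq[of g lebesgue "\<lambda>_. 0"] by simp
  have fin: "finite_measure \<nu>"
    using g nn by (intro finite_measureI) (simp add: \<nu>_def emeasure_density nn_integral_eq_integral)
  have \<nu>Z0: "emeasure \<nu> Z0 = 0"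
    unfolding \<nu>_def using Z0 by (subst emeasure_density) (auto simp: Z0_def nn_integral_0_iff_AE indicator_def)
  have meas: "measure \<nu> A = (LINT y:A|lebesgue. g y)" if "A \<in> sets lebesgue" for A
  proof -
    have "integrable lebesgue (\<lambda>y. indicator A y *\<^sub>R g y)" using g that by (rule integrable_mult_indicator[rotated])
    then have "(\<integral>\<^sup>+y. ennreal (indicator A y *\<^sub>R g y) \<partial>lebesgue) = ennreal (LINT y:A|lebesgue. g y)"
      unfolding set_lebesgue_integral_def using nn by (intro nn_integral_eq_integral) auto
    moreover have "emeasure \<nu> A = (\<integral>\<^sup>+y. ennreal (indicator A y *\<^sub>R g y) \<partial>lebesgue)"
      unfolding \<nu>_def using that
      by (subst emeasure_density) (auto intro!: nn_integral_cong simp: indicator_def)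
    ultimately have "emeasure \<nu> A = ennreal (LINT y:A|lebesgue. g y)" by simp
    moreover have "0 \<le> (LINT y:A|lebesgue. g y)"
      unfolding set_lebesgue_integral_def using nn by (intro integral_nonneg_AE) auto
    ultimately show ?thesis by (simp add: measure_def)
  qed
  define bad where "bad x r \<longleftrightarrow> \<eta> * r < (LINT y:cball x r|lebesgue. g y)" for x r
  define Z where "Z = {x. g x = 0 \<and> (\<forall>d>0. \<exists>r. 0 < r \<and> r < d \<and> bad x r)}"
  have "negligible Z"
  proof (rule negligible_outer_le[THEN iffD2, rule_format])
    fix e :: real assume e: "0 < e"
    define e' where "e' = e * \<eta> / 10"
    have e': "0 < e'" using e \<eta> by (simp add: e'_def)
    \<comment> \<open>an open neighbourhood of the zero set with small \<open>\<nu>\<close>-mass\<close>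
    have "\<exists>U. open U \<and> Z0 \<subseteq> U \<and> measure \<nu> U < e'"
    proof -
      have "absolutely_continuous lebesgue \<nu>"
        unfolding \<nu>_def by (rule absolutely_continuousI_density) simp
      obtain U where U: "\<And>n. open (U n)" "\<And>n. Z0 \<subseteq> U n" "\<And>n. emeasure lebesgue (U n - Z0) < ennreal (1 / (2 ^ n))"
      proof -
        have "\<exists>U. open U \<and> Z0 \<subseteq> U \<and> U - Z0 \<in> lmeasurable \<and> emeasure lebesgue (U - Z0) < ennreal (1 / (2 ^ n))" for n :: nat
          using sets_lebesgue_outer_open[OF Z0, of "1 / 2 ^ n"] by fastforce
        then show ?thesis using that by metis
      qed
      define W where "W n = (\<Inter>k\<le>n. U k)" for n
      have W: "open (W n)" "Z0 \<subseteq> W n" for n unfolding W_def using U by auto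
      have dW: "decseq W" unfolding W_def decseq_def by (auto intro: order_trans)
      have sW: "W n \<in> sets \<nu>" for n using W(1) by (simp add: \<nu>_def)
      have "emeasure lebesgue ((\<Inter>n. W n) - Z0) \<le> ennreal (1 / 2 ^ n)" for n
      proof -
        have "emeasure lebesgue ((\<Inter>n. W n) - Z0) \<le> emeasure lebesgue (U n - Z0)"
          using U(1) Z0 by (intro emeasure_mono) (auto simp: W_def)
        then show ?thesis using U(3)[of n] by (rule order_trans[OF _ less_imp_le])
      qed
      then have "emeasure lebesgue ((\<Inter>n. W n) - Z0) = 0"
      proof -
        have "(\<lambda>n. ennreal (1 / 2 ^ n)) \<longlonglongrightarrow> ennreal 0"
          using LIMSEQ_power_zero[of "1 / 2 :: real"] by (intro tendsto_ennrealI) (simp add: power_divide)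
        then have "emeasure lebesgue ((\<Inter>n. W n) - Z0) \<le> 0"
          by (intro LIMSEQ_le_const[of "\<lambda>n. ennreal (1 / 2 ^ n)"]) (use \<open>\<And>n. _ \<le> ennreal (1 / 2 ^ n)\<close> in auto)
        then show ?thesis by simp
      qed
      moreover have "(\<Inter>n. W n) - Z0 \<in> sets lebesgue" using W(1) Z0 by auto
      ultimately have "(\<Inter>n. W n) - Z0 \<in> null_sets \<nu>"
        using \<open>absolutely_continuous lebesgue \<nu>\<close> unfolding absolutely_continuous_def by blast
      moreover have "Z0 \<in> null_sets \<nu>" using \<nu>Z0 Z0 by (auto simp: \<nu>_def)
      moreover have "(\<Inter>n. W n) = ((\<Inter>n. W n) - Z0) \<union> Z0" using W(2) by blast
      ultimately have "emeasure \<nu> (\<Inter>n. W n) = 0" by (metis null_setsD1 null_sets.Un)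
      moreover have "(\<lambda>n. measure \<nu> (W n)) \<longlonglongrightarrow> measure \<nu> (\<Inter>n. W n)"
        using sW dW by (intro finite_measure.finite_Lim_measure_decseq[OF fin]) auto
      ultimately have "(\<lambda>n. measure \<nu> (W n)) \<longlonglongrightarrow> 0" by (simp add: measure_def)
      then have "\<forall>\<^sub>F n in sequentially. measure \<nu> (W n) < e'" using e' by (rule order_tendstoD(2))
      then show ?thesis unfolding eventually_sequentially using W by blast
    qed
    then obtain U where U: "open U" "Z0 \<subseteq> U" "measure \<nu> U < e'" by blast
    \<comment> \<open>the bad intervals to which the covering lemma is applied\<close>
    define K where "K = {(x, r). 0 < r \<and> r < 1 \<and> cball x r \<subseteq> U \<and> bad x r}"
    have KD: "0 < snd i" "snd i < 1" "cball (fst i) (snd i) \<subseteq> U" "bad (fst i) (snd i)" if "i \<in> K" for i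
      using that unfolding K_def by (auto simp del: mem_cball subset_iff)
    have cov: "Z \<subseteq> (\<Union>i\<in>K. cball (fst i) (snd i))"
    proof
      fix x assume x: "x \<in> Z"
      then have "x \<in> U" using U(2) by (auto simp: Z0_def Z_def)
      then obtain d where d: "0 < d" "cball x d \<subseteq> U" using U(1) open_contains_cball by blast
      have "0 < min d 1" using d by simp
      then obtain r where r: "0 < r" "r < min d 1" "bad x r"
        using x unfolding Z_def by blast
      have "cball x r \<subseteq> cball x d" using r by (intro subset_cball) simp
      then have "(x, r) \<in> K" using r d(2) unfolding K_def by simp
      then show "x \<in> (\<Union>i\<in>K. cball (fst i) (snd i))" using r(1) by force
    qed
    have K1: "0 < snd i \<and> snd i \<le> 1" if "i \<in> K" for i
      using KD(1,2)[OF that] by linarith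
    obtain C where C: "countable C" "C \<subseteq> K"
      "pairwise (\<lambda>i j. disjnt (cball (fst i) (snd i)) (cball (fst j) (snd j))) C"
      "Z \<subseteq> (\<Union>i\<in>C. cball (fst i) (5 * snd i))"
      by (rule Vitali_covering_lemma_cballs[OF cov K1])
    let ?T = "\<Union>i\<in>C. cball (fst i) (5 * snd i)"
    have bd: "measure lebesgue (\<Union>i\<in>F. cball (fst i) (5 * snd i)) \<le> e" if F: "F \<subseteq> C" "finite F" for F
    proof -
      have "measure lebesgue (\<Union>i\<in>F. cball (fst i) (5 * snd i)) \<le> (\<Sum>i\<in>F. measure lebesgue (cball (fst i) (5 * snd i)))"
        using F(2) by (intro measure_UNION_le) auto
      also have "\<dots> = (\<Sum>i\<in>F. 10 * snd i)"
      proof (rule sum.cong)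
        fix i assume "i \<in> F"
        then have "0 < snd i" using F C(2) KD(1) by blast
        then show "measure lebesgue (cball (fst i) (5 * snd i)) = 10 * snd i"
          by (simp add: cball_eq_atLeastAtMost)
      qed simp
      also have "\<dots> \<le> (\<Sum>i\<in>F. 10 / \<eta> * measure \<nu> (cball (fst i) (snd i)))"
      proof (rule sum_mono)
        fix i assume "i \<in> F"
        then have "\<eta> * snd i \<le> measure \<nu> (cball (fst i) (snd i))"
          using F C(2) KD(4)[of i] by (auto simp: bad_def meas)
        then show "10 * snd i \<le> 10 / \<eta> * measure \<nu> (cball (fst i) (snd i))"
          using \<eta> by (simp add: field_simps)
      qed
      also have "\<dots> = 10 / \<eta> * measure \<nu> (\<Union>i\<in>F. cball (fst i) (snd i))"
      proof -
        have "disjoint_family_on (\<lambda>i. cball (fst i) (snd i)) F"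
          using C(3) F(1) unfolding disjoint_family_on_def pairwise_def disjnt_def by blast
        then show ?thesis
          using F(2) by (subst measure_finite_Union)
            (auto simp: sum_distrib_left \<nu>_def finite_measure.emeasure_finite[OF fin, unfolded \<nu>_def])
      qed
      also have "\<dots> \<le> 10 / \<eta> * measure \<nu> U"
      proof (intro mult_left_mono finite_measure.finite_measure_mono[OF fin])
        show "(\<Union>i\<in>F. cball (fst i) (snd i)) \<subseteq> U" using F C(2) KD(3) by blast
      qed (use \<eta> U(1) in \<open>auto simp: \<nu>_def\<close>)
      also have "\<dots> \<le> 10 / \<eta> * e'" using \<eta> U(3) by (intro mult_left_mono) auto
      also have "\<dots> = e" using \<eta> by (simp add: e'_def)
      finally show ?thesis .
    qed
    have "?T \<in> lmeasurable" by (rule fmeasurable_UN_bound[OF C(1) _ bd]) auto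
    moreover have "measure lebesgue ?T \<le> e" by (rule measure_UN_bound[OF C(1) _ bd]) auto
    ultimately show "\<exists>T. Z \<subseteq> T \<and> T \<in> lmeasurable \<and> measure lebesgue T \<le> e"
      using C(4) by blast
  qed
  then show ?thesis unfolding Z_def bad_def .
qed

text \<open>For \<open>q\<close> slightly above \<open>f \<tau>\<close>, the excess \<open>max 0 (f - q)\<close> vanishes at \<open>\<tau>\<close>, so by
  \<open>Vitali_density\<close> its averages near \<open>\<tau>\<close> are small. Only rational \<open>q\<close> and \<open>\<eta>\<close> are needed, so
  the exceptional sets add up to a null set. The intervals need not be centred at \<open>\<tau>\<close>, as their
  integral is compared with that over the centred interval of twice the length.\<close>

lemma AE_eventually_average_le:
  fixes f :: "real \<Rightarrow> real"
  assumes f: "set_integrable lebesgue {0..T} f"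
  shows "AE \<tau> in lebesgue. \<tau> \<in> {0<..<T} \<longrightarrow> (\<forall>\<delta>>0. \<exists>d>0. \<forall>a b. a \<le> \<tau> \<longrightarrow> \<tau> \<le> b \<longrightarrow> b - a < d \<longrightarrow>
     0 \<le> a \<and> b \<le> T \<and> (LINT t:{a..b}|lebesgue. f t) \<le> (f \<tau> + \<delta>) * (b - a))"
proof -
  define g where "g q t = indicator {0..T} t * max 0 (f t - q)" for q t
  have g: "integrable lebesgue (g q)" for q
  proof -
    have c: "integrable lebesgue (\<lambda>t. indicator {0..T} t *\<^sub>R q)"
      by (intro integrable_scaleR_left) (simp add: lmeasurable_iff_integrable[symmetric])
    have "integrable lebesgue (\<lambda>t. max 0 (indicator {0..T} t *\<^sub>R f t - indicator {0..T} t *\<^sub>R q))"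
      using f c unfolding set_integrable_def by (intro integrable_max Bochner_Integration.integrable_diff) auto
    moreover have "(\<lambda>t. max 0 (indicator {0..T} t *\<^sub>R f t - indicator {0..T} t *\<^sub>R q)) = g q"
      by (auto simp: g_def indicator_def)
    ultimately show ?thesis by simp
  qed
  have g0: "0 \<le> g q t" for q t by (simp add: g_def)
  have "AE \<tau> in lebesgue. g q \<tau> = 0 \<longrightarrow> (\<exists>d>0. \<forall>r. 0 < r \<and> r < d \<longrightarrow> (LINT y:cball \<tau> r|lebesgue. g q y) \<le> \<eta> * r)"
    if "0 < \<eta>" for q \<eta>
    using Vitali_density[OF g[of q] g0 that] unfolding negligible_iff_null_sets
    by (rule AE_I') (force simp: not_le)
  then have "AE \<tau> in lebesgue. \<forall>q\<in>\<rat>. \<forall>\<eta>\<in>\<rat> \<inter> {0<..}. g q \<tau> = 0 \<longrightarrow>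
      (\<exists>d>0. \<forall>r. 0 < r \<and> r < d \<longrightarrow> (LINT y:cball \<tau> r|lebesgue. g q y) \<le> \<eta> * r)"
    by (intro AE_ball_countable[THEN iffD2] ballI countable_Int1 countable_rat) auto
  then show ?thesis
  proof eventually_elim
    case (elim \<tau>)
    show ?case
    proof (intro impI allI)
      fix \<delta> :: real assume \<tau>: "\<tau> \<in> {0<..<T}" and \<delta>: "0 < \<delta>"
      obtain q where q: "q \<in> \<rat>" "f \<tau> < q" "q < f \<tau> + \<delta> / 2"
        using Rats_dense_in_real[of "f \<tau>" "f \<tau> + \<delta> / 2"] \<delta> by auto
      obtain \<eta> where \<eta>: "\<eta> \<in> \<rat>" "0 < \<eta>" "\<eta> < \<delta> / 2"
        using Rats_dense_in_real[of 0 "\<delta> / 2"] \<delta> by auto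
      have "g q \<tau> = 0" using q(2) by (simp add: g_def)
      then obtain d where d: "0 < d" "\<And>r. 0 < r \<Longrightarrow> r < d \<Longrightarrow> (LINT y:cball \<tau> r|lebesgue. g q y) \<le> \<eta> * r"
        using elim q(1) \<eta> by fastforce
      define d' where "d' = Min {d, \<tau>, T - \<tau>}"
      have d': "0 < d'" "d' \<le> d" "d' \<le> \<tau>" "d' \<le> T - \<tau>" using d(1) \<tau> by (auto simp: d'_def)
      show "\<exists>d>0. \<forall>a b. a \<le> \<tau> \<longrightarrow> \<tau> \<le> b \<longrightarrow> b - a < d \<longrightarrow>
          0 \<le> a \<and> b \<le> T \<and> (LINT t:{a..b}|lebesgue. f t) \<le> (f \<tau> + \<delta>) * (b - a)"
      proof (intro exI[of _ d'] conjI allI impI)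
        fix a b assume ab: "a \<le> \<tau>" "\<tau> \<le> b" "b - a < d'"
        show ab': "0 \<le> a" "b \<le> T" using ab d' by linarith+
        have fab: "set_integrable lebesgue {a..b} f"
          by (rule set_integrable_subset[OF f]) (use ab' in auto)
        show "(LINT t:{a..b}|lebesgue. f t) \<le> (f \<tau> + \<delta>) * (b - a)"
        proof (cases "a = b")
          case True
          have "AE t in lebesgue. t \<noteq> a" by (rule AE_I'[of "{a}"]) auto
          then have "AE t in lebesgue. indicator {a..b} t *\<^sub>R f t = 0"
            by eventually_elim (use True in \<open>auto simp: indicator_def\<close>)
          then have "(LINT t:{a..b}|lebesgue. f t) = 0"
            unfolding set_lebesgue_integral_def by (rule integral_eq_zero_AE)
          then show ?thesis using True by simp
        next
          case False
          define r where "r = b - a"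
          have r: "0 < r" "r < d" using False ab d' by (auto simp: r_def)
          have gab: "set_integrable lebesgue A (g q)" if "A \<in> sets lebesgue" for A
            unfolding set_integrable_def using g that by (rule integrable_mult_indicator[rotated])
          have qab: "set_integrable lebesgue {a..b} (\<lambda>_. q)"
            unfolding set_integrable_def
            by (intro integrable_scaleR_left) (simp add: lmeasurable_iff_integrable[symmetric])
          have "(LINT t:{a..b}|lebesgue. f t) \<le> (LINT t:{a..b}|lebesgue. q + g q t)"
            by (rule set_integral_mono[OF fab set_integral_add(1)[OF qab gab]])
              (use ab' in \<open>auto simp: g_def\<close>)
          also have "\<dots> = (LINT t:{a..b}|lebesgue. q) + (LINT t:{a..b}|lebesgue. g q t)"
            by (rule set_integral_add(2)[OF qab gab]) auto
          also have "(LINT t:{a..b}|lebesgue. q) = q * r"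
            using ab by (simp add: set_lebesgue_integral_def r_def)
          also have "(LINT t:{a..b}|lebesgue. g q t) \<le> (LINT t:cball \<tau> r|lebesgue. g q t)"
            unfolding set_lebesgue_integral_def
            by (rule integral_mono; (rule gab[unfolded set_integrable_def])?)
              (use ab g0[of q] in \<open>auto simp: cball_eq_atLeastAtMost r_def indicator_def\<close>)
          also have "\<dots> \<le> \<eta> * r" by (rule d(2)[OF r])
          also have "q * r + \<eta> * r \<le> (f \<tau> + \<delta>) * r"
            using q(3) \<eta>(3) r(1) by (simp add: distrib_right[symmetric] mult_right_mono)
          finally show ?thesis by (simp add: r_def)
        qed
      qed (use d' in auto)
    qed
  qed
qed

text \<open>One half of the Lebesgue point property. An upper bound suffices both for the integrable constants of
  the field and for its support functions, and it also holds on intervals that end at \<open>\<tau>\<close>, which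
  are those that a step of one sign produces.\<close>

definition upper_Lebesgue_point :: "real \<Rightarrow> (real \<Rightarrow> real) \<Rightarrow> real \<Rightarrow> bool" where
  "upper_Lebesgue_point T f \<tau> \<longleftrightarrow> (\<forall>\<delta>>0. \<exists>d>0. \<forall>a b. a \<le> \<tau> \<longrightarrow> \<tau> \<le> b \<longrightarrow> b - a < d \<longrightarrow>
     0 \<le> a \<and> b \<le> T \<and> (LINT t:{a..b}|lebesgue. f t) \<le> (f \<tau> + \<delta>) * (b - a))"

lemma upper_Lebesgue_pointD:
  assumes "upper_Lebesgue_point T f \<tau>" "0 < \<delta>"
  obtains d where "0 < d" "\<And>a b. a \<le> \<tau> \<Longrightarrow> \<tau> \<le> b \<Longrightarrow> b - a < d \<Longrightarrow>
     0 \<le> a \<and> b \<le> T \<and> (LINT t:{a..b}|lebesgue. f t) \<le> (f \<tau> + \<delta>) * (b - a)"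
  using assms unfolding upper_Lebesgue_point_def by metis

lemma AE_upper_Lebesgue_point:
  assumes "set_integrable lebesgue {0..T} f"
  shows "AE \<tau> in lebesgue. \<tau> \<in> {0<..<T} \<longrightarrow> upper_Lebesgue_point T f \<tau>"
  using AE_eventually_average_le[OF assms] by (simp add: upper_Lebesgue_point_def)

section \<open>Estimates for the Wasserstein distance\<close>

lemma Young_powr:
  fixes s p :: real
  assumes "1 \<le> p" "0 \<le> s"
  shows "s \<le> s powr p / p + (1 - 1 / p)"
proof (cases "p = 1")
  case True
  then show ?thesis using assms by simp
next
  case False
  then have p: "1 < p" using assms by simp
  define q where "q = p / (p - 1)"
  have q: "1 < q" "1 / p + 1 / q = 1" using p by (auto simp: q_def field_simps)
  have "s * 1 \<le> s powr p / p + 1 powr q / q"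
    using Youngs_inequality[OF p q(1) q(2), of s 1] assms by simp
  moreover have "1 / q = 1 - 1 / p" using q(2) by linarith
  ultimately show ?thesis by simp
qed

lemma powr_sum_le:
  fixes a b p :: real
  assumes "0 \<le> a" "0 \<le> b" "0 \<le> p"
  shows "(a + b) powr p \<le> 2 powr p * (a powr p + b powr p)"
proof -
  have "(a + b) powr p \<le> (2 * max a b) powr p" using assms by (intro powr_mono2) auto
  also have "\<dots> = 2 powr p * (max a b) powr p" using assms by (simp add: powr_mult)
  also have "\<dots> \<le> 2 powr p * (a powr p + b powr p)"
    by (intro mult_left_mono) (auto simp: max_def)
  finally show ?thesis .
qed

lemma PpD:
  assumes "\<mu> \<in> Pp p" "1 \<le> p"
  shows "prob_space \<mu>" "sets \<mu> = sets borel" "space \<mu> = UNIV" "integrable \<mu> (\<lambda>x. norm x powr p)"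
    "integrable \<mu> (\<lambda>x. norm x)"
proof -
  show 1: "prob_space \<mu>" "sets \<mu> = sets borel" "integrable \<mu> (\<lambda>x. norm x powr p)"
    using assms by (auto simp: Pp_def)
  show "space \<mu> = UNIV" using sets_eq_imp_space_eq[OF 1(2)] by simp
  interpret prob_space \<mu> by fact
  have [measurable]: "(\<lambda>x. norm x) \<in> borel_measurable \<mu>" using 1(2) by (simp add: measurable_cong_sets[OF 1(2) refl])
  show "integrable \<mu> (\<lambda>x. norm x)"
  proof (rule Bochner_Integration.integrable_bound)
    show "integrable \<mu> (\<lambda>x. 1 + norm x powr p)" using 1(3) by simp
    show "AE x in \<mu>. norm (norm x) \<le> norm (1 + norm x powr p)"
    proof (intro AE_I2)
      fix x :: 'a
      have "norm x powr p / p \<le> norm x powr p" using assms(2) mult_left_mono[of 1 p "norm x powr p"] by (simp add: divide_le_eq)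
      moreover have "0 \<le> 1 / p" using assms(2) by simp
      ultimately have "norm x \<le> 1 + norm x powr p"
        using Young_powr[OF assms(2) norm_ge_zero, of x] by linarith
      then show "norm (norm x) \<le> norm (1 + norm x powr p)" by simp
    qed
  qed simp
qed

lemma coupling_distr:
  fixes f g :: "'b \<Rightarrow> 'a::euclidean_space"
  assumes "f \<in> M \<rightarrow>\<^sub>M borel" "g \<in> M \<rightarrow>\<^sub>M borel"
  shows "distr M borel (\<lambda>x. (f x, g x)) \<in> couplings (distr M borel f) (distr M borel g)"
proof -
  have m: "(\<lambda>x. (f x, g x)) \<in> M \<rightarrow>\<^sub>M borel"
    using measurable_Pair[OF assms] by (simp add: borel_prod)
  have 1: "fst \<in> (borel :: ('a \<times> 'a) measure) \<rightarrow>\<^sub>M borel" "snd \<in> (borel :: ('a \<times> 'a) measure) \<rightarrow>\<^sub>M borel"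
    by (simp_all add: borel_prod[symmetric])
  show ?thesis unfolding couplings_def
    using distr_distr[OF 1(1) m] distr_distr[OF 1(2) m] by (simp add: o_def)
qed

lemma measurable_dist_powr:
  assumes "sets \<gamma> = sets (borel :: ('a::euclidean_space \<times> 'a) measure)"
  shows "(\<lambda>z. dist (fst z) (snd z)) \<in> borel_measurable \<gamma>"
    "(\<lambda>z. dist (fst z) (snd z) powr p) \<in> borel_measurable \<gamma>"
  unfolding measurable_cong_sets[OF assms refl] by (simp_all add: borel_prod[symmetric])

lemma Wasserstein_leI:
  assumes p: "1 \<le> p" and \<gamma>: "\<gamma> \<in> couplings \<mu> \<nu>" and B: "0 \<le> B"
    and c: "(\<integral>\<^sup>+z. ennreal (dist (fst z) (snd z) powr p) \<partial>\<gamma>) \<le> ennreal (B powr p)"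
  shows "Wasserstein p \<mu> \<nu> \<le> ennreal B"
proof -
  have c': "transport_cost p \<mu> \<nu> \<le> ennreal (B powr p)"
    unfolding transport_cost_def using INF_lower[OF \<gamma>] c by (rule order_trans)
  have fin: "transport_cost p \<mu> \<nu> \<noteq> \<top>" using c' by (auto simp: top_unique)
  have "enn2real (transport_cost p \<mu> \<nu>) \<le> B powr p"
    using c' by (intro enn2real_leI) auto
  then have "enn2real (transport_cost p \<mu> \<nu>) powr (1 / p) \<le> (B powr p) powr (1 / p)"
    using p by (intro powr_mono2) auto
  also have "\<dots> = B" using p B by (simp add: powr_powr)
  finally show ?thesis using fin by (simp add: Wasserstein_def ennreal_leI)
qed

lemma Wasserstein_distr_le:
  fixes f g :: "'b \<Rightarrow> 'a::euclidean_space"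
  assumes p: "1 \<le> p" and m: "f \<in> M \<rightarrow>\<^sub>M borel" "g \<in> M \<rightarrow>\<^sub>M borel" and B: "0 \<le> B"
    and c: "(\<integral>\<^sup>+x. ennreal (dist (f x) (g x) powr p) \<partial>M) \<le> ennreal (B powr p)"
  shows "Wasserstein p (distr M borel f) (distr M borel g) \<le> ennreal B"
proof (rule Wasserstein_leI[OF p coupling_distr[OF m] B])
  have m': "(\<lambda>x. (f x, g x)) \<in> M \<rightarrow>\<^sub>M borel"
    using measurable_Pair[OF m] by (simp add: borel_prod)
  have "(\<integral>\<^sup>+z. ennreal (dist (fst z) (snd z) powr p) \<partial>distr M borel (\<lambda>x. (f x, g x)))
      = (\<integral>\<^sup>+x. ennreal (dist (f x) (g x) powr p) \<partial>M)"
    using nn_integral_distr[OF m', of "\<lambda>z. ennreal (dist (fst z) (snd z) powr p)"]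
      measurable_dist_powr(2)[OF refl, of p] by simp
  then show "(\<integral>\<^sup>+z. ennreal (dist (fst z) (snd z) powr p) \<partial>distr M borel (\<lambda>x. (f x, g x))) \<le> ennreal (B powr p)"
    using c by simp
qed

lemma Wasserstein_coupling:
  assumes p: "1 \<le> p" and W: "Wasserstein p \<mu> \<nu> < ennreal B"
  obtains \<gamma> where "\<gamma> \<in> couplings \<mu> \<nu>" "(\<integral>\<^sup>+z. ennreal (dist (fst z) (snd z) powr p) \<partial>\<gamma>) \<le> ennreal (B powr p)"
proof -
  have fin: "transport_cost p \<mu> \<nu> \<noteq> \<top>" using W by (auto simp: Wasserstein_def)
  define c where "c = enn2real (transport_cost p \<mu> \<nu>)"
  have c0: "0 \<le> c" by (simp add: c_def)
  have "c powr (1 / p) < B" using W fin by (simp add: Wasserstein_def c_def ennreal_less_iff)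
  then have "(c powr (1 / p)) powr p < B powr p" using p by (intro powr_less_mono2) auto
  then have "c < B powr p" using p c0 by (simp add: powr_powr)
  then have "transport_cost p \<mu> \<nu> < ennreal (B powr p)"
    using fin c0 by (simp add: c_def enn2real_less_iff top.not_eq_extremum)
  then show ?thesis
    unfolding transport_cost_def INF_less_iff using that less_imp_le by blast
qed

lemma Wasserstein_commute_le: "Wasserstein p \<nu> \<mu> \<le> Wasserstein p \<mu> \<nu>" if p: "1 \<le> p"
proof -
  have "transport_cost p \<nu> \<mu> \<le> transport_cost p \<mu> \<nu>"
    unfolding transport_cost_def
  proof (rule INF_greatest)
    fix \<gamma> assume g: "\<gamma> \<in> couplings \<mu> \<nu>"
    then have s: "sets \<gamma> = sets borel" and d: "distr \<gamma> borel fst = \<mu>" "distr \<gamma> borel snd = \<nu>"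
      by (auto simp: couplings_def)
    have m: "fst \<in> \<gamma> \<rightarrow>\<^sub>M borel" "snd \<in> \<gamma> \<rightarrow>\<^sub>M borel"
      unfolding measurable_cong_sets[OF s refl] by (simp_all add: borel_prod[symmetric])
    have m': "(\<lambda>z. (snd z, fst z)) \<in> \<gamma> \<rightarrow>\<^sub>M borel"
      using measurable_Pair[OF m(2,1)] by (simp add: borel_prod)
    have "(\<integral>\<^sup>+z. ennreal (dist (fst z) (snd z) powr p) \<partial>distr \<gamma> borel (\<lambda>z. (snd z, fst z)))
        = (\<integral>\<^sup>+z. ennreal (dist (fst z) (snd z) powr p) \<partial>\<gamma>)"
      using nn_integral_distr[OF m', of "\<lambda>z. ennreal (dist (fst z) (snd z) powr p)"]
        measurable_dist_powr(2)[OF refl, of p] by (simp add: dist_commute)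
    then show "(INF \<gamma>\<in>couplings \<nu> \<mu>. \<integral>\<^sup>+z. ennreal (dist (fst z) (snd z) powr p) \<partial>\<gamma>)
        \<le> (\<integral>\<^sup>+z. ennreal (dist (fst z) (snd z) powr p) \<partial>\<gamma>)"
      using INF_lower[OF coupling_distr[OF m(2,1)], of "\<lambda>\<gamma>. \<integral>\<^sup>+z. ennreal (dist (fst z) (snd z) powr p) \<partial>\<gamma>"] d
      by simp
  qed
  then show ?thesis
    using p by (auto simp: Wasserstein_def top_unique less_top[symmetric]
        intro!: ennreal_leI powr_mono2 enn2real_mono)
qed

lemma coupling_prob_space:
  assumes "\<gamma> \<in> couplings \<mu> \<nu>" "prob_space \<mu>"
  shows "prob_space \<gamma>" "fst \<in> \<gamma> \<rightarrow>\<^sub>M borel" "snd \<in> \<gamma> \<rightarrow>\<^sub>M borel"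
proof -
  have s: "sets \<gamma> = sets borel" and d: "distr \<gamma> borel fst = \<mu>" using assms by (auto simp: couplings_def)
  show m: "fst \<in> \<gamma> \<rightarrow>\<^sub>M borel" "snd \<in> \<gamma> \<rightarrow>\<^sub>M borel"
    unfolding measurable_cong_sets[OF s refl] by (simp_all add: borel_prod[symmetric])
  show "prob_space \<gamma>" using prob_space_distrD[OF m(1)] d assms(2) by simp
qed

lemma coupling_integrals:
  fixes f :: "'a::euclidean_space \<Rightarrow> real"
  assumes "\<gamma> \<in> couplings \<mu> \<nu>" and [measurable]: "f \<in> borel_measurable borel"
  shows "(LINT x|\<mu>. f x) = (LINT z|\<gamma>. f (fst z))" "(LINT x|\<nu>. f x) = (LINT z|\<gamma>. f (snd z))"
    "integrable \<mu> f \<longleftrightarrow> integrable \<gamma> (\<lambda>z. f (fst z))" "integrable \<nu> f \<longleftrightarrow> integrable \<gamma> (\<lambda>z. f (snd z))"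
proof -
  have s: "sets \<gamma> = sets borel" and d: "distr \<gamma> borel fst = \<mu>" "distr \<gamma> borel snd = \<nu>"
    using assms by (auto simp: couplings_def)
  have m: "fst \<in> \<gamma> \<rightarrow>\<^sub>M borel" "snd \<in> \<gamma> \<rightarrow>\<^sub>M borel"
    unfolding measurable_cong_sets[OF s refl] by (simp_all add: borel_prod[symmetric])
  show "(LINT x|\<mu>. f x) = (LINT z|\<gamma>. f (fst z))" "(LINT x|\<nu>. f x) = (LINT z|\<gamma>. f (snd z))"
    "integrable \<mu> f \<longleftrightarrow> integrable \<gamma> (\<lambda>z. f (fst z))" "integrable \<nu> f \<longleftrightarrow> integrable \<gamma> (\<lambda>z. f (snd z))"
    using integral_distr[OF m(1), of f] integral_distr[OF m(2), of f]
      integrable_distr_eq[OF m(1), of f] integrable_distr_eq[OF m(2), of f] d by auto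
qed

text \<open>The easy half of Kantorovich duality, by integrating \<open>|f x - f y| \<le> C |x - y|\<close> against a
  coupling. The passage from the \<open>p\<close>-th to the first moment of \<open>|x - y|\<close> is Young's inequality,
  scaled by the bound.\<close>

lemma Wasserstein_Lipschitz_bound:
  fixes f :: "'a::euclidean_space \<Rightarrow> real"
  assumes p: "1 \<le> p" and \<mu>: "prob_space \<mu>" and W: "Wasserstein p \<mu> \<nu> \<le> ennreal B" and B: "0 \<le> B"
    and f: "C-lipschitz_on UNIV f" "integrable \<mu> f" "integrable \<nu> f"
  shows "\<bar>(LINT x|\<mu>. f x) - (LINT x|\<nu>. f x)\<bar> \<le> C * B"
proof -
  have C: "0 \<le> C" using f(1) lipschitz_on_nonneg by blast
  have [measurable]: "f \<in> borel_measurable borel"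
    using lipschitz_on_continuous_on[OF f(1)] by (rule borel_measurable_continuous_onI)
  have "\<bar>(LINT x|\<mu>. f x) - (LINT x|\<nu>. f x)\<bar> \<le> C * B'" if B': "B < B'" for B'
  proof -
    have "Wasserstein p \<mu> \<nu> < ennreal B'"
      using W B B' by (meson ennreal_lessI le_less_trans order.strict_trans1)
    then obtain \<gamma> where \<gamma>: "\<gamma> \<in> couplings \<mu> \<nu>" "(\<integral>\<^sup>+z. ennreal (dist (fst z) (snd z) powr p) \<partial>\<gamma>) \<le> ennreal (B' powr p)"
      using Wasserstein_coupling[OF p] by metis
    interpret prob_space \<gamma> by (rule coupling_prob_space[OF \<gamma>(1) \<mu>])
    have s: "sets \<gamma> = sets borel" using \<gamma>(1) by (auto simp: couplings_def)
    note md = measurable_dist_powr[OF s]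
    have B0: "0 < B'" using B B' by simp
    have i: "integrable \<gamma> (\<lambda>z. dist (fst z) (snd z) powr p)"
      using md \<gamma>(2) by (intro integrableI_bounded) (auto simp: le_less_trans[OF \<gamma>(2)])
    have I: "(LINT z|\<gamma>. dist (fst z) (snd z) powr p) \<le> B' powr p"
      using \<gamma>(2) by (subst (asm) nn_integral_eq_integral[OF i]) auto
    let ?Y = "\<lambda>z. B' * (dist (fst z) (snd z) powr p / B' powr p / p + (1 - 1 / p))"
    have Y: "dist (fst z) (snd z) \<le> ?Y z" for z :: "'a \<times> 'a"
    proof -
      have "dist (fst z) (snd z) / B' \<le> (dist (fst z) (snd z) / B') powr p / p + (1 - 1 / p)"
        using B0 by (intro Young_powr[OF p]) auto
      then show ?thesis using B0 by (simp add: powr_divide pos_divide_le_eq mult.commute)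
    qed
    have iY: "integrable \<gamma> ?Y" using i by simp
    have id: "integrable \<gamma> (\<lambda>z. dist (fst z) (snd z))"
      by (rule Bochner_Integration.integrable_bound[OF iY md(1)])
        (use Y in \<open>auto intro!: AE_I2 order_trans[OF Y] abs_ge_self\<close>)
    note cf = coupling_integrals[OF \<gamma>(1), of f]
    have "\<bar>(LINT x|\<mu>. f x) - (LINT x|\<nu>. f x)\<bar> = \<bar>LINT z|\<gamma>. (f (fst z) - f (snd z))\<bar>"
      using f cf by simp
    also have "\<dots> \<le> (LINT z|\<gamma>. \<bar>f (fst z) - f (snd z)\<bar>)" by (rule integral_abs_bound)
    also have "\<dots> \<le> (LINT z|\<gamma>. C * dist (fst z) (snd z))"
      using f cf id lipschitz_onD[OF f(1)] by (intro integral_mono) (auto simp: dist_real_def)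
    also have "\<dots> = C * (LINT z|\<gamma>. dist (fst z) (snd z))" by simp
    also have "\<dots> \<le> C * (LINT z|\<gamma>. ?Y z)" by (intro mult_left_mono integral_mono id iY Y C)
    also have "(LINT z|\<gamma>. ?Y z) = B' * ((LINT z|\<gamma>. dist (fst z) (snd z) powr p) / B' powr p / p + (1 - 1 / p))"
      using i by (simp add: prob_space)
    also have "\<dots> \<le> B' * (1 / p + (1 - 1 / p))"
      using B0 I p by (intro mult_left_mono add_right_mono divide_right_mono) auto
    finally show ?thesis using C by (simp add: mult_left_mono)
  qed
  then have "\<forall>B'>B. \<bar>(LINT x|\<mu>. f x) - (LINT x|\<nu>. f x)\<bar> \<le> C * B'" by blast
  moreover have "((\<lambda>b. C * b) \<longlongrightarrow> C * B) (at_right B)" by (intro tendsto_intros)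
  ultimately show ?thesis
    by (intro tendsto_lowerbound[of _ "C * B" "at_right B"]) (auto simp: eventually_at_filter)
qed

lemma Wasserstein_moment_bound:
  fixes \<mu> \<nu> :: "'a::euclidean_space measure"
  assumes p: "1 \<le> p" and \<mu>: "\<mu> \<in> Pp p" and \<nu>: "\<nu> \<in> Pp p" and W: "Wasserstein p \<mu> \<nu> \<le> ennreal B" and B: "0 \<le> B"
  shows "moment p \<nu> \<le> (2 powr p * ((B + 1) powr p + (LINT x|\<mu>. norm x powr p))) powr (1 / p)"
proof -
  have "Wasserstein p \<mu> \<nu> < ennreal (B + 1)"
    by (rule le_less_trans[OF W]) (simp add: ennreal_less_iff B)
  then obtain \<gamma> where \<gamma>: "\<gamma> \<in> couplings \<mu> \<nu>" "(\<integral>\<^sup>+z. ennreal (dist (fst z) (snd z) powr p) \<partial>\<gamma>) \<le> ennreal ((B + 1) powr p)"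
    using Wasserstein_coupling[OF p] by metis
  interpret prob_space \<gamma> by (rule coupling_prob_space[OF \<gamma>(1) PpD(1)[OF \<mu> p]])
  have s: "sets \<gamma> = sets borel" using \<gamma>(1) by (auto simp: couplings_def)
  note md = measurable_dist_powr[OF s]
  have i: "integrable \<gamma> (\<lambda>z. dist (fst z) (snd z) powr p)"
    using md \<gamma>(2) by (intro integrableI_bounded) (auto simp: le_less_trans[OF \<gamma>(2)])
  have I: "(LINT z|\<gamma>. dist (fst z) (snd z) powr p) \<le> (B + 1) powr p"
    using \<gamma>(2) by (subst (asm) nn_integral_eq_integral[OF i]) auto
  note cf = coupling_integrals[OF \<gamma>(1), of "\<lambda>x. norm x powr p"]
  have i1: "integrable \<gamma> (\<lambda>z. norm (fst z) powr p)" and i2: "integrable \<gamma> (\<lambda>z. norm (snd z) powr p)"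
    using cf(3,4) PpD(4)[OF \<mu> p] PpD(4)[OF \<nu> p] by auto
  have "(LINT x|\<nu>. norm x powr p) = (LINT z|\<gamma>. norm (snd z) powr p)" using cf(2) by simp
  also have "\<dots> \<le> (LINT z|\<gamma>. 2 powr p * (dist (fst z) (snd z) powr p + norm (fst z) powr p))"
  proof (rule integral_mono)
    fix z :: "'a \<times> 'a"
    have "norm (snd z) \<le> dist (fst z) (snd z) + norm (fst z)"
      using norm_triangle_ineq2[of "snd z" "fst z"] by (simp add: dist_norm norm_minus_commute)
    then have "norm (snd z) powr p \<le> (dist (fst z) (snd z) + norm (fst z)) powr p"
      using p by (intro powr_mono2) auto
    also have "\<dots> \<le> 2 powr p * (dist (fst z) (snd z) powr p + norm (fst z) powr p)"
      using p by (intro powr_sum_le) auto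
    finally show "norm (snd z) powr p \<le> 2 powr p * (dist (fst z) (snd z) powr p + norm (fst z) powr p)" .
  qed (use i i1 i2 in auto)
  also have "\<dots> = 2 powr p * ((LINT z|\<gamma>. dist (fst z) (snd z) powr p) + (LINT x|\<mu>. norm x powr p))"
    using i i1 cf(1) by simp
  also have "\<dots> \<le> 2 powr p * ((B + 1) powr p + (LINT x|\<mu>. norm x powr p))"
    using I by (intro mult_left_mono) auto
  finally show ?thesis
    unfolding moment_def using p by (intro powr_mono2) (auto intro: integral_nonneg_AE)
qed

section \<open>Separability of the Wasserstein space\<close>

lemma countable_rational_pmfs: "countable {P :: nat pmf. finite (set_pmf P) \<and> (\<forall>i. pmf P i \<in> \<rat>)}"
    (is "countable ?S")
proof (rule countable_image_inj_on)
  let ?h = "\<lambda>P :: nat pmf. (\<lambda>i. (i, pmf P i)) ` set_pmf P"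
  have "?h ` ?S \<subseteq> {A. finite A \<and> A \<subseteq> UNIV \<times> \<rat>}" by auto
  moreover have "countable {A. finite A \<and> A \<subseteq> (UNIV :: nat set) \<times> (\<rat> :: real set)}"
    by (intro countable_Collect_finite_subset countable_SIGMA countable_rat) auto
  ultimately show "countable (?h ` ?S)" by (rule countable_subset)
  show "inj_on ?h ?S"
  proof (rule inj_onI)
    fix P Q :: "nat pmf" assume h: "?h P = ?h Q"
    have "set_pmf P = fst ` ?h P" "set_pmf Q = fst ` ?h Q" by force+
    then have s: "set_pmf P = set_pmf Q" using h by simp
    show "P = Q"
    proof (rule pmf_eqI)
      fix i
      show "pmf P i = pmf Q i"
      proof (cases "i \<in> set_pmf P")
        case True
        then have "(i, pmf P i) \<in> ?h Q" using h by blast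
        then show ?thesis by auto
      next
        case False
        moreover have "i \<notin> set_pmf Q" using False s by simp
        ultimately show ?thesis by (simp add: set_pmf_iff)
      qed
    qed
  qed
qed

lemma pmf_of_prob_space_nat:
  fixes N :: "nat measure"
  assumes "prob_space N" "sets N = UNIV"
  obtains P where "measure_pmf P = N"
proof -
  interpret prob_space N by fact
  have sp: "space N = UNIV" using sets_eq_imp_space_eq[of N "count_space UNIV"] assms(2) by simp
  have "(\<Union>x\<in>{x. measure N {x} = 0}. {x}) \<in> null_sets N"
    by (rule null_sets_UN') (auto simp: assms(2) emeasure_eq_measure null_sets_def)
  then have "AE x in N. measure N {x} \<noteq> 0" by (rule AE_I') auto
  then have "measure_pmf (Abs_pmf N) = N"
    using assms by (intro Abs_pmf_inverse) auto
  then show ?thesis by (rule that)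
qed

lemma emeasure_uniform_tail:
  assumes "0 \<le> r" "r \<le> 1"
  shows "measure (uniform_measure lborel {0..1::real}) {0..r} = r"
    "measure (uniform_measure lborel {0..1::real}) {r<..} = 1 - r"
proof -
  have "{0..1} \<inter> {0..r} = {0..r}" "{0..1} \<inter> {r<..} = {r<..1}" using assms by auto
  then show "measure (uniform_measure lborel {0..1::real}) {0..r} = r"
    "measure (uniform_measure lborel {0..1::real}) {r<..} = 1 - r"
    using assms by (simp_all add: measure_uniform_measure)
qed

text \<open>The dense set consists of the finitely supported measures with rational weights on a
  countable dense set of points. A given \<open>\<mu>\<close> is rounded in two ways. Points are moved to the
  first point of the dense set within distance \<open>e\<close>, except for those in a tail of small \<open>p\<close>-th moment,
  which go to the origin. The resulting masses \<open>a i\<close> are lowered to rationals \<open>b i\<close>, the missing mass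
  going to the origin as well. The second rounding needs a splitting of mass, which an auxiliary
  uniform variable on \<open>[0,1]\<close> provides: it turns the plan into a map on a product space.\<close>

lemma Pp_separable:
  assumes p: "1 \<le> p"
  obtains D :: "('a::euclidean_space) measure set" where "countable D" "D \<subseteq> Pp p"
    "\<And>\<mu> \<delta>. \<mu> \<in> Pp p \<Longrightarrow> 0 < \<delta> \<Longrightarrow> \<exists>\<nu>\<in>D. Wasserstein p \<mu> \<nu> \<le> ennreal \<delta>"
proof -
  obtain Q :: "'a set" where Q: "countable Q" "\<And>X. open X \<Longrightarrow> X \<noteq> {} \<Longrightarrow> \<exists>d\<in>Q. d \<in> X"
    using countable_dense_setE by metis
  have "Q \<noteq> {}" using Q(2)[of UNIV] by auto
  define q where "q = from_nat_into Q"
  have dense: "\<exists>i. dist x (q i) < e" if "0 < e" for x e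
  proof -
    have "ball x e \<noteq> {}" using that by simp
    then obtain d where "d \<in> Q" "d \<in> ball x e" using Q(2)[OF open_ball] by blast
    then show ?thesis using from_nat_into_surj[OF Q(1)] by (auto simp: q_def)
  qed
  \<comment> \<open>the support points: index 0 is the origin, which receives the mass left over by rounding\<close>
  define z where "z i = (case i of 0 \<Rightarrow> 0 | Suc j \<Rightarrow> q j)" for i :: nat
  define D where "D = (\<lambda>P. distr (measure_pmf P) borel z) ` {P :: nat pmf. finite (set_pmf P) \<and> (\<forall>i. pmf P i \<in> \<rat>)}"
  show ?thesis
  proof (rule that)
    show "countable D" unfolding D_def by (intro countable_image countable_rational_pmfs)
    show "D \<subseteq> Pp p"
    proof
      fix \<nu> assume "\<nu> \<in> D"
      then obtain P where P: "finite (set_pmf P)" "\<nu> = distr (measure_pmf P) borel z" by (auto simp: D_def)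
      have "integrable (measure_pmf P) (\<lambda>i. norm (z i) powr p)"
        by (rule integrable_measure_pmf_finite[OF P(1)])
      then show "\<nu> \<in> Pp p"
        unfolding Pp_def P(2) by (auto intro!: measure_pmf.prob_space_distr simp: integrable_distr_eq)
    qed
    fix \<mu> :: "'a measure" and \<delta> :: real assume \<mu>: "\<mu> \<in> Pp p" and \<delta>: "0 < \<delta>"
    note m = PpD[OF \<mu> p]
    interpret \<mu>: prob_space \<mu> by (rule m(1))
    note [measurable_cong] = m(2)
    define \<delta>' where "\<delta>' = \<delta> powr p / 4"
    have \<delta>': "0 < \<delta>'" using \<delta> by (simp add: \<delta>'_def)
    define e where "e = \<delta> / 4"
    have e: "0 < e" using \<delta> by (simp add: e_def)
    have ep: "e powr p \<le> \<delta>'"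
    proof -
      have "e powr p = \<delta> powr p / 4 powr p" using \<delta> by (simp add: e_def powr_divide)
      also have "\<dots> \<le> \<delta> powr p / 4 powr 1" using p by (intro divide_left_mono powr_mono) auto
      finally show ?thesis by (simp add: \<delta>'_def)
    qed
    \<comment> \<open>index of the first net point within distance \<open>e\<close>, shifted by one; 0 if there is none among the first \<open>N\<close>\<close>
    define f where "f x = (LEAST i. dist x (q i) < e)" for x
    have f: "dist x (q (f x)) < e" for x unfolding f_def by (rule LeastI_ex[OF dense[OF e]])
    have fm: "f \<in> borel \<rightarrow>\<^sub>M count_space UNIV"
      unfolding f_def by measurable
    have "(\<lambda>N. LINT x|\<mu>. indicator {x. N \<le> f x} x * norm x powr p) \<longlonglongrightarrow> (LINT x|\<mu>. 0)"
    proof (rule integral_dominated_convergence[where w = "\<lambda>x. norm x powr p"])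
      show "AE x in \<mu>. (\<lambda>N. indicator {x. N \<le> f x} x * norm x powr p) \<longlonglongrightarrow> 0"
      proof (intro AE_I2)
        fix x
        have "\<forall>\<^sub>F N in sequentially. 0 = indicator {x. N \<le> f x} x * norm x powr p"
          using eventually_gt_at_top[of "f x"] by eventually_elim simp
        then show "(\<lambda>N. indicator {x. N \<le> f x} x * norm x powr p) \<longlonglongrightarrow> 0"
          by (rule Lim_transform_eventually[OF tendsto_const])
      qed
    qed (use fm m in \<open>auto simp: indicator_def\<close>)
    then have "\<forall>\<^sub>F N in sequentially. (LINT x|\<mu>. indicator {x. N \<le> f x} x * norm x powr p) < \<delta>'"
      using \<delta>' by (intro order_tendstoD(2)[of _ 0]) auto
    then obtain N where N: "(LINT x|\<mu>. indicator {x. N \<le> f x} x * norm x powr p) < \<delta>'"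
      by (auto simp: eventually_sequentially)
    define A where "A i = {x. f x = i}" for i
    have A[measurable]: "A i \<in> sets borel" for i
      using measurable_sets[OF fm, of "{i}"] by (simp add: A_def vimage_def)
    \<comment> \<open>a bound for the cost of moving a point of one of the first \<open>N\<close> cells to the origin\<close>
    define R where "R = 1 + (\<Sum>i<N. (norm (q i) + e) powr p)"
    have R: "0 < R" unfolding R_def by (intro add_pos_nonneg sum_nonneg) auto
    define \<eta> where "\<eta> = \<delta>' / (R * real (Suc N))"
    have \<eta>: "0 < \<eta>" using \<delta>' R by (simp add: \<eta>_def)
    define a where "a i = measure \<mu> (A i)" for i
    have "\<exists>b. b \<in> \<rat> \<and> 0 \<le> b \<and> b \<le> a i \<and> a i - \<eta> \<le> b" for i
    proof (cases "a i \<le> \<eta>")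
      case True
      then show ?thesis by (intro exI[of _ 0]) (auto simp: a_def)
    next
      case False
      then obtain b where "b \<in> \<rat>" "a i - \<eta> < b" "b < a i"
        using Rats_dense_in_real[of "a i - \<eta>" "a i"] \<eta> by auto
      then show ?thesis using False by (intro exI[of _ b]) auto
    qed
    then obtain b where b: "\<And>i. b i \<in> \<rat>" "\<And>i. 0 \<le> b i" "\<And>i. b i \<le> a i" "\<And>i. a i - \<eta> \<le> b i"
      by metis
    define r where "r i = (if a i = 0 then 0 else b i / a i)" for i
    have a0: "0 \<le> a i" for i by (simp add: a_def)
    have r: "0 \<le> r i" "r i \<le> 1" "a i * r i = b i" for i
      using b(2,3)[of i] a0[of i] by (auto simp: r_def divide_le_eq_1)
    define U where "U = uniform_measure lborel {0..1::real}"
    interpret U: prob_space U unfolding U_def by (rule prob_space_uniform_measure) auto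
    have [measurable_cong]: "sets U = sets borel" by (simp add: U_def)
    interpret MU: pair_prob_space \<mu> U ..
    let ?M = "\<mu> \<Otimes>\<^sub>M U"
    define G where "G i = A i \<times> {0..r i}" for i
    \<comment> \<open>the index to which a point with uniform variable \<open>snd w\<close> is sent\<close>
    define J where "J w = (if f (fst w) < N \<and> snd w \<in> {0..r (f (fst w))} then Suc (f (fst w)) else 0)" for w :: "'a \<times> real"
    have J_Suc: "J -` {Suc i} = (if i < N then G i else {})" for i
      by (auto simp: J_def G_def A_def split: if_splits)
    have Gm[measurable]: "G i \<in> sets ?M" for i unfolding G_def by measurable
    have spM: "space ?M = UNIV" using m(3) by (simp add: space_pair_measure U_def)
    have Jm[measurable]: "J \<in> ?M \<rightarrow>\<^sub>M count_space UNIV"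
    proof (rule measurable_count_space_eq2_countable[THEN iffD2, OF conjI])
      show "\<forall>a\<in>UNIV. J -` {a} \<inter> space ?M \<in> sets ?M"
      proof
        fix n
        have Jlt: "i < N" if "J w = Suc i" for w i using that by (auto simp: J_def split: if_splits)
        have "J -` {0} = UNIV - (\<Union>i<N. J -` {Suc i})"
        proof (rule set_eqI)
          show "w \<in> J -` {0} \<longleftrightarrow> w \<in> UNIV - (\<Union>i<N. J -` {Suc i})" for w
            by (cases "J w") (auto dest: Jlt)
        qed
        then have "J -` {0} = UNIV - (\<Union>i<N. G i)" by (simp add: J_Suc)
        moreover have "UNIV - (\<Union>i<N. G i) \<in> sets ?M"
          using sets.compl_sets[of "\<Union>i<N. G i" ?M] spM by auto
        ultimately show "J -` {n} \<inter> space ?M \<in> sets ?M"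
          using J_Suc spM by (cases n) auto
      qed
    qed auto
    have "prob_space (distr ?M (count_space UNIV) J)" by (rule MU.prob_space_distr[OF Jm])
    then obtain P where P: "measure_pmf P = distr ?M (count_space UNIV) J"
      by (rule pmf_of_prob_space_nat) auto
    have times: "measure ?M (X \<times> Y) = measure \<mu> X * measure U Y" if "X \<in> sets borel" "Y \<in> sets borel" for X Y
      using that by (simp add: measure_def U.emeasure_pair_measure_Times enn2real_mult m(2) U_def[THEN arg_cong[of _ _ sets]])
    have mG: "measure ?M (G i) = b i" for i
      unfolding G_def using emeasure_uniform_tail(1)[OF r(1,2)[of i], folded U_def] r(3)[of i]
      by (simp add: times a_def)
    have P_Suc: "pmf P (Suc i) = (if i < N then b i else 0)" for i
    proof -
      have "pmf P (Suc i) = measure (measure_pmf P) {Suc i}" by (simp add: measure_pmf_single)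
      also have "\<dots> = measure ?M (J -` {Suc i})" unfolding P by (subst measure_distr) (auto simp: spM)
      also have "\<dots> = (if i < N then b i else 0)" by (simp add: J_Suc mG)
      finally show ?thesis .
    qed
    have sP: "set_pmf P \<subseteq> {..N}"
    proof
      fix n assume "n \<in> set_pmf P"
      then show "n \<in> {..N}" using P_Suc by (cases n) (auto simp: set_pmf_iff split: if_splits)
    qed
    then have finP: "finite (set_pmf P)" by (rule finite_subset) simp
    have P0: "pmf P 0 = 1 - (\<Sum>i<N. b i)"
    proof -
      have "(\<Sum>n\<le>N. pmf P n) = 1" using sP by (intro sum_pmf_eq_1) auto
      then show ?thesis by (simp add: sum.atMost_shift P_Suc)
    qed
    have "pmf P i \<in> \<rat>" for i
      using b(1) by (cases i) (auto simp: P_Suc P0 intro!: Rats_diff Rats_sum)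
    then have "distr (measure_pmf P) borel z \<in> D" using finP by (auto simp: D_def)
    moreover have "distr (measure_pmf P) borel z = distr ?M borel (\<lambda>w. z (J w))"
      unfolding P by (subst distr_distr) (auto simp: o_def)
    moreover have "distr ?M borel fst = \<mu>"
    proof -
      have "distr ?M borel fst = distr ?M \<mu> fst" by (rule distr_cong) (auto simp: m(2))
      then show ?thesis by (simp add: U.distr_pair_fst)
    qed
    moreover have "Wasserstein p (distr ?M borel fst) (distr ?M borel (\<lambda>w. z (J w))) \<le> ennreal \<delta>"
    proof (rule Wasserstein_distr_le[OF p])
      show "(\<lambda>w. z (J w)) \<in> ?M \<rightarrow>\<^sub>M borel" by measurable
      show "fst \<in> ?M \<rightarrow>\<^sub>M borel" by measurable
      \<comment> \<open>the part of cell \<open>i\<close> that is sent to the origin by the rounding of weights\<close>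
      define H where "H i = A i \<times> {r i<..}" for i
      have Hm[measurable]: "H i \<in> sets ?M" for i unfolding H_def by measurable
      have mH: "emeasure ?M (H i) \<le> ennreal \<eta>" for i
      proof -
        have "measure ?M (H i) = a i * (1 - r i)"
          unfolding H_def using emeasure_uniform_tail(2)[OF r(1,2)[of i], folded U_def]
          by (simp add: times a_def)
        also have "\<dots> \<le> \<eta>" using r(3)[of i] b(4)[of i] by (simp add: right_diff_distrib)
        finally show ?thesis by (simp add: MU.emeasure_eq_measure ennreal_leI)
      qed
      define t where "t x = indicator {x. N \<le> f x} x * norm x powr p" for x
      have S: "{x. N \<le> f x} \<in> sets borel"
        using measurable_sets[OF fm, of "{N..}"] by (simp add: vimage_def)
      have tm[measurable]: "t \<in> borel_measurable borel"
        unfolding t_def[abs_def] by (intro borel_measurable_times borel_measurable_indicator S) measurable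
      have tf: "(\<lambda>w. ennreal (t (fst w))) \<in> borel_measurable ?M" by measurable
      have negl: "AE w in ?M. 0 \<le> snd w"
      proof -
        have "AE u in U. 0 \<le> u" unfolding U_def by (rule AE_uniform_measureI) auto
        then show ?thesis by (intro MU.AE_pair_measure) auto
      qed
      have "(\<integral>\<^sup>+w. ennreal (dist (fst w) (z (J w)) powr p) \<partial>?M)
          \<le> (\<integral>\<^sup>+w. ennreal (e powr p) + ennreal (t (fst w)) + (\<Sum>i<N. ennreal R * indicator (H i) w) \<partial>?M)"
      proof (rule nn_integral_mono_AE, use negl in eventually_elim)
        case (elim w)
        obtain x u where w: "w = (x, u)" by fastforce
        consider "N \<le> f x" | "f x < N" "u \<le> r (f x)" | "f x < N" "r (f x) < u" by linarith
        then show ?case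
        proof cases
          case 1
          then have "J w = 0" by (simp add: J_def w)
          then show ?thesis using 1 by (simp add: w z_def t_def add_increasing add_increasing2)
        next
          case 2
          then have "J w = Suc (f x)" using elim by (simp add: J_def w)
          then have "dist (fst w) (z (J w)) powr p \<le> e powr p"
            using f[of x] p by (intro powr_mono2) (auto simp: w z_def)
          then have "ennreal (dist (fst w) (z (J w)) powr p) \<le> ennreal (e powr p)" by (rule ennreal_leI)
          then show ?thesis by (simp add: add_increasing2 add.assoc)
        next
          case 3
          then have J0: "J w = 0" by (simp add: J_def w)
          have "norm x \<le> norm (q (f x)) + e"
            using f[of x] norm_triangle_ineq2[of x "q (f x)"] by (simp add: dist_norm)
          then have "norm x powr p \<le> (norm (q (f x)) + e) powr p" using p by (intro powr_mono2) auto
          also have "\<dots> \<le> (\<Sum>i<N. (norm (q i) + e) powr p)"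
            using 3 by (intro member_le_sum) auto
          also have "\<dots> \<le> R" by (simp add: R_def)
          finally have "ennreal (dist (fst w) (z (J w)) powr p) \<le> ennreal R"
            by (intro ennreal_leI) (use J0 in \<open>simp add: w z_def\<close>)
          also have "ennreal R = ennreal R * indicator (H (f x)) w" using 3 by (simp add: H_def A_def w)
          also have "\<dots> \<le> (\<Sum>i<N. ennreal R * indicator (H i) w)"
            using 3 by (intro member_le_sum) auto
          finally show ?thesis by (simp add: add_increasing)
        qed
      qed
      also have "\<dots> = ennreal (e powr p) + (\<integral>\<^sup>+w. ennreal (t (fst w)) \<partial>?M) + (\<Sum>i<N. ennreal R * emeasure ?M (H i))"
      proof -
        have s: "(\<lambda>w. \<Sum>i<N. ennreal R * indicator (H i) w) \<in> borel_measurable ?M" by measurable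
        have "(\<integral>\<^sup>+w. (\<Sum>i<N. ennreal R * indicator (H i) w) \<partial>?M) = (\<Sum>i<N. ennreal R * emeasure ?M (H i))"
          by (subst nn_integral_sum) (auto intro!: sum.cong nn_integral_cmult_indicator)
        then show ?thesis
          using s tf by (subst nn_integral_add) (auto simp: nn_integral_add MU.emeasure_space_1)
      qed
      also have "(\<integral>\<^sup>+w. ennreal (t (fst w)) \<partial>?M) = (\<integral>\<^sup>+x. ennreal (t x) \<partial>\<mu>)"
        by (subst U.nn_integral_fst[symmetric]) (auto simp: U.emeasure_space_1)
      also have "\<dots> = ennreal (LINT x|\<mu>. t x)"
        by (rule nn_integral_eq_integral)
          (auto intro!: Bochner_Integration.integrable_bound[OF m(4)], auto simp: t_def indicator_def)
      also have "ennreal (e powr p) + ennreal (LINT x|\<mu>. t x) + (\<Sum>i<N. ennreal R * emeasure ?M (H i))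
          \<le> ennreal \<delta>' + ennreal \<delta>' + (\<Sum>i<N. ennreal R * ennreal \<eta>)"
        using N ep unfolding t_def[symmetric] by (intro add_mono sum_mono mult_left_mono mH ennreal_leI) auto
      also have "\<dots> = ennreal (\<delta>' + \<delta>' + real N * (R * \<eta>))"
      proof -
        have "(\<Sum>i<N. ennreal R * ennreal \<eta>) = ennreal (real N * (R * \<eta>))"
          using R \<eta> by (simp add: ennreal_of_nat_eq_real_of_nat ennreal_mult less_imp_le)
        moreover have "0 \<le> real N * (R * \<eta>)" using R \<eta> by simp
        ultimately show ?thesis
          using \<delta>' by (simp only: ennreal_plus[symmetric] add_nonneg_nonneg less_imp_le)
      qed
      also have "\<dots> \<le> ennreal (\<delta> powr p)"
      proof (rule ennreal_leI)
        have "real N * (R * \<eta>) \<le> \<delta>'" using R \<delta>' by (simp add: \<eta>_def divide_le_eq)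
        then show "\<delta>' + \<delta>' + real N * (R * \<eta>) \<le> \<delta> powr p"
          using \<delta>'_def \<delta>' by linarith
      qed
      finally show "(\<integral>\<^sup>+w. ennreal (dist (fst w) (z (J w)) powr p) \<partial>?M) \<le> ennreal (\<delta> powr p)" .
    qed (use \<delta> in auto)
    ultimately show "\<exists>\<nu>\<in>D. Wasserstein p \<mu> \<nu> \<le> ennreal \<delta>" by auto
  qed
qed

section \<open>Flows of Caratheodory vector fields\<close>

text \<open>\<open>u s (g s)\<close> is the limit of \<open>u s (q\<^sub>n (g s))\<close>, where \<open>q\<^sub>n\<close> rounds to the first point of a dense
  sequence within distance \<open>1 / n\<close> and hence takes countably many values.\<close>

lemma measurable_Caratheodory:
  fixes u :: "'b \<Rightarrow> 'a::euclidean_space \<Rightarrow> 'c::euclidean_space"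
  assumes u: "\<And>x. (\<lambda>s. u s x) \<in> borel_measurable M" and c: "\<And>s. s \<in> space M \<Longrightarrow> continuous_on UNIV (u s)"
    and g: "g \<in> borel_measurable M"
  shows "(\<lambda>s. u s (g s)) \<in> borel_measurable M"
proof -
  obtain Q :: "'a set" where Q: "countable Q" "\<And>X. open X \<Longrightarrow> X \<noteq> {} \<Longrightarrow> \<exists>d\<in>Q. d \<in> X"
    using countable_dense_setE by metis
  define q where "q = from_nat_into Q"
  have dense: "\<exists>i. dist x (q i) < e" if "0 < e" for x e
  proof -
    have "ball x e \<noteq> {}" using that by simp
    then obtain d where "d \<in> Q" "d \<in> ball x e" using Q(2)[OF open_ball] by blast
    then show ?thesis using from_nat_into_surj[OF Q(1)] by (auto simp: q_def)
  qed
  define f where "f n x = (LEAST i. dist x (q i) < inverse (real (Suc n)))" for n x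
  have f: "dist x (q (f n x)) < inverse (real (Suc n))" for n x
    unfolding f_def by (rule LeastI_ex[OF dense]) simp
  have fm: "f n \<in> borel \<rightarrow>\<^sub>M count_space UNIV" for n
    unfolding f_def by measurable
  show ?thesis
  proof (rule borel_measurable_LIMSEQ_metric)
    show "(\<lambda>s. u s (q (f n (g s)))) \<in> borel_measurable M" for n
    proof -
      have 1: "(\<lambda>s. f n (g s)) \<in> M \<rightarrow>\<^sub>M count_space UNIV"
        by (rule measurable_compose[OF g fm])
      show ?thesis
        by (rule measurable_compose_countable[of "\<lambda>i s. u s (q i)", OF u 1])
    qed
    fix s assume s: "s \<in> space M"
    have "(\<lambda>n. dist (q (f n (g s))) (g s)) \<longlonglongrightarrow> 0"
    proof (rule tendsto_sandwich[OF _ _ tendsto_const LIMSEQ_inverse_real_of_nat])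
      show "\<forall>\<^sub>F n in sequentially. dist (q (f n (g s))) (g s) \<le> inverse (real (Suc n))"
        using f[of "g s"] by (auto simp: dist_commute less_imp_le)
    qed simp
    then have "(\<lambda>n. q (f n (g s))) \<longlonglongrightarrow> g s" by (rule tendsto_dist_iff[THEN iffD2])
    then show "(\<lambda>n. u s (q (f n (g s)))) \<longlonglongrightarrow> u s (g s)"
      using c[OF s] by (intro isCont_tendsto_compose[of "g s" "u s"]) (auto simp: continuous_on_eq_continuous_at)
  qed
qed

lemma integral_dominated:
  fixes f :: "real \<Rightarrow> 'b::euclidean_space" and G :: "real \<Rightarrow> real"
  assumes "f \<in> borel_measurable lebesgue" "G integrable_on {a..b}" "\<And>s. s \<in> {a..b} \<Longrightarrow> norm (f s) \<le> G s * c"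
  shows "f absolutely_integrable_on {a..b}" "f integrable_on {a..b}"
    "norm (integral {a..b} f) \<le> integral {a..b} G * c"
proof -
  have c: "(\<lambda>s. G s * c) integrable_on {a..b}" using assms(2) by (rule integrable_on_mult_left)
  show f: "f absolutely_integrable_on {a..b}"
    by (rule measurable_bounded_by_integrable_imp_absolutely_integrable[OF _ _ c assms(3)])
      (auto intro: measurable_restrict_space1 assms(1))
  then show i: "f integrable_on {a..b}" by (rule set_lebesgue_integral_eq_integral(1))
  have "norm (integral {a..b} f) \<le> integral {a..b} (\<lambda>s. G s * c)"
    by (rule integral_norm_bound_integral[OF i c assms(3)])
  then show "norm (integral {a..b} f) \<le> integral {a..b} G * c" by simp
qed

text \<open>One control \<open>G\<close> bounds growth and Lipschitz constant. Its total mass is at most one half, which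
  makes the integral operator of the differential equation a contraction; since the theorem is local in
  time, this is arranged by a short time interval.\<close>

locale Caratheodory_field =
  fixes u :: "real \<Rightarrow> 'a::euclidean_space \<Rightarrow> 'a" and G :: "real \<Rightarrow> real"
  assumes G_integrable: "integrable lebesgue G"
    and G_nonneg: "0 \<le> G t"
    and G_small: "(LINT t|lebesgue. G t) \<le> 1 / 2"
    and u_measurable: "(\<lambda>t. u t x) \<in> borel_measurable lebesgue"
    and u_lipschitz: "(G t)-lipschitz_on UNIV (u t)"
    and u_growth: "norm (u t x) \<le> G t * (1 + norm x)"
begin

definition mass :: "real \<Rightarrow> real \<Rightarrow> real" where
  "mass a b = integral {a..b} G"

lemma G_abs: "G absolutely_integrable_on {a..b}"
  unfolding set_integrable_def by (rule integrable_mult_indicator[OF _ G_integrable]) simp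

lemma G_int: "G integrable_on {a..b}"
  using G_abs by (rule set_lebesgue_integral_eq_integral(1))

lemma mass_nonneg: "0 \<le> mass a b"
  unfolding mass_def by (rule integral_nonneg[OF G_int]) (rule G_nonneg)

lemma mass_add: "a \<le> b \<Longrightarrow> b \<le> c \<Longrightarrow> mass a b + mass b c = mass a c"
  unfolding mass_def by (rule Henstock_Kurzweil_Integration.integral_combine) (auto intro: G_int)

lemma mass_mono: "a \<le> a' \<Longrightarrow> a' \<le> b' \<Longrightarrow> b' \<le> b \<Longrightarrow> mass a' b' \<le> mass a b"
  using mass_add[of a a' b] mass_add[of a' b' b] mass_nonneg[of a a'] mass_nonneg[of b' b] by simp

lemma mass_le_half: "mass a b \<le> 1 / 2"
proof -
  have "mass a b = (LINT t:{a..b}|lebesgue. G t)"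
    unfolding mass_def by (rule set_lebesgue_integral_eq_integral(2)[OF G_abs, symmetric])
  also have "\<dots> \<le> (LINT t|lebesgue. G t)"
    unfolding set_lebesgue_integral_def
    by (rule integral_mono[OF G_abs[unfolded set_integrable_def] G_integrable])
      (use G_nonneg in \<open>auto simp: indicator_def\<close>)
  finally show ?thesis using G_small by simp
qed

lemma mass_continuous: "continuous_on {0..b} (mass 0)"
  unfolding mass_def[abs_def] by (rule indefinite_integral_continuous_1[OF G_int])

lemma bounded_by_G:
  fixes f :: "real \<Rightarrow> 'b::euclidean_space"
  assumes "f \<in> borel_measurable lebesgue" "\<And>s. s \<in> {a..b} \<Longrightarrow> norm (f s) \<le> G s * c"
  shows "f absolutely_integrable_on {a..b}" "f integrable_on {a..b}"
    "norm (integral {a..b} f) \<le> mass a b * c"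
  unfolding mass_def by (rule integral_dominated[OF assms(1) G_int assms(2)]; assumption)+

lemma u_continuous: "continuous_on UNIV (u t)"
  using u_lipschitz by (rule lipschitz_on_continuous_on)

lemma u_curve_measurable:
  assumes "continuous_on UNIV c"
  shows "(\<lambda>s. u s (c s)) \<in> borel_measurable lebesgue"
proof (rule measurable_Caratheodory[OF u_measurable u_continuous])
  show "c \<in> borel_measurable lebesgue"
    using borel_measurable_continuous_onI[OF assms] by (simp add: measurable_completion)
qed

lemma u_diff: "norm (u t x - u t y) \<le> G t * norm (x - y)"
  using lipschitz_onD[OF u_lipschitz, of x y t] by (simp add: dist_norm)

text \<open>Banach's fixed point theorem for bounded continuous curves. Time is clamped to \<open>[0,H]\<close> so that
  the operator acts on curves defined on the whole line, which form a complete space.\<close>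

lemma flow_exists_point:
  assumes H: "0 \<le> H"
  shows "\<exists>\<phi> :: real \<Rightarrow>\<^sub>C 'a. \<forall>t\<in>{0..H}. \<phi> t = x + integral {0..t} (\<lambda>s. u s (\<phi> s))"
proof -
  define \<Gamma> where "\<Gamma> \<phi> t = x + integral {0..max 0 (min t H)} (\<lambda>s. u s (apply_bcontfun \<phi> s))"
    for \<phi> :: "real \<Rightarrow>\<^sub>C 'a" and t
  have m: "(\<lambda>s. u s (apply_bcontfun \<phi> s)) \<in> borel_measurable lebesgue" for \<phi> :: "real \<Rightarrow>\<^sub>C 'a"
    using apply_bcontfun[of \<phi>] by (intro u_curve_measurable) (simp add: bcontfun_def)
  have g: "norm (u s (apply_bcontfun \<phi> s)) \<le> G s * (1 + norm \<phi>)" for s and \<phi> :: "real \<Rightarrow>\<^sub>C 'a"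
    by (rule order_trans[OF u_growth]) (intro mult_left_mono add_left_mono norm_bounded G_nonneg)
  note b = bounded_by_G[OF m g]
  have in_bc: "\<Gamma> \<phi> \<in> bcontfun" for \<phi> :: "real \<Rightarrow>\<^sub>C 'a"
  proof (rule bcontfun_normI)
    have "continuous_on {0..H} (\<lambda>t. integral {0..t} (\<lambda>s. u s (apply_bcontfun \<phi> s)))"
      by (rule indefinite_integral_continuous_1[OF b(2)])
    then have "continuous_on UNIV (\<lambda>t. integral {0..max 0 (min t H)} (\<lambda>s. u s (apply_bcontfun \<phi> s)))"
      by (rule continuous_on_compose2) (use H in \<open>auto intro!: continuous_intros\<close>)
    then show "continuous_on UNIV (\<Gamma> \<phi>)" unfolding \<Gamma>_def by (intro continuous_intros)
    fix t
    have "norm (\<Gamma> \<phi> t) \<le> norm x + mass 0 (max 0 (min t H)) * (1 + norm \<phi>)"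
      unfolding \<Gamma>_def by (rule norm_triangle_le) (use b(3) in auto)
    also have "\<dots> \<le> norm x + 1 / 2 * (1 + norm \<phi>)"
      by (intro add_left_mono mult_right_mono mass_le_half) simp
    finally show "norm (\<Gamma> \<phi> t) \<le> norm x + 1 / 2 * (1 + norm \<phi>)" .
  qed
  have "\<exists>!\<phi>. Bcontfun (\<Gamma> \<phi>) = \<phi>"
  proof (rule banach_fix_type[where c = "1 / 2"])
    show "\<forall>\<phi> \<psi>. dist (Bcontfun (\<Gamma> \<phi>)) (Bcontfun (\<Gamma> \<psi>)) \<le> 1 / 2 * dist \<phi> \<psi>"
    proof (intro allI dist_bound)
      fix \<phi> \<psi> :: "real \<Rightarrow>\<^sub>C 'a" and t
      have "norm (integral {0..max 0 (min t H)} (\<lambda>s. u s (apply_bcontfun \<phi> s) - u s (apply_bcontfun \<psi> s)))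
          \<le> mass 0 (max 0 (min t H)) * dist \<phi> \<psi>"
      proof (rule bounded_by_G(3))
        show "(\<lambda>s. u s (apply_bcontfun \<phi> s) - u s (apply_bcontfun \<psi> s)) \<in> borel_measurable lebesgue"
          by (intro borel_measurable_diff m)
        fix s
        have "norm (apply_bcontfun \<phi> s - apply_bcontfun \<psi> s) \<le> dist \<phi> \<psi>"
          using dist_bounded[of \<phi> s \<psi>] by (simp add: dist_norm)
        then show "norm (u s (apply_bcontfun \<phi> s) - u s (apply_bcontfun \<psi> s)) \<le> G s * dist \<phi> \<psi>"
          by (intro order_trans[OF u_diff] mult_left_mono G_nonneg)
      qed
      also have "\<dots> \<le> 1 / 2 * dist \<phi> \<psi>" by (intro mult_right_mono mass_le_half) simp
      finally show "dist (apply_bcontfun (Bcontfun (\<Gamma> \<phi>)) t) (apply_bcontfun (Bcontfun (\<Gamma> \<psi>)) t) \<le> 1 / 2 * dist \<phi> \<psi>"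
        using b(2) by (simp add: Bcontfun_inverse[OF in_bc] dist_norm \<Gamma>_def Henstock_Kurzweil_Integration.integral_diff)
    qed
  qed auto
  then obtain \<phi> where "Bcontfun (\<Gamma> \<phi>) = \<phi>" by blast
  then have "apply_bcontfun \<phi> = \<Gamma> \<phi>" using Bcontfun_inverse[OF in_bc, of \<phi>] by simp
  then have "apply_bcontfun \<phi> t = x + integral {0..t} (\<lambda>s. u s (apply_bcontfun \<phi> s))" if "t \<in> {0..H}" for t
    using that by (metis \<Gamma>_def atLeastAtMost_iff max.absorb2 min.absorb1)
  then show ?thesis by blast
qed

lemma flow_exists:
  assumes H: "0 \<le> H"
  obtains \<Phi> :: "real \<Rightarrow> 'a \<Rightarrow> 'a" where
    "\<And>x. continuous_on UNIV (\<lambda>t. \<Phi> t x)"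
    "\<And>t x. t \<in> {0..H} \<Longrightarrow> \<Phi> t x = x + integral {0..t} (\<lambda>s. u s (\<Phi> s x))"
    "\<And>t x. t \<in> {0..H} \<Longrightarrow> 1 + norm (\<Phi> t x) \<le> 2 * (1 + norm x)"
    "\<And>t. t \<in> {0..H} \<Longrightarrow> continuous_on UNIV (\<Phi> t)"
proof -
  obtain \<phi> :: "'a \<Rightarrow> (real \<Rightarrow>\<^sub>C 'a)" where \<phi>:
    "\<And>x t. t \<in> {0..H} \<Longrightarrow> \<phi> x t = x + integral {0..t} (\<lambda>s. u s (\<phi> x s))"
    using flow_exists_point[OF H] by metis
  define \<Phi> where "\<Phi> t x = apply_bcontfun (\<phi> x) t" for t x
  have c: "continuous_on UNIV (\<lambda>t. \<Phi> t x)" for x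
    using apply_bcontfun[of "\<phi> x"] by (simp add: bcontfun_def \<Phi>_def)
  have eq: "\<Phi> t x = x + integral {0..t} (\<lambda>s. u s (\<Phi> s x))" if "t \<in> {0..H}" for t x
    using \<phi>[OF that] by (simp add: \<Phi>_def)
  note m = u_curve_measurable[OF c]
  \<comment> \<open>a function bounded by half of its supremum plus a constant is bounded by twice the constant\<close>
  have absorb: "f t \<le> 2 * K" if f: "continuous_on UNIV f" "t \<in> {0..H}"
      "\<And>t S. t \<in> {0..H} \<Longrightarrow> 0 \<le> S \<Longrightarrow> (\<And>s. s \<in> {0..H} \<Longrightarrow> f s \<le> S) \<Longrightarrow> f t \<le> K + S / 2"
      "\<And>t. 0 \<le> f t"
    for f :: "real \<Rightarrow> real" and K t
  proof -
    obtain t0 where t0: "t0 \<in> {0..H}" "\<And>s. s \<in> {0..H} \<Longrightarrow> f s \<le> f t0"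
      using continuous_attains_sup[of "{0..H}" f] continuous_on_subset[OF f(1)] H by auto
    have "f t0 \<le> K + f t0 / 2" by (rule f(3)[OF t0(1) f(4) t0(2)])
    then show ?thesis using t0(2)[OF f(2)] by simp
  qed
  have bd: "1 + norm (\<Phi> t x) \<le> 2 * (1 + norm x)" if t: "t \<in> {0..H}" for t x
  proof (rule absorb[OF _ t])
    show "continuous_on UNIV (\<lambda>t. 1 + norm (\<Phi> t x))" by (intro continuous_intros c)
    fix t S assume t: "t \<in> {0..H}" and S: "0 \<le> S" "\<And>s. s \<in> {0..H} \<Longrightarrow> 1 + norm (\<Phi> s x) \<le> S"
    have "norm (integral {0..t} (\<lambda>s. u s (\<Phi> s x))) \<le> mass 0 t * S"
      by (rule bounded_by_G(3)[OF m]) (use t S in \<open>auto intro!: order_trans[OF u_growth] mult_left_mono G_nonneg\<close>)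
    also have "\<dots> \<le> 1 / 2 * S" by (intro mult_right_mono mass_le_half S)
    finally show "1 + norm (\<Phi> t x) \<le> (1 + norm x) + S / 2"
      using norm_triangle_ineq[of x "integral {0..t} (\<lambda>s. u s (\<Phi> s x))"] eq[OF t, of x] by simp
  qed simp
  \<comment> \<open>the same absorption gives the Lipschitz dependence on the initial point\<close>
  have lip: "norm (\<Phi> t x - \<Phi> t y) \<le> 2 * norm (x - y)" if t: "t \<in> {0..H}" for t x y
  proof (rule absorb[OF _ t])
    show "continuous_on UNIV (\<lambda>t. norm (\<Phi> t x - \<Phi> t y))" by (intro continuous_intros c)
    fix t S assume t: "t \<in> {0..H}" and S: "0 \<le> S" "\<And>s. s \<in> {0..H} \<Longrightarrow> norm (\<Phi> s x - \<Phi> s y) \<le> S"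
    have i: "(\<lambda>s. u s (\<Phi> s x)) integrable_on {0..t}" for x
      by (rule bounded_by_G(2)[OF m, of _ _ _ "2 * (1 + norm x)"])
        (use t bd in \<open>auto intro!: order_trans[OF u_growth] mult_left_mono G_nonneg\<close>)
    have "norm (integral {0..t} (\<lambda>s. u s (\<Phi> s x) - u s (\<Phi> s y))) \<le> mass 0 t * S"
      by (rule bounded_by_G(3)[OF borel_measurable_diff[OF m m]])
        (use t S in \<open>auto intro!: order_trans[OF u_diff] mult_left_mono G_nonneg\<close>)
    also have "\<dots> \<le> 1 / 2 * S" by (intro mult_right_mono mass_le_half S)
    finally have "norm (integral {0..t} (\<lambda>s. u s (\<Phi> s x)) - integral {0..t} (\<lambda>s. u s (\<Phi> s y))) \<le> 1 / 2 * S"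
      by (simp add: Henstock_Kurzweil_Integration.integral_diff[OF i i])
    moreover have "\<Phi> t x - \<Phi> t y = (x - y) + (integral {0..t} (\<lambda>s. u s (\<Phi> s x)) - integral {0..t} (\<lambda>s. u s (\<Phi> s y)))"
      by (subst (1 2) eq[OF t]) simp
    ultimately show "norm (\<Phi> t x - \<Phi> t y) \<le> norm (x - y) + S / 2"
      using norm_triangle_ineq[of "x - y" "integral {0..t} (\<lambda>s. u s (\<Phi> s x)) - integral {0..t} (\<lambda>s. u s (\<Phi> s y))"]
      by simp
  qed simp
  have "continuous_on UNIV (\<Phi> t)" if "t \<in> {0..H}" for t
  proof (rule lipschitz_on_continuous_on)
    show "2-lipschitz_on UNIV (\<Phi> t)"
      using lip[OF that] by (intro lipschitz_onI) (auto simp: dist_norm)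
  qed
  then show ?thesis using that[of \<Phi>, OF c eq bd] by blast
qed

end

section \<open>Solutions of the continuity equation are transported by the flow\<close>

lemma integrable_vanish_prob:
  fixes f :: "'a::euclidean_space \<Rightarrow> real"
  assumes "continuous_on UNIV f" "\<And>x. Q < norm x \<Longrightarrow> f x = 0" "prob_space M" "sets M = sets borel"
  shows "integrable M f"
proof -
  interpret prob_space M by fact
  have [measurable]: "f \<in> borel_measurable M"
    using borel_measurable_continuous_onI[OF assms(1)] by (simp add: measurable_cong_sets[OF assms(4) refl])
  have "bounded (f ` cball 0 Q)"
    by (intro compact_imp_bounded compact_continuous_image continuous_on_subset[OF assms(1)]) auto
  then obtain B where B: "0 < B" "\<And>x. x \<in> cball 0 Q \<Longrightarrow> norm (f x) \<le> B"
    by (metis bounded_pos imageI)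
  have "norm (f x) \<le> B" for x
    using B assms(2)[of x] by (cases "Q < norm x") auto
  then show ?thesis by (intro integrable_const_bound[of _ B]) auto
qed

lemma Taylor_gradient:
  fixes f :: "'a::euclidean_space \<Rightarrow> real"
  assumes f: "smooth f" and K: "\<And>x y. norm (gradient f x - gradient f y) \<le> K * norm (x - y)"
  shows "\<bar>f y - f x - gradient f x \<bullet> (y - x)\<bar> \<le> K * (norm (y - x))\<^sup>2"
proof -
  have K0: "0 \<le> K" if "x \<noteq> y"
    using order_trans[OF norm_ge_zero K[of x y]] that by (simp add: zero_le_mult_iff)
  let ?h = "\<lambda>z. f z - gradient f x \<bullet> z"
  have "norm (?h y - ?h x) \<le> K * norm (y - x) * norm (y - x)"
  proof (cases "x = y")
    case False
    show ?thesis
    proof (rule differentiable_bound[where S = "cball x (norm (y - x))" and f' = "\<lambda>z h. (gradient f z - gradient f x) \<bullet> h"])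
      fix z assume z: "z \<in> cball x (norm (y - x))"
      have "(?h has_derivative (\<lambda>h. gradient f z \<bullet> h - gradient f x \<bullet> h)) (at z within cball x (norm (y - x)))"
        by (intro derivative_intros has_derivative_at_withinI[OF smooth_gradient(1)[OF f]])
      then show "(?h has_derivative (\<lambda>h. (gradient f z - gradient f x) \<bullet> h)) (at z within cball x (norm (y - x)))"
        by (simp add: inner_diff_left)
      show "onorm (\<lambda>h. (gradient f z - gradient f x) \<bullet> h) \<le> K * norm (y - x)"
      proof (rule onorm_le)
        fix h
        have "norm ((gradient f z - gradient f x) \<bullet> h) \<le> norm (gradient f z - gradient f x) * norm h"
          using Cauchy_Schwarz_ineq2 by simp
        also have "\<dots> \<le> (K * norm (z - x)) * norm h" by (intro mult_right_mono K) auto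
        also have "\<dots> \<le> (K * norm (y - x)) * norm h"
          using z K0[OF False] by (intro mult_right_mono mult_left_mono) (auto simp: dist_norm norm_minus_commute)
        finally show "norm ((gradient f z - gradient f x) \<bullet> h) \<le> K * norm (y - x) * norm h" .
      qed
    qed (auto simp: dist_norm norm_minus_commute)
  qed simp
  then show ?thesis by (simp add: inner_diff_right power2_eq_square algebra_simps)
qed

lemma inner_field_lipschitz:
  fixes g w :: "'a::euclidean_space \<Rightarrow> 'a"
  assumes gb: "\<And>x. norm (g x) \<le> K" and gl: "\<And>x y. norm (g x - g y) \<le> K * norm (x - y)"
    and gQ: "\<And>x. Q + 1 < norm x \<Longrightarrow> g x = 0" and w: "c-lipschitz_on UNIV w" "\<And>x. norm (w x) \<le> c * (1 + norm x)"
    and c: "0 \<le> c" and Q: "0 \<le> Q"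
  shows "(K * (Q + 3) * c)-lipschitz_on UNIV (\<lambda>x. g x \<bullet> w x)"
proof (rule lipschitz_onI)
  have K: "0 \<le> K" using gb norm_ge_zero order_trans by blast
  show "0 \<le> K * (Q + 3) * c" using K Q c by simp
  have wl: "norm (w x - w y) \<le> c * norm (x - y)" for x y
    using lipschitz_onD[OF w(1), of x y] by (simp add: dist_norm)
  have *: "\<bar>g x \<bullet> w x - g y \<bullet> w y\<bar> \<le> K * (Q + 3) * c * norm (x - y)" if "norm y \<le> Q + 1" for x y
  proof -
    have "g x \<bullet> w x - g y \<bullet> w y = g x \<bullet> (w x - w y) + (g x - g y) \<bullet> w y"
      by (simp add: inner_diff_left inner_diff_right)
    then have "\<bar>g x \<bullet> w x - g y \<bullet> w y\<bar> \<le> norm (g x) * norm (w x - w y) + norm (g x - g y) * norm (w y)"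
      using Cauchy_Schwarz_ineq2[of "g x" "w x - w y"] Cauchy_Schwarz_ineq2[of "g x - g y" "w y"] by linarith
    also have "\<dots> \<le> K * (c * norm (x - y)) + (K * norm (x - y)) * (c * (1 + (Q + 1)))"
      using that by (intro add_mono mult_mono gb gl wl order_trans[OF w(2)] mult_left_mono)
        (auto intro!: mult_nonneg_nonneg K c)
    finally show ?thesis by (simp add: algebra_simps)
  qed
  fix x y :: 'a
  consider "norm y \<le> Q + 1" | "norm x \<le> Q + 1" | "Q + 1 < norm x" "Q + 1 < norm y" by linarith
  then show "dist (g x \<bullet> w x) (g y \<bullet> w y) \<le> K * (Q + 3) * c * dist x y"
  proof cases
    case 1
    then show ?thesis using *[of y x] by (simp add: dist_norm)
  next
    case 2
    then show ?thesis using *[of x y] by (simp add: dist_norm norm_minus_commute abs_minus_commute)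
  next
    case 3
    then show ?thesis using K Q c by (simp add: gQ)
  qed
qed

context Caratheodory_field
begin

text \<open>One explicit Euler step from time \<open>s\<close> to time \<open>t\<close>.\<close>

definition Euler :: "real \<Rightarrow> real \<Rightarrow> 'a \<Rightarrow> 'a" where
  "Euler s t x = x + integral {s..t} (\<lambda>r. u r x)"

lemma Euler_growth: "norm (Euler s t x - x) \<le> mass s t * (1 + norm x)"
  unfolding Euler_def using bounded_by_G(3)[OF u_measurable u_growth] by simp

text \<open>The displacement of an Euler step has a Lipschitz constant as small as the mass of the step. This is
  what makes the commutator with mollification small.\<close>

lemma Euler_diff: "norm ((Euler s t x - x) - (Euler s t y - y)) \<le> mass s t * norm (x - y)"
proof -
  have i: "(\<lambda>r. u r x) integrable_on {s..t}" for x
    by (rule bounded_by_G(2)[OF u_measurable u_growth])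
  have "norm (integral {s..t} (\<lambda>r. u r x - u r y)) \<le> mass s t * norm (x - y)"
    by (rule bounded_by_G(3)[OF borel_measurable_diff[OF u_measurable u_measurable] u_diff])
  then show ?thesis by (simp add: Euler_def Henstock_Kurzweil_Integration.integral_diff[OF i i])
qed

lemma Euler_lipschitz: "(1 + mass s t)-lipschitz_on UNIV (Euler s t)"
proof (rule lipschitz_onI)
  fix x y
  have "norm (Euler s t x - Euler s t y) \<le> norm (x - y) + norm ((Euler s t x - x) - (Euler s t y - y))"
    using norm_triangle_ineq[of "x - y" "(Euler s t x - x) - (Euler s t y - y)"] by (simp add: algebra_simps)
  then show "dist (Euler s t x) (Euler s t y) \<le> (1 + mass s t) * dist x y"
    using Euler_diff[of s t x y] by (simp add: dist_norm algebra_simps)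
qed (use mass_nonneg[of s t] in auto)

lemma Euler_continuous: "continuous_on UNIV (Euler s t)"
  by (rule lipschitz_on_continuous_on[OF Euler_lipschitz])

lemma Euler_lower: "1 + norm x \<le> (1 + norm (Euler s t x)) * (1 + 2 * mass s t)"
proof -
  let ?a = "mass s t"
  have "norm x \<le> norm (Euler s t x) + ?a * (1 + norm x)"
    using Euler_growth[of s t x] norm_triangle_ineq2[of x "Euler s t x"] by (simp add: norm_minus_commute)
  then have "(1 + norm x) * (1 - ?a) \<le> 1 + norm (Euler s t x)" by (simp add: algebra_simps)
  then have "(1 + norm x) * (1 - ?a) * (1 + 2 * ?a) \<le> (1 + norm (Euler s t x)) * (1 + 2 * ?a)"
    using mass_nonneg[of s t] by (intro mult_right_mono) auto
  moreover have "1 \<le> (1 - ?a) * (1 + 2 * ?a)"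
    using mult_nonneg_nonneg[OF mass_nonneg[of s t], of "1 - 2 * ?a"] mass_le_half[of s t] by (simp add: algebra_simps)
  then have "(1 + norm x) * 1 \<le> (1 + norm x) * ((1 - ?a) * (1 + 2 * ?a))"
    by (intro mult_left_mono) auto
  ultimately show ?thesis by (simp add: mult.assoc)
qed

text \<open>Points are moved inwards by at most a controlled factor, so pulling back a compactly supported
  function keeps the support compact.\<close>

lemma Euler_vanish:
  assumes "\<And>x. Q < norm x \<Longrightarrow> \<eta> x = 0" "(1 + Q) * (1 + 2 * mass s t) < 1 + norm x"
  shows "\<eta> (Euler s t x) = 0"
proof (rule assms(1), rule ccontr)
  assume "\<not> Q < norm (Euler s t x)"
  then have "(1 + norm (Euler s t x)) * (1 + 2 * mass s t) \<le> (1 + Q) * (1 + 2 * mass s t)"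
    using mass_nonneg[of s t] by (intro mult_right_mono) auto
  then show False using Euler_lower[of x s t] assms(2) by simp
qed

lemma Fubini_Euler:
  assumes M: "prob_space M" "sets M = sets borel"
    and g: "continuous_on UNIV g" "\<And>x. Q < norm x \<Longrightarrow> g x = 0" "\<And>x. norm (g x) \<le> K"
  shows "(\<lambda>r. LINT x|M. g x \<bullet> u r x) integrable_on {s..t}"
    "integral {s..t} (\<lambda>r. LINT x|M. g x \<bullet> u r x) = (LINT x|M. g x \<bullet> (Euler s t x - x))"
proof -
  interpret M: prob_space M by fact
  let ?L = "lebesgue_on {s..t}"
  interpret L: finite_measure ?L by (rule finite_measure_lebesgue_on) simp
  interpret LM: pair_sigma_finite ?L M by (intro pair_sigma_finite.intro) unfold_locales
  note [measurable_cong] = M(2)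
  have gm[measurable]: "g \<in> borel_measurable borel" using g(1) by (rule borel_measurable_continuous_onI)
  have um: "(\<lambda>w. u (fst w) (snd w)) \<in> borel_measurable (?L \<Otimes>\<^sub>M M)"
  proof (rule measurable_Caratheodory[where u = "\<lambda>w. u (fst w)"])
    show "(\<lambda>w. u (fst w) x) \<in> borel_measurable (?L \<Otimes>\<^sub>M M)" for x
      by (rule measurable_compose[OF measurable_fst]) (rule measurable_restrict_space1[OF u_measurable])
    show "snd \<in> borel_measurable (?L \<Otimes>\<^sub>M M)" by measurable
  qed (rule u_continuous)
  have K: "0 \<le> K" using g(3) norm_ge_zero order_trans by blast
  define c where "c = K * (1 + max 0 Q)"
  have bd: "norm (g x \<bullet> u r x) \<le> G r * c" for r x
  proof (cases "Q < norm x")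
    case False
    have "norm (g x \<bullet> u r x) \<le> norm (g x) * norm (u r x)" using Cauchy_Schwarz_ineq2 by simp
    also have "\<dots> \<le> K * (G r * (1 + norm x))" by (intro mult_mono g(3) u_growth K) auto
    also have "\<dots> \<le> K * (G r * (1 + max 0 Q))"
      using False by (intro mult_left_mono K G_nonneg) auto
    finally show ?thesis by (simp add: c_def mult_ac)
  next
    case True
    then show ?thesis using g(2)[of x] G_nonneg[of r] K by (simp add: c_def)
  qed
  have Gi: "integrable ?L G"
    using G_abs[of s t] by (simp add: integrable_restrict_space set_integrable_def)
  have Gp: "integrable (?L \<Otimes>\<^sub>M M) (\<lambda>w. G (fst w) * c)"
  proof (rule LM.Fubini_integrable)
    show "(\<lambda>w. G (fst w) * c) \<in> borel_measurable (?L \<Otimes>\<^sub>M M)"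
      by (intro borel_measurable_times measurable_compose[OF measurable_fst] borel_measurable_integrable[OF Gi]) auto
    show "integrable ?L (\<lambda>x. LINT y|M. norm (G (fst (x, y)) * c))"
      using Gi by (simp add: M.prob_space)
  qed simp
  have int: "integrable (?L \<Otimes>\<^sub>M M) (\<lambda>w. g (snd w) \<bullet> u (fst w) (snd w))"
  proof (rule Bochner_Integration.integrable_bound[OF Gp])
    show "(\<lambda>w. g (snd w) \<bullet> u (fst w) (snd w)) \<in> borel_measurable (?L \<Otimes>\<^sub>M M)"
      by (intro borel_measurable_inner um measurable_compose[OF measurable_snd]) measurable
    show "AE w in ?L \<Otimes>\<^sub>M M. norm (g (snd w) \<bullet> u (fst w) (snd w)) \<le> norm (G (fst w) * c)"
      using bd by (intro AE_I2) (auto intro: order_trans[OF _ abs_ge_self])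
  qed
  have i1: "integrable ?L (\<lambda>r. LINT x|M. g x \<bullet> u r x)"
    using LM.integrable_fst[of "\<lambda>r x. g x \<bullet> u r x"] int by (simp add: case_prod_beta')
  show "(\<lambda>r. LINT x|M. g x \<bullet> u r x) integrable_on {s..t}"
    using i1 by (intro integrable_on_lebesgue_on) auto
  have "integral {s..t} (\<lambda>r. LINT x|M. g x \<bullet> u r x) = (LINT r|?L. LINT x|M. g x \<bullet> u r x)"
    by (rule lebesgue_integral_eq_integral[OF i1, symmetric]) simp
  also have "\<dots> = (LINT x|M. LINT r|?L. g x \<bullet> u r x)"
    using LM.Fubini_integral[of "\<lambda>r x. g x \<bullet> u r x"] int by (simp add: case_prod_beta')
  also have "\<dots> = (LINT x|M. g x \<bullet> (Euler s t x - x))"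
  proof (rule Bochner_Integration.integral_cong[OF refl])
    fix x
    have a: "(\<lambda>r. u r x) absolutely_integrable_on {s..t}"
      by (rule bounded_by_G(1)[OF u_measurable u_growth])
    then have b: "integrable ?L (\<lambda>r. u r x)"
      by (simp add: integrable_restrict_space set_integrable_def)
    then have "(LINT r|?L. g x \<bullet> u r x) = g x \<bullet> (LINT r|?L. u r x)" by simp
    also have "(LINT r|?L. u r x) = Euler s t x - x"
      by (simp add: Euler_def lebesgue_integral_eq_integral[OF b])
    finally show "(LINT r|?L. g x \<bullet> u r x) = g x \<bullet> (Euler s t x - x)" .
  qed
  finally show "integral {s..t} (\<lambda>r. LINT x|M. g x \<bullet> u r x) = (LINT x|M. g x \<bullet> (Euler s t x - x))" .
qed

end

text \<open>The last two assumptions are what a solution of the continuity equation satisfies: Lipschitz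
  test functions see a curve of variation at most \<open>mass\<close>, and smooth test functions satisfy the equation
  integrated in time.\<close>

locale transported_curve = Caratheodory_field u G
  for u :: "real \<Rightarrow> 'a::euclidean_space \<Rightarrow> 'a" and G +
  fixes \<rho> :: "real \<Rightarrow> 'a measure" and H :: real
  assumes H: "0 \<le> H"
    and \<rho>_prob: "t \<in> {0..H} \<Longrightarrow> prob_space (\<rho> t)"
    and \<rho>_sets: "t \<in> {0..H} \<Longrightarrow> sets (\<rho> t) = sets borel"
    and \<rho>_moment: "integrable (\<rho> 0) norm"
    and \<rho>_continuous: "\<lbrakk>0 \<le> s; s \<le> t; t \<le> H; C-lipschitz_on UNIV f; \<And>x. Q < norm x \<Longrightarrow> f x = 0\<rbrakk>
      \<Longrightarrow> \<bar>(LINT x|\<rho> t. f x) - (LINT x|\<rho> s. f x)\<bar> \<le> C * mass s t"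
    and \<rho>_equation: "\<lbrakk>0 \<le> s; s \<le> t; t \<le> H; smooth f; \<And>x. Q < norm x \<Longrightarrow> f x = 0\<rbrakk>
      \<Longrightarrow> ((\<lambda>r. LINT x|\<rho> r. gradient f x \<bullet> u r x) has_integral (LINT x|\<rho> t. f x) - (LINT x|\<rho> s. f x)) {s..t}"
begin

text \<open>Over one time step, testing the later measure amounts to testing the earlier one with the test
  function pulled back by an Euler step. The pullback of a smooth function is only Lipschitz, so it
  could not be used for a further step; therefore a mollified Lipschitz function is compared with the
  mollification of its pullback, an assertion that can be iterated. Three errors
  occur. Freezing the measure at time \<open>s\<close> and Taylor's formula cost a multiple \<open>K\<close> of the squared mass,
  where \<open>K\<close> depends on the mollifier; summed over a fine partition, this is negligible. The commutator
  of mollification and pullback costs \<open>C * \<epsilon>\<close> times the mass, with no constant depending on the mollifier;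
  summed over a partition it is of order \<open>\<epsilon>\<close>.\<close>

lemma one_step:
  assumes \<kappa>: "smooth \<kappa>" "\<And>x. 0 \<le> \<kappa> x" "\<And>x. \<epsilon> < norm x \<Longrightarrow> \<kappa> x = 0"
      "integrable lborel \<kappa>" "(LINT x|lborel. \<kappa> x) = 1" and \<epsilon>: "0 < \<epsilon>" "\<epsilon> \<le> 1" and Q: "0 \<le> Q" and M: "0 \<le> M"
  obtains K where "0 \<le> K"
    "\<And>\<eta> C s t. \<lbrakk>0 \<le> s; s \<le> t; t \<le> H; C-lipschitz_on UNIV \<eta>; \<And>x. \<bar>\<eta> x\<bar> \<le> M; \<And>x. Q < norm x \<Longrightarrow> \<eta> x = 0\<rbrakk> \<Longrightarrow>
       \<bar>(LINT x|\<rho> t. conv \<eta> \<kappa> x) - (LINT x|\<rho> s. conv (\<lambda>x. \<eta> (Euler s t x)) \<kappa> x)\<bar> \<le> C * \<epsilon> * mass s t + K * (mass s t)\<^sup>2"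
proof -
  have \<kappa>1: "\<kappa> x = 0" if "1 < norm x" for x using \<kappa>(3)[of x] that \<epsilon> by simp
  obtain K0 where K0: "0 \<le> K0" and K0b:
    "\<And>\<eta> M x y. continuous_on UNIV \<eta> \<Longrightarrow> (\<And>x. Q < norm x \<Longrightarrow> \<eta> x = 0) \<Longrightarrow> (\<And>x. \<bar>\<eta> x\<bar> \<le> M) \<Longrightarrow>
       norm (gradient (conv \<eta> \<kappa>) x) \<le> M * K0 \<and>
       norm (gradient (conv \<eta> \<kappa>) x - gradient (conv \<eta> \<kappa>) y) \<le> M * K0 * norm (x - y)"
    using conv_gradient_bounds[OF \<kappa>(1) \<kappa>1, of Q] by blast
  define K1 where "K1 = M * K0"
  have K1: "0 \<le> K1" using M K0 by (simp add: K1_def)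
  \<comment> \<open>an Euler step at most doubles \<open>1 + norm x\<close>, so this radius contains the supports of all pullbacks\<close>
  define Q3 where "Q3 = 2 * Q + 3"
  define K where "K = K1 * (Q + 3) + K1 * (1 + Q3)\<^sup>2"
  show ?thesis
  proof (rule that[of K])
    show "0 \<le> K" using K1 Q by (simp add: K_def)
    fix \<eta> :: "'a \<Rightarrow> real" and C s t
    assume st: "0 \<le> s" "s \<le> t" "t \<le> H" and C: "C-lipschitz_on UNIV \<eta>" and \<eta>M: "\<And>x. \<bar>\<eta> x\<bar> \<le> M"
      and \<eta>Q: "\<And>x. Q < norm x \<Longrightarrow> \<eta> x = 0"
    have C0: "0 \<le> C" using C lipschitz_on_nonneg by blast
    have \<eta>c: "continuous_on UNIV \<eta>" using C by (rule lipschitz_on_continuous_on)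
    let ?a = "mass s t"
    have a: "0 \<le> ?a" "?a \<le> 1 / 2" by (rule mass_nonneg mass_le_half)+
    define f where "f = conv \<eta> \<kappa>"
    define g where "g = gradient f"
    have fs: "smooth f" unfolding f_def using smooth_conv[OF \<eta>c \<eta>Q \<kappa>(1)] by blast
    have fQ: "f x = 0" if "Q + 1 < norm x" for x
      unfolding f_def by (rule conv_vanish[OF \<eta>Q \<kappa>1 that])
    have gQ: "g x = 0" if "Q + 1 < norm x" for x
      unfolding g_def by (rule gradient_vanish[OF fQ that])
    have gb: "norm (g x) \<le> K1" and gl: "norm (g x - g y) \<le> K1 * norm (x - y)" for x y
      using K0b[OF \<eta>c \<eta>Q \<eta>M, of x y] by (auto simp: g_def f_def K1_def)
    have gc: "continuous_on UNIV g" unfolding g_def by (rule smooth_gradient(2)[OF fs])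
    have fc: "continuous_on UNIV f" by (rule smooth_gradient(3)[OF fs])
    have tin: "t \<in> {0..H}" and sin: "s \<in> {0..H}" using st by auto
    note S = \<rho>_prob[OF sin] \<rho>_sets[OF sin]
    interpret S: prob_space "\<rho> s" by (rule S(1))
    have fE: "f (Euler s t x) = 0" if "Q3 < norm x" for x
    proof (rule Euler_vanish[OF fQ])
      have "(1 + (Q + 1)) * (1 + 2 * ?a) \<le> (1 + (Q + 1)) * 2" using a Q by (intro mult_left_mono) auto
      then show "(1 + (Q + 1)) * (1 + 2 * ?a) < 1 + norm x" using that by (simp add: Q3_def)
    qed
    have \<eta>E: "\<eta> (Euler s t x) = 0" if "Q3 < norm x" for x
    proof (rule Euler_vanish[OF \<eta>Q])
      have "(1 + Q) * (1 + 2 * ?a) \<le> (1 + Q) * 2" using a Q by (intro mult_left_mono) auto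
      then show "(1 + Q) * (1 + 2 * ?a) < 1 + norm x" using that by (simp add: Q3_def)
    qed
    have \<eta>Ec: "continuous_on UNIV (\<lambda>x. \<eta> (Euler s t x))"
      by (rule continuous_on_compose2[OF \<eta>c Euler_continuous]) auto
    have fEc: "continuous_on UNIV (\<lambda>x. f (Euler s t x))"
      by (rule continuous_on_compose2[OF fc Euler_continuous]) auto
    have cc: "continuous_on UNIV (conv (\<lambda>x. \<eta> (Euler s t x)) \<kappa>)"
      using smooth_conv[OF \<eta>Ec \<eta>E \<kappa>(1), where k = 0] by simp
    have cQ: "conv (\<lambda>x. \<eta> (Euler s t x)) \<kappa> x = 0" if "Q3 + 1 < norm x" for x
      by (rule conv_vanish[OF \<eta>E \<kappa>1 that])
    have gEc: "continuous_on UNIV (\<lambda>x. g x \<bullet> (Euler s t x - x))"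
      by (intro continuous_intros gc Euler_continuous)
    have if1: "integrable (\<rho> s) f" by (rule integrable_vanish_prob[OF fc fQ S])
    have if2: "integrable (\<rho> s) (\<lambda>x. f (Euler s t x))" by (rule integrable_vanish_prob[OF fEc fE S])
    have if3: "integrable (\<rho> s) (conv (\<lambda>x. \<eta> (Euler s t x)) \<kappa>)" by (rule integrable_vanish_prob[OF cc cQ S])
    have if4: "integrable (\<rho> s) (\<lambda>x. g x \<bullet> (Euler s t x - x))"
      by (rule integrable_vanish_prob[OF gEc _ S, of "Q + 1"]) (simp add: gQ)
    \<comment> \<open>freezing the measure at its initial time\<close>
    have 1: "\<bar>(LINT x|\<rho> t. f x) - (LINT x|\<rho> s. f x) - (LINT x|\<rho> s. g x \<bullet> (Euler s t x - x))\<bar> \<le> K1 * (Q + 3) * ?a\<^sup>2"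
    proof -
      have F: "(K1 * (Q + 3) * G r)-lipschitz_on UNIV (\<lambda>x. g x \<bullet> u r x)" for r
        using inner_field_lipschitz[OF gb gl gQ u_lipschitz u_growth G_nonneg] Q by (simp add: add.commute)
      have eq: "((\<lambda>r. LINT x|\<rho> r. g x \<bullet> u r x) has_integral (LINT x|\<rho> t. f x) - (LINT x|\<rho> s. f x)) {s..t}"
        unfolding g_def by (rule \<rho>_equation[OF st fs, where Q = "Q + 1"]) (rule fQ)
      have Fub: "(\<lambda>r. LINT x|\<rho> s. g x \<bullet> u r x) integrable_on {s..t}"
        "integral {s..t} (\<lambda>r. LINT x|\<rho> s. g x \<bullet> u r x) = (LINT x|\<rho> s. g x \<bullet> (Euler s t x - x))"
        by (rule Fubini_Euler[OF S gc, where Q = "Q + 1" and K = K1]; (rule gQ gb; assumption?))+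
      have "norm (integral {s..t} (\<lambda>r. (LINT x|\<rho> r. g x \<bullet> u r x) - (LINT x|\<rho> s. g x \<bullet> u r x)))
          \<le> integral {s..t} (\<lambda>r. G r * (K1 * (Q + 3) * ?a))"
      proof (rule integral_norm_bound_integral)
        show "(\<lambda>r. (LINT x|\<rho> r. g x \<bullet> u r x) - (LINT x|\<rho> s. g x \<bullet> u r x)) integrable_on {s..t}"
          using eq Fub(1) by (intro Henstock_Kurzweil_Integration.integrable_diff) auto
        show "(\<lambda>r. G r * (K1 * (Q + 3) * ?a)) integrable_on {s..t}"
          using G_int by (rule integrable_on_mult_left)
        fix r assume r: "r \<in> {s..t}"
        have "\<bar>(LINT x|\<rho> r. g x \<bullet> u r x) - (LINT x|\<rho> s. g x \<bullet> u r x)\<bar> \<le> K1 * (Q + 3) * G r * mass s r"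
          by (rule \<rho>_continuous[OF _ _ _ F, where Q = "Q + 1"]) (use r st gQ in auto)
        also have "\<dots> \<le> K1 * (Q + 3) * G r * ?a"
          using r K1 Q G_nonneg[of r] by (intro mult_left_mono mass_mono) auto
        finally show "norm ((LINT x|\<rho> r. g x \<bullet> u r x) - (LINT x|\<rho> s. g x \<bullet> u r x)) \<le> G r * (K1 * (Q + 3) * ?a)"
          by (simp add: mult_ac)
      qed
      also have "\<dots> = K1 * (Q + 3) * ?a\<^sup>2" by (simp add: mass_def power2_eq_square)
      finally show ?thesis
        using integral_unique[OF eq] Fub eq
        by (subst (asm) Henstock_Kurzweil_Integration.integral_diff) auto
    qed
    \<comment> \<open>second-order Taylor expansion of the smooth function\<close>
    have 2: "\<bar>LINT x|\<rho> s. f x + g x \<bullet> (Euler s t x - x) - f (Euler s t x)\<bar> \<le> K1 * (1 + Q3)\<^sup>2 * ?a\<^sup>2"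
    proof -
      have "\<bar>f x + g x \<bullet> (Euler s t x - x) - f (Euler s t x)\<bar> \<le> K1 * (1 + Q3)\<^sup>2 * ?a\<^sup>2" for x
      proof (cases "Q3 < norm x")
        case True
        then show ?thesis using fE fQ[of x] gQ[of x] K1 Q by (simp add: Q3_def)
      next
        case False
        have "\<bar>f (Euler s t x) - f x - g x \<bullet> (Euler s t x - x)\<bar> \<le> K1 * (norm (Euler s t x - x))\<^sup>2"
          unfolding g_def by (rule Taylor_gradient[OF fs]) (use gl in \<open>simp add: g_def\<close>)
        also have "\<dots> \<le> K1 * (?a * (1 + Q3))\<^sup>2"
        proof (intro mult_left_mono power_mono K1 norm_ge_zero)
          show "norm (Euler s t x - x) \<le> ?a * (1 + Q3)"
            by (rule order_trans[OF Euler_growth]) (use False a in \<open>intro mult_left_mono, auto\<close>)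
        qed
        also have "\<dots> = K1 * (1 + Q3)\<^sup>2 * ?a\<^sup>2" by (simp add: power_mult_distrib)
        finally show ?thesis by linarith
      qed
      then have "\<bar>LINT x|\<rho> s. f x + g x \<bullet> (Euler s t x - x) - f (Euler s t x)\<bar> \<le> (LINT x|\<rho> s. K1 * (1 + Q3)\<^sup>2 * ?a\<^sup>2)"
        using if1 if2 if4 by (intro order_trans[OF integral_abs_bound] integral_mono) auto
      then show ?thesis by (simp add: S.prob_space)
    qed
    \<comment> \<open>commutator of mollification and transport\<close>
    have 3: "\<bar>LINT x|\<rho> s. f (Euler s t x) - conv (\<lambda>x. \<eta> (Euler s t x)) \<kappa> x\<bar> \<le> C * \<epsilon> * ?a"
    proof -
      have "\<bar>f (Euler s t x) - conv (\<lambda>x. \<eta> (Euler s t x)) \<kappa> x\<bar> \<le> C * \<epsilon> * ?a" for x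
        unfolding f_def
      proof (rule conv_commutator[OF \<kappa> \<eta>c Euler_continuous])
        fix z :: 'a assume z: "norm z \<le> \<epsilon>"
        have "\<bar>\<eta> (Euler s t x - z) - \<eta> (Euler s t (x - z))\<bar> \<le> C * norm ((Euler s t x - z) - Euler s t (x - z))"
          using lipschitz_onD[OF C, of "Euler s t x - z" "Euler s t (x - z)"] by (simp add: dist_norm)
        also have "\<dots> = C * norm ((Euler s t x - x) - (Euler s t (x - z) - (x - z)))" by (simp add: algebra_simps)
        also have "\<dots> \<le> C * (?a * norm z)"
          using Euler_diff[of s t x "x - z"] by (intro mult_left_mono C0) simp
        also have "\<dots> \<le> C * (?a * \<epsilon>)" using z a by (intro mult_left_mono C0) auto
        finally show "\<bar>\<eta> (Euler s t x - z) - \<eta> (Euler s t (x - z))\<bar> \<le> C * \<epsilon> * ?a" by (simp add: mult_ac)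
      qed (use C0 \<epsilon> a in auto)
      then have "\<bar>LINT x|\<rho> s. f (Euler s t x) - conv (\<lambda>x. \<eta> (Euler s t x)) \<kappa> x\<bar> \<le> (LINT x|\<rho> s. C * \<epsilon> * ?a)"
        using if2 if3 by (intro order_trans[OF integral_abs_bound] integral_mono) auto
      then show ?thesis by (simp add: S.prob_space)
    qed
    have "\<bar>(LINT x|\<rho> t. f x) - (LINT x|\<rho> s. conv (\<lambda>x. \<eta> (Euler s t x)) \<kappa> x)\<bar> \<le> C * \<epsilon> * ?a + K * ?a\<^sup>2"
    proof -
      have "(LINT x|\<rho> s. f x + g x \<bullet> (Euler s t x - x) - f (Euler s t x))
          = (LINT x|\<rho> s. f x) + (LINT x|\<rho> s. g x \<bullet> (Euler s t x - x)) - (LINT x|\<rho> s. f (Euler s t x))"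
        using if1 if2 if4 by simp
      moreover have "(LINT x|\<rho> s. f (Euler s t x) - conv (\<lambda>x. \<eta> (Euler s t x)) \<kappa> x)
          = (LINT x|\<rho> s. f (Euler s t x)) - (LINT x|\<rho> s. conv (\<lambda>x. \<eta> (Euler s t x)) \<kappa> x)"
        using if2 if3 by simp
      moreover have "K * ?a\<^sup>2 = K1 * (Q + 3) * ?a\<^sup>2 + K1 * (1 + Q3)\<^sup>2 * ?a\<^sup>2"
        by (simp add: K_def algebra_simps)
      ultimately show ?thesis using 1 2 3 by linarith
    qed
    then show "\<bar>(LINT x|\<rho> t. conv \<eta> \<kappa> x) - (LINT x|\<rho> s. conv (\<lambda>x. \<eta> (Euler s t x)) \<kappa> x)\<bar> \<le> C * \<epsilon> * ?a + K * ?a\<^sup>2"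
      by (simp add: f_def)
  qed
qed

text \<open>Going backwards from time \<open>t\<close> along a partition, the test function is pulled back by Euler steps. On
  the side of the measures, \<open>one_step\<close> bounds the change of the integrals of the mollified
  functions; on the side of the trajectories, the Euler steps approximate the flow. The mesh tends
  to 0 for a fixed mollifier, and only then the mollifier is removed.\<close>

lemma transport_test_function:
  fixes \<psi> :: "'a \<Rightarrow> real"
  assumes \<Phi>: "\<And>x. continuous_on UNIV (\<lambda>t. \<Phi> t x)"
    "\<And>t x. t \<in> {0..H} \<Longrightarrow> \<Phi> t x = x + integral {0..t} (\<lambda>s. u s (\<Phi> s x))"
    "\<And>t x. t \<in> {0..H} \<Longrightarrow> 1 + norm (\<Phi> t x) \<le> 2 * (1 + norm x)"
    "\<And>t. t \<in> {0..H} \<Longrightarrow> continuous_on UNIV (\<Phi> t)"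
    and t: "t \<in> {0..H}" and \<psi>: "C-lipschitz_on UNIV \<psi>" "\<And>x. Q < norm x \<Longrightarrow> \<psi> x = 0"
  shows "(LINT x|\<rho> t. \<psi> x) = (LINT x|\<rho> 0. \<psi> (\<Phi> t x))"
proof -
  have C: "0 \<le> C" using \<psi>(1) lipschitz_on_nonneg by blast
  have \<psi>c: "continuous_on UNIV \<psi>" using \<psi>(1) by (rule lipschitz_on_continuous_on)
  have "bounded (\<psi> ` cball 0 Q)"
    by (intro compact_imp_bounded compact_continuous_image continuous_on_subset[OF \<psi>c]) auto
  then obtain M where M: "0 < M" "\<And>x. x \<in> cball 0 Q \<Longrightarrow> norm (\<psi> x) \<le> M" by (metis bounded_pos imageI)
  have \<psi>M: "\<bar>\<psi> x\<bar> \<le> M" for x using M \<psi>(2)[of x] by (cases "Q < norm x") auto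
  \<comment> \<open>the support radius and Lipschitz constant of all pullbacks: a step multiplies \<open>1 +\<close> radius by at
    most \<open>exp (2 * mass)\<close> and the Lipschitz constant by at most \<open>exp mass\<close>, and the total mass is
    at most one half\<close>
  define Q' where "Q' = (1 + max 0 Q) * exp 1"
  have Q': "0 \<le> Q'" by (simp add: Q'_def)
  define C' where "C' = C * exp (1 / 2)"
  have C': "0 \<le> C'" "C \<le> C'" using C by (simp_all add: C'_def mult_le_cancel_left1)
  have in0: "0 \<in> {0..H}" using H by simp
  interpret P0: prob_space "\<rho> 0" by (rule \<rho>_prob[OF in0])
  interpret Pt: prob_space "\<rho> t" by (rule \<rho>_prob[OF t])
  define m where "m = (LINT x|\<rho> 0. 2 * (1 + norm x))"
  have m: "0 \<le> m" unfolding m_def by (intro integral_nonneg_AE) auto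
  have im: "integrable (\<rho> 0) (\<lambda>x. 2 * (1 + norm x))" using \<rho>_moment by simp
  \<comment> \<open>local error of the Euler method\<close>
  have flow_step: "norm (\<Phi> b x - Euler a b (\<Phi> a x)) \<le> (mass a b)\<^sup>2 * (2 * (1 + norm x))"
    if ab: "0 \<le> a" "a \<le> b" "b \<le> H" for a b x
  proof -
    note um = u_curve_measurable[OF \<Phi>(1)]
    have g: "norm (u s (\<Phi> s x)) \<le> G s * (2 * (1 + norm x))" if "s \<in> {0..H}" for s
      by (rule order_trans[OF u_growth]) (intro mult_left_mono \<Phi>(3) that G_nonneg)
    have i: "(\<lambda>s. u s (\<Phi> s x)) integrable_on {c..d}" if "0 \<le> c" "d \<le> H" for c d
      by (rule bounded_by_G(2)[OF um g]) (use that in auto)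
    have inc: "\<Phi> d x - \<Phi> c x = integral {c..d} (\<lambda>s. u s (\<Phi> s x))" if "0 \<le> c" "c \<le> d" "d \<le> H" for c d
    proof -
      have "integral {0..c} (\<lambda>s. u s (\<Phi> s x)) + integral {c..d} (\<lambda>s. u s (\<Phi> s x)) = integral {0..d} (\<lambda>s. u s (\<Phi> s x))"
        using that by (intro Henstock_Kurzweil_Integration.integral_combine i) auto
      moreover have "\<Phi> d x = x + integral {0..d} (\<lambda>s. u s (\<Phi> s x))" using that by (intro \<Phi>(2)) auto
      moreover have "\<Phi> c x = x + integral {0..c} (\<lambda>s. u s (\<Phi> s x))" using that by (intro \<Phi>(2)) auto
      ultimately show ?thesis by (simp add: algebra_simps)
    qed
    have incb: "norm (\<Phi> s x - \<Phi> a x) \<le> mass a b * (2 * (1 + norm x))" if s: "s \<in> {a..b}" for s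
    proof -
      have "norm (\<Phi> s x - \<Phi> a x) \<le> mass a s * (2 * (1 + norm x))"
      proof -
        have "norm (integral {a..s} (\<lambda>s. u s (\<Phi> s x))) \<le> mass a s * (2 * (1 + norm x))"
          by (rule bounded_by_G(3)[OF um g]) (use s ab in auto)
        then show ?thesis using s ab inc[of a s] by simp
      qed
      also have "\<dots> \<le> mass a b * (2 * (1 + norm x))" using s by (intro mult_right_mono mass_mono) auto
      finally show ?thesis .
    qed
    have ic: "(\<lambda>s. u s (\<Phi> a x)) integrable_on {a..b}" by (rule bounded_by_G(2)[OF u_measurable u_growth])
    have "\<Phi> b x - Euler a b (\<Phi> a x) = integral {a..b} (\<lambda>s. u s (\<Phi> s x)) - integral {a..b} (\<lambda>s. u s (\<Phi> a x))"
      using inc[of a b] ab by (simp add: Euler_def algebra_simps)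
    also have "\<dots> = integral {a..b} (\<lambda>s. u s (\<Phi> s x) - u s (\<Phi> a x))"
      using ab by (intro Henstock_Kurzweil_Integration.integral_diff[symmetric] i ic) auto
    also have "norm \<dots> \<le> mass a b * (mass a b * (2 * (1 + norm x)))"
      by (rule bounded_by_G(3)[OF borel_measurable_diff[OF um u_measurable]])
        (intro order_trans[OF u_diff] mult_left_mono incb G_nonneg)
    finally show ?thesis by (simp add: power2_eq_square mult.assoc)
  qed
  have main: "\<bar>(LINT x|\<rho> t. \<psi> x) - (LINT x|\<rho> 0. \<psi> (\<Phi> t x))\<bar> \<le> 3 * C' * \<epsilon> + \<delta>"
    if \<epsilon>: "0 < \<epsilon>" "\<epsilon> \<le> 1" and \<delta>: "0 < \<delta>" for \<epsilon> \<delta>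
  proof -
    obtain \<kappa> :: "'a \<Rightarrow> real" where \<kappa>: "smooth \<kappa>" "\<And>x. 0 \<le> \<kappa> x" "\<And>x. \<epsilon> < norm x \<Longrightarrow> \<kappa> x = 0"
      "integrable lborel \<kappa>" "(LINT x|lborel. \<kappa> x) = 1"
      using mollifier_exists[OF \<epsilon>(1)] by blast
    have \<kappa>1: "\<kappa> x = 0" if "1 < norm x" for x using \<kappa>(3)[of x] that \<epsilon> by simp
    obtain K where K: "0 \<le> K" and step:
      "\<And>\<eta> C s t. \<lbrakk>0 \<le> s; s \<le> t; t \<le> H; C-lipschitz_on UNIV \<eta>; \<And>x. \<bar>\<eta> x\<bar> \<le> M; \<And>x. Q' < norm x \<Longrightarrow> \<eta> x = 0\<rbrakk> \<Longrightarrow>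
       \<bar>(LINT x|\<rho> t. conv \<eta> \<kappa> x) - (LINT x|\<rho> s. conv (\<lambda>x. \<eta> (Euler s t x)) \<kappa> x)\<bar> \<le> C * \<epsilon> * mass s t + K * (mass s t)\<^sup>2"
      using one_step[OF \<kappa> \<epsilon> Q' less_imp_le[OF M(1)]] by blast
    define \<omega> where "\<omega> = \<delta> / (K + C' * m + 1)"
    have \<omega>: "0 < \<omega>" using \<delta> K C' m by (simp add: \<omega>_def add_nonneg_pos)
    \<comment> \<open>a partition into steps of small \<open>G\<close>-mass\<close>
    have "uniformly_continuous_on {0..t} (mass 0)"
      by (intro compact_uniformly_continuous mass_continuous) auto
    then obtain d where d: "0 < d" "\<And>a b. a \<in> {0..t} \<Longrightarrow> b \<in> {0..t} \<Longrightarrow> dist b a < d \<Longrightarrow> dist (mass 0 b) (mass 0 a) < \<omega>"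
      using \<omega> unfolding uniformly_continuous_on_def by metis
    obtain n where n: "t / d < real n" using reals_Archimedean2 by blast
    have n0: "0 < n" using n t d(1) by (cases n) (auto simp: divide_less_eq)
    \<comment> \<open>numbered backwards, from \<open>t\<close> at \<open>j = 0\<close> to 0 at \<open>j = n\<close>\<close>
    define T where "T j = t * real (n - j) / real n" for j
    have T0: "T 0 = t" and Tn: "T n = 0" using n0 by (auto simp: T_def)
    have T_le: "T (Suc j) \<le> T j" for j using t by (auto simp: T_def intro!: divide_right_mono mult_left_mono)
    have T_nn: "0 \<le> T j" for j using t by (simp add: T_def)
    have T_t: "T j \<le> t" for j
      using t n0 mult_left_mono[of "real (n - j)" "real n" t] by (simp add: T_def divide_le_eq)
    have T_H: "T j \<le> H" "T j \<in> {0..H}" for j using T_t[of j] T_nn[of j] t by auto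
    have A\<omega>: "mass (T (Suc j)) (T j) \<le> \<omega>" for j
    proof -
      have "T j - T (Suc j) \<le> t / real n"
      proof -
        have "real (n - j) - real (n - Suc j) \<le> 1" by linarith
        then have "t * (real (n - j) - real (n - Suc j)) / real n \<le> t * 1 / real n"
          using t by (intro divide_right_mono mult_left_mono) auto
        then show ?thesis by (simp add: T_def right_diff_distrib diff_divide_distrib)
      qed
      also have "t / real n < d" using n d(1) n0 by (simp add: field_simps)
      finally have "dist (mass 0 (T j)) (mass 0 (T (Suc j))) < \<omega>"
        using T_nn T_t T_le[of j] by (intro d(2)) (auto simp: dist_real_def)
      then show ?thesis using mass_add[OF T_nn T_le, of j] by (simp add: dist_real_def)
    qed
    \<comment> \<open>the iterated pullbacks of the test function\<close>
    define P where "P = rec_nat \<psi> (\<lambda>j \<eta> x. \<eta> (Euler (T (Suc j)) (T j) x))"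
    have P_0: "P 0 = \<psi>" and P_Suc: "P (Suc j) = (\<lambda>x. P j (Euler (T (Suc j)) (T j) x))" for j
      by (simp_all add: P_def)
    let ?a = "\<lambda>j. mass (T j) t"
    have a_Suc: "?a (Suc j) = mass (T (Suc j)) (T j) + ?a j" for j
      using mass_add[OF T_le T_t, of j] by simp
    have a_half: "?a j \<le> 1 / 2" for j by (rule mass_le_half)
    have A1: "1 + mass a b \<le> exp (mass a b)" for a b using exp_ge_add_one_self[of "mass a b"] by (simp add: add.commute)
    have P_lip: "(C * exp (?a j))-lipschitz_on UNIV (P j)" for j
    proof (induction j)
      case 0
      have "mass t t = 0" by (simp add: mass_def)
      then show ?case using \<psi>(1) by (simp add: P_0 T0)
    next
      case (Suc j)
      have "(C * exp (?a j) * (1 + mass (T (Suc j)) (T j)))-lipschitz_on UNIV (P j \<circ> Euler (T (Suc j)) (T j))"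
        by (rule lipschitz_on_compose[OF Euler_lipschitz]) (rule lipschitz_on_subset[OF Suc], simp)
      moreover have "C * exp (?a j) * (1 + mass (T (Suc j)) (T j)) \<le> C * exp (?a j) * exp (mass (T (Suc j)) (T j))"
        using C by (intro mult_left_mono A1) auto
      ultimately show ?case unfolding P_Suc
        by (rule_tac lipschitz_on_le) (auto simp: o_def a_Suc exp_add mult_ac)
    qed
    have P_lip': "C'-lipschitz_on UNIV (P j)" for j
      by (rule lipschitz_on_le[OF P_lip]) (use C a_half in \<open>auto simp: C'_def intro!: mult_left_mono\<close>)
    have P_M: "\<bar>P j x\<bar> \<le> M" for j x by (induction j arbitrary: x) (auto simp: P_0 P_Suc \<psi>M)
    have P_van: "P j x = 0" if "(1 + max 0 Q) * exp (2 * ?a j) < 1 + norm x" for j x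
      using that
    proof (induction j arbitrary: x)
      case 0
      have "mass t t = 0" by (simp add: mass_def)
      then show ?case using 0 \<psi>(2)[of x] by (simp add: P_0 T0)
    next
      case (Suc j)
      define q where "q = (1 + max 0 Q) * exp (2 * ?a j) - 1"
      let ?b = "mass (T (Suc j)) (T j)"
      have "P j (Euler (T (Suc j)) (T j) x) = 0"
      proof (rule Euler_vanish)
        show "P j y = 0" if "q < norm y" for y using Suc.IH[of y] that by (simp add: q_def)
        have "(1 + q) * (1 + 2 * ?b) \<le> (1 + q) * exp (2 * ?b)"
          using exp_ge_add_one_self[of "2 * ?b"] by (intro mult_left_mono) (auto simp: q_def add.commute)
        also have "\<dots> = (1 + max 0 Q) * exp (2 * ?a (Suc j))"
          by (simp add: q_def a_Suc exp_add distrib_left mult_ac)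
        finally show "(1 + q) * (1 + 2 * ?b) < 1 + norm x" using Suc.prems by simp
      qed
      then show ?case by (simp add: P_Suc)
    qed
    have P_van': "P j x = 0" if "Q' < norm x" for j x
    proof (rule P_van)
      have "(1 + max 0 Q) * exp (2 * ?a j) \<le> Q'"
        unfolding Q'_def using a_half[of j] by (intro mult_left_mono) auto
      then show "(1 + max 0 Q) * exp (2 * ?a j) < 1 + norm x" using that by simp
    qed
    have P_c: "continuous_on UNIV (P j)" for j by (rule lipschitz_on_continuous_on[OF P_lip])
    \<comment> \<open>telescoping along the curve of measures\<close>
    define D where "D j = (LINT x|\<rho> (T j). conv (P j) \<kappa> x)" for j
    have D: "\<bar>D 0 - D j\<bar> \<le> (C' * \<epsilon> + K * \<omega>) * ?a j" for j
    proof (induction j)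
      case 0
      then show ?case using mass_nonneg C' \<epsilon> K \<omega> by simp
    next
      case (Suc j)
      let ?b = "mass (T (Suc j)) (T j)"
      have "\<bar>D j - D (Suc j)\<bar> \<le> C' * \<epsilon> * ?b + K * ?b\<^sup>2"
        unfolding D_def P_Suc by (rule step[OF T_nn T_le T_H(1) P_lip' P_M P_van'])
      also have "\<dots> \<le> C' * \<epsilon> * ?b + K * (\<omega> * ?b)"
        unfolding power2_eq_square using mass_nonneg by (intro add_left_mono mult_left_mono mult_right_mono A\<omega> K)
      finally have "\<bar>D j - D (Suc j)\<bar> \<le> (C' * \<epsilon> + K * \<omega>) * ?b" by (simp add: algebra_simps)
      then have "\<bar>D 0 - D (Suc j)\<bar> \<le> (C' * \<epsilon> + K * \<omega>) * ?a j + (C' * \<epsilon> + K * \<omega>) * ?b"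
        using Suc by linarith
      then show ?case unfolding a_Suc by (simp add: algebra_simps)
    qed
    \<comment> \<open>telescoping along the trajectories\<close>
    have F: "\<bar>\<psi> (\<Phi> t x) - P j (\<Phi> (T j) x)\<bar> \<le> C' * \<omega> * (2 * (1 + norm x)) * ?a j" for j x
    proof (induction j)
      case 0
      then show ?case using mass_nonneg C' \<omega> by (simp add: P_0 T0)
    next
      case (Suc j)
      let ?b = "mass (T (Suc j)) (T j)"
      have "\<bar>P j (\<Phi> (T j) x) - P (Suc j) (\<Phi> (T (Suc j)) x)\<bar> \<le> C' * norm (\<Phi> (T j) x - Euler (T (Suc j)) (T j) (\<Phi> (T (Suc j)) x))"
        unfolding P_Suc using lipschitz_onD[OF P_lip'[of j]] by (simp add: dist_norm)
      also have "\<dots> \<le> C' * (?b\<^sup>2 * (2 * (1 + norm x)))"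
        by (intro mult_left_mono flow_step T_nn T_le T_H(1) C'(1))
      also have "\<dots> \<le> C' * (\<omega> * ?b * (2 * (1 + norm x)))"
        unfolding power2_eq_square using mass_nonneg C'(1) by (intro mult_left_mono mult_right_mono A\<omega>) auto
      finally have "\<bar>P j (\<Phi> (T j) x) - P (Suc j) (\<Phi> (T (Suc j)) x)\<bar> \<le> C' * \<omega> * (2 * (1 + norm x)) * ?b"
        by (simp add: mult_ac)
      then have "\<bar>\<psi> (\<Phi> t x) - P (Suc j) (\<Phi> (T (Suc j)) x)\<bar>
          \<le> C' * \<omega> * (2 * (1 + norm x)) * ?a j + C' * \<omega> * (2 * (1 + norm x)) * ?b"
        using Suc by linarith
      then show ?case unfolding a_Suc by (simp only: distrib_left add.commute)
    qed
    have \<Phi>0: "\<Phi> 0 x = x" for x using \<Phi>(2)[OF in0, of x] by simp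
    have c\<psi>: "continuous_on UNIV (conv \<psi> \<kappa>)" using smooth_conv[OF \<psi>c \<psi>(2) \<kappa>(1), where k = 0] by simp
    have cP: "continuous_on UNIV (conv (P n) \<kappa>)" using smooth_conv[OF P_c P_van' \<kappa>(1), where k = 0] by simp
    have i1: "integrable (\<rho> t) \<psi>" by (rule integrable_vanish_prob[OF \<psi>c \<psi>(2) \<rho>_prob[OF t] \<rho>_sets[OF t]])
    have i2: "integrable (\<rho> t) (conv \<psi> \<kappa>)"
      by (rule integrable_vanish_prob[OF c\<psi> conv_vanish[OF \<psi>(2) \<kappa>1] \<rho>_prob[OF t] \<rho>_sets[OF t]])
    have i3: "integrable (\<rho> 0) (P n)" by (rule integrable_vanish_prob[OF P_c P_van' \<rho>_prob[OF in0] \<rho>_sets[OF in0]])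
    have i4: "integrable (\<rho> 0) (conv (P n) \<kappa>)"
      by (rule integrable_vanish_prob[OF cP conv_vanish[OF P_van' \<kappa>1] \<rho>_prob[OF in0] \<rho>_sets[OF in0]])
    have i5: "integrable (\<rho> 0) (\<lambda>x. \<psi> (\<Phi> t x))"
    proof (rule P0.integrable_const_bound[of _ M])
      have "continuous_on UNIV (\<lambda>x. \<psi> (\<Phi> t x))" by (rule continuous_on_compose2[OF \<psi>c \<Phi>(4)[OF t]]) auto
      then show "(\<lambda>x. \<psi> (\<Phi> t x)) \<in> borel_measurable (\<rho> 0)"
        unfolding measurable_cong_sets[OF \<rho>_sets[OF in0] refl] by (rule borel_measurable_continuous_onI)
    qed (use \<psi>M in auto)
    have 1: "\<bar>(LINT x|\<rho> t. \<psi> x) - D 0\<bar> \<le> C' * \<epsilon>"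
    proof -
      have "\<bar>\<psi> x - conv \<psi> \<kappa> x\<bar> \<le> C' * \<epsilon>" for x
        using conv_close[OF \<kappa> \<psi>(1) less_imp_le[OF \<epsilon>(1)], where x = x] mult_right_mono[OF C'(2) less_imp_le[OF \<epsilon>(1)]] by (simp add: abs_minus_commute)
      then have "\<bar>LINT x|\<rho> t. \<psi> x - conv \<psi> \<kappa> x\<bar> \<le> (LINT x|\<rho> t. C' * \<epsilon>)"
        using i1 i2 by (intro order_trans[OF integral_abs_bound] integral_mono) auto
      then show ?thesis using i1 i2 by (simp add: D_def T0 P_0 Pt.prob_space)
    qed
    have 2: "\<bar>D n - (LINT x|\<rho> 0. P n x)\<bar> \<le> C' * \<epsilon>"
    proof -
      have "\<bar>conv (P n) \<kappa> x - P n x\<bar> \<le> C' * \<epsilon>" for x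
        by (rule conv_close[OF \<kappa> P_lip' less_imp_le[OF \<epsilon>(1)]])
      then have "\<bar>LINT x|\<rho> 0. conv (P n) \<kappa> x - P n x\<bar> \<le> (LINT x|\<rho> 0. C' * \<epsilon>)"
        using i3 i4 by (intro order_trans[OF integral_abs_bound] integral_mono) auto
      then show ?thesis using i3 i4 by (simp add: D_def Tn P0.prob_space)
    qed
    have a1: "?a n \<le> 1" using a_half[of n] by simp
    have 3: "\<bar>D 0 - D n\<bar> \<le> C' * \<epsilon> + K * \<omega>"
      using D[of n] mult_left_mono[OF a1, of "C' * \<epsilon> + K * \<omega>"] C' \<epsilon> K \<omega> by simp
    have 4: "\<bar>(LINT x|\<rho> 0. P n x) - (LINT x|\<rho> 0. \<psi> (\<Phi> t x))\<bar> \<le> C' * \<omega> * m"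
    proof -
      have "\<bar>P n x - \<psi> (\<Phi> t x)\<bar> \<le> C' * \<omega> * (2 * (1 + norm x))" for x
        using F[of x n] mult_left_mono[OF a1, of "C' * \<omega> * (2 * (1 + norm x))"] C' \<omega>
        by (simp add: Tn \<Phi>0 abs_minus_commute)
      then have "\<bar>LINT x|\<rho> 0. P n x - \<psi> (\<Phi> t x)\<bar> \<le> (LINT x|\<rho> 0. C' * \<omega> * (2 * (1 + norm x)))"
        using i3 i5 im by (intro order_trans[OF integral_abs_bound] integral_mono) auto
      then show ?thesis using i3 i5 by (simp add: m_def)
    qed
    have "K * \<omega> + C' * \<omega> * m \<le> (K + C' * m + 1) * \<omega>" using \<omega> by (simp add: algebra_simps)
    also have "\<dots> = \<delta>" using K C' m by (simp add: \<omega>_def add_nonneg_pos less_imp_neq[symmetric])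
    finally show ?thesis using 1 2 3 4 by linarith
  qed
  have "\<bar>(LINT x|\<rho> t. \<psi> x) - (LINT x|\<rho> 0. \<psi> (\<Phi> t x))\<bar> \<le> 0"
  proof (rule field_le_epsilon)
    fix e :: real assume e: "0 < e"
    define \<epsilon> where "\<epsilon> = min 1 (e / (2 * (3 * C' + 1)))"
    have \<epsilon>: "0 < \<epsilon>" "\<epsilon> \<le> 1" using e C' by (auto simp: \<epsilon>_def add_nonneg_pos)
    have "3 * C' * \<epsilon> \<le> (3 * C' + 1) * (e / (2 * (3 * C' + 1)))"
      using C' \<epsilon> by (intro mult_mono) (auto simp: \<epsilon>_def)
    also have "\<dots> = e / 2" using C' by (simp add: add_nonneg_pos less_imp_neq[symmetric] field_simps)
    finally show "\<bar>(LINT x|\<rho> t. \<psi> x) - (LINT x|\<rho> 0. \<psi> (\<Phi> t x))\<bar> \<le> 0 + e"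
      using main[OF \<epsilon>, of "e / 2"] e by simp
  qed
  then show ?thesis by simp
qed

end

text \<open>Indicators of open boxes are increasing limits of the Lipschitz functions
  \<open>min 1 (n * dist(x, complement))\<close>.\<close>

lemma measure_eqI_Lipschitz:
  fixes M N :: "'a::euclidean_space measure"
  assumes M: "prob_space M" "sets M = sets borel" and N: "prob_space N" "sets N = sets borel"
    and eq: "\<And>(\<psi> :: 'a \<Rightarrow> real) C Q. C-lipschitz_on UNIV \<psi> \<Longrightarrow> (\<And>x. Q < norm x \<Longrightarrow> \<psi> x = 0) \<Longrightarrow> (LINT x|M. \<psi> x) = (LINT x|N. \<psi> x)"
  shows "M = N"
proof -
  interpret M: prob_space M by fact
  interpret N: prob_space N by fact
  have box: "measure M (box a b) = measure N (box a b)" for a b :: 'a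
  proof -
    let ?K = "- box a b"
    have cl: "closed ?K" by (simp add: closed_Compl open_box)
    have ne: "?K \<noteq> {}" using bounded_box[of a b] not_bounded_UNIV by (metis double_complement Compl_empty_eq)
    define \<psi> where "\<psi> n x = min 1 (real n * infdist x ?K)" for n and x :: 'a
    have lip: "(real n)-lipschitz_on UNIV (\<psi> n)" for n
    proof (rule lipschitz_onI)
      fix x y :: 'a
      have "\<bar>real n * infdist x ?K - real n * infdist y ?K\<bar> \<le> real n * dist x y"
        unfolding right_diff_distrib[symmetric] abs_mult using infdist_triangle_abs[of x ?K y]
        by (auto intro!: mult_left_mono)
      then show "dist (\<psi> n x) (\<psi> n y) \<le> real n * dist x y"
        by (auto simp: \<psi>_def dist_real_def)
    qed simp
    obtain B where B: "0 < B" "\<And>x. x \<in> box a b \<Longrightarrow> norm x \<le> B" using bounded_box[of a b] bounded_pos by metis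
    have van: "\<psi> n x = 0" if "B < norm x" for n x
    proof -
      have "x \<in> ?K" using B(2)[of x] that by auto
      then show ?thesis by (simp add: \<psi>_def)
    qed
    have lim: "(\<lambda>n. \<psi> n x) \<longlonglongrightarrow> indicator (box a b) x" for x
    proof (cases "x \<in> ?K")
      case True
      then show ?thesis by (simp add: \<psi>_def)
    next
      case False
      then have "0 < infdist x ?K" using infdist_pos_not_in_closed[OF cl ne] by blast
      then obtain N where N: "1 < real N * infdist x ?K" using reals_Archimedean3 by blast
      have "\<forall>\<^sub>F n in sequentially. 1 = \<psi> n x"
        using eventually_ge_at_top[of N]
      proof eventually_elim
        case (elim n)
        have "real N * infdist x ?K \<le> real n * infdist x ?K"
          using elim infdist_nonneg by (intro mult_right_mono) auto
        then show ?case using N by (simp add: \<psi>_def)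
      qed
      then show ?thesis using False by (auto intro: Lim_transform_eventually[OF tendsto_const])
    qed
    have conv: "(\<lambda>n. LINT x|L. \<psi> n x) \<longlonglongrightarrow> measure L (box a b)"
      if L: "prob_space L" "sets L = sets borel" for L :: "'a measure"
    proof -
      interpret L: prob_space L by fact
      have "(\<lambda>n. LINT x|L. \<psi> n x) \<longlonglongrightarrow> (LINT x|L. indicator (box a b) x)"
      proof (rule integral_dominated_convergence[where w = "\<lambda>_. 1"])
        show "\<psi> n \<in> borel_measurable L" for n
          unfolding measurable_cong_sets[OF L(2) refl]
          by (rule borel_measurable_continuous_onI[OF lipschitz_on_continuous_on[OF lip]])
        show "AE x in L. norm (\<psi> n x) \<le> 1" for n
          by (auto simp: \<psi>_def infdist_nonneg)
      qed (use lim L in auto)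
      then show ?thesis using L(2) sets_eq_imp_space_eq[OF L(2)] by simp
    qed
    have "(LINT x|M. \<psi> n x) = (LINT x|N. \<psi> n x)" for n
      by (rule eq[where C = "real n" and Q = B]) (fact lip, fact van)
    then show ?thesis using LIMSEQ_unique[OF conv[OF M]] conv[OF N] by simp
  qed
  show ?thesis
  proof (rule measure_eqI_generator_eq[where E = "range (\<lambda>(a, b). box a b)" and \<Omega> = UNIV
        and A = "\<lambda>n::nat. box (- (real n *\<^sub>R One)) (real n *\<^sub>R One)"])
    show "Int_stable (range (\<lambda>(a, b). box a b :: 'a set))"
      by (auto simp: Int_stable_def Int_interval box_Int_box intro!: exI)
    show "sets M = sigma_sets UNIV (range (\<lambda>(a, b). box a b))"
      "sets N = sigma_sets UNIV (range (\<lambda>(a, b). box a b))"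
      using M N by (simp_all add: borel_eq_box)
    show "(\<Union>n::nat. box (- (real n *\<^sub>R One)) (real n *\<^sub>R One)) = (UNIV :: 'a set)"
      by (rule UN_box_eq_UNIV)
    show "emeasure M X = emeasure N X" if "X \<in> range (\<lambda>(a, b). box a b)" for X
    proof (cases "X = {}")
      case False
      then show ?thesis using that box by (auto simp: M.emeasure_eq_measure N.emeasure_eq_measure)
    qed simp
  qed auto
qed

text \<open>Uniqueness for the continuity equation with a Lipschitz field, in the form that any solution is the
  image of its initial value under the flow.\<close>

theorem (in transported_curve) curve_is_flow:
  obtains \<Phi> :: "real \<Rightarrow> 'a \<Rightarrow> 'a" where
    "\<And>x. continuous_on UNIV (\<lambda>t. \<Phi> t x)"
    "\<And>t x. t \<in> {0..H} \<Longrightarrow> \<Phi> t x = x + integral {0..t} (\<lambda>s. u s (\<Phi> s x))"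
    "\<And>t x. t \<in> {0..H} \<Longrightarrow> 1 + norm (\<Phi> t x) \<le> 2 * (1 + norm x)"
    "\<And>t. t \<in> {0..H} \<Longrightarrow> continuous_on UNIV (\<Phi> t)"
    "\<And>t. t \<in> {0..H} \<Longrightarrow> \<rho> t = distr (\<rho> 0) borel (\<Phi> t)"
proof -
  obtain \<Phi> :: "real \<Rightarrow> 'a \<Rightarrow> 'a" where \<Phi>: "\<And>x. continuous_on UNIV (\<lambda>t. \<Phi> t x)"
    "\<And>t x. t \<in> {0..H} \<Longrightarrow> \<Phi> t x = x + integral {0..t} (\<lambda>s. u s (\<Phi> s x))"
    "\<And>t x. t \<in> {0..H} \<Longrightarrow> 1 + norm (\<Phi> t x) \<le> 2 * (1 + norm x)"
    "\<And>t. t \<in> {0..H} \<Longrightarrow> continuous_on UNIV (\<Phi> t)"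
    using flow_exists[OF H] by blast
  have "\<rho> t = distr (\<rho> 0) borel (\<Phi> t)" if t: "t \<in> {0..H}" for t
  proof (rule measure_eqI_Lipschitz)
    have in0: "0 \<in> {0..H}" using H by simp
    have m: "\<Phi> t \<in> \<rho> 0 \<rightarrow>\<^sub>M borel"
      unfolding measurable_cong_sets[OF \<rho>_sets[OF in0] refl]
      by (rule borel_measurable_continuous_onI[OF \<Phi>(4)[OF t]])
    show "prob_space (distr (\<rho> 0) borel (\<Phi> t))"
      by (rule prob_space.prob_space_distr[OF \<rho>_prob[OF in0] m])
    fix \<psi> :: "'a \<Rightarrow> real" and C Q assume \<psi>: "C-lipschitz_on UNIV \<psi>" "\<And>x. Q < norm x \<Longrightarrow> \<psi> x = 0"
    have "\<psi> \<in> borel_measurable borel"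
      by (rule borel_measurable_continuous_onI[OF lipschitz_on_continuous_on[OF \<psi>(1)]])
    then have "(LINT x|distr (\<rho> 0) borel (\<Phi> t). \<psi> x) = (LINT x|\<rho> 0. \<psi> (\<Phi> t x))"
      by (rule integral_distr[OF m])
    then show "(LINT x|\<rho> t. \<psi> x) = (LINT x|distr (\<rho> 0) borel (\<Phi> t). \<psi> x)"
      using transport_test_function[OF \<Phi> t \<psi>] by simp
  qed (use \<rho>_prob[OF t] \<rho>_sets[OF t] in auto)
  then show ?thesis using that[OF \<Phi>] by blast
qed

section \<open>The continuity equation integrated in time\<close>

text \<open>Testing with the difference of two smooth steps, at \<open>s\<close> and at \<open>t\<close>, whose slopes tend to infinity:
  their derivatives concentrate at \<open>s\<close> and \<open>t\<close>, while the difference itself tends to the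
  indicator of \<open>[s,t]\<close>.\<close>

lemma weak_derivative_integral:
  fixes F g :: "real \<Rightarrow> real"
  assumes F: "continuous_on {0..T} F" and g: "integrable (lebesgue_on {0..T}) g"
    and weak: "\<And>\<xi> \<xi>' a b. \<lbrakk>smooth \<xi>; \<And>r. (\<xi> has_real_derivative \<xi>' r) (at r); 0 < a; b < T; \<And>r. r \<notin> {a..b} \<Longrightarrow> \<xi> r = 0\<rbrakk>
      \<Longrightarrow> (LINT r|lebesgue_on {0..T}. \<xi>' r * F r + \<xi> r * g r) = 0"
    and st: "0 < s" "s \<le> t" "t < T"
  shows "(g has_integral F t - F s) {s..t}"
proof -
  let ?L = "lebesgue_on {0..T}"
  obtain \<theta> \<theta>' :: "real \<Rightarrow> real" where \<theta>: "smooth \<theta>" "\<And>s. (\<theta> has_real_derivative \<theta>' s) (at s)"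
    "\<And>s. 0 \<le> \<theta>' s" "\<And>s. 1 \<le> \<bar>s\<bar> \<Longrightarrow> \<theta>' s = 0" "continuous_on UNIV \<theta>'"
    "\<And>s. s \<le> -1 \<Longrightarrow> \<theta> s = 0" "\<And>s. 1 \<le> s \<Longrightarrow> \<theta> s = 1" "\<And>s. 0 \<le> \<theta> s" "\<And>s. \<theta> s \<le> 1"
    using smooth_step_exists by blast
  \<comment> \<open>a step at \<open>c\<close> of width of order \<open>1 / n\<close>\<close>
  define \<Theta> where "\<Theta> n c r = \<theta> (real (Suc n) *\<^sub>R r + (- real (Suc n) * c))" for n c r
  define \<Theta>' where "\<Theta>' n c r = real (Suc n) * \<theta>' (real (Suc n) *\<^sub>R r + (- real (Suc n) * c))" for n c r
  have arg: "real (Suc n) *\<^sub>R r + (- real (Suc n) * c) = real (Suc n) * (r - c)" for n r c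
    by (simp add: algebra_simps)
  have \<Theta>s: "smooth (\<Theta> n c)" for n c
    unfolding \<Theta>_def using \<theta>(1) by (intro allI C_k_compose_affine bounded_linear_scaleR_right) auto
  have \<Theta>d: "(\<Theta> n c has_real_derivative \<Theta>' n c r) (at r)" for n c r
    unfolding \<Theta>_def[abs_def] \<Theta>'_def
    by (rule DERIV_chain2[OF \<theta>(2), THEN DERIV_cong]) (auto intro!: derivative_eq_intros)
  have \<Theta>'c: "continuous_on S (\<Theta>' n c)" for S n c
    unfolding \<Theta>'_def by (intro continuous_intros continuous_on_compose2[OF \<theta>(5)]) auto
  have \<Theta>c: "continuous_on S (\<Theta> n c)" for S n c
    using \<Theta>d by (auto intro!: continuous_at_imp_continuous_on DERIV_isCont)
  have \<Theta>0: "\<Theta> n c r = 0" if "real (Suc n) * (r - c) \<le> -1" for n c r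
    unfolding \<Theta>_def arg by (rule \<theta>(6)[OF that])
  have \<Theta>1: "\<Theta> n c r = 1" if "1 \<le> real (Suc n) * (r - c)" for n c r
    unfolding \<Theta>_def arg by (rule \<theta>(7)[OF that])
  have \<Theta>b: "0 \<le> \<Theta> n c r" "\<Theta> n c r \<le> 1" for n c r unfolding \<Theta>_def by (rule \<theta>)+
  have iF: "integrable ?L (\<lambda>r. \<Theta>' n c r * F r)" for n c
    by (intro continuous_imp_integrable_real continuous_on_mult F \<Theta>'c)
  have ig: "integrable ?L (\<lambda>r. \<Theta> n c r * g r)" for n c
  proof (rule Bochner_Integration.integrable_bound[OF g])
    have "\<Theta> n c \<in> borel_measurable ?L"
      by (intro measurable_restrict_space1 measurable_completion) (simp add: borel_measurable_continuous_onI \<Theta>c)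
    then show "(\<lambda>r. \<Theta> n c r * g r) \<in> borel_measurable ?L" using g by (intro borel_measurable_times) auto
    show "AE r in ?L. norm (\<Theta> n c r * g r) \<le> norm (g r)"
      using \<Theta>b by (auto simp: abs_mult mult_left_le_one_le intro!: AE_I2)
  qed
  \<comment> \<open>the derivatives of the steps form an approximate identity\<close>
  have peak: "(\<lambda>n. LINT r|?L. \<Theta>' n c r * F r) \<longlonglongrightarrow> F c" if c: "0 < c" "c < T" for c
  proof (rule LIMSEQ_I)
    fix e :: real assume e: "0 < e"
    obtain d where d: "0 < d" "\<And>r. r \<in> {0..T} \<Longrightarrow> dist r c < d \<Longrightarrow> dist (F r) (F c) < e / 2"
      using F c e unfolding continuous_on_iff by (metis atLeastAtMost_iff half_gt_zero less_imp_le)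
    define m where "m = Min {d, c, T - c}"
    have m: "0 < m" "m \<le> d" "m \<le> c" "m \<le> T - c" using d(1) c by (auto simp: m_def)
    obtain N where N: "1 / m < real N" using reals_Archimedean2 by blast
    have "norm ((LINT r|?L. \<Theta>' n c r * F r) - F c) < e" if n: "N \<le> n" for n
    proof -
      have Nm: "1 < real (Suc n) * m"
      proof -
        have "1 / m < real (Suc n)" using N n by linarith
        then show ?thesis using m by (simp add: divide_less_eq)
      qed
      have Sn: "real (Suc n) * m \<le> real (Suc n) * x" if "m \<le> x" for x using that by (intro mult_left_mono) auto
      have "integral {0..T} (\<Theta>' n c) = \<Theta> n c T - \<Theta> n c 0"
        using c \<Theta>d by (intro integral_unique fundamental_theorem_of_calculus)
          (auto simp: has_real_derivative_iff_has_vector_derivative[symmetric] intro: has_field_derivative_at_within)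
      also have "\<Theta> n c T = 1" using Sn[OF m(4)] Nm by (intro \<Theta>1) linarith
      also have "\<Theta> n c 0 = 0" using Sn[OF m(3)] Nm by (intro \<Theta>0) (simp add: algebra_simps)
      finally have one: "(LINT r|?L. \<Theta>' n c r) = 1"
        using lebesgue_integral_eq_integral[OF continuous_imp_integrable_real[OF \<Theta>'c]] by simp
      have i': "integrable ?L (\<Theta>' n c)" by (intro continuous_imp_integrable_real \<Theta>'c)
      have "(LINT r|?L. \<Theta>' n c r * F r) - F c = (LINT r|?L. \<Theta>' n c r * (F r - F c))"
        using iF[of n c] i' one by (simp add: right_diff_distrib)
      also have "\<bar>\<dots>\<bar> \<le> (LINT r|?L. \<Theta>' n c r * (e / 2))"
      proof (rule order_trans[OF integral_abs_bound integral_mono])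
        have "integrable ?L (\<lambda>r. \<Theta>' n c r * F r - \<Theta>' n c r * F c)" using iF i' by auto
        then show "integrable ?L (\<lambda>r. \<bar>\<Theta>' n c r * (F r - F c)\<bar>)" by (simp add: right_diff_distrib)
        show "integrable ?L (\<lambda>r. \<Theta>' n c r * (e / 2))" using i' by simp
        fix r assume r: "r \<in> space ?L"
        show "\<bar>\<Theta>' n c r * (F r - F c)\<bar> \<le> \<Theta>' n c r * (e / 2)"
        proof (cases "dist r c < d")
          case True
          have "0 \<le> \<Theta>' n c r" using \<theta>(3) by (simp add: \<Theta>'_def)
          moreover have "\<bar>F r - F c\<bar> \<le> e / 2" using d(2)[OF _ True] r by (simp add: dist_real_def)
          ultimately have "\<Theta>' n c r * \<bar>F r - F c\<bar> \<le> \<Theta>' n c r * (e / 2)" by (intro mult_left_mono)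
          then show ?thesis using \<open>0 \<le> \<Theta>' n c r\<close> by (simp only: abs_mult abs_of_nonneg)
        next
          case False
          then have "m \<le> \<bar>r - c\<bar>" using m by (simp add: dist_real_def)
          then have "1 \<le> real (Suc n) * \<bar>r - c\<bar>" using Sn[of "\<bar>r - c\<bar>"] Nm by linarith
          then have "\<Theta>' n c r = 0" unfolding \<Theta>'_def arg by (simp add: \<theta>(4) abs_mult)
          then show ?thesis by simp
        qed
      qed
      also have "\<dots> = e / 2" using one by simp
      finally show ?thesis using e by simp
    qed
    then show "\<exists>N. \<forall>n\<ge>N. norm ((LINT r|?L. \<Theta>' n c r * F r) - F c) < e" by blast
  qed
  have lim: "(\<lambda>n. LINT r|?L. \<Theta> n s r * g r - \<Theta> n t r * g r) \<longlonglongrightarrow> (LINT r|?L. indicator {s..t} r * g r)"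
  proof (rule integral_dominated_convergence[where w = "\<lambda>r. 2 * norm (g r)"])
    have big: "\<forall>\<^sub>F n in sequentially. 1 \<le> real (Suc n) * x" if "0 < x" for x
    proof -
      obtain N where "1 / x < real N" using reals_Archimedean2 by blast
      then have N: "1 < real N * x" using that by (simp add: divide_less_eq)
      show ?thesis using eventually_ge_at_top[of N]
      proof eventually_elim
        case (elim n)
        have "real N * x \<le> real (Suc n) * x" using elim that by (intro mult_right_mono) auto
        then show ?case using N by linarith
      qed
    qed
    have "AE r in lebesgue. r \<noteq> s \<and> r \<noteq> t" by (rule AE_I'[of "{s, t}"]) auto
    then have "AE r in ?L. r \<noteq> s \<and> r \<noteq> t" by (subst AE_restrict_space_iff) (auto elim: eventually_mono)
    then show "AE r in ?L. (\<lambda>n. \<Theta> n s r * g r - \<Theta> n t r * g r) \<longlonglongrightarrow> indicator {s..t} r * g r"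
    proof eventually_elim
      case (elim r)
      have "(\<lambda>n. \<Theta> n c r) \<longlonglongrightarrow> (if c < r then 1 else 0)" if "r \<noteq> c" for c
      proof (cases "c < r")
        case True
        have "\<forall>\<^sub>F n in sequentially. 1 = \<Theta> n c r"
          using big[of "r - c"] True by (auto elim!: eventually_mono simp: \<Theta>1)
        then show ?thesis using True by (auto intro: Lim_transform_eventually[OF tendsto_const])
      next
        case False
        have "\<forall>\<^sub>F n in sequentially. 1 \<le> real (Suc n) * (c - r)"
          using big[of "c - r"] False that by auto
        then have "\<forall>\<^sub>F n in sequentially. 0 = \<Theta> n c r"
          by eventually_elim (subst \<Theta>0, auto simp: algebra_simps)
        then show ?thesis using False by (auto intro: Lim_transform_eventually[OF tendsto_const])
      qed
      then have "(\<lambda>n. \<Theta> n s r * g r - \<Theta> n t r * g r)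
          \<longlonglongrightarrow> (if s < r then 1 else 0) * g r - (if t < r then 1 else 0) * g r"
        using elim by (intro tendsto_intros) auto
      moreover have "(if s < r then 1 else 0) * g r - (if t < r then 1 else 0) * g r = indicator {s..t} r * g r"
        using elim st by (auto simp: indicator_def)
      ultimately show ?case by simp
    qed
    show "AE r in ?L. norm (\<Theta> n s r * g r - \<Theta> n t r * g r) \<le> 2 * norm (g r)" for n
    proof (intro AE_I2)
      fix r
      have "\<bar>\<Theta> n s r * g r\<bar> \<le> \<bar>g r\<bar>" "\<bar>\<Theta> n t r * g r\<bar> \<le> \<bar>g r\<bar>"
        using \<Theta>b by (auto simp: abs_mult mult_left_le_one_le)
      then show "norm (\<Theta> n s r * g r - \<Theta> n t r * g r) \<le> 2 * norm (g r)"
        unfolding real_norm_def by linarith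
    qed
    have "(indicator {s..t} :: real \<Rightarrow> real) \<in> borel_measurable ?L"
      by (intro measurable_restrict_space1 borel_measurable_indicator) auto
    then show "(\<lambda>r. indicator {s..t} r * g r) \<in> borel_measurable ?L" using g by (intro borel_measurable_times) auto
  qed (use g ig in auto)
  have zero: "\<forall>\<^sub>F n in sequentially. (LINT r|?L. \<Theta>' n s r * F r) - (LINT r|?L. \<Theta>' n t r * F r)
      + (LINT r|?L. \<Theta> n s r * g r - \<Theta> n t r * g r) = 0"
  proof -
    define m where "m = min s (T - t)"
    have m: "0 < m" "m \<le> s" "m \<le> T - t" using st by (auto simp: m_def)
    obtain N where "2 / m < real N" using reals_Archimedean2 by blast
    then have N: "2 < real N * m" using m by (simp add: divide_less_eq)
    show ?thesis using eventually_ge_at_top[of N]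
    proof eventually_elim
      case (elim n)
      have "real N * m \<le> real (Suc n) * m" using elim m by (intro mult_right_mono) auto
      then have n: "2 < real (Suc n) * m" using N by linarith
      have "(LINT r|?L. (\<Theta>' n s r - \<Theta>' n t r) * F r + (\<Theta> n s r - \<Theta> n t r) * g r) = 0"
      proof (rule weak[of "\<lambda>r. \<Theta> n s r - \<Theta> n t r" _ "s - m / 2" "t + m / 2"])
        have "C_k k (\<lambda>r. \<Theta> n s r + (- 1) * \<Theta> n t r)" for k
          using \<Theta>s by (intro C_k_add C_k_mult C_k_const) auto
        then show "smooth (\<lambda>r. \<Theta> n s r - \<Theta> n t r)" by simp
        show "((\<lambda>r. \<Theta> n s r - \<Theta> n t r) has_real_derivative \<Theta>' n s r - \<Theta>' n t r) (at r)" for r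
          by (intro DERIV_diff \<Theta>d)
        fix r assume r: "r \<notin> {s - m / 2..t + m / 2}"
        then consider "r < s - m / 2" | "t + m / 2 < r" by fastforce
        then show "\<Theta> n s r - \<Theta> n t r = 0"
        proof cases
          case 1
          have "real (Suc n) * (m / 2) \<le> real (Suc n) * (s - r)" "real (Suc n) * (m / 2) \<le> real (Suc n) * (t - r)"
            using 1 st by (intro mult_left_mono; simp)+
          then have "real (Suc n) * (r - s) \<le> -1" "real (Suc n) * (r - t) \<le> -1"
            using n unfolding right_diff_distrib by linarith+
          then show ?thesis by (simp only: \<Theta>0)
        next
          case 2
          have "real (Suc n) * (m / 2) \<le> real (Suc n) * (r - s)" "real (Suc n) * (m / 2) \<le> real (Suc n) * (r - t)"
            using 2 st by (intro mult_left_mono; simp)+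
          then have "1 \<le> real (Suc n) * (r - s)" "1 \<le> real (Suc n) * (r - t)"
            using n unfolding right_diff_distrib by linarith+
          then show ?thesis by (simp only: \<Theta>1)
        qed
      qed (use m in auto)
      then show ?case using iF ig by (simp add: left_diff_distrib)
    qed
  qed
  have "(\<lambda>n. (LINT r|?L. \<Theta>' n s r * F r) - (LINT r|?L. \<Theta>' n t r * F r)
      + (LINT r|?L. \<Theta> n s r * g r - \<Theta> n t r * g r)) \<longlonglongrightarrow> F s - F t + (LINT r|?L. indicator {s..t} r * g r)"
    using st by (intro tendsto_intros peak lim) auto
  moreover have "(\<lambda>n. (LINT r|?L. \<Theta>' n s r * F r) - (LINT r|?L. \<Theta>' n t r * F r)
      + (LINT r|?L. \<Theta> n s r * g r - \<Theta> n t r * g r)) \<longlonglongrightarrow> 0"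
    by (rule tendsto_eventually[OF zero])
  ultimately have z: "F s - F t + (LINT r|?L. indicator {s..t} r * g r) = 0" by (rule LIMSEQ_unique)
  have "g absolutely_integrable_on {0..T}"
    using g by (simp add: integrable_restrict_space set_integrable_def)
  then have a: "g absolutely_integrable_on {s..t}" by (rule set_integrable_subset) (use st in auto)
  have e: "(LINT r|?L. indicator {s..t} r * g r) = (LINT r:{s..t}|lebesgue. g r)"
    using st by (subst integral_restrict_space)
      (auto simp: set_lebesgue_integral_def indicator_def intro!: Bochner_Integration.integral_cong)
  have "(LINT r:{s..t}|lebesgue. g r) = F t - F s" using z unfolding e by linarith
  then show ?thesis using has_integral_set_lebesgue[OF a] by simp
qed

text \<open>Product test functions \<open>\<xi> t * f x\<close> reduce the distributional equation to a weak derivative in time of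
  \<open>t \<mapsto> \<integral> f d\<mu>\<^sub>t\<close>. The flux \<open>\<integral> grad f \<bullet> u\<^sub>t d\<mu>\<^sub>t\<close> is measurable in time because it is the limit of
  the fluxes through the measures at the times of a finer and finer grid, and for a fixed
  measure measurability is Fubini's theorem.\<close>

lemma weak_equation_integrated:
  fixes \<mu> :: "real \<Rightarrow> 'a::euclidean_space measure" and u v :: "real \<Rightarrow> 'a \<Rightarrow> 'a" and G :: "real \<Rightarrow> real"
  assumes \<mu>: "\<And>t. t \<in> {0..T} \<Longrightarrow> prob_space (\<mu> t)" "\<And>t. t \<in> {0..T} \<Longrightarrow> sets (\<mu> t) = sets borel"
    and G: "G absolutely_integrable_on {0..T}" "\<And>t. 0 \<le> G t"
    and cont: "\<And>s t C f Q. \<lbrakk>0 \<le> s; s \<le> t; t \<le> T; C-lipschitz_on UNIV f; \<And>x::'a. Q < norm x \<Longrightarrow> f x = 0\<rbrakk>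
      \<Longrightarrow> \<bar>(LINT x|\<mu> t. f x) - (LINT x|\<mu> s. f x)\<bar> \<le> C * integral {s..t} G"
    and u: "\<And>x. (\<lambda>t. u t x) \<in> borel_measurable (lebesgue_on {0..T})" "\<And>t. (G t)-lipschitz_on UNIV (u t)"
      "\<And>t x. norm (u t x) \<le> G t * (1 + norm x)"
    and eq: "solves_continuity_equation T \<mu> v" "AE t in lebesgue_on {0..T}. v t = u t"
    and f: "smooth f" "\<And>x. Q < norm x \<Longrightarrow> f x = 0" and st: "0 < s" "s \<le> t" "t < T"
  shows "((\<lambda>r. LINT x|\<mu> r. gradient f x \<bullet> u r x) has_integral (LINT x|\<mu> t. f x) - (LINT x|\<mu> s. f x)) {s..t}"
proof (rule weak_derivative_integral[OF _ _ _ st])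
  let ?L = "lebesgue_on {0..T}"
  interpret L: finite_measure ?L by (rule finite_measure_lebesgue_on) simp
  have T: "0 < T" using st by simp
  define Q' where "Q' = max 0 Q"
  have fQ': "f x = 0" if "Q' < norm x" for x using f(2)[of x] that by (simp add: Q'_def)
  obtain K where K: "0 \<le> K" "\<And>x. norm (gradient f x) \<le> K"
    "\<And>x y. norm (gradient f x - gradient f y) \<le> K * norm (x - y)"
    using gradient_lipschitz[OF f(1) fQ'] by metis
  have gQ: "gradient f x = 0" if "Q' + 1 < norm x" for x
    by (rule gradient_vanish[OF fQ']) (use that in auto)
  note sg = smooth_gradient[OF f(1)]
  have u_cont: "continuous_on UNIV (u r)" for r by (rule lipschitz_on_continuous_on[OF u(2)])
  have gu_cont: "continuous_on UNIV (\<lambda>x. gradient f x \<bullet> u r x)" for r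
    by (intro continuous_on_inner sg(2) u_cont)
  define q where "q r = (LINT x|\<mu> r. gradient f x \<bullet> u r x)" for r
  have G_int: "G integrable_on {0..T}" using G(1) by (rule set_lebesgue_integral_eq_integral(1))
  have AG: "continuous_on {0..T} (\<lambda>t. integral {0..t} G)" by (rule indefinite_integral_continuous_1[OF G_int])
  have comb: "integral {s..t} G = integral {0..t} G - integral {0..s} G" if "0 \<le> s" "s \<le> t" "t \<le> T" for s t
  proof -
    have "G integrable_on {0..t}" by (rule integrable_on_subinterval[OF G_int]) (use that in auto)
    then show ?thesis using Henstock_Kurzweil_Integration.integral_combine[of 0 s t G] that by simp
  qed
  have lipF: "(K * (Q' + 3) * G r)-lipschitz_on UNIV (\<lambda>x. gradient f x \<bullet> u r x)" for r
    by (rule inner_field_lipschitz[OF K(2,3) gQ u(2,3) G(2)]) (auto simp: Q'_def)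
  have vanF: "gradient f x \<bullet> u r x = 0" if "Q' + 1 < norm x" for r x using gQ[OF that] by simp
  have bF: "\<bar>gradient f x \<bullet> u r x\<bar> \<le> K * (Q' + 2) * G r" for x r
  proof (cases "Q' + 1 < norm x")
    case False
    have "\<bar>gradient f x \<bullet> u r x\<bar> \<le> norm (gradient f x) * norm (u r x)" by (rule Cauchy_Schwarz_ineq2)
    also have "\<dots> \<le> K * (G r * (1 + norm x))" by (intro mult_mono K u) auto
    also have "\<dots> \<le> K * (G r * (Q' + 2))" using False by (intro mult_left_mono K G(2)) auto
    finally show ?thesis by (simp add: mult_ac)
  next
    case True
    then show ?thesis using vanF K(1) G(2)[of r] by (simp add: Q'_def)
  qed
  have iF: "integrable (\<mu> t) (\<lambda>x. gradient f x \<bullet> u r x)" if "t \<in> {0..T}" for t r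
    by (rule integrable_vanish_prob[OF gu_cont vanF \<mu>(1)[OF that] \<mu>(2)[OF that]])
  \<comment> \<open>for a fixed measure the spatial average of the flux depends measurably on time\<close>
  have fixed: "(\<lambda>r. LINT x|\<mu> t. gradient f x \<bullet> u r x) \<in> borel_measurable ?L" if t: "t \<in> {0..T}" for t
  proof -
    interpret M: prob_space "\<mu> t" by (rule \<mu>(1)[OF t])
    have "(\<lambda>w. u (fst w) (snd w)) \<in> borel_measurable (?L \<Otimes>\<^sub>M \<mu> t)"
    proof (rule measurable_Caratheodory[where u = "\<lambda>w. u (fst w)"])
      show "(\<lambda>w. u (fst w) x) \<in> borel_measurable (?L \<Otimes>\<^sub>M \<mu> t)" for x
        by (rule measurable_compose[OF measurable_fst u(1)])
      show "snd \<in> borel_measurable (?L \<Otimes>\<^sub>M \<mu> t)"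
        using measurable_snd[of ?L "\<mu> t"] by (simp add: measurable_cong_sets[OF refl \<mu>(2)[OF t]])
    qed (rule u_cont)
    moreover have "(\<lambda>w. gradient f (snd w)) \<in> borel_measurable (?L \<Otimes>\<^sub>M \<mu> t)"
      by (rule measurable_compose[OF measurable_snd])
        (simp add: measurable_cong_sets[OF \<mu>(2)[OF t] refl] borel_measurable_continuous_onI[OF sg(2)])
    ultimately have "(\<lambda>w. gradient f (snd w) \<bullet> u (fst w) (snd w)) \<in> borel_measurable (?L \<Otimes>\<^sub>M \<mu> t)"
      by (rule borel_measurable_inner[rotated])
    then show ?thesis
      by (intro M.borel_measurable_lebesgue_integral) (simp add: case_prod_beta')
  qed
  have qm: "q \<in> borel_measurable ?L"
  proof (rule borel_measurable_LIMSEQ_metric)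
    define \<tau> where "\<tau> n i = max 0 (min T (real_of_int i / real (Suc n)))" for n :: nat and i :: int
    have \<tau>: "\<tau> n i \<in> {0..T}" for n i using T by (auto simp: \<tau>_def)
    show "(\<lambda>r. LINT x|\<mu> (\<tau> n \<lfloor>r * real (Suc n)\<rfloor>). gradient f x \<bullet> u r x) \<in> borel_measurable ?L" for n
    proof -
      have 1: "(\<lambda>r. \<lfloor>r * real (Suc n)\<rfloor>) \<in> ?L \<rightarrow>\<^sub>M count_space UNIV"
        by (intro measurable_restrict_space1 measurable_completion) measurable
      show ?thesis
        by (rule measurable_compose_countable[of "\<lambda>i r. LINT x|\<mu> (\<tau> n i). gradient f x \<bullet> u r x", OF fixed[OF \<tau>] 1])
    qed
    fix r assume "r \<in> space ?L"
    then have r: "r \<in> {0..T}" by simp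
    let ?t = "\<lambda>n. \<tau> n \<lfloor>r * real (Suc n)\<rfloor>"
    have tr: "?t n \<le> r" "r - inverse (real (Suc n)) \<le> ?t n" for n
    proof -
      have "real_of_int \<lfloor>r * real (Suc n)\<rfloor> \<le> r * real (Suc n)" "r * real (Suc n) < real_of_int \<lfloor>r * real (Suc n)\<rfloor> + 1"
        by linarith+
      then have a: "real_of_int \<lfloor>r * real (Suc n)\<rfloor> / real (Suc n) \<le> r"
        and b: "r < real_of_int \<lfloor>r * real (Suc n)\<rfloor> / real (Suc n) + inverse (real (Suc n))"
        by (simp_all add: field_simps)
      show "?t n \<le> r" using a r by (auto simp: \<tau>_def)
      show "r - inverse (real (Suc n)) \<le> ?t n" using b a r by (auto simp: \<tau>_def)
    qed
    have "?t \<longlonglongrightarrow> r"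
    proof (rule tendsto_sandwich)
      show "(\<lambda>n. r - inverse (real (Suc n))) \<longlonglongrightarrow> r"
        using tendsto_diff[OF tendsto_const LIMSEQ_inverse_real_of_nat, of r] by simp
    qed (use tr in auto)
    then have "(\<lambda>n. integral {0..?t n} G) \<longlonglongrightarrow> integral {0..r} G"
      using AG r \<tau> by (intro continuous_on_tendsto_compose[OF AG]) auto
    then have "(\<lambda>n. K * (Q' + 3) * G r * (integral {0..r} G - integral {0..?t n} G)) \<longlonglongrightarrow> K * (Q' + 3) * G r * (integral {0..r} G - integral {0..r} G)"
      by (intro tendsto_intros)
    then have z: "(\<lambda>n. K * (Q' + 3) * G r * (integral {0..r} G - integral {0..?t n} G)) \<longlonglongrightarrow> 0" by simp
    have "\<bar>q r - (LINT x|\<mu> (?t n). gradient f x \<bullet> u r x)\<bar> \<le> K * (Q' + 3) * G r * (integral {0..r} G - integral {0..?t n} G)" for n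
    proof -
      have "\<bar>q r - (LINT x|\<mu> (?t n). gradient f x \<bullet> u r x)\<bar> \<le> K * (Q' + 3) * G r * integral {?t n..r} G"
        unfolding q_def by (rule cont[OF _ _ _ lipF, where Q = "Q' + 1"]) (use \<tau>[of n] tr r vanF in auto)
      then show ?thesis using comb[of "?t n" r] \<tau>[of n] tr[of n] r by simp
    qed
    then have "(\<lambda>n. q r - (LINT x|\<mu> (?t n). gradient f x \<bullet> u r x)) \<longlonglongrightarrow> 0"
      by (intro tendsto_0_le[OF z, of _ 1] always_eventually allI) (simp, meson abs_ge_self order_trans)
    then have "(\<lambda>n. q r - (q r - (LINT x|\<mu> (?t n). gradient f x \<bullet> u r x))) \<longlonglongrightarrow> q r - 0"
      by (intro tendsto_intros)
    then show "(\<lambda>n. LINT x|\<mu> (?t n). gradient f x \<bullet> u r x) \<longlonglongrightarrow> q r" by simp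
  qed
  have GL: "integrable ?L G" using G(1) by (simp add: integrable_restrict_space set_integrable_def)
  have qi: "integrable ?L q"
  proof (rule Bochner_Integration.integrable_bound[OF _ qm])
    show "integrable ?L (\<lambda>r. K * (Q' + 2) * G r)" using GL by simp
    show "AE r in ?L. norm (q r) \<le> norm (K * (Q' + 2) * G r)"
    proof (rule AE_I2)
      fix r assume "r \<in> space ?L"
      then have r: "r \<in> {0..T}" by simp
      interpret M: prob_space "\<mu> r" by (rule \<mu>(1)[OF r])
      have "\<bar>q r\<bar> \<le> (LINT x|\<mu> r. K * (Q' + 2) * G r)"
        unfolding q_def using iF[OF r] bF by (intro order_trans[OF integral_abs_bound] integral_mono) auto
      then show "norm (q r) \<le> norm (K * (Q' + 2) * G r)" by (simp add: M.prob_space)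
    qed
  qed
  show "integrable ?L (\<lambda>r. LINT x|\<mu> r. gradient f x \<bullet> u r x)" using qi by (simp add: q_def[abs_def])
  define F where "F r = (LINT x|\<mu> r. f x)" for r
  have lipf: "K-lipschitz_on UNIV f"
    using smooth_lipschitz[OF f(1) K(2)] K(1) by (intro lipschitz_onI) (auto simp: dist_norm)
  have Fc: "continuous_on {0..T} F"
  proof (rule continuous_on_eq_continuous_within[THEN iffD2, rule_format])
    fix r assume r: "r \<in> {0..T}"
    let ?A = "\<lambda>t. integral {0..t} G"
    have "((\<lambda>t. K * (?A t - ?A r)) \<longlongrightarrow> K * (?A r - ?A r)) (at r within {0..T})"
      using AG r by (intro tendsto_intros) (auto simp: continuous_on_def)
    then have z: "((\<lambda>t. K * (?A t - ?A r)) \<longlongrightarrow> 0) (at r within {0..T})" by simp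
    have le: "\<bar>F t - F r\<bar> \<le> \<bar>K * (?A t - ?A r)\<bar>" if t: "t \<in> {0..T}" for t
    proof (cases "r \<le> t")
      case True
      have "\<bar>F t - F r\<bar> \<le> K * integral {r..t} G"
        unfolding F_def by (rule cont[OF _ _ _ lipf fQ']) (use True t r in auto)
      then show ?thesis using comb[of r t] True t r by simp
    next
      case False
      have "\<bar>F r - F t\<bar> \<le> K * integral {t..r} G"
        unfolding F_def by (rule cont[OF _ _ _ lipf fQ']) (use False t r in auto)
      also have "\<dots> = - (K * (?A t - ?A r))" using comb[of t r] False t r by (simp add: right_diff_distrib)
      finally show ?thesis by linarith
    qed
    have "\<forall>\<^sub>F t in at r within {0..T}. t \<in> {0..T}" by (simp add: eventually_at_filter)
    then have "\<forall>\<^sub>F t in at r within {0..T}. norm (F t - F r) \<le> norm (K * (?A t - ?A r)) * 1"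
      by (rule eventually_mono) (simp add: le del: atLeastAtMost_iff)
    then have "((\<lambda>t. F t - F r) \<longlongrightarrow> 0) (at r within {0..T})"
      by (rule tendsto_0_le[OF z])
    then show "continuous (at r within {0..T}) F"
      by (simp add: continuous_within LIM_zero_iff)
  qed
  then show "continuous_on {0..T} (\<lambda>t. LINT x|\<mu> t. f x)" by (simp add: F_def[abs_def])
  fix \<xi> \<xi>' :: "real \<Rightarrow> real" and a b
  assume \<xi>: "smooth \<xi>" "\<And>r. (\<xi> has_real_derivative \<xi>' r) (at r)" and ab: "0 < a" "b < T"
    and \<xi>0: "\<And>r. r \<notin> {a..b} \<Longrightarrow> \<xi> r = 0"
  define \<phi> where "\<phi> z = \<xi> (fst z + 0) * f (snd z + 0)" for z :: "real \<times> 'a"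
  have "test_function T \<phi>"
    unfolding test_function_def
  proof (intro conjI exI[of _ "{a..b} \<times> cball 0 Q'"])
    show "smooth \<phi>"
      unfolding \<phi>_def[abs_def] using \<xi>(1) f(1)
      by (intro allI C_k_mult C_k_compose_affine bounded_linear_fst bounded_linear_snd) auto
    show "compact ({a..b} \<times> (cball 0 Q' :: 'a set))" by (intro compact_Times) auto
    show "{a..b} \<times> cball 0 Q' \<subseteq> {0<..<T} \<times> UNIV" using ab by auto
    show "\<forall>z. z \<notin> {a..b} \<times> cball 0 Q' \<longrightarrow> \<phi> z = 0"
      using \<xi>0 fQ' by (force simp: \<phi>_def)
  qed
  then have zero: "(LINT t|?L. (LINT x|\<mu> t. deriv (\<lambda>s. \<phi> (s, x)) t + gradient (\<lambda>y. \<phi> (t, y)) x \<bullet> v t x)) = 0"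
    using eq(1) unfolding solves_continuity_equation_def by blast
  have d: "deriv (\<lambda>s. \<phi> (s, x)) t = \<xi>' t * f x" for t x
    unfolding \<phi>_def by (rule DERIV_imp_deriv) (auto intro!: derivative_eq_intros \<xi>(2))
  have g: "gradient (\<lambda>y. \<phi> (t, y)) x = \<xi> t *\<^sub>R gradient f x" for t x
  proof (rule has_derivative_gradient_unique)
    have "((\<lambda>y. \<xi> t * f y) has_derivative (\<lambda>h. \<xi> t * (gradient f x \<bullet> h))) (at x)"
      by (rule has_derivative_mult_right[OF sg(1)])
    then show "((\<lambda>y. \<phi> (t, y)) has_derivative (\<lambda>h. (\<xi> t *\<^sub>R gradient f x) \<bullet> h)) (at x)"
      by (simp add: \<phi>_def)
  qed
  have AEeq: "AE t in ?L. (LINT x|\<mu> t. deriv (\<lambda>s. \<phi> (s, x)) t + gradient (\<lambda>y. \<phi> (t, y)) x \<bullet> v t x)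
      = \<xi>' t * F t + \<xi> t * q t"
    using eq(2) AE_space
  proof eventually_elim
    case (elim t)
    then have t: "t \<in> {0..T}" by simp
    have if1: "integrable (\<mu> t) f" by (rule integrable_vanish_prob[OF sg(3) fQ' \<mu>(1)[OF t] \<mu>(2)[OF t]])
    have "(LINT x|\<mu> t. \<xi>' t * f x + \<xi> t * (gradient f x \<bullet> u t x)) = \<xi>' t * F t + \<xi> t * q t"
      using if1 iF[OF t] by (simp add: F_def q_def)
    then show ?case using elim by (simp add: d g)
  qed
  have \<xi>'c: "\<xi>' = (\<lambda>r. gradient \<xi> r \<bullet> 1)"
  proof
    fix r
    have "gradient \<xi> r = \<xi>' r"
      by (rule has_derivative_gradient_unique) (use \<xi>(2)[of r] in \<open>simp add: has_field_derivative_def\<close>)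
    then show "\<xi>' r = gradient \<xi> r \<bullet> 1" by simp
  qed
  have rhs: "(\<lambda>t. \<xi>' t * F t + \<xi> t * q t) \<in> borel_measurable ?L"
  proof -
    have "continuous_on {0..T} (\<lambda>t. \<xi>' t * F t)"
      unfolding \<xi>'c by (intro continuous_intros Fc continuous_on_subset[OF smooth_gradient(2)[OF \<xi>(1)]]) auto
    then have 1: "(\<lambda>t. \<xi>' t * F t) \<in> borel_measurable ?L"
      using continuous_imp_integrable_real by blast
    have "\<xi> \<in> borel_measurable ?L"
      by (intro measurable_restrict_space1 measurable_completion)
        (simp add: borel_measurable_continuous_onI smooth_gradient(3)[OF \<xi>(1)])
    then show ?thesis by (intro borel_measurable_add[OF 1] borel_measurable_times qm)
  qed
  have lhs: "(\<lambda>t. LINT x|\<mu> t. deriv (\<lambda>s. \<phi> (s, x)) t + gradient (\<lambda>y. \<phi> (t, y)) x \<bullet> v t x) \<in> borel_measurable ?L"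
    (is "?I \<in> _")
  proof -
    have "(\<lambda>t. indicator {0..T} t *\<^sub>R (\<xi>' t * F t + \<xi> t * q t)) \<in> borel_measurable lebesgue"
      using rhs by (subst (asm) borel_measurable_restrict_space_iff) auto
    moreover have "AE t in lebesgue. indicator {0..T} t *\<^sub>R (\<xi>' t * F t + \<xi> t * q t) = indicator {0..T} t *\<^sub>R ?I t"
      using AEeq by (subst (asm) AE_restrict_space_iff) (auto elim!: eventually_mono simp: indicator_def)
    ultimately have "(\<lambda>t. indicator {0..T} t *\<^sub>R ?I t) \<in> borel_measurable lebesgue" by (rule borel_measurable_AE)
    then show ?thesis by (subst borel_measurable_restrict_space_iff) auto
  qed
  have "(LINT t|?L. \<xi>' t * F t + \<xi> t * q t) = 0"
    using integral_cong_AE[OF lhs rhs AEeq] zero by simp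
  then show "(LINT r|?L. \<xi>' r * (LINT x|\<mu> r. f x) + \<xi> r * (LINT x|\<mu> r. gradient f x \<bullet> u r x)) = 0"
    by (simp add: F_def q_def)
qed

section \<open>Finitely many values of continuous fields\<close>

lemma norm_le_sup_ball:
  assumes "norm x \<le> real k"
  shows "ennreal (norm (v x - w x)) \<le> sup_ball k v w"
  unfolding sup_ball_def by (rule SUP_upper) (use assms in simp)

lemma d_cc_pointwise:
  fixes x :: "'a::euclidean_space"
  assumes e: "0 < e"
  shows "\<exists>r>0. \<forall>v w. d_cc v w < r \<longrightarrow> norm (v x - w x) < e"
proof -
  obtain k where k: "norm x \<le> real k" using real_arch_simple by blast
  define r where "r = (1 / 2) ^ Suc k * min e 1"
  show ?thesis
  proof (intro exI[of _ r] conjI allI impI)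
    show "0 < r" using e by (simp add: r_def)
    fix v w :: "'a \<Rightarrow> 'a" assume d: "d_cc v w < r"
    let ?t = "\<lambda>k. (1 / 2) ^ Suc k * enn2real (min 1 (sup_ball (Suc k) v w))"
    have "?t k \<le> d_cc v w"
      unfolding d_cc_def using sum_le_suminf[OF d_cc_summable, of "{k}" v w] by simp
    then have "(1 / 2) ^ Suc k * enn2real (min 1 (sup_ball (Suc k) v w)) < (1 / 2) ^ Suc k * min e 1"
      using d unfolding r_def by (rule le_less_trans)
    then have lt: "enn2real (min 1 (sup_ball (Suc k) v w)) < min e 1"
      using mult_less_cancel_left_pos[of "(1 / 2 :: real) ^ Suc k"] by (metis half_gt_zero zero_less_one zero_less_power)
    have fin: "min 1 (sup_ball (Suc k) v w) < \<top>" by (rule le_less_trans[of _ 1]) auto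
    have "min 1 (sup_ball (Suc k) v w) < ennreal (min e 1)"
      using lt fin by (metis enn2real_less_iff top.not_eq_extremum)
    then have "sup_ball (Suc k) v w < ennreal (min e 1)"
      by (metis ennreal_1 ennreal_leI leD linorder_le_cases min.absorb1 min.absorb2 min.cobounded2)
    then have "ennreal (norm (v x - w x)) < ennreal (min e 1)"
      using norm_le_sup_ball[of x "Suc k" v w] k by (auto intro: le_less_trans)
    then show "norm (v x - w x) < e" by (simp add: ennreal_less_iff)
  qed
qed

text \<open>Convergence in \<open>d_cc\<close> implies pointwise convergence, so a set that is open for pointwise
  convergence is open.\<close>

lemma openin_cc_topologyI:
  fixes U :: "('a::euclidean_space \<Rightarrow> 'a) set"
  assumes "U \<subseteq> C0"
    and "\<And>v. v \<in> U \<Longrightarrow> \<exists>S e. finite S \<and> 0 < e \<and> (\<forall>w\<in>C0. (\<forall>x\<in>S. norm (v x - w x) < e) \<longrightarrow> w \<in> U)"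
  shows "openin cc_topology U"
  unfolding cc_topology_def Metric_space.openin_mtopology[OF Metric_space_d_cc]
proof (intro conjI assms(1) allI impI)
  fix v assume "v \<in> U"
  then obtain S e where S: "finite S" "0 < e" "\<And>w. w \<in> C0 \<Longrightarrow> (\<forall>x\<in>S. norm (v x - w x) < e) \<Longrightarrow> w \<in> U"
    using assms(2) by metis
  obtain r :: "'a \<Rightarrow> real" where r: "\<And>x. 0 < r x" "\<And>x (v :: 'a \<Rightarrow> 'a) w. d_cc v w < r x \<Longrightarrow> norm (v x - w x) < e"
    using d_cc_pointwise[OF S(2)] by metis
  define r0 where "r0 = Min (insert 1 (r ` S))"
  have r0: "0 < r0" "\<And>x. x \<in> S \<Longrightarrow> r0 \<le> r x"
    using S(1) r(1) by (auto simp: r0_def)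
  show "\<exists>r>0. Metric_space.mball C0 d_cc v r \<subseteq> U"
  proof (intro exI[of _ r0] conjI r0(1) subsetI)
    fix w assume "w \<in> Metric_space.mball C0 d_cc v r0"
    then have "w \<in> C0" "d_cc v w < r0" by (auto simp: Metric_space.in_mball[OF Metric_space_d_cc])
    then show "w \<in> U"
      using r(2)[of v w] r0(2) by (intro S(3) ballI) (meson less_le_trans)+
  qed
qed

lemma openin_cc_eval:
  fixes x :: "'a::euclidean_space"
  assumes "open O'"
  shows "openin cc_topology {w \<in> C0. w x \<in> O'}"
proof (rule openin_cc_topologyI)
  fix v assume "v \<in> {w \<in> C0. w x \<in> O'}"
  then obtain e where "0 < e" "\<And>y. dist y (v x) < e \<Longrightarrow> y \<in> O'"
    using assms unfolding open_dist by blast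
  then show "\<exists>S e. finite S \<and> 0 < e \<and> (\<forall>w\<in>C0. (\<forall>x\<in>S. norm (v x - w x) < e) \<longrightarrow> w \<in> {w \<in> C0. w x \<in> O'})"
    by (intro exI[of _ "{x}"] exI[of _ e]) (auto simp: dist_norm norm_minus_commute)
qed auto

lemma measurable_eval:
  fixes v :: "'b \<Rightarrow> ('a::euclidean_space \<Rightarrow> 'a)"
  assumes "v \<in> M \<rightarrow>\<^sub>M sigma C0 {U. openin cc_topology U}"
  shows "(\<lambda>t. v t x) \<in> borel_measurable M" "\<And>t. t \<in> space M \<Longrightarrow> continuous_on UNIV (v t)"
proof -
  have sub: "{U. openin cc_topology U} \<subseteq> Pow (C0 :: ('a \<Rightarrow> 'a) set)"
    using openin_subset[of cc_topology] Metric_space.topspace_mtopology[OF Metric_space_d_cc]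
    by (auto simp: cc_topology_def)
  have C: "v t \<in> C0" if "t \<in> space M" for t
    using measurable_space[OF assms that] sub by (simp add: space_measure_of_conv)
  then show "\<And>t. t \<in> space M \<Longrightarrow> continuous_on UNIV (v t)" by (auto simp: C0_def)
  show "(\<lambda>t. v t x) \<in> borel_measurable M"
  proof (rule borel_measurableI)
    fix S :: "'a set" assume "open S"
    then have "{w \<in> C0. w x \<in> S} \<in> sets (sigma C0 {U. openin cc_topology U})"
      using openin_cc_eval sub by (auto simp: sets_measure_of)
    from measurable_sets[OF assms this]
    have "v -` {w \<in> C0. w x \<in> S} \<inter> space M \<in> sets M" .
    moreover have "v -` {w \<in> C0. w x \<in> S} \<inter> space M = (\<lambda>t. v t x) -` S \<inter> space M" using C by auto
    ultimately show "(\<lambda>t. v t x) -` S \<inter> space M \<in> sets M" by simp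
  qed
qed

text \<open>A linear functional on fields that uses only their values at finitely many points: a list of pairs of a
  point and a coefficient vector. Lists over a countable set are countable.\<close>

definition ell :: "('a::euclidean_space \<times> 'a) list \<Rightarrow> ('a \<Rightarrow> 'a) \<Rightarrow> real" where
  "ell xs w = (\<Sum>(x, c)\<leftarrow>xs. c \<bullet> w x)"

text \<open>The norm of \<open>ell xs\<close> with respect to the sup-norm of the values.\<close>

definition ell_mass :: "('a::euclidean_space \<times> 'a) list \<Rightarrow> real" where
  "ell_mass xs = (\<Sum>(x, c)\<leftarrow>xs. norm c)"

lemma ell_mass_nonneg: "0 \<le> ell_mass xs"
  unfolding ell_mass_def by (intro sum_list_nonneg) auto

lemma ell_diff_le:
  assumes "\<And>x c. (x, c) \<in> set xs \<Longrightarrow> norm (v x - w x) \<le> e"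
  shows "\<bar>ell xs v - ell xs w\<bar> \<le> ell_mass xs * e"
  using assms
proof (induction xs)
  case (Cons z xs)
  obtain x c where z: "z = (x, c)" by fastforce
  have "\<bar>c \<bullet> v x - c \<bullet> w x\<bar> \<le> norm c * norm (v x - w x)"
    using Cauchy_Schwarz_ineq2[of c "v x - w x"] by (simp add: inner_diff_right)
  also have "\<dots> \<le> norm c * e" using Cons.prems[of x c] z by (intro mult_left_mono) auto
  finally have 1: "\<bar>c \<bullet> v x - c \<bullet> w x\<bar> \<le> norm c * e" .
  have 2: "\<bar>ell xs v - ell xs w\<bar> \<le> ell_mass xs * e" using Cons by auto
  show ?case using 1 2 by (simp add: ell_def ell_mass_def z distrib_right)
qed (simp add: ell_def ell_mass_def)

lemma ell_growth:
  assumes "\<And>x. norm (w x) \<le> M * (1 + norm x)" "0 \<le> M"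
  shows "\<bar>ell xs w\<bar> \<le> (\<Sum>(x, c)\<leftarrow>xs. norm c * (1 + norm x)) * M"
proof (induction xs)
  case (Cons z xs)
  obtain x c where z: "z = (x, c)" by fastforce
  have "\<bar>c \<bullet> w x\<bar> \<le> norm c * norm (w x)" by (rule Cauchy_Schwarz_ineq2)
  also have "\<dots> \<le> norm c * (M * (1 + norm x))" by (intro mult_left_mono assms) auto
  finally show ?case using Cons by (simp add: ell_def z algebra_simps)
qed (simp add: ell_def)

lemma openin_cc_ell: "openin cc_topology {w \<in> C0. a < ell xs w}"
proof (rule openin_cc_topologyI)
  fix v assume v: "v \<in> {w \<in> C0. a < ell xs w}"
  define e where "e = (ell xs v - a) / (ell_mass xs + 1)"
  have e: "0 < e" using v ell_mass_nonneg[of xs] by (simp add: e_def)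
  have "w \<in> {w \<in> C0. a < ell xs w}" if w: "w \<in> C0" "\<forall>x\<in>fst ` set xs. norm (v x - w x) < e" for w
  proof -
    have "\<bar>ell xs v - ell xs w\<bar> \<le> ell_mass xs * e"
      using w(2) by (intro ell_diff_le) (force intro: less_imp_le)
    also have "\<dots> < (ell_mass xs + 1) * e" using e by simp
    also have "\<dots> = ell xs v - a" using ell_mass_nonneg[of xs] by (simp add: e_def)
    finally show ?thesis using w(1) by auto
  qed
  then show "\<exists>S e. finite S \<and> 0 < e \<and> (\<forall>w\<in>C0. (\<forall>x\<in>S. norm (v x - w x) < e) \<longrightarrow> w \<in> {w \<in> C0. a < ell xs w})"
    using e by (intro exI[of _ "fst ` set xs"] exI[of _ e]) auto
qed auto

text \<open>The separation theorem for the convex set of restrictions of \<open>F\<close> to \<open>Y\<close>, by way of the distance to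
  the point \<open>a\<close>. If the infimum \<open>I\<close> of the squared distance were positive, a near-minimiser \<open>w0\<close> would
  satisfy the variational inequality up to \<open>I / 2\<close>; the functional with coefficients \<open>a - w0\<close> would then
  be larger at \<open>a\<close> than on \<open>F\<close>. Coefficients in a dense set suffice because the values are
  bounded.\<close>

lemma convex_fields_separation:
  fixes F :: "('a::euclidean_space \<Rightarrow> 'a) set"
  assumes F: "F \<noteq> {}" "convex_fields F" and Y: "finite Y" and B: "\<And>w y. w \<in> F \<Longrightarrow> y \<in> Y \<Longrightarrow> norm (w y) \<le> B"
    and D: "\<And>x e. 0 < e \<Longrightarrow> \<exists>d\<in>D. dist x d < e"
    and sup: "\<And>c. (\<And>y. c y \<in> D) \<Longrightarrow> (\<Sum>y\<in>Y. c y \<bullet> a y) \<le> (SUP w\<in>F. \<Sum>y\<in>Y. c y \<bullet> w y)"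
    and \<delta>: "0 < \<delta>"
  shows "\<exists>w\<in>F. \<forall>y\<in>Y. norm (w y - a y) \<le> \<delta>"
proof -
  define q where "q w = (\<Sum>y\<in>Y. (norm (w y - a y))\<^sup>2)" for w
  have q0: "0 \<le> q w" for w unfolding q_def by (intro sum_nonneg) auto
  define I where "I = (INF w\<in>F. q w)"
  have bdd: "bdd_below (q ` F)" using q0 by (intro bdd_belowI[of _ 0]) auto
  have I_le: "I \<le> q w" if "w \<in> F" for w unfolding I_def by (rule cINF_lower[OF bdd that])
  have I0: "0 \<le> I" unfolding I_def using F(1) q0 by (intro cINF_greatest) auto
  obtain w1 where w1: "w1 \<in> F" using F(1) by blast
  have B0: "0 \<le> B \<or> Y = {}" using B[OF w1] norm_ge_zero order_trans by blast
  \<comment> \<open>a bound for the squared distance of two elements of \<open>F\<close> on \<open>Y\<close>\<close>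
  define E where "E = real (card Y) * (2 * B)\<^sup>2 + 1"
  have E: "0 < E" unfolding E_def by (intro add_nonneg_pos) auto
  \<comment> \<open>the separation inequality, first for coefficients in the dense set, then for all\<close>
  have sep: "(\<Sum>y\<in>Y. c y \<bullet> a y) \<le> K" if K: "\<And>w. w \<in> F \<Longrightarrow> (\<Sum>y\<in>Y. c y \<bullet> w y) \<le> K" for c K
  proof (rule field_le_epsilon)
    fix e :: real assume e: "0 < e"
    define M where "M = (\<Sum>y\<in>Y. norm (a y) + \<bar>B\<bar>) + 1"
    have M: "0 < M" unfolding M_def by (intro add_nonneg_pos sum_nonneg) auto
    define r where "r = e / M"
    have r: "0 < r" using e M by (simp add: r_def)
    have "\<forall>y. \<exists>d. d \<in> D \<and> dist (c y) d < r" using D[OF r] by blast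
    then obtain c' where c': "\<And>y. c' y \<in> D" "\<And>y. dist (c y) (c' y) < r" by metis
    have close: "\<bar>(\<Sum>y\<in>Y. c' y \<bullet> b y) - (\<Sum>y\<in>Y. c y \<bullet> b y)\<bar> \<le> r * (\<Sum>y\<in>Y. norm (b y))" for b :: "'a \<Rightarrow> 'a"
    proof -
      have "\<bar>(\<Sum>y\<in>Y. c' y \<bullet> b y) - (\<Sum>y\<in>Y. c y \<bullet> b y)\<bar> = \<bar>\<Sum>y\<in>Y. (c' y - c y) \<bullet> b y\<bar>"
        by (simp add: sum_subtractf inner_diff_left)
      also have "\<dots> \<le> (\<Sum>y\<in>Y. \<bar>(c' y - c y) \<bullet> b y\<bar>)" by (rule sum_abs)
      also have "\<dots> \<le> (\<Sum>y\<in>Y. r * norm (b y))"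
      proof (rule sum_mono)
        fix y
        have "\<bar>(c' y - c y) \<bullet> b y\<bar> \<le> norm (c' y - c y) * norm (b y)" by (rule Cauchy_Schwarz_ineq2)
        also have "\<dots> \<le> r * norm (b y)"
          using c'(2)[of y] by (intro mult_right_mono) (auto simp: dist_norm norm_minus_commute less_imp_le)
        finally show "\<bar>(c' y - c y) \<bullet> b y\<bar> \<le> r * norm (b y)" .
      qed
      finally show ?thesis by (simp add: sum_distrib_left)
    qed
    have "(\<Sum>y\<in>Y. c' y \<bullet> w y) \<le> K + r * (\<Sum>y\<in>Y. \<bar>B\<bar>)" if w: "w \<in> F" for w
    proof -
      have "(\<Sum>y\<in>Y. norm (w y)) \<le> (\<Sum>y\<in>Y. \<bar>B\<bar>)" using B[OF w] by (intro sum_mono) force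
      then have "r * (\<Sum>y\<in>Y. norm (w y)) \<le> r * (\<Sum>y\<in>Y. \<bar>B\<bar>)" using r by (intro mult_left_mono) auto
      then show ?thesis using close[of w] K[OF w] by linarith
    qed
    then have "(SUP w\<in>F. \<Sum>y\<in>Y. c' y \<bullet> w y) \<le> K + r * (\<Sum>y\<in>Y. \<bar>B\<bar>)"
      using F(1) by (intro cSUP_least) auto
    then have "(\<Sum>y\<in>Y. c y \<bullet> a y) \<le> K + r * (\<Sum>y\<in>Y. \<bar>B\<bar>) + r * (\<Sum>y\<in>Y. norm (a y))"
      using sup[of c', OF c'(1)] close[of a] by linarith
    also have "\<dots> \<le> K + r * M" using r by (simp add: M_def sum.distrib distrib_left)
    also have "\<dots> = K + e" using M by (simp add: r_def)
    finally show "(\<Sum>y\<in>Y. c y \<bullet> a y) \<le> K + e" .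
  qed
  have "I = 0"
  proof (rule ccontr)
    assume "I \<noteq> 0"
    then have I: "0 < I" using I0 by simp
    \<comment> \<open>the step from \<open>w0\<close> towards another element: the quadratic term \<open>s\<^sup>2 * E\<close> must not exceed half of
      \<open>s * I\<close>, and the slack \<open>\<eta>\<close> of the near-minimiser takes the other half\<close>
    define s where "s = min 1 (I / (2 * E))"
    have s: "0 < s" "s \<le> 1" "s * E \<le> I / 2" using I E by (auto simp: s_def min_def field_simps)
    define \<eta> where "\<eta> = s * I / 2"
    have \<eta>: "0 < \<eta>" using s I by (simp add: \<eta>_def)
    have "\<exists>w0\<in>F. q w0 < I + \<eta>"
      using \<eta> cINF_less_iff[OF F(1) bdd, of "I + \<eta>"] by (simp add: I_def)
    then obtain w0 where w0: "w0 \<in> F" "q w0 < I + \<eta>" by blast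
    have "(\<Sum>y\<in>Y. (a y - w0 y) \<bullet> w y) \<le> (\<Sum>y\<in>Y. (a y - w0 y) \<bullet> w0 y) + I / 2" if w: "w \<in> F" for w
    proof -
      let ?w = "\<lambda>x. (1 - s) *\<^sub>R w0 x + s *\<^sub>R w x"
      have "?w \<in> F" using F(2) w0(1) w s unfolding convex_fields_def by auto
      then have "q w0 - \<eta> < q ?w" using I_le[of ?w] w0(2) by linarith
      also have "q ?w = (\<Sum>y\<in>Y. (norm (w0 y - a y))\<^sup>2 - 2 * s * ((a y - w0 y) \<bullet> (w y - w0 y)) + s\<^sup>2 * (norm (w y - w0 y))\<^sup>2)"
        unfolding q_def
      proof (rule sum.cong[OF refl])
        fix y
        have "?w y - a y = (w0 y - a y) + s *\<^sub>R (w y - w0 y)" by (simp add: algebra_simps)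
        then show "(norm (?w y - a y))\<^sup>2 = (norm (w0 y - a y))\<^sup>2 - 2 * s * ((a y - w0 y) \<bullet> (w y - w0 y)) + s\<^sup>2 * (norm (w y - w0 y))\<^sup>2"
          by (simp only: power2_norm_eq_inner) (simp add: algebra_simps inner_commute power2_eq_square)
      qed
      also have "\<dots> = q w0 - 2 * s * (\<Sum>y\<in>Y. (a y - w0 y) \<bullet> (w y - w0 y)) + s\<^sup>2 * (\<Sum>y\<in>Y. (norm (w y - w0 y))\<^sup>2)"
        by (simp add: q_def sum.distrib sum_subtractf sum_distrib_left)
      also have "(\<Sum>y\<in>Y. (norm (w y - w0 y))\<^sup>2) \<le> E"
      proof -
        have "(norm (w y - w0 y))\<^sup>2 \<le> (2 * B)\<^sup>2" if "y \<in> Y" for y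
          using norm_triangle_ineq4[of "w y" "w0 y"] B[OF w that] B[OF w0(1) that] by (intro power_mono) auto
        then have "(\<Sum>y\<in>Y. (norm (w y - w0 y))\<^sup>2) \<le> (\<Sum>y\<in>Y. (2 * B)\<^sup>2)" by (rule sum_mono)
        then show ?thesis by (simp add: E_def)
      qed
      finally have "2 * s * (\<Sum>y\<in>Y. (a y - w0 y) \<bullet> (w y - w0 y)) < \<eta> + s\<^sup>2 * E" by (simp add: mult_left_mono)
      also have "\<dots> \<le> s * I"
      proof -
        have "s * (s * E) \<le> s * (I / 2)" using s by (intro mult_left_mono) auto
        moreover have "s\<^sup>2 * E = s * (s * E)" "\<eta> = s * (I / 2)" "s * I = s * (I / 2) + s * (I / 2)"
          by (simp_all add: \<eta>_def power2_eq_square)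
        ultimately show ?thesis by linarith
      qed
      finally have "2 * (\<Sum>y\<in>Y. (a y - w0 y) \<bullet> (w y - w0 y)) < I" using s(1) by (simp add: mult.assoc mult.left_commute)
      then show ?thesis by (simp add: inner_diff_right sum_subtractf)
    qed
    from sep[of "\<lambda>y. a y - w0 y", OF this]
    have "(\<Sum>y\<in>Y. (a y - w0 y) \<bullet> a y) \<le> (\<Sum>y\<in>Y. (a y - w0 y) \<bullet> w0 y) + I / 2" by blast
    moreover have "q w0 = (\<Sum>y\<in>Y. (a y - w0 y) \<bullet> a y) - (\<Sum>y\<in>Y. (a y - w0 y) \<bullet> w0 y)"
      unfolding q_def sum_subtractf[symmetric]
      by (rule sum.cong[OF refl]) (simp add: power2_norm_eq_inner inner_diff_left inner_diff_right inner_commute)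
    ultimately show False using I_le[OF w0(1)] I by linarith
  qed
  then have "\<exists>w\<in>F. q w < \<delta>\<^sup>2"
    using \<delta> cINF_less_iff[OF F(1) bdd, of "\<delta>\<^sup>2"] by (simp add: I_def)
  then obtain w where w: "w \<in> F" "q w < \<delta>\<^sup>2" by blast
  have "norm (w y - a y) \<le> \<delta>" if "y \<in> Y" for y
  proof -
    have "(norm (w y - a y))\<^sup>2 \<le> q w" unfolding q_def using Y that by (intro member_le_sum) auto
    then have "(norm (w y - a y))\<^sup>2 \<le> \<delta>\<^sup>2" using w(2) by simp
    then show ?thesis using \<delta> by (simp add: power2_le_iff_abs_le)
  qed
  then show ?thesis using w(1) by blast
qed

section \<open>Support functions and universal good times\<close>

lemma moment_nonneg: "0 \<le> moment p \<mu>"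
  by (simp add: moment_def)

lemma d_supD:
  assumes "d_sup v w \<le> ennreal c * W" "W \<le> ennreal B" "0 \<le> B" "0 \<le> c"
  shows "norm (v x - w x) \<le> c * B"
proof -
  have "ennreal (norm (v x - w x)) \<le> d_sup v w" unfolding d_sup_def by (rule SUP_upper) simp
  also have "\<dots> \<le> ennreal c * ennreal B"
    using assms(1) mult_left_mono[OF assms(2), of "ennreal c"] by (auto intro: order_trans)
  also have "\<dots> = ennreal (c * B)" using assms by (simp add: ennreal_mult)
  finally show ?thesis using assms by (simp add: ennreal_le_iff)
qed

text \<open>The hypotheses with their almost everywhere clauses collected in one null set \<open>N\<close>. The witnesses \<open>m\<close>,
  \<open>l\<close> and \<open>L\<close> become parameters because the good times depend on them.\<close>

locale CI_field =
  fixes p T :: real and V :: "real \<Rightarrow> ('a::euclidean_space) measure \<Rightarrow> ('a \<Rightarrow> 'a) set"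
    and N :: "real set" and m l L :: "real \<Rightarrow> real"
  assumes p: "1 \<le> p" and T: "0 < T" and N: "N \<in> null_sets lebesgue"
    and V_measurable: "\<mu> \<in> Pp p \<Longrightarrow> set_valued_measurable T (\<lambda>t. V t \<mu>)"
    and V_C0: "t \<in> {0..T} \<Longrightarrow> \<mu> \<in> Pp p \<Longrightarrow> V t \<mu> \<subseteq> C0"
    and V_nonempty: "t \<in> {0..T} \<Longrightarrow> \<mu> \<in> Pp p \<Longrightarrow> V t \<mu> \<noteq> {}"
    and V_convex: "t \<in> {0..T} \<Longrightarrow> \<mu> \<in> Pp p \<Longrightarrow> convex_fields (V t \<mu>)"
    and m: "L1_nonneg T m" and l: "L1_nonneg T l" and L: "L1_nonneg T L"
    and V_growth: "\<lbrakk>t \<in> {0..T} - N; \<mu> \<in> Pp p; w \<in> V t \<mu>\<rbrakk> \<Longrightarrow> norm (w x) \<le> m t * (1 + norm x + moment p \<mu>)"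
    and V_lipschitz: "\<lbrakk>t \<in> {0..T} - N; \<mu> \<in> Pp p; w \<in> V t \<mu>\<rbrakk> \<Longrightarrow> (l t)-lipschitz_on UNIV w"
    and V_stable: "\<lbrakk>t \<in> {0..T} - N; \<mu> \<in> Pp p; \<nu> \<in> Pp p; w \<in> V t \<mu>\<rbrakk>
      \<Longrightarrow> \<exists>w'\<in>V t \<nu>. d_sup w w' \<le> ennreal (L t) * Wasserstein p \<mu> \<nu>"

lemma CI_fieldI:
  assumes "1 \<le> p" "0 < T" and conv: "\<And>t \<mu>. t \<in> {0..T} \<Longrightarrow> \<mu> \<in> Pp p \<Longrightarrow> convex_fields (V t \<mu>)" and CI: "CI p T V"
  obtains N m l L where "CI_field p T V N m l L"
proof -
  have null: "\<exists>N\<in>null_sets lebesgue. \<forall>t\<in>{0..T} - N. P t" if "AE t in lebesgue_on {0..T}. P t" for P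
  proof -
    have "AE t in lebesgue. t \<in> {0..T} \<longrightarrow> P t" using that by (subst (asm) AE_restrict_space_iff) auto
    then obtain N where "N \<in> null_sets lebesgue" "{t \<in> space lebesgue. \<not> (t \<in> {0..T} \<longrightarrow> P t)} \<subseteq> N"
      by (auto simp: eventually_ae_filter)
    then show ?thesis by (intro bexI[of _ N]) auto
  qed
  obtain m where m: "L1_nonneg T m" "AE t in lebesgue_on {0..T}. \<forall>\<mu>\<in>Pp p. \<forall>v\<in>V t \<mu>. \<forall>x.
           norm (v x) \<le> m t * (1 + norm x + moment p \<mu>)" using CI unfolding CI_def by blast
  obtain l where l: "L1_nonneg T l" "AE t in lebesgue_on {0..T}. \<forall>\<mu>\<in>Pp p. \<forall>v\<in>V t \<mu>. (l t)-lipschitz_on UNIV v"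
    using CI unfolding CI_def by blast
  obtain L where L: "L1_nonneg T L" "AE t in lebesgue_on {0..T}. \<forall>\<mu>\<in>Pp p. \<forall>\<nu>\<in>Pp p. \<forall>v\<in>V t \<mu>. \<exists>w\<in>V t \<nu>.
           d_sup v w \<le> ennreal (L t) * Wasserstein p \<mu> \<nu>" using CI unfolding CI_def by blast
  obtain N1 where N1: "N1 \<in> null_sets lebesgue" "\<forall>t\<in>{0..T} - N1. \<forall>\<mu>\<in>Pp p. \<forall>v\<in>V t \<mu>. \<forall>x.
           norm (v x) \<le> m t * (1 + norm x + moment p \<mu>)" using null[OF m(2)] by blast
  obtain N2 where N2: "N2 \<in> null_sets lebesgue" "\<forall>t\<in>{0..T} - N2. \<forall>\<mu>\<in>Pp p. \<forall>v\<in>V t \<mu>. (l t)-lipschitz_on UNIV v"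
    using null[OF l(2)] by blast
  obtain N3 where N3: "N3 \<in> null_sets lebesgue" "\<forall>t\<in>{0..T} - N3. \<forall>\<mu>\<in>Pp p. \<forall>\<nu>\<in>Pp p. \<forall>v\<in>V t \<mu>. \<exists>w\<in>V t \<nu>.
           d_sup v w \<le> ennreal (L t) * Wasserstein p \<mu> \<nu>" using null[OF L(2)] by blast
  have closed: "V t \<mu> \<subseteq> C0" "V t \<mu> \<noteq> {}" "set_valued_measurable T (\<lambda>t. V t \<mu>)" if "t \<in> {0..T}" "\<mu> \<in> Pp p" for t \<mu>
  proof -
    have "closedin cc_topology (V t \<mu>)" using CI that unfolding CI_def by blast
    then show "V t \<mu> \<subseteq> C0"
      using closedin_subset Metric_space.topspace_mtopology[OF Metric_space_d_cc] unfolding cc_topology_def by metis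
    show "V t \<mu> \<noteq> {}" "set_valued_measurable T (\<lambda>t. V t \<mu>)" using CI that unfolding CI_def by blast+
  qed
  have "CI_field p T V (N1 \<union> N2 \<union> N3) m l L"
  proof
    show "N1 \<union> N2 \<union> N3 \<in> null_sets lebesgue" using N1 N2 N3 by auto
    show "set_valued_measurable T (\<lambda>t. V t \<mu>)" if "\<mu> \<in> Pp p" for \<mu>
      using closed(3)[OF _ that, of 0] assms(2) by simp
  qed (use assms m(1) l(1) L(1) closed(1,2) N1(2) N2(2) N3(2) in \<open>blast+\<close>)
  then show ?thesis by (rule that)
qed

context CI_field
begin

lemma m_nonneg: "t \<in> {0..T} \<Longrightarrow> 0 \<le> m t" and l_nonneg: "t \<in> {0..T} \<Longrightarrow> 0 \<le> l t"
  and L_nonneg: "t \<in> {0..T} \<Longrightarrow> 0 \<le> L t"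
  using m l L by (auto simp: L1_nonneg_def)

text \<open>The support function of \<open>V t \<nu>\<close>, set to 0 at the exceptional times, where it may be infinite.\<close>

definition \<sigma> :: "('a \<times> 'a) list \<Rightarrow> 'a measure \<Rightarrow> real \<Rightarrow> real" where
  "\<sigma> xs \<nu> t = (if t \<in> {0..T} - N then SUP w\<in>V t \<nu>. ell xs w else 0)"

lemma ell_bound:
  assumes "t \<in> {0..T} - N" "\<nu> \<in> Pp p" "w \<in> V t \<nu>"
  shows "\<bar>ell xs w\<bar> \<le> (\<Sum>(x, c)\<leftarrow>xs. norm c * (1 + norm x)) * (m t * (1 + moment p \<nu>))"
proof (rule ell_growth)
  have m0: "0 \<le> m t" using m_nonneg assms by auto
  then show "0 \<le> m t * (1 + moment p \<nu>)" using moment_nonneg[of p \<nu>] by simp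
  fix x
  have "norm (w x) \<le> m t * (1 + norm x + moment p \<nu>)" by (rule V_growth[OF assms])
  also have "\<dots> \<le> m t * ((1 + moment p \<nu>) * (1 + norm x))"
    using m0 moment_nonneg[of p \<nu>] by (intro mult_left_mono) (auto simp: algebra_simps)
  finally show "norm (w x) \<le> m t * (1 + moment p \<nu>) * (1 + norm x)" by (simp add: mult.assoc)
qed

lemma \<sigma>_bdd:
  assumes "t \<in> {0..T} - N" "\<nu> \<in> Pp p"
  shows "bdd_above (ell xs ` V t \<nu>)"
  using ell_bound[OF assms] by (intro bdd_aboveI2) (blast intro: order_trans[OF abs_ge_self])

lemma \<sigma>_upper:
  assumes "t \<in> {0..T} - N" "\<nu> \<in> Pp p" "w \<in> V t \<nu>"
  shows "ell xs w \<le> \<sigma> xs \<nu> t"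
  unfolding \<sigma>_def using assms cSUP_upper[OF assms(3) \<sigma>_bdd[OF assms(1,2)]] by simp

lemma \<sigma>_least:
  assumes "t \<in> {0..T} - N" "\<nu> \<in> Pp p" "\<And>w. w \<in> V t \<nu> \<Longrightarrow> ell xs w \<le> K"
  shows "\<sigma> xs \<nu> t \<le> K"
  unfolding \<sigma>_def using assms V_nonempty[of t \<nu>] by (auto intro!: cSUP_least)

text \<open>A supremum exceeds \<open>a\<close> exactly when \<open>V t \<nu>\<close> meets the open set where the functional
  exceeds \<open>a\<close>, which is the measurability of the set-valued map.\<close>

lemma \<sigma>_measurable:
  assumes "\<nu> \<in> Pp p"
  shows "\<sigma> xs \<nu> \<in> borel_measurable lebesgue"
proof (rule borel_measurableI_greater)
  fix a
  have Ns: "N \<in> sets lebesgue" using N by auto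
  let ?S = "{t \<in> {0..T}. V t \<nu> \<inter> {w \<in> C0. a < ell xs w} \<noteq> {}}"
  have S: "?S \<in> sets lebesgue"
    using V_measurable[OF assms] openin_cc_ell unfolding set_valued_measurable_def by blast
  have "{t \<in> space lebesgue. a < \<sigma> xs \<nu> t} = (?S - N) \<union> (if a < 0 then - ({0..T} - N) else {})"
  proof -
    have 1: "a < \<sigma> xs \<nu> t \<longleftrightarrow> t \<in> ?S" if t: "t \<in> {0..T} - N" for t
    proof -
      have t': "t \<in> {0..T}" using t by simp
      have "\<sigma> xs \<nu> t = (SUP w\<in>V t \<nu>. ell xs w)" using t by (simp only: \<sigma>_def if_True)
      then have "a < \<sigma> xs \<nu> t \<longleftrightarrow> (\<exists>w\<in>V t \<nu>. a < ell xs w)"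
        using less_cSUP_iff[OF V_nonempty[OF t' assms] \<sigma>_bdd[OF t assms]] by simp
      then show ?thesis using V_C0[OF t' assms] t' by blast
    qed
    have 2: "\<sigma> xs \<nu> t = 0" if "t \<notin> {0..T} - N" for t using that by (simp only: \<sigma>_def if_False)
    show ?thesis
    proof (rule set_eqI)
      fix t
      show "t \<in> {t \<in> space lebesgue. a < \<sigma> xs \<nu> t} \<longleftrightarrow> t \<in> (?S - N) \<union> (if a < 0 then - ({0..T} - N) else {})"
      proof (cases "t \<in> {0..T} - N")
        case True
        then show ?thesis using 1[OF True] by auto
      next
        case False
        then have "t \<notin> ?S - N" by blast
        then show ?thesis using 2[OF False] False by auto
      qed
    qed
  qed
  moreover have "- ({0..T} - N) \<in> sets lebesgue" using Ns by auto
  ultimately show "{t \<in> space lebesgue. a < \<sigma> xs \<nu> t} \<in> sets lebesgue" using S Ns by auto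
qed

lemma \<sigma>_integrable:
  assumes "\<nu> \<in> Pp p"
  shows "set_integrable lebesgue {0..T} (\<sigma> xs \<nu>)"
proof -
  let ?K = "(\<Sum>(x, c)\<leftarrow>xs. norm c * (1 + norm x)) * (1 + moment p \<nu>)"
  have "integrable lebesgue (\<lambda>t. ?K * (indicator {0..T} t *\<^sub>R m t))"
    using m unfolding L1_nonneg_def set_integrable_def by (intro integrable_mult_right) auto
  then show ?thesis
    unfolding set_integrable_def
  proof (rule Bochner_Integration.integrable_bound)
    show "(\<lambda>t. indicator {0..T} t *\<^sub>R \<sigma> xs \<nu> t) \<in> borel_measurable lebesgue"
      by (intro borel_measurable_scaleR \<sigma>_measurable[OF assms] borel_measurable_indicator) auto
    have "\<bar>\<sigma> xs \<nu> t\<bar> \<le> ?K * m t" if t: "t \<in> {0..T}" for t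
    proof (cases "t \<in> N")
      case True
      have "0 \<le> (\<Sum>(x, c)\<leftarrow>xs. norm c * (1 + norm (x::'a)))" by (intro sum_list_nonneg) auto
      then show ?thesis using True m_nonneg[OF t] moment_nonneg[of p \<nu>] by (simp add: \<sigma>_def)
    next
      case False
      then have t': "t \<in> {0..T} - N" using t by simp
      have b: "\<bar>ell xs w\<bar> \<le> ?K * m t" if "w \<in> V t \<nu>" for w
        using ell_bound[OF t' assms that, of xs] by (simp add: mult_ac)
      obtain w where w: "w \<in> V t \<nu>" using V_nonempty[OF t assms] by blast
      have "\<sigma> xs \<nu> t \<le> ?K * m t" using b by (intro \<sigma>_least[OF t' assms]) (blast intro: order_trans[OF abs_ge_self])
      moreover have "- (?K * m t) \<le> \<sigma> xs \<nu> t" using \<sigma>_upper[OF t' assms w, of xs] b[OF w] by linarith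
      ultimately show ?thesis by linarith
    qed
    then show "AE t in lebesgue. norm (indicator {0..T} t *\<^sub>R \<sigma> xs \<nu> t) \<le> norm (?K * (indicator {0..T} t *\<^sub>R m t))"
      by (intro AE_I2) (auto simp: indicator_def intro: order_trans[OF _ abs_ge_self])
  qed
qed

lemma \<sigma>_stable:
  assumes t: "t \<in> {0..T} - N" and \<mu>: "\<mu> \<in> Pp p" and \<nu>: "\<nu> \<in> Pp p" and W: "Wasserstein p \<mu> \<nu> \<le> ennreal B" "0 \<le> B"
  shows "\<sigma> xs \<mu> t \<le> \<sigma> xs \<nu> t + ell_mass xs * (L t * B)"
proof (rule \<sigma>_least[OF t \<mu>])
  fix w assume "w \<in> V t \<mu>"
  then obtain w' where w': "w' \<in> V t \<nu>" "d_sup w w' \<le> ennreal (L t) * Wasserstein p \<mu> \<nu>"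
    using V_stable[OF t \<mu> \<nu>] by blast
  have "\<bar>ell xs w - ell xs w'\<bar> \<le> ell_mass xs * (L t * B)"
    using L_nonneg t by (intro ell_diff_le d_supD[OF w'(2) W]) auto
  then show "ell xs w \<le> \<sigma> xs \<nu> t + ell_mass xs * (L t * B)"
    using \<sigma>_upper[OF t \<nu> w'(1), of xs] by linarith
qed

text \<open>The support functions are made good for countably many measures and functionals only. For an
  arbitrary measure the second property gives a good measure nearby, and
  \<open>\<sigma>_stable\<close> compares the support functions of the two.\<close>

lemma good_times:
  assumes Q: "countable Q"
  obtains \<T> where "\<T> \<subseteq> {0<..<T} - N" "{0<..<T} - \<T> \<in> null_sets lebesgue"
    "\<And>\<tau>. \<tau> \<in> \<T> \<Longrightarrow> upper_Lebesgue_point T m \<tau> \<and> upper_Lebesgue_point T l \<tau> \<and> upper_Lebesgue_point T L \<tau>"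
    "\<And>\<tau> xs \<mu> \<eta>. \<lbrakk>\<tau> \<in> \<T>; xs \<in> lists (Q \<times> Q); \<mu> \<in> Pp p; 0 < \<eta>\<rbrakk> \<Longrightarrow>
       \<exists>\<nu>\<in>Pp p. Wasserstein p \<mu> \<nu> \<le> ennreal \<eta> \<and> upper_Lebesgue_point T (\<sigma> xs \<nu>) \<tau>"
proof -
  obtain D :: "'a measure set" where D: "countable D" "D \<subseteq> Pp p"
    "\<And>\<mu> \<delta>. \<mu> \<in> Pp p \<Longrightarrow> 0 < \<delta> \<Longrightarrow> \<exists>\<nu>\<in>D. Wasserstein p \<mu> \<nu> \<le> ennreal \<delta>"
    using Pp_separable[OF p] by metis
  define P where "P \<tau> \<longleftrightarrow> upper_Lebesgue_point T m \<tau> \<and> upper_Lebesgue_point T l \<tau> \<and> upper_Lebesgue_point T L \<tau> \<and>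
     (\<forall>\<nu>\<in>D. \<forall>xs\<in>lists (Q \<times> Q). upper_Lebesgue_point T (\<sigma> xs \<nu>) \<tau>)" for \<tau>
  define \<T> where "\<T> = {\<tau> \<in> {0<..<T} - N. P \<tau>}"
  have "AE \<tau> in lebesgue. \<forall>\<nu>\<in>D. \<forall>xs\<in>lists (Q \<times> Q). \<tau> \<in> {0<..<T} \<longrightarrow> upper_Lebesgue_point T (\<sigma> xs \<nu>) \<tau>"
    using D Q by (intro AE_ball_countable[THEN iffD2] ballI AE_upper_Lebesgue_point \<sigma>_integrable
        countable_lists countable_SIGMA) auto
  moreover have "AE \<tau> in lebesgue. \<tau> \<in> {0<..<T} \<longrightarrow> upper_Lebesgue_point T f \<tau>" if "L1_nonneg T f" for f
    using that by (intro AE_upper_Lebesgue_point) (simp add: L1_nonneg_def)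
  note this[OF m] this[OF l] this[OF L]
  moreover have "AE \<tau> in lebesgue. \<tau> \<notin> N" using N by (rule AE_not_in)
  ultimately have "AE \<tau> in lebesgue. \<not> (\<tau> \<in> {0<..<T} - \<T>)"
    by eventually_elim (auto simp: \<T>_def P_def)
  then have "(AE \<tau> in lebesgue. \<tau> \<notin> {0<..<T} - \<T>) \<and> {0<..<T} - \<T> \<subseteq> space lebesgue"
    by (intro conjI) (assumption, simp)
  then have "{0<..<T} - \<T> \<in> null_sets lebesgue"
    by (rule completion.null_sets_iff_AE[of "{0<..<T} - \<T>" lborel, THEN iffD2])
  then show ?thesis
  proof (rule that[rotated])
    show "\<exists>\<nu>\<in>Pp p. Wasserstein p \<mu> \<nu> \<le> ennreal \<eta> \<and> upper_Lebesgue_point T (\<sigma> xs \<nu>) \<tau>"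
      if as: "\<tau> \<in> \<T>" "xs \<in> lists (Q \<times> Q)" "\<mu> \<in> Pp p" "0 < \<eta>" for \<tau> xs \<mu> \<eta>
    proof -
      obtain \<nu> where \<nu>: "\<nu> \<in> D" "Wasserstein p \<mu> \<nu> \<le> ennreal \<eta>" using D(3)[OF as(3,4)] by blast
      have "P \<tau>" using as(1) by (simp add: \<T>_def)
      then have "upper_Lebesgue_point T (\<sigma> xs \<nu>) \<tau>" using \<nu>(1) as(2) unfolding P_def by blast
      then show ?thesis using \<nu> D(2) by blast
    qed
  qed (auto simp: \<T>_def P_def)
qed

text \<open>Three replacements bound the functional along the selection by the support function at \<open>(\<tau>, \<mu> \<tau>)\<close>:
  \<open>\<mu> t\<close> by \<open>\<mu> \<tau>\<close>, by continuity of the curve; \<open>\<mu> \<tau>\<close> by a good measure \<open>\<nu>\<close>; and, after averaging,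
  \<open>\<nu>\<close> by \<open>\<mu> \<tau>\<close> again. Each costs at most \<open>\<eta>\<close> times \<open>L\<close>, whose averages are bounded by
  \<open>L \<tau> + 1\<close>, which explains the choice of \<open>\<eta>\<close>.\<close>

lemma average_ell_le:
  assumes \<tau>: "\<tau> \<in> {0<..<T} - N" and \<nu>: "\<mu> \<tau> \<in> Pp p" and \<mu>: "\<And>t. t \<in> {0..T} \<Longrightarrow> \<mu> t \<in> Pp p"
    and cont: "\<And>\<omega>. 0 < \<omega> \<Longrightarrow> \<exists>d>0. \<forall>t\<in>{0..T}. \<bar>t - \<tau>\<bar> < d \<longrightarrow> Wasserstein p (\<mu> t) (\<mu> \<tau>) \<le> ennreal \<omega>"
    and L\<tau>: "upper_Lebesgue_point T L \<tau>"
    and dense: "\<And>\<eta>. 0 < \<eta> \<Longrightarrow> \<exists>\<nu>\<in>Pp p. Wasserstein p (\<mu> \<tau>) \<nu> \<le> ennreal \<eta> \<and> upper_Lebesgue_point T (\<sigma> xs \<nu>) \<tau>"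
    and u: "AE t in lebesgue. t \<in> {0..T} \<longrightarrow> u t \<in> V t (\<mu> t)" and ui: "set_integrable lebesgue {0..T} (\<lambda>t. ell xs (u t))"
    and \<delta>: "0 < \<delta>"
  obtains d where "0 < d" "\<And>a b. a \<le> \<tau> \<Longrightarrow> \<tau> \<le> b \<Longrightarrow> b - a < d \<Longrightarrow>
     (LINT t:{a..b}|lebesgue. ell xs (u t)) \<le> (\<sigma> xs (\<mu> \<tau>) \<tau> + \<delta>) * (b - a)"
proof -
  define c where "c = ell_mass xs"
  have c: "0 \<le> c" by (simp add: c_def ell_mass_nonneg)
  have \<tau>': "\<tau> \<in> {0..T} - N" "\<tau> \<in> {0..T}" using \<tau> by auto
  have L0: "0 \<le> L \<tau>" using L_nonneg \<tau>' by blast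
  define \<eta> where "\<eta> = \<delta> / 4 / (c + 1) / (L \<tau> + 1)"
  have \<eta>: "0 < \<eta>" using \<delta> c L0 by (simp add: \<eta>_def)
  have c\<eta>: "c * (\<eta> * (L \<tau> + 1)) \<le> \<delta> / 4"
  proof -
    have "\<eta> * (L \<tau> + 1) = \<delta> / 4 / (c + 1)" using L0 by (simp add: \<eta>_def)
    moreover have "c * (\<delta> / 4 / (c + 1)) \<le> (c + 1) * (\<delta> / 4 / (c + 1))"
      using \<delta> c by (intro mult_right_mono) auto
    moreover have "(c + 1) * (\<delta> / 4 / (c + 1)) = \<delta> / 4"
      using c nonzero_mult_div_cancel_left[of "c + 1" "\<delta> / 4"] by (simp only: times_divide_eq_right)
    ultimately show ?thesis by (simp only:)
  qed
  obtain \<nu> where \<nu>: "\<nu> \<in> Pp p" "Wasserstein p (\<mu> \<tau>) \<nu> \<le> ennreal \<eta>" "upper_Lebesgue_point T (\<sigma> xs \<nu>) \<tau>"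
    using dense[OF \<eta>] by blast
  obtain d1 where d1: "0 < d1" "\<And>t. t \<in> {0..T} \<Longrightarrow> \<bar>t - \<tau>\<bar> < d1 \<Longrightarrow> Wasserstein p (\<mu> t) (\<mu> \<tau>) \<le> ennreal \<eta>"
    using cont[OF \<eta>] by blast
  obtain d2 where d2: "0 < d2" "\<And>a b. a \<le> \<tau> \<Longrightarrow> \<tau> \<le> b \<Longrightarrow> b - a < d2 \<Longrightarrow>
     0 \<le> a \<and> b \<le> T \<and> (LINT t:{a..b}|lebesgue. L t) \<le> (L \<tau> + 1) * (b - a)"
    using upper_Lebesgue_pointD[OF L\<tau>, of 1] by auto
  obtain d3 where d3: "0 < d3" "\<And>a b. a \<le> \<tau> \<Longrightarrow> \<tau> \<le> b \<Longrightarrow> b - a < d3 \<Longrightarrow>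
     0 \<le> a \<and> b \<le> T \<and> (LINT t:{a..b}|lebesgue. \<sigma> xs \<nu> t) \<le> (\<sigma> xs \<nu> \<tau> + \<delta> / 4) * (b - a)"
    using upper_Lebesgue_pointD[OF \<nu>(3), of "\<delta> / 4"] \<delta> by auto
  show ?thesis
  proof (rule that[of "min d1 (min d2 d3)"])
    show "0 < min d1 (min d2 d3)" using d1 d2 d3 by simp
    fix a b assume ab: "a \<le> \<tau>" "\<tau> \<le> b" "b - a < min d1 (min d2 d3)"
    have ab': "0 \<le> a" "b \<le> T" "{a..b} \<subseteq> {0..T}" using d2(2)[of a b] ab by auto
    have sub: "set_integrable lebesgue {a..b} f" if "set_integrable lebesgue {0..T} f" for f :: "real \<Rightarrow> real"
      by (rule set_integrable_subset[OF that _ ab'(3)]) simp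
    have iL: "set_integrable lebesgue {a..b} L" using sub L by (simp add: L1_nonneg_def)
    have i\<sigma>: "set_integrable lebesgue {a..b} (\<sigma> xs \<nu>)" by (rule sub[OF \<sigma>_integrable[OF \<nu>(1)]])
    have i2: "set_integrable lebesgue {a..b} (\<lambda>t. (2 * c * \<eta>) * L t)" using iL by (rule set_integrable_mult_right)
    have "(LINT t:{a..b}|lebesgue. ell xs (u t)) \<le> (LINT t:{a..b}|lebesgue. \<sigma> xs \<nu> t + (2 * c * \<eta>) * L t)"
    proof (rule set_integral_mono_AE[OF sub[OF ui] set_integral_add(1)[OF i\<sigma> i2]])
      have "AE t in lebesgue. t \<notin> N" using N by (rule AE_not_in)
      then show "AE t \<in> {a..b} in lebesgue. ell xs (u t) \<le> \<sigma> xs \<nu> t + (2 * c * \<eta>) * L t"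
        using u
      proof eventually_elim
        case (elim t)
        show ?case
        proof
          assume "t \<in> {a..b}"
          then have t: "t \<in> {0..T}" "t \<in> {0..T} - N" "\<bar>t - \<tau>\<bar> < d1" using ab ab' elim by auto
          have "ell xs (u t) \<le> \<sigma> xs (\<mu> t) t" using \<sigma>_upper[OF t(2) \<mu>[OF t(1)]] elim t by blast
          also have "\<dots> \<le> \<sigma> xs (\<mu> \<tau>) t + ell_mass xs * (L t * \<eta>)"
            by (rule \<sigma>_stable[OF t(2) \<mu>[OF t(1)] assms(2) d1(2)[OF t(1,3)]]) (use \<eta> in simp)
          also have "\<sigma> xs (\<mu> \<tau>) t \<le> \<sigma> xs \<nu> t + ell_mass xs * (L t * \<eta>)"
            by (rule \<sigma>_stable[OF t(2) assms(2) \<nu>(1,2)]) (use \<eta> in simp)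
          finally show "ell xs (u t) \<le> \<sigma> xs \<nu> t + (2 * c * \<eta>) * L t" by (simp add: c_def algebra_simps)
        qed
      qed
    qed
    also have "\<dots> = (LINT t:{a..b}|lebesgue. \<sigma> xs \<nu> t) + (2 * c * \<eta>) * (LINT t:{a..b}|lebesgue. L t)"
      using set_integral_add(2)[OF i\<sigma> i2] by simp
    also have "\<dots> \<le> (\<sigma> xs \<nu> \<tau> + \<delta> / 4) * (b - a) + (2 * c * \<eta>) * ((L \<tau> + 1) * (b - a))"
      using d2(2)[of a b] d3(2)[of a b] ab c \<eta> by (intro add_mono mult_left_mono) auto
    also have "\<dots> = (\<sigma> xs \<nu> \<tau> + \<delta> / 4 + 2 * (c * (\<eta> * (L \<tau> + 1)))) * (b - a)" by (simp add: algebra_simps)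
    also have "\<dots> \<le> (\<sigma> xs (\<mu> \<tau>) \<tau> + \<delta>) * (b - a)"
    proof (rule mult_right_mono)
      have "\<sigma> xs \<nu> \<tau> \<le> \<sigma> xs (\<mu> \<tau>) \<tau> + ell_mass xs * (L \<tau> * \<eta>)"
        using order_trans[OF Wasserstein_commute_le[OF p] \<nu>(2)] \<eta> by (intro \<sigma>_stable[OF \<tau>'(1) \<nu>(1) assms(2)]) auto
      moreover have "ell_mass xs * (L \<tau> * \<eta>) \<le> c * (\<eta> * (L \<tau> + 1))"
        using c \<eta> by (simp add: c_def[symmetric] mult.commute mult_left_mono)
      ultimately show "\<sigma> xs \<nu> \<tau> + \<delta> / 4 + 2 * (c * (\<eta> * (L \<tau> + 1))) \<le> \<sigma> xs (\<mu> \<tau>) \<tau> + \<delta>"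
        using c\<eta> \<delta> by linarith
    qed (use ab in simp)
    finally show "(LINT t:{a..b}|lebesgue. ell xs (u t)) \<le> (\<sigma> xs (\<mu> \<tau>) \<tau> + \<delta>) * (b - a)" .
  qed
qed

end

lemma finite_bounded_subsequence:
  fixes f :: "nat \<Rightarrow> 'b \<Rightarrow> 'a::euclidean_space"
  assumes "finite Y" "\<And>y. y \<in> Y \<Longrightarrow> bounded (range (\<lambda>k. f k y))"
  shows "\<exists>r a. strict_mono (r :: nat \<Rightarrow> nat) \<and> (\<forall>y\<in>Y. (\<lambda>k. f (r k) y) \<longlonglongrightarrow> a y)"
  using assms
proof (induction Y rule: finite_induct)
  case empty
  show ?case by (intro exI[of _ id]) (auto simp: strict_mono_def)
next
  case (insert z Y)
  then obtain r a where r: "strict_mono r" "\<forall>y\<in>Y. (\<lambda>k. f (r k) y) \<longlonglongrightarrow> a y" by auto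
  have "bounded (range (\<lambda>k. f (r k) z))"
    by (rule bounded_subset[OF insert.prems[of z]]) auto
  then obtain b r' where r': "strict_mono r'" "((\<lambda>k. f (r k) z) \<circ> r') \<longlonglongrightarrow> b"
    using bounded_imp_convergent_subsequence by metis
  show ?case
  proof (intro exI[of _ "r \<circ> r'"] exI[of _ "a(z := b)"] conjI ballI)
    show "strict_mono (r \<circ> r')" using r(1) r'(1) by (rule strict_mono_o)
    fix y assume "y \<in> insert z Y"
    then show "(\<lambda>k. f ((r \<circ> r') k) y) \<longlonglongrightarrow> (a(z := b)) y"
      using r'(2) LIMSEQ_subseq_LIMSEQ[OF _ r'(1), of "\<lambda>k. f (r k) y"] r(2) insert.hyps(2)
      by (auto simp: o_def)
  qed
qed

section \<open>Solutions of the inclusion and averages of their velocity\<close>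

text \<open>The selection \<open>v\<close> is only almost everywhere in \<open>V\<close>. Its modification \<open>u\<close>, obtained by setting it to zero at
  exceptional times and outside \<open>[0,T]\<close>, is controlled at all times, while \<open>v\<close> is kept because the equation is stated for it.
  The bound \<open>M\<close> for the moments turns the growth condition into one that is independent of the measure.\<close>

locale CI_solution = CI_field p T V N m l L
  for p T and V :: "real \<Rightarrow> ('a::euclidean_space) measure \<Rightarrow> ('a \<Rightarrow> 'a) set" and N m l L +
  fixes \<mu> :: "real \<Rightarrow> 'a measure" and g :: "real \<Rightarrow> real" and u v :: "real \<Rightarrow> 'a \<Rightarrow> 'a" and M :: real
  assumes \<mu>_Pp: "t \<in> {0..T} \<Longrightarrow> \<mu> t \<in> Pp p"
    and g: "L1_nonneg T g"
    and \<mu>_AC: "\<lbrakk>0 \<le> s; s \<le> t; t \<le> T\<rbrakk> \<Longrightarrow> Wasserstein p (\<mu> s) (\<mu> t) \<le> ennreal (LINT r:{s..t}|lebesgue. g r)"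
    and M: "0 \<le> M"
    and u_measurable: "(\<lambda>t. u t x) \<in> borel_measurable lebesgue"
    and u_selection: "AE t in lebesgue. t \<in> {0..T} \<longrightarrow> u t \<in> V t (\<mu> t)"
    and u_growth: "norm (u t x) \<le> (if t \<in> {0..T} then m t * (1 + M) else 0) * (1 + norm x)"
    and u_lipschitz: "(if t \<in> {0..T} then l t else 0)-lipschitz_on UNIV (u t)"
    and moment_le: "t \<in> {0..T} \<Longrightarrow> moment p (\<mu> t) \<le> M"
    and equation: "solves_continuity_equation T \<mu> v" "AE t in lebesgue_on {0..T}. v t = u t"

lemma (in CI_field) CI_solutionI:
  assumes "solves_continuity_inclusion p T V \<mu>"
  obtains g u v M where "CI_solution p T V N m l L \<mu> g u v M"
proof -
  from assms obtain g where \<mu>: "\<And>t. t \<in> {0..T} \<Longrightarrow> \<mu> t \<in> Pp p" and g: "L1_nonneg T g"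
    and AC: "\<And>s t. 0 \<le> s \<Longrightarrow> s \<le> t \<Longrightarrow> t \<le> T \<Longrightarrow> Wasserstein p (\<mu> s) (\<mu> t) \<le> ennreal (LINT r:{s..t}|lebesgue. g r)"
    unfolding solves_continuity_inclusion_def AC_curve_def by blast
  from assms obtain v where vm: "v \<in> lebesgue_on {0..T} \<rightarrow>\<^sub>M sigma C0 {U. openin cc_topology U}"
    and vs: "AE t in lebesgue_on {0..T}. v t \<in> V t (\<mu> t)" and eq: "solves_continuity_equation T \<mu> v"
    unfolding solves_continuity_inclusion_def by blast
  define B where "B = (LINT r:{0..T}|lebesgue. g r)"
  have gi: "g absolutely_integrable_on {0..T}" using g by (simp add: L1_nonneg_def)
  have B0: "0 \<le> B" unfolding B_def set_lebesgue_integral_def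
    using g by (intro integral_nonneg_AE AE_I2) (auto simp: L1_nonneg_def indicator_def)
  define M where "M = (2 powr p * ((B + 1) powr p + (LINT x|\<mu> 0. norm x powr p))) powr (1 / p)"
  have Mle: "moment p (\<mu> t) \<le> M" if t: "t \<in> {0..T}" for t
  proof -
    have "(LINT r:{0..t}|lebesgue. g r) \<le> B"
    proof -
      have "set_integrable lebesgue {0..t} g" by (rule set_integrable_subset[OF gi]) (use t in auto)
      then show ?thesis unfolding B_def set_lebesgue_integral_def using gi g t
        by (intro integral_mono) (auto simp: set_integrable_def L1_nonneg_def indicator_def)
    qed
    then have "Wasserstein p (\<mu> 0) (\<mu> t) \<le> ennreal B"
      using AC[of 0 t] t by (auto intro: order_trans ennreal_leI)
    then show ?thesis unfolding M_def
      using t T by (intro Wasserstein_moment_bound[OF p \<mu> \<mu> _ B0]) auto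
  qed
  have M: "0 \<le> M" by (simp add: M_def)
  have "AE t in lebesgue. t \<in> {0..T} \<longrightarrow> v t \<in> V t (\<mu> t)"
    using vs by (subst (asm) AE_restrict_space_iff) auto
  then obtain N' where N': "N' \<in> null_sets lebesgue" "{t \<in> space lebesgue. \<not> (t \<in> {0..T} \<longrightarrow> v t \<in> V t (\<mu> t))} \<subseteq> N'"
    by (auto simp: eventually_ae_filter)
  define S where "S = {0..T} - (N \<union> N')"
  have S: "S \<in> sets lebesgue" unfolding S_def using null_setsD2[OF N] null_setsD2[OF N'(1)] by (intro sets.Diff sets.Un) auto
  have SV: "t \<in> {0..T} - N" "v t \<in> V t (\<mu> t)" if "t \<in> S" for t using that N'(2) by (auto simp: S_def)
  define u where "u t = (if t \<in> S then v t else (\<lambda>_. 0))" for t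
  have notin: "AE t in lebesgue. t \<notin> N \<union> N'" using N N'(1) by (intro AE_not_in null_sets.Un)
  have "CI_solution p T V N m l L \<mu> g u v M"
  proof
    show "(\<lambda>t. u t x) \<in> borel_measurable lebesgue" for x
    proof -
      have "(\<lambda>t. v t x) \<in> borel_measurable (lebesgue_on {0..T})" by (rule measurable_eval(1)[OF vm])
      then have "(\<lambda>t. indicator {0..T} t *\<^sub>R v t x) \<in> borel_measurable lebesgue"
        by (subst (asm) borel_measurable_restrict_space_iff) auto
      then have "(\<lambda>t. indicator S t *\<^sub>R (indicator {0..T} t *\<^sub>R v t x)) \<in> borel_measurable lebesgue"
        by (rule borel_measurable_scaleR[OF borel_measurable_indicator[OF S]])
      moreover have "(\<lambda>t. indicator S t *\<^sub>R (indicator {0..T} t *\<^sub>R v t x)) = (\<lambda>t. u t x)"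
        by (auto simp: u_def indicator_def S_def)
      ultimately show ?thesis by simp
    qed
    show "AE t in lebesgue. t \<in> {0..T} \<longrightarrow> u t \<in> V t (\<mu> t)"
      using notin
    proof eventually_elim
      case (elim t)
      show ?case
      proof
        assume "t \<in> {0..T}"
        then have "t \<in> S" using elim by (simp add: S_def)
        then show "u t \<in> V t (\<mu> t)" using SV(2) by (simp add: u_def)
      qed
    qed
    show "AE t in lebesgue_on {0..T}. v t = u t"
    proof (subst AE_restrict_space_iff)
      show "AE t in lebesgue. t \<in> {0..T} \<longrightarrow> v t = u t"
        using notin by eventually_elim (simp add: u_def S_def)
    qed simp
    show "norm (u t x) \<le> (if t \<in> {0..T} then m t * (1 + M) else 0) * (1 + norm x)" for t x
    proof (cases "t \<in> S")
      case True
      note t = SV[OF True]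
      have tT: "t \<in> {0..T}" using t by simp
      have "norm (v t x) \<le> m t * (1 + norm x + moment p (\<mu> t))" by (rule V_growth[OF t(1) \<mu>[OF tT] t(2)])
      also have "\<dots> \<le> m t * ((1 + M) * (1 + norm x))"
        using Mle[OF tT] mult_nonneg_nonneg[OF M norm_ge_zero, of x] m_nonneg[OF tT]
        by (intro mult_left_mono) (simp_all add: algebra_simps)
      finally show ?thesis using True tT by (simp add: u_def mult.assoc)
    next
      case False
      then show ?thesis using m_nonneg[of t] M by (auto simp: u_def)
    qed
    show "(if t \<in> {0..T} then l t else 0)-lipschitz_on UNIV (u t)" for t
    proof (cases "t \<in> S")
      case True
      note t = SV[OF True]
      have tT: "t \<in> {0..T}" using t by simp
      show ?thesis using V_lipschitz[OF t(1) \<mu>[OF tT] t(2)] True tT by (simp add: u_def)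
    next
      case False
      then show ?thesis using l_nonneg[of t] by (auto simp: u_def intro!: lipschitz_onI)
    qed
  qed (use \<mu> g AC M Mle eq in auto)
  then show ?thesis by (rule that)
qed

context CI_solution
begin

definition m0 :: "real \<Rightarrow> real" where "m0 t = (if t \<in> {0..T} then m t * (1 + M) else 0)"
definition l0 :: "real \<Rightarrow> real" where "l0 t = (if t \<in> {0..T} then l t else 0)"
definition g0 :: "real \<Rightarrow> real" where "g0 t = (if t \<in> {0..T} then g t else 0)"

lemma nonneg0: "0 \<le> m0 t" "0 \<le> l0 t" "0 \<le> g0 t"
  using m_nonneg l_nonneg g M by (auto simp: m0_def l0_def g0_def L1_nonneg_def)

lemma abs_integrable_extend:
  assumes "f absolutely_integrable_on {0..T}"
  shows "(\<lambda>t. if t \<in> {0..T} then f t else 0) absolutely_integrable_on {a..b}"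
proof -
  have "integrable lebesgue (\<lambda>t. indicator {0..T} t *\<^sub>R f t)" using assms by (simp add: set_integrable_def)
  then have "integrable lebesgue (\<lambda>t. indicator {a..b} t *\<^sub>R (indicator {0..T} t *\<^sub>R f t))"
    by (rule integrable_mult_indicator[rotated]) simp
  moreover have "(\<lambda>t. indicator {0..T} t *\<^sub>R f t) = (\<lambda>t. if t \<in> {0..T} then f t else 0)"
    by (auto simp: indicator_def)
  ultimately show ?thesis unfolding set_integrable_def by metis
qed

lemma abs_integrable0: "m0 absolutely_integrable_on {a..b}" "l0 absolutely_integrable_on {a..b}" "g0 absolutely_integrable_on {a..b}"
  unfolding m0_def[abs_def] l0_def[abs_def] g0_def[abs_def]
  using m l g by (intro abs_integrable_extend set_integrable_mult_left; simp add: L1_nonneg_def)+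

lemma integrable0: "m0 integrable_on {a..b}" "l0 integrable_on {a..b}" "g0 integrable_on {a..b}"
  using abs_integrable0 set_lebesgue_integral_eq_integral(1) by blast+

lemma integral0_eq:
  assumes "0 \<le> a" "b \<le> T"
  shows "integral {a..b} m0 = (LINT t:{a..b}|lebesgue. m t) * (1 + M)" "integral {a..b} l0 = (LINT t:{a..b}|lebesgue. l t)"
    "integral {a..b} g0 = (LINT t:{a..b}|lebesgue. g t)"
proof -
  have *: "(LINT t:{a..b}|lebesgue. (if t \<in> {0..T} then f t else 0)) = (LINT t:{a..b}|lebesgue. f t)" for f :: "real \<Rightarrow> real"
    using assms by (intro set_lebesgue_integral_cong) auto
  show "integral {a..b} m0 = (LINT t:{a..b}|lebesgue. m t) * (1 + M)"
    using * set_lebesgue_integral_eq_integral(2)[OF abs_integrable0(1), of a b] by (simp add: m0_def[abs_def])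
  show "integral {a..b} l0 = (LINT t:{a..b}|lebesgue. l t)"
    using * set_lebesgue_integral_eq_integral(2)[OF abs_integrable0(2), of a b] by (simp add: l0_def[abs_def])
  show "integral {a..b} g0 = (LINT t:{a..b}|lebesgue. g t)"
    using * set_lebesgue_integral_eq_integral(2)[OF abs_integrable0(3), of a b] by (simp add: g0_def[abs_def])
qed

lemma u_growth0: "norm (u t x) \<le> m0 t * (1 + norm x)"
  using u_growth[of t x] by (simp add: m0_def)

lemma u_lipschitz0: "(l0 t)-lipschitz_on UNIV (u t)"
  using u_lipschitz[of t] by (simp add: l0_def)

lemma u_diff0: "norm (u t x - u t y) \<le> l0 t * norm (x - y)"
  using lipschitz_onD[OF u_lipschitz0, of x y t] by (simp add: dist_norm)

lemma u_integrable: "(\<lambda>t. u t x) integrable_on {a..b}" "(\<lambda>t. u t x) absolutely_integrable_on {a..b}"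
  by (rule integral_dominated[OF u_measurable integrable0(1) u_growth0])+

lemma Wasserstein_close:
  assumes "t \<in> {0..T}" "s \<in> {0..T}"
  shows "Wasserstein p (\<mu> t) (\<mu> s) \<le> ennreal \<bar>integral {0..t} g0 - integral {0..s} g0\<bar>"
proof -
  have comb: "integral {a..b} g0 = integral {0..b} g0 - integral {0..a} g0" if "0 \<le> a" "a \<le> b" for a b
    using Henstock_Kurzweil_Integration.integral_combine[OF that integrable0(3)] by simp
  have W: "Wasserstein p (\<mu> a) (\<mu> b) \<le> ennreal \<bar>integral {0..b} g0 - integral {0..a} g0\<bar>"
    if "a \<in> {0..T}" "b \<in> {0..T}" "a \<le> b" for a b
  proof -
    have "Wasserstein p (\<mu> a) (\<mu> b) \<le> ennreal (integral {0..b} g0 - integral {0..a} g0)"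
      using \<mu>_AC[of a b] that integral0_eq(3)[of a b] comb[of a b] by simp
    then show ?thesis by (rule order_trans) (simp add: ennreal_leI)
  qed
  show ?thesis
  proof (cases "t \<le> s")
    case True
    then show ?thesis using W[of t s] assms by (simp add: abs_minus_commute)
  next
    case False
    then have "Wasserstein p (\<mu> s) (\<mu> t) \<le> ennreal \<bar>integral {0..t} g0 - integral {0..s} g0\<bar>"
      using W[of s t] assms by simp
    then show ?thesis by (rule order_trans[OF Wasserstein_commute_le[OF p]])
  qed
qed

lemma Wasserstein_continuous:
  assumes \<tau>: "\<tau> \<in> {0..T}" and \<omega>: "0 < \<omega>"
  shows "\<exists>d>0. \<forall>t\<in>{0..T}. \<bar>t - \<tau>\<bar> < d \<longrightarrow> Wasserstein p (\<mu> t) (\<mu> \<tau>) \<le> ennreal \<omega>"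
proof -
  have "continuous_on {0..T} (\<lambda>t. integral {0..t} g0)"
    by (rule indefinite_integral_continuous_1[OF integrable0(3)])
  then obtain d where d: "0 < d" "\<And>t. t \<in> {0..T} \<Longrightarrow> dist t \<tau> < d \<Longrightarrow> dist (integral {0..t} g0) (integral {0..\<tau>} g0) < \<omega>"
    using \<tau> \<omega> unfolding continuous_on_iff by metis
  have "Wasserstein p (\<mu> t) (\<mu> \<tau>) \<le> ennreal \<omega>" if t: "t \<in> {0..T}" "\<bar>t - \<tau>\<bar> < d" for t
    using d(2)[OF t(1)] t(2)
    by (intro order_trans[OF Wasserstein_close[OF t(1) \<tau>]] ennreal_leI) (simp add: dist_real_def)
  then show ?thesis using d(1) by blast
qed

text \<open>Along a subsequence the averages converge on a finite net \<open>Y\<close>, and their limit \<open>z\<close> is close to an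
  element \<open>w\<close> of \<open>V \<tau> (\<mu> \<tau>)\<close> there, since \<open>average_ell_le\<close> verifies the hypothesis of
  \<open>convex_fields_separation\<close>. The common Lipschitz constant \<open>c\<close> extends this to the ball.\<close>

lemma averages_accumulate:
  fixes a b :: "nat \<Rightarrow> real"
  assumes \<tau>: "\<tau> \<in> {0<..<T} - N"
    and Leb: "upper_Lebesgue_point T m \<tau>" "upper_Lebesgue_point T l \<tau>" "upper_Lebesgue_point T L \<tau>"
    and dense: "\<And>xs \<eta>. xs \<in> lists (Q \<times> Q) \<Longrightarrow> 0 < \<eta> \<Longrightarrow>
       \<exists>\<nu>\<in>Pp p. Wasserstein p (\<mu> \<tau>) \<nu> \<le> ennreal \<eta> \<and> upper_Lebesgue_point T (\<sigma> xs \<nu>) \<tau>"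
    and Q: "\<And>x e. 0 < e \<Longrightarrow> \<exists>d\<in>Q. dist x d < e"
    and ab: "\<And>k. a k \<le> \<tau>" "\<And>k. \<tau> \<le> b k" "\<And>k. a k < b k" "(\<lambda>k. b k - a k) \<longlonglongrightarrow> 0" and \<delta>: "0 < \<delta>"
  shows "\<exists>w\<in>V \<tau> (\<mu> \<tau>). \<exists>r::nat \<Rightarrow> nat. strict_mono r \<and> (\<forall>k x. norm x \<le> R \<longrightarrow>
     norm ((1 / (b (r k) - a (r k))) *\<^sub>R integral {a (r k)..b (r k)} (\<lambda>t. u t x) - w x) \<le> \<delta>)"
proof -
  have \<tau>': "\<tau> \<in> {0..T}" "\<tau> \<in> {0..T} - N" using \<tau> by auto
  note \<mu>\<tau> = \<mu>_Pp[OF \<tau>'(1)]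
  define avg where "avg k x = (1 / (b k - a k)) *\<^sub>R integral {a k..b k} (\<lambda>t. u t x)" for k x
  define B where "B = (m \<tau> + 1) * (1 + M)"
  have B: "0 \<le> B" using m_nonneg[OF \<tau>'(1)] M by (simp add: B_def)
  define c where "c = l \<tau> + 1"
  have c: "1 \<le> c" using l_nonneg[OF \<tau>'(1)] by (simp add: c_def)
  obtain dm where dm: "0 < dm" "\<And>a b. a \<le> \<tau> \<Longrightarrow> \<tau> \<le> b \<Longrightarrow> b - a < dm \<Longrightarrow>
     0 \<le> a \<and> b \<le> T \<and> (LINT t:{a..b}|lebesgue. m t) \<le> (m \<tau> + 1) * (b - a)"
    using upper_Lebesgue_pointD[OF Leb(1), of 1] by auto
  obtain dl where dl: "0 < dl" "\<And>a b. a \<le> \<tau> \<Longrightarrow> \<tau> \<le> b \<Longrightarrow> b - a < dl \<Longrightarrow>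
     0 \<le> a \<and> b \<le> T \<and> (LINT t:{a..b}|lebesgue. l t) \<le> (l \<tau> + 1) * (b - a)"
    using upper_Lebesgue_pointD[OF Leb(2), of 1] by auto
  have small: "\<forall>\<^sub>F k in sequentially. b k - a k < d" if "0 < d" for d
    using ab(4) that by (rule order_tendstoD(2))
  obtain K0 where K0: "\<And>k. K0 \<le> k \<Longrightarrow> b k - a k < min dm dl"
    using small[of "min dm dl"] dm(1) dl(1) by (auto simp: eventually_sequentially)
  have avg_growth: "norm (avg k x) \<le> B * (1 + norm x)" if "K0 \<le> k" for k x
  proof -
    have h: "0 < b k - a k" using ab(3)[of k] by simp
    have "norm (integral {a k..b k} (\<lambda>t. u t x)) \<le> integral {a k..b k} m0 * (1 + norm x)"
      by (rule integral_dominated(3)[OF u_measurable integrable0(1) u_growth0])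
    also have "integral {a k..b k} m0 \<le> ((m \<tau> + 1) * (b k - a k)) * (1 + M)"
      using dm(2)[OF ab(1,2)[of k]] K0[OF that] M by (subst integral0_eq(1)) (auto intro!: mult_right_mono)
    finally have "norm (integral {a k..b k} (\<lambda>t. u t x)) \<le> (B * (1 + norm x)) * (b k - a k)"
      by (simp add: B_def mult_ac mult_right_mono)
    then show ?thesis using h by (simp add: avg_def divide_le_eq)
  qed
  have avg_lip: "norm (avg k x - avg k y) \<le> c * norm (x - y)" if "K0 \<le> k" for k x y
  proof -
    have h: "0 < b k - a k" using ab(3)[of k] by simp
    have "norm (integral {a k..b k} (\<lambda>t. u t x - u t y)) \<le> integral {a k..b k} l0 * norm (x - y)"
      by (rule integral_dominated(3)[OF borel_measurable_diff[OF u_measurable u_measurable] integrable0(2) u_diff0])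
    also have "integral {a k..b k} l0 \<le> c * (b k - a k)"
      using dl(2)[OF ab(1,2)[of k]] K0[OF that] by (subst integral0_eq(2)) (auto simp: c_def)
    finally have "norm (integral {a k..b k} (\<lambda>t. u t x) - integral {a k..b k} (\<lambda>t. u t y)) \<le> (c * norm (x - y)) * (b k - a k)"
      by (simp add: Henstock_Kurzweil_Integration.integral_diff[OF u_integrable(1) u_integrable(1)] mult_ac mult_right_mono)
    then show ?thesis using h by (simp add: avg_def scaleR_diff_right[symmetric] divide_le_eq)
  qed
  \<comment> \<open>mesh of the net: two Lipschitz errors \<open>c * \<delta>1\<close> and two errors \<open>\<delta>1\<close> on the net\<close>
  define \<delta>1 where "\<delta>1 = \<delta> / (2 * c + 2)"
  have \<delta>1: "0 < \<delta>1" using \<delta> c by (simp add: \<delta>1_def)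
  \<comment> \<open>a finite net of the ball\<close>
  have "cball 0 R \<subseteq> (\<Union>y\<in>Q. ball y \<delta>1)"
  proof
    fix x :: 'a
    obtain y where "y \<in> Q" "dist x y < \<delta>1" using Q[OF \<delta>1] by blast
    then show "x \<in> (\<Union>y\<in>Q. ball y \<delta>1)" by (auto simp: dist_commute)
  qed
  then obtain Y where Y: "Y \<subseteq> Q" "finite Y" "cball 0 R \<subseteq> (\<Union>y\<in>Y. ball y \<delta>1)"
    using compactE_image[OF compact_cball, of Q "\<lambda>y. ball y \<delta>1" 0 R] by auto
  have "bounded (range (\<lambda>k. avg (k + K0) y))" for y
    unfolding bounded_iff using avg_growth by (intro exI[of _ "B * (1 + norm y)"]) auto
  then obtain r1 z where r1: "strict_mono (r1 :: nat \<Rightarrow> nat)" "\<And>y. y \<in> Y \<Longrightarrow> (\<lambda>k. avg (r1 k + K0) y) \<longlonglongrightarrow> z y"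
    using finite_bounded_subsequence[OF Y(2), of "\<lambda>k. avg (k + K0)"] by auto
  define r2 where "r2 k = r1 k + K0" for k
  have r2: "strict_mono r2" "\<And>k. K0 \<le> r2 k" using r1(1) by (auto simp: r2_def strict_mono_def)
  have small2: "\<forall>\<^sub>F k in sequentially. b (r2 k) - a (r2 k) < d" if "0 < d" for d
    using eventually_compose_filterlim[OF small[OF that] filterlim_subseq[OF r2(1)]] .
  have sup: "(\<Sum>y\<in>Y. cf y \<bullet> z y) \<le> (SUP w\<in>V \<tau> (\<mu> \<tau>). \<Sum>y\<in>Y. cf y \<bullet> w y)" if cf: "\<And>y. cf y \<in> Q" for cf
  proof -
    obtain ys where ys: "set ys = Y" "distinct ys" using finite_distinct_list[OF Y(2)] by blast
    define xs where "xs = map (\<lambda>y. (y, cf y)) ys"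
    have xs: "xs \<in> lists (Q \<times> Q)" using cf Y(1) ys(1) by (auto simp: xs_def)
    have ell: "ell xs w = (\<Sum>y\<in>Y. cf y \<bullet> w y)" for w
      using ys by (simp add: ell_def xs_def o_def sum_list_distinct_conv_sum_set)
    have i: "(\<lambda>t. ell xs (u t)) absolutely_integrable_on {a'..b'}" for a' b'
    proof -
      have "(\<lambda>t. cf y \<bullet> u t y) absolutely_integrable_on {a'..b'}" for y
      proof (rule integral_dominated(1)[OF _ integrable0(1), of _ _ _ "norm (cf y) * (1 + norm y)"])
        show "(\<lambda>t. cf y \<bullet> u t y) \<in> borel_measurable lebesgue"
          by (intro borel_measurable_inner u_measurable) auto
        fix t
        have "norm (cf y \<bullet> u t y) \<le> norm (cf y) * norm (u t y)" using Cauchy_Schwarz_ineq2 by simp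
        also have "\<dots> \<le> norm (cf y) * (m0 t * (1 + norm y))" by (intro mult_left_mono u_growth0) auto
        finally show "norm (cf y \<bullet> u t y) \<le> m0 t * (norm (cf y) * (1 + norm y))" by (simp add: mult_ac)
      qed
      then show ?thesis unfolding ell using Y(2) by (intro absolutely_integrable_sum) auto
    qed
    have le: "(\<Sum>y\<in>Y. cf y \<bullet> z y) \<le> \<sigma> xs (\<mu> \<tau>) \<tau>"
    proof (rule field_le_epsilon)
      fix e :: real assume e: "0 < e"
      obtain d where d: "0 < d" "\<And>a b. a \<le> \<tau> \<Longrightarrow> \<tau> \<le> b \<Longrightarrow> b - a < d \<Longrightarrow>
         (LINT t:{a..b}|lebesgue. ell xs (u t)) \<le> (\<sigma> xs (\<mu> \<tau>) \<tau> + e) * (b - a)"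
        using average_ell_le[where \<mu> = \<mu> and u = u and xs = xs, OF \<tau> \<mu>\<tau> \<mu>_Pp Wasserstein_continuous[OF \<tau>'(1)] Leb(3) dense[OF xs] u_selection i e]
        by blast
      have "(\<lambda>k. \<Sum>y\<in>Y. cf y \<bullet> avg (r2 k) y) \<longlonglongrightarrow> (\<Sum>y\<in>Y. cf y \<bullet> z y)"
        using r1(2) by (intro tendsto_intros) (auto simp: r2_def)
      moreover have "\<forall>\<^sub>F k in sequentially. (\<Sum>y\<in>Y. cf y \<bullet> avg (r2 k) y) \<le> \<sigma> xs (\<mu> \<tau>) \<tau> + e"
        using small2[OF d(1)]
      proof eventually_elim
        case (elim k)
        let ?a = "a (r2 k)" and ?b = "b (r2 k)"
        have h: "0 < ?b - ?a" using ab(3)[of "r2 k"] by simp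
        have "(LINT t:{?a..?b}|lebesgue. ell xs (u t)) = integral {?a..?b} (\<lambda>t. \<Sum>y\<in>Y. cf y \<bullet> u t y)"
          using set_lebesgue_integral_eq_integral(2)[OF i] by (simp add: ell)
        also have "\<dots> = (\<Sum>y\<in>Y. integral {?a..?b} (\<lambda>t. cf y \<bullet> u t y))"
          using u_integrable(1) Y(2)
          by (intro Henstock_Kurzweil_Integration.integral_sum)
            (auto intro!: integrable_linear[OF _ bounded_linear_inner_right, unfolded o_def])
        also have "\<dots> = (\<Sum>y\<in>Y. cf y \<bullet> integral {?a..?b} (\<lambda>t. u t y))"
          using integral_linear[OF u_integrable(1) bounded_linear_inner_right] by (simp add: o_def)
        also have "\<dots> = (\<Sum>y\<in>Y. cf y \<bullet> avg (r2 k) y) * (?b - ?a)"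
          using h by (simp add: avg_def sum_distrib_right)
        finally have "(\<Sum>y\<in>Y. cf y \<bullet> avg (r2 k) y) * (?b - ?a) \<le> (\<sigma> xs (\<mu> \<tau>) \<tau> + e) * (?b - ?a)"
          using d(2)[OF ab(1,2)[of "r2 k"] elim] by simp
        then show ?case using h by (rule mult_right_le_imp_le)
      qed
      ultimately show "(\<Sum>y\<in>Y. cf y \<bullet> z y) \<le> \<sigma> xs (\<mu> \<tau>) \<tau> + e"
        by (rule tendsto_upperbound) simp
    qed
    have "\<sigma> xs (\<mu> \<tau>) \<tau> = (SUP w\<in>V \<tau> (\<mu> \<tau>). ell xs w)" using \<tau>'(2) by (simp only: \<sigma>_def if_True)
    then show ?thesis using le by (simp only: ell)
  qed
  have wb: "norm (w x) \<le> B * (1 + norm x)" if "w \<in> V \<tau> (\<mu> \<tau>)" for w x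
  proof -
    have "norm (w x) \<le> m \<tau> * (1 + norm x + moment p (\<mu> \<tau>))" by (rule V_growth[OF \<tau>'(2) \<mu>\<tau> that])
    also have "\<dots> \<le> m \<tau> * ((1 + M) * (1 + norm x))"
      using moment_le[OF \<tau>'(1)] mult_nonneg_nonneg[OF M norm_ge_zero, of x] m_nonneg[OF \<tau>'(1)]
      by (intro mult_left_mono) (simp_all add: algebra_simps)
    also have "\<dots> \<le> (m \<tau> + 1) * ((1 + M) * (1 + norm x))" using M by (intro mult_right_mono) auto
    finally show ?thesis by (simp add: B_def mult.assoc)
  qed
  have wb': "norm (w y) \<le> B * (1 + (\<Sum>y\<in>Y. norm y))" if "w \<in> V \<tau> (\<mu> \<tau>)" "y \<in> Y" for w y
  proof -
    have "norm y \<le> (\<Sum>y\<in>Y. norm y)" using that(2) Y(2) by (intro member_le_sum) auto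
    then have "B * (1 + norm y) \<le> B * (1 + (\<Sum>y\<in>Y. norm y))" using B by (intro mult_left_mono) auto
    then show ?thesis using wb[OF that(1), of y] by simp
  qed
  have "\<exists>w\<in>V \<tau> (\<mu> \<tau>). \<forall>y\<in>Y. norm (w y - z y) \<le> \<delta>1"
  proof (rule convex_fields_separation[where F = "V \<tau> (\<mu> \<tau>)" and Y = Y and B = "B * (1 + (\<Sum>y\<in>Y. norm y))" and D = Q])
    show "norm (w y) \<le> B * (1 + (\<Sum>y\<in>Y. norm y))" if "w \<in> V \<tau> (\<mu> \<tau>)" "y \<in> Y" for w y by (rule wb'[OF that])
    show "\<exists>d\<in>Q. dist x d < e" if "0 < e" for x e by (rule Q[OF that])
    show "(\<Sum>y\<in>Y. cf y \<bullet> z y) \<le> (SUP w\<in>V \<tau> (\<mu> \<tau>). \<Sum>y\<in>Y. cf y \<bullet> w y)" if "\<And>y. cf y \<in> Q" for cf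
      by (rule sup[OF that])
  qed (fact V_nonempty[OF \<tau>'(1) \<mu>\<tau>] V_convex[OF \<tau>'(1) \<mu>\<tau>] Y(2) \<delta>1)+
  then obtain w where w: "w \<in> V \<tau> (\<mu> \<tau>)" "\<And>y. y \<in> Y \<Longrightarrow> norm (w y - z y) \<le> \<delta>1"
    by blast
  have "\<forall>\<^sub>F k in sequentially. \<forall>y\<in>Y. norm (avg (r2 k) y - z y) < \<delta>1"
    using r1(2) \<delta>1 by (intro eventually_ball_finite Y(2)) (auto simp: r2_def dist_norm tendsto_iff)
  then obtain K1 where K1: "\<And>k y. K1 \<le> k \<Longrightarrow> y \<in> Y \<Longrightarrow> norm (avg (r2 k) y - z y) < \<delta>1"
    by (auto simp: eventually_sequentially)
  have wl: "norm (w x - w y) \<le> c * norm (x - y)" for x y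
    using lipschitz_onD[OF V_lipschitz[OF \<tau>'(2) \<mu>\<tau> w(1)], of x y]
    by (simp add: dist_norm c_def distrib_right add_increasing2)
  have "norm (avg (r2 (k + K1)) x - w x) \<le> \<delta>" if x: "norm x \<le> R" for k x
  proof -
    have "x \<in> cball 0 R" using x by simp
    then obtain y where y: "y \<in> Y" "dist y x < \<delta>1" using Y(3) by auto
    let ?k = "r2 (k + K1)"
    have xy: "c * norm (x - y) \<le> c * \<delta>1"
      using y(2) c by (intro mult_left_mono) (auto simp: dist_norm norm_minus_commute)
    have 1: "norm (avg ?k x - avg ?k y) \<le> c * \<delta>1"
      using avg_lip[OF r2(2), of "k + K1" x y] xy by linarith
    have 2: "norm (w x - w y) \<le> c * \<delta>1"
      using wl[of x y] xy by linarith
    have "norm (avg ?k x - w x) \<le> norm (avg ?k x - avg ?k y) + norm (avg ?k y - z y) + norm (w y - z y) + norm (w x - w y)"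
      using norm_triangle_ineq[of "avg ?k x - avg ?k y" "avg ?k y - z y"]
        norm_triangle_ineq4[of "avg ?k x - avg ?k y + (avg ?k y - z y)" "w y - z y"]
        norm_triangle_ineq4[of "avg ?k x - avg ?k y + (avg ?k y - z y) - (w y - z y)" "w x - w y"]
      by (simp add: algebra_simps)
    also have "\<dots> \<le> c * \<delta>1 + \<delta>1 + \<delta>1 + c * \<delta>1"
      using 1 2 K1[of "k + K1" y] w(2)[OF y(1)] y(1) by (intro add_mono) (auto intro: less_imp_le)
    also have "\<dots> = (2 * c + 2) * \<delta>1" by (simp add: algebra_simps)
    also have "\<dots> = \<delta>" using c by (simp add: \<delta>1_def)
    finally show ?thesis .
  qed
  moreover have "strict_mono (\<lambda>k. r2 (k + K1))" using r2(1) by (auto simp: strict_mono_def)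
  ultimately show ?thesis using w(1) unfolding avg_def by (intro bexI[of _ w] exI[of _ "\<lambda>k. r2 (k + K1)"]) auto
qed

end

section \<open>The flow of a solution in a time direction\<close>

lemma has_integral_time_change:
  fixes f :: "real \<Rightarrow> 'b::euclidean_space"
  assumes f: "(f has_integral i) {min (\<tau> + s * r1) (\<tau> + s * r2)..max (\<tau> + s * r1) (\<tau> + s * r2)}"
    and s: "s = 1 \<or> s = -1" and r: "r1 \<le> r2"
  shows "((\<lambda>r. f (\<tau> + s * r)) has_integral i) {r1..r2}"
proof -
  have s0: "s \<noteq> 0" "\<bar>s\<bar> = 1" using s by auto
  let ?a = "min (\<tau> + s * r1) (\<tau> + s * r2)" and ?b = "max (\<tau> + s * r1) (\<tau> + s * r2)"
  have "((\<lambda>x. f (s *\<^sub>R x + \<tau>)) has_integral (1 / (\<bar>s\<bar> ^ DIM(real))) *\<^sub>R i)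
      ((\<lambda>x. (1 / s) *\<^sub>R x + - ((1 / s) *\<^sub>R \<tau>)) ` cbox ?a ?b)"
    by (rule has_integral_affinity) (use f s0 in \<open>simp_all add: cbox_interval\<close>)
  moreover have "(\<lambda>x. (1 / s) *\<^sub>R x + - ((1 / s) *\<^sub>R \<tau>)) ` cbox ?a ?b = {r1..r2}"
  proof -
    have "(\<lambda>x. (1 / s) *\<^sub>R x + - ((1 / s) *\<^sub>R \<tau>)) ` cbox ?a ?b = (\<lambda>x. s * (x - \<tau>)) ` {?a..?b}"
      using s by (auto simp: cbox_interval right_diff_distrib)
    also have "\<dots> = {r1..r2}"
    proof (rule set_eqI)
      fix y
      have "y \<in> (\<lambda>x. s * (x - \<tau>)) ` {?a..?b} \<longleftrightarrow> \<tau> + s * y \<in> {?a..?b}"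
        using s by (auto simp: image_iff intro!: bexI[of _ "\<tau> + s * y"])
      also have "\<dots> \<longleftrightarrow> y \<in> {r1..r2}" using s r by auto
      finally show "y \<in> (\<lambda>x. s * (x - \<tau>)) ` {?a..?b} \<longleftrightarrow> y \<in> {r1..r2}" .
    qed
    finally show ?thesis .
  qed
  ultimately show ?thesis using s0 by (simp add: add.commute)
qed

text \<open>The coupling \<open>(f, g)\<close> with an error that consists of a small linear part, a small constant, and a part of
  moderate size outside a large ball. The factor 9 is \<open>3 * 3\<close>: one 3 for the \<open>p\<close>-th power of a sum
  of three terms, one for adding three equal contributions.\<close>

lemma Wasserstein_maps_close:
  fixes \<mu> :: "'a::euclidean_space measure" and f g :: "'a \<Rightarrow> 'a"
  assumes p: "1 \<le> p" and \<mu>: "\<mu> \<in> Pp p" and m: "f \<in> borel_measurable borel" "g \<in> borel_measurable borel"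
    and bd: "\<And>x. norm (f x - g x) \<le> h * (e1 * (1 + norm x) + e2 + (if norm x \<le> R then 0 else e3 * (1 + norm x)))"
    and h: "0 \<le> h" and e: "0 \<le> e1" "0 \<le> e2" "0 \<le> e3" "0 < \<epsilon>"
    and b1: "e1 powr p * (LINT x|\<mu>. (1 + norm x) powr p) \<le> (\<epsilon> / 9) powr p"
    and b2: "e2 \<le> \<epsilon> / 9"
    and b3: "e3 powr p * (LINT x|\<mu>. indicator {x. R < norm x} x * (1 + norm x) powr p) \<le> (\<epsilon> / 9) powr p"
  shows "Wasserstein p (distr \<mu> borel f) (distr \<mu> borel g) \<le> ennreal (\<epsilon> * h)"
proof (rule Wasserstein_distr_le[OF p])
  note P = PpD[OF \<mu> p]
  interpret prob_space \<mu> by (rule P(1))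
  show fm: "f \<in> \<mu> \<rightarrow>\<^sub>M borel" and gm: "g \<in> \<mu> \<rightarrow>\<^sub>M borel"
    using m by (simp_all add: measurable_cong_sets[OF P(2) refl])
  show "0 \<le> \<epsilon> * h" using e h by simp
  have nm: "(\<lambda>x. norm x) \<in> borel_measurable \<mu>" by (simp add: measurable_cong_sets[OF P(2) refl])
  have J: "integrable \<mu> (\<lambda>x. (1 + norm x) powr p)"
  proof (rule Bochner_Integration.integrable_bound)
    show "integrable \<mu> (\<lambda>x. 2 powr p * (1 powr p + norm x powr p))" using P(4) by simp
    show "(\<lambda>x. (1 + norm x) powr p) \<in> borel_measurable \<mu>" using nm by simp
    have "(1 + norm x) powr p \<le> 2 powr p * (1 powr p + norm x powr p)" for x :: 'a
      using p by (intro powr_sum_le) auto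
    then show "AE x in \<mu>. norm ((1 + norm x) powr p) \<le> norm (2 powr p * (1 powr p + norm x powr p))"
      by (intro AE_I2) (auto intro: order_trans[OF _ abs_ge_self])
  qed
  have Rm: "{x. R < norm x} \<in> sets \<mu>" unfolding P(2) by measurable
  have JR: "integrable \<mu> (\<lambda>x. indicator {x. R < norm x} x * (1 + norm x) powr p)"
    using integrable_mult_indicator[OF Rm J] by simp
  let ?F = "\<lambda>x. h powr p * (3 powr p * (e1 powr p * (1 + norm x) powr p + (\<epsilon> / 9) powr p
      + e3 powr p * (indicator {x. R < norm x} x * (1 + norm x) powr p)))"
  have iF: "integrable \<mu> ?F" using J JR by simp
  have pw: "dist (f x) (g x) powr p \<le> ?F x" for x
  proof -
    define c where "c = (if norm x \<le> R then 0 else e3 * (1 + norm x))"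
    have c: "0 \<le> c" using e by (simp add: c_def)
    let ?b = "e1 * (1 + norm x)"
    have b: "0 \<le> ?b" using e by simp
    have "dist (f x) (g x) \<le> h * (3 * max ?b (max e2 c))"
    proof -
      have "dist (f x) (g x) \<le> h * (?b + e2 + c)" using bd[of x] by (simp add: dist_norm c_def)
      also have "\<dots> \<le> h * (3 * max ?b (max e2 c))" using h by (intro mult_left_mono) (auto simp: max_def)
      finally show ?thesis .
    qed
    then have "dist (f x) (g x) powr p \<le> (h * (3 * max ?b (max e2 c))) powr p" using p by (intro powr_mono2) auto
    also have "\<dots> = h powr p * (3 powr p * (max ?b (max e2 c)) powr p)"
      using h b by (simp add: powr_mult)
    also have "\<dots> \<le> ?F x"
    proof (intro mult_left_mono)
      have e2p: "e2 powr p \<le> (\<epsilon> / 9) powr p" using b2 e p by (intro powr_mono2) auto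
      have bp: "?b powr p = e1 powr p * (1 + norm x) powr p" using e by (simp add: powr_mult)
      have cp: "c powr p = e3 powr p * (indicator {x. R < norm x} x * (1 + norm x) powr p)"
        using e p by (auto simp: c_def indicator_def powr_mult)
      have "(max ?b (max e2 c)) powr p \<le> ?b powr p + e2 powr p + c powr p"
        by (auto simp: max_def intro: add_increasing add_increasing2)
      then show "(max ?b (max e2 c)) powr p \<le> e1 powr p * (1 + norm x) powr p + (\<epsilon> / 9) powr p
          + e3 powr p * (indicator {x. R < norm x} x * (1 + norm x) powr p)"
        using e2p unfolding bp cp by linarith
    qed auto
    finally show ?thesis .
  qed
  have F0: "0 \<le> ?F x" for x :: 'a using pw[of x] powr_ge_zero[of "dist (f x) (g x)" p] by linarith
  have "(\<integral>\<^sup>+x. ennreal (dist (f x) (g x) powr p) \<partial>\<mu>) \<le> (\<integral>\<^sup>+x. ennreal (?F x) \<partial>\<mu>)"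
    by (intro nn_integral_mono ennreal_leI pw)
  also have "\<dots> = ennreal (LINT x|\<mu>. ?F x)" using F0 by (intro nn_integral_eq_integral[OF iF]) auto
  also have "(LINT x|\<mu>. ?F x) = h powr p * (3 powr p * (e1 powr p * (LINT x|\<mu>. (1 + norm x) powr p) + (\<epsilon> / 9) powr p
      + e3 powr p * (LINT x|\<mu>. indicator {x. R < norm x} x * (1 + norm x) powr p)))"
    using J JR by (simp add: prob_space)
  also have "\<dots> \<le> h powr p * (3 powr p * (3 * (\<epsilon> / 9) powr p))"
    using b1 b3 by (intro mult_left_mono) auto
  also have "\<dots> \<le> h powr p * (3 powr p * (3 powr p * (\<epsilon> / 9) powr p))"
    using p powr_mono[of 1 p "3 :: real"] by (intro mult_left_mono mult_right_mono) auto
  also have "\<dots> = (\<epsilon> * h) powr p"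
  proof -
    have "\<epsilon> * h = h * (3 * (3 * (\<epsilon> / 9)))" by simp
    then show ?thesis using h e by (simp only: powr_mult)
  qed
  finally show "(\<integral>\<^sup>+x. ennreal (dist (f x) (g x) powr p) \<partial>\<mu>) \<le> ennreal ((\<epsilon> * h) powr p)"
    by (simp add: ennreal_leI)
qed

context CI_solution
begin

text \<open>One control for the growth and Lipschitz constants of the field and for the metric speed of the curve.\<close>

definition G0 :: "real \<Rightarrow> real" where "G0 t = m0 t + l0 t + g0 t"

lemma G0_nonneg: "0 \<le> G0 t"
  using nonneg0[of t] by (simp add: G0_def)

lemma G0_abs_integrable: "G0 absolutely_integrable_on {a..b}"
  unfolding G0_def[abs_def] by (intro set_integral_add(1) abs_integrable0)

lemma G0_integrable: "G0 integrable_on {a..b}"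
  using G0_abs_integrable set_lebesgue_integral_eq_integral(1) by blast

lemma curve_Lipschitz_G0:
  assumes st: "0 \<le> s" "s \<le> t" "t \<le> T" and f: "C-lipschitz_on UNIV f" "\<And>x. Q < norm x \<Longrightarrow> f x = 0"
  shows "\<bar>(LINT x|\<mu> t. f x) - (LINT x|\<mu> s. f x)\<bar> \<le> C * integral {s..t} G0"
proof -
  have tin: "t \<in> {0..T}" "s \<in> {0..T}" using st by auto
  have C: "0 \<le> C" using f(1) lipschitz_on_nonneg by blast
  have fc: "continuous_on UNIV f" using f(1) by (rule lipschitz_on_continuous_on)
  note Ps = PpD[OF \<mu>_Pp[OF tin(2)] p] and Pt = PpD[OF \<mu>_Pp[OF tin(1)] p]
  have "Wasserstein p (\<mu> s) (\<mu> t) \<le> ennreal (integral {s..t} g0)"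
    using \<mu>_AC[OF st] integral0_eq(3)[OF st(1,3)] by simp
  moreover have "0 \<le> integral {s..t} g0" using nonneg0(3) integrable0(3) by (intro integral_nonneg)
  ultimately have "\<bar>(LINT x|\<mu> s. f x) - (LINT x|\<mu> t. f x)\<bar> \<le> C * integral {s..t} g0"
    by (intro Wasserstein_Lipschitz_bound[OF p Ps(1) _ _ f(1)] integrable_vanish_prob[OF fc f(2)] Ps Pt)
  also have "\<dots> \<le> C * integral {s..t} G0"
    using nonneg0 by (intro mult_left_mono C integral_le integrable0 G0_integrable) (auto simp: G0_def)
  finally show ?thesis by (simp add: abs_minus_commute)
qed

text \<open>The solution, read in the direction \<open>s\<close> of time from \<open>\<tau>\<close> on, is a transported curve for the field
  \<open>s * u\<close>. The error estimate follows by comparing the trajectory with its initial point inside the integral: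
  the displacement is bounded by the integral of the growth bound, and the Lipschitz bound integrates this
  once more.\<close>

lemma flow_estimate:
  assumes \<tau>: "\<tau> \<in> {0<..<T}" and s: "s = 1 \<or> s = -1"
  obtains H \<Phi> where "0 < H"
    "\<And>h. h \<in> {0..H} \<Longrightarrow> \<tau> + s * h \<in> {0..T}"
    "\<And>h. h \<in> {0..H} \<Longrightarrow> \<mu> (\<tau> + s * h) = distr (\<mu> \<tau>) borel (\<Phi> h)"
    "\<And>h. h \<in> {0..H} \<Longrightarrow> continuous_on UNIV (\<Phi> h)"
    "\<And>h x. h \<in> {0..H} \<Longrightarrow> norm (\<Phi> h x - x - s *\<^sub>R integral {min \<tau> (\<tau> + s * h)..max \<tau> (\<tau> + s * h)} (\<lambda>t. u t x))
       \<le> integral {min \<tau> (\<tau> + s * h)..max \<tau> (\<tau> + s * h)} l0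
         * (integral {min \<tau> (\<tau> + s * h)..max \<tau> (\<tau> + s * h)} m0 * (2 * (1 + norm x)))"
proof -
  let ?I = "\<lambda>r1 r2. {min (\<tau> + s * r1) (\<tau> + s * r2)..max (\<tau> + s * r1) (\<tau> + s * r2)}"
  have s1: "\<bar>s\<bar> = 1" "s * s = 1" using s by auto
  \<comment> \<open>a time interval on which the total mass of the control is at most one half\<close>
  have "\<exists>H>0. H < \<tau> \<and> \<tau> + H < T \<and> integral {\<tau> - H..\<tau> + H} G0 \<le> 1 / 2"
  proof -
    have "continuous_on {0..T} (\<lambda>t. integral {0..t} G0)" by (rule indefinite_integral_continuous_1[OF G0_integrable])
    then obtain d where d: "0 < d" "\<And>t. t \<in> {0..T} \<Longrightarrow> dist t \<tau> < d \<Longrightarrow> dist (integral {0..t} G0) (integral {0..\<tau>} G0) < 1 / 4"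
      using \<tau> unfolding continuous_on_iff by (metis greaterThanLessThan_iff atLeastAtMost_iff less_imp_le zero_less_divide_1_iff zero_less_numeral)
    define H where "H = Min {d, \<tau>, T - \<tau>} / 2"
    have "0 < Min {d, \<tau>, T - \<tau>}" using d(1) \<tau> by auto
    moreover have "Min {d, \<tau>, T - \<tau>} \<le> d" "Min {d, \<tau>, T - \<tau>} \<le> \<tau>" "Min {d, \<tau>, T - \<tau>} \<le> T - \<tau>" by auto
    ultimately have H: "0 < H" "H < d" "H < \<tau>" "H < T - \<tau>" by (auto simp: H_def)
    have "integral {0..\<tau> - H} G0 + integral {\<tau> - H..\<tau> + H} G0 = integral {0..\<tau> + H} G0"
      using H by (intro Henstock_Kurzweil_Integration.integral_combine G0_integrable) auto
    moreover have "dist (integral {0..\<tau> - H} G0) (integral {0..\<tau>} G0) < 1 / 4"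
      by (rule d(2)) (use H \<tau> in \<open>auto simp: dist_real_def\<close>)
    moreover have "dist (integral {0..\<tau> + H} G0) (integral {0..\<tau>} G0) < 1 / 4"
      by (rule d(2)) (use H \<tau> in \<open>auto simp: dist_real_def\<close>)
    ultimately have "integral {\<tau> - H..\<tau> + H} G0 \<le> 1 / 2" unfolding dist_real_def abs_less_iff by linarith
    then show ?thesis using H by (intro exI[of _ H]) auto
  qed
  then obtain H where H: "0 < H" "H < \<tau>" "\<tau> + H < T" "integral {\<tau> - H..\<tau> + H} G0 \<le> 1 / 2" by blast
  have rT: "\<tau> + s * r \<in> {0<..<T}" if "r \<in> {0..H}" for r using that s H by auto
  have rT': "\<tau> + s * r \<in> {0..T}" if "r \<in> {0..H}" for r using rT[OF that] by auto
  have IT: "?I r1 r2 \<subseteq> {\<tau> - H..\<tau> + H}" if "0 \<le> r1" "r1 \<le> r2" "r2 \<le> H" for r1 r2 using that s by auto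
  have tc: "((\<lambda>r. f (\<tau> + s * r)) has_integral integral (?I r1 r2) f) {r1..r2}"
    if "r1 \<le> r2" "f integrable_on ?I r1 r2" for r1 r2 and f :: "real \<Rightarrow> 'c::euclidean_space"
    using that s by (intro has_integral_time_change) auto
  define u' where "u' r = (if r \<in> {0..H} then (\<lambda>x. s *\<^sub>R u (\<tau> + s * r) x) else (\<lambda>_. 0))" for r
  define G where "G r = (if r \<in> {0..H} then G0 (\<tau> + s * r) else 0)" for r
  have Gint: "integral {r1..r2} G = integral (?I r1 r2) G0" if "0 \<le> r1" "r1 \<le> r2" "r2 \<le> H" for r1 r2
  proof -
    have "integral {r1..r2} G = integral {r1..r2} (\<lambda>r. G0 (\<tau> + s * r))"
      using that by (intro Henstock_Kurzweil_Integration.integral_cong) (auto simp: G_def)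
    then show ?thesis using integral_unique[OF tc[OF that(2) G0_integrable]] by simp
  qed
  have um: "(\<lambda>r. u' r x) \<in> borel_measurable lebesgue" for x
  proof -
    have "(\<lambda>r. u (\<tau> + s * r) x) \<in> borel_measurable lebesgue"
      using measurable_compose[OF lebesgue_affine_measurable[of "\<lambda>_. s" \<tau>] u_measurable[of x]] s1 by simp
    then have "(\<lambda>r. indicator {0..H} r *\<^sub>R (s *\<^sub>R u (\<tau> + s * r) x)) \<in> borel_measurable lebesgue"
      by (intro borel_measurable_scaleR borel_measurable_indicator borel_measurable_const) auto
    moreover have "(\<lambda>r. indicator {0..H} r *\<^sub>R (s *\<^sub>R u (\<tau> + s * r) x)) = (\<lambda>r. u' r x)"
      by (auto simp: u'_def indicator_def)
    ultimately show ?thesis by simp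
  qed
  have Gabs: "(\<lambda>r. G0 (\<tau> + s * r)) absolutely_integrable_on {0..H}"
    using tc[of 0 H G0] H(1) G0_integrable G0_nonneg
    by (intro nonnegative_absolutely_integrable_1) auto
  have Gind: "G = (\<lambda>r. indicator {0..H} r *\<^sub>R G0 (\<tau> + s * r))" by (auto simp: G_def indicator_def)
  interpret C: Caratheodory_field u' G
  proof
    show "integrable lebesgue G" using Gabs unfolding Gind set_integrable_def .
    show "0 \<le> G t" for t using G0_nonneg by (simp add: G_def)
    have "(LINT t|lebesgue. G t) = integral {0..H} (\<lambda>r. G0 (\<tau> + s * r))"
      using set_lebesgue_integral_eq_integral(2)[OF Gabs] unfolding Gind by (simp add: set_lebesgue_integral_def)
    also have "\<dots> = integral (?I 0 H) G0" using integral_unique[OF tc[of 0 H G0]] H(1) G0_integrable by simp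
    also have "\<dots> \<le> integral {\<tau> - H..\<tau> + H} G0"
      using IT[of 0 H] H(1) G0_nonneg by (intro integral_subset_le G0_integrable) auto
    finally show "(LINT t|lebesgue. G t) \<le> 1 / 2" using H(4) by simp
    show "(\<lambda>t. u' t x) \<in> borel_measurable lebesgue" for x by (rule um)
    show "(G t)-lipschitz_on UNIV (u' t)" for t
    proof (cases "t \<in> {0..H}")
      case True
      have "(\<bar>s\<bar> * l0 (\<tau> + s * t))-lipschitz_on UNIV (\<lambda>x. s *\<^sub>R u (\<tau> + s * t) x)"
        by (rule lipschitz_on_cmult[OF u_lipschitz0])
      then show ?thesis using True nonneg0[of "\<tau> + s * t"] s1
        by (auto simp: u'_def G_def G0_def intro: lipschitz_on_le)
    next
      case False
      then show ?thesis by (auto simp: u'_def G_def intro!: lipschitz_onI)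
    qed
    show "norm (u' t x) \<le> G t * (1 + norm x)" for t x
    proof (cases "t \<in> {0..H}")
      case True
      have "norm (u (\<tau> + s * t) x) \<le> m0 (\<tau> + s * t) * (1 + norm x)" by (rule u_growth0)
      also have "\<dots> \<le> G0 (\<tau> + s * t) * (1 + norm x)"
        using nonneg0[of "\<tau> + s * t"] by (intro mult_right_mono) (auto simp: G0_def)
      finally show ?thesis using True s1 by (simp add: u'_def G_def)
    qed (auto simp: u'_def G_def)
  qed
  have AG: "C.mass r1 r2 = integral (?I r1 r2) G0" if "0 \<le> r1" "r1 \<le> r2" "r2 \<le> H" for r1 r2
    using Gint[OF that] by (simp add: C.mass_def)
  have G0lip: "(G0 t)-lipschitz_on UNIV (u t)" for t
    using u_lipschitz0[of t] by (rule lipschitz_on_le) (use nonneg0[of t] in \<open>simp add: G0_def\<close>)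
  have G0gr: "norm (u t x) \<le> G0 t * (1 + norm x)" for t x
    by (rule order_trans[OF u_growth0]) (use nonneg0[of t] in \<open>intro mult_right_mono, auto simp: G0_def\<close>)
  interpret tr: transported_curve u' G "\<lambda>r. \<mu> (\<tau> + s * r)" H
  proof (intro transported_curve.intro transported_curve_axioms.intro)
    show "Caratheodory_field u' G" by (rule C.Caratheodory_field_axioms)
    show "0 \<le> H" using H(1) by simp
    show "prob_space (\<mu> (\<tau> + s * t))" if "t \<in> {0..H}" for t by (rule PpD(1)[OF \<mu>_Pp[OF rT'[OF that]] p])
    show "sets (\<mu> (\<tau> + s * t)) = sets borel" if "t \<in> {0..H}" for t by (rule PpD(2)[OF \<mu>_Pp[OF rT'[OF that]] p])
    show "integrable (\<mu> (\<tau> + s * 0)) norm" using PpD(5)[OF \<mu>_Pp[of \<tau>] p] \<tau> by simp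
    show "\<bar>(LINT x|\<mu> (\<tau> + s * t2). f x) - (LINT x|\<mu> (\<tau> + s * t1). f x)\<bar> \<le> C * C.mass t1 t2"
      if "0 \<le> t1" "t1 \<le> t2" "t2 \<le> H" "C-lipschitz_on UNIV f" "\<And>x. Q < norm x \<Longrightarrow> f x = 0" for t1 t2 C f Q
    proof -
      have tH: "t1 \<in> {0..H}" "t2 \<in> {0..H}" using that by auto
      note t12 = rT'[OF tH(1)] rT'[OF tH(2)]
      note c = curve_Lipschitz_G0[OF _ _ _ that(4), of _ _ Q]
      show ?thesis
      proof (cases "s = 1")
        case True
        then have "?I t1 t2 = {\<tau> + s * t1..\<tau> + s * t2}" using that by auto
        then show ?thesis using c[of "\<tau> + s * t1" "\<tau> + s * t2"] that(5) t12 True that(2) AG[OF that(1-3)] by simp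
      next
        case False
        then have s': "s = -1" using s by simp
        then have "?I t1 t2 = {\<tau> + s * t2..\<tau> + s * t1}" using that by auto
        then show ?thesis using c[of "\<tau> + s * t2" "\<tau> + s * t1"] that(5) t12 s' that(2) AG[OF that(1-3)]
          by (simp add: abs_minus_commute)
      qed
    qed
    show "((\<lambda>r. LINT x|\<mu> (\<tau> + s * r). gradient f x \<bullet> u' r x) has_integral
        (LINT x|\<mu> (\<tau> + s * t2). f x) - (LINT x|\<mu> (\<tau> + s * t1). f x)) {t1..t2}"
      if "0 \<le> t1" "t1 \<le> t2" "t2 \<le> H" "smooth f" "\<And>x. Q < norm x \<Longrightarrow> f x = 0" for t1 t2 f Q
    proof -
      have tH: "t1 \<in> {0..H}" "t2 \<in> {0..H}" using that by auto
      note t12 = rT[OF tH(1)] rT[OF tH(2)]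
      let ?q = "\<lambda>t. LINT x|\<mu> t. gradient f x \<bullet> u t x"
      have w: "(?q has_integral (LINT x|\<mu> b. f x) - (LINT x|\<mu> a. f x)) {a..b}" if ab: "0 < a" "a \<le> b" "b < T" for a b
      proof (rule weak_equation_integrated[OF _ _ G0_abs_integrable G0_nonneg _ _ G0lip G0gr equation \<open>smooth f\<close> _ ab])
        show "prob_space (\<mu> t)" "sets (\<mu> t) = sets borel" if "t \<in> {0..T}" for t
          using PpD[OF \<mu>_Pp[OF that] p] by auto
        show "(\<lambda>t. u t x) \<in> borel_measurable (lebesgue_on {0..T})" for x
          by (rule measurable_restrict_space1[OF u_measurable])
        show "\<bar>(LINT x|\<mu> t. f x) - (LINT x|\<mu> s. f x)\<bar> \<le> C * integral {s..t} G0"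
          if "0 \<le> s" "s \<le> t" "t \<le> T" "C-lipschitz_on UNIV f" "\<And>x. Q < norm x \<Longrightarrow> f x = 0" for s t C f Q
          by (rule curve_Lipschitz_G0[OF that(1-4)]) (rule that(5))
        show "f x = 0" if "Q < norm x" for x by (rule \<open>\<And>x. Q < norm x \<Longrightarrow> f x = 0\<close>[OF that])
      qed
      have *: "((\<lambda>r. s * ?q (\<tau> + s * r)) has_integral (LINT x|\<mu> (\<tau> + s * t2). f x) - (LINT x|\<mu> (\<tau> + s * t1). f x)) {t1..t2}"
      proof (cases "s = 1")
        case True
        then have "?I t1 t2 = {\<tau> + s * t1..\<tau> + s * t2}" using that by auto
        then have "(?q has_integral (LINT x|\<mu> (\<tau> + s * t2). f x) - (LINT x|\<mu> (\<tau> + s * t1). f x)) (?I t1 t2)"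
          using w[of "\<tau> + s * t1" "\<tau> + s * t2"] t12 True that(2) by simp
        from has_integral_time_change[OF this s that(2)] show ?thesis using True by simp
      next
        case False
        then have s': "s = -1" using s by simp
        then have "?I t1 t2 = {\<tau> + s * t2..\<tau> + s * t1}" using that by auto
        then have "(?q has_integral (LINT x|\<mu> (\<tau> + s * t1). f x) - (LINT x|\<mu> (\<tau> + s * t2). f x)) (?I t1 t2)"
          using w[of "\<tau> + s * t2" "\<tau> + s * t1"] t12 s' that(2) by simp
        from has_integral_neg[OF has_integral_time_change[OF this s that(2)]] show ?thesis using s' by simp
      qed
      show ?thesis
      proof (rule has_integral_eq[OF _ *])
        fix r assume "r \<in> {t1..t2}"
        then have "r \<in> {0..H}" using that by auto
        then show "s * ?q (\<tau> + s * r) = (LINT x|\<mu> (\<tau> + s * r). gradient f x \<bullet> u' r x)"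
          by (simp add: u'_def)
      qed
    qed
  qed
  obtain \<Phi> :: "real \<Rightarrow> 'a \<Rightarrow> 'a" where \<Phi>: "\<And>x. continuous_on UNIV (\<lambda>t. \<Phi> t x)"
    "\<And>t x. t \<in> {0..H} \<Longrightarrow> \<Phi> t x = x + integral {0..t} (\<lambda>s. u' s (\<Phi> s x))"
    "\<And>t x. t \<in> {0..H} \<Longrightarrow> 1 + norm (\<Phi> t x) \<le> 2 * (1 + norm x)"
    "\<And>t. t \<in> {0..H} \<Longrightarrow> continuous_on UNIV (\<Phi> t)"
    "\<And>t. t \<in> {0..H} \<Longrightarrow> \<mu> (\<tau> + s * t) = distr (\<mu> (\<tau> + s * 0)) borel (\<Phi> t)"
    by (rule tr.curve_is_flow) (rule that)
  have est: "norm (\<Phi> h x - x - s *\<^sub>R integral (?I 0 h) (\<lambda>t. u t x))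
       \<le> integral (?I 0 h) l0 * (integral (?I 0 h) m0 * (2 * (1 + norm x)))" if h: "h \<in> {0..H}" for h x
  proof -
    define K where "K = 2 * (1 + norm x)"
    have K: "0 \<le> K" by (simp add: K_def)
    note cm = C.u_curve_measurable[OF \<Phi>(1), of x]
    have i: "(\<lambda>r. m0 (\<tau> + s * r)) integrable_on {0..r}" "(\<lambda>r. l0 (\<tau> + s * r)) integrable_on {0..r}" if "0 \<le> r" for r
      using tc[OF that integrable0(1)] tc[OF that integrable0(2)] by blast+
    have mono: "integral {0..r} (\<lambda>r. m0 (\<tau> + s * r)) \<le> integral (?I 0 h) m0" if "0 \<le> r" "r \<le> h" for r
    proof -
      have "integral {0..r} (\<lambda>r. m0 (\<tau> + s * r)) \<le> integral {0..h} (\<lambda>r. m0 (\<tau> + s * r))"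
        using that i nonneg0 by (intro integral_subset_le) auto
      also have "\<dots> = integral (?I 0 h) m0" using h by (intro integral_unique tc integrable0) auto
      finally show ?thesis .
    qed
    have gr: "norm (u' r (\<Phi> r x)) \<le> m0 (\<tau> + s * r) * K" if r: "r \<in> {0..H}" for r
    proof -
      have "norm (u (\<tau> + s * r) (\<Phi> r x)) \<le> m0 (\<tau> + s * r) * (1 + norm (\<Phi> r x))" by (rule u_growth0)
      also have "\<dots> \<le> m0 (\<tau> + s * r) * K"
        unfolding K_def using nonneg0 \<Phi>(3)[OF r] by (intro mult_left_mono)
      finally show ?thesis using r s1 by (simp add: u'_def)
    qed
    have inc: "norm (\<Phi> r x - x) \<le> integral (?I 0 h) m0 * K" if r: "0 \<le> r" "r \<le> h" for r
    proof -
      have rH: "r \<in> {0..H}" using r h by auto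
      have "norm (integral {0..r} (\<lambda>q. u' q (\<Phi> q x))) \<le> integral {0..r} (\<lambda>r. m0 (\<tau> + s * r)) * K"
        by (rule integral_dominated(3)[OF cm i(1)[OF r(1)] gr]) (use rH in auto)
      also have "\<dots> \<le> integral (?I 0 h) m0 * K" by (intro mult_right_mono mono r K)
      finally show ?thesis using \<Phi>(2)[OF rH, of x] by simp
    qed
    have ui: "(\<lambda>r. u' r x) integrable_on {0..h}" by (rule C.bounded_by_G(2)[OF C.u_measurable C.u_growth])
    have ui': "(\<lambda>r. u' r (\<Phi> r x)) integrable_on {0..h}"
      by (rule integral_dominated(2)[OF cm i(1) gr]) (use h in auto)
    have "integral {0..h} (\<lambda>r. u' r x) = integral {0..h} (\<lambda>r. s *\<^sub>R u (\<tau> + s * r) x)"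
      using h by (intro Henstock_Kurzweil_Integration.integral_cong) (auto simp: u'_def)
    also have "\<dots> = s *\<^sub>R integral {0..h} (\<lambda>r. u (\<tau> + s * r) x)" by simp
    also have "integral {0..h} (\<lambda>r. u (\<tau> + s * r) x) = integral (?I 0 h) (\<lambda>t. u t x)"
      using h by (intro integral_unique tc u_integrable) auto
    finally have e: "\<Phi> h x - x - s *\<^sub>R integral (?I 0 h) (\<lambda>t. u t x) = integral {0..h} (\<lambda>r. u' r (\<Phi> r x) - u' r x)"
      using \<Phi>(2)[OF h, of x] Henstock_Kurzweil_Integration.integral_diff[OF ui' ui] by simp
    have "norm (integral {0..h} (\<lambda>r. u' r (\<Phi> r x) - u' r x)) \<le> integral {0..h} (\<lambda>r. l0 (\<tau> + s * r)) * (integral (?I 0 h) m0 * K)"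
    proof (rule integral_dominated(3)[OF borel_measurable_diff[OF cm um] i(2)])
      show "0 \<le> h" using h by simp
      fix r assume r: "r \<in> {0..h}"
      have "norm (u (\<tau> + s * r) (\<Phi> r x) - u (\<tau> + s * r) x) \<le> l0 (\<tau> + s * r) * (integral (?I 0 h) m0 * K)"
        using r by (intro order_trans[OF u_diff0] mult_left_mono inc nonneg0) auto
      then show "norm (u' r (\<Phi> r x) - u' r x) \<le> l0 (\<tau> + s * r) * (integral (?I 0 h) m0 * K)"
        using r h s1 by (simp add: u'_def scaleR_diff_right[symmetric])
    qed
    also have "integral {0..h} (\<lambda>r. l0 (\<tau> + s * r)) = integral (?I 0 h) l0"
      using h by (intro integral_unique tc integrable0) auto
    finally show ?thesis unfolding e K_def .
  qed
  show ?thesis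
  proof (rule that[OF H(1)])
    show "\<tau> + s * h \<in> {0..T}" if "h \<in> {0..H}" for h by (rule rT'[OF that])
    show "\<mu> (\<tau> + s * h) = distr (\<mu> \<tau>) borel (\<Phi> h)" if "h \<in> {0..H}" for h using \<Phi>(5)[OF that] by simp
    show "continuous_on UNIV (\<Phi> h)" if "h \<in> {0..H}" for h by (rule \<Phi>(4)[OF that])
  qed (use est in simp)
qed

end

section \<open>The first-order expansion\<close>

lemma tail_integral_small:
  fixes \<mu> :: "'a::euclidean_space measure"
  assumes p: "1 \<le> p" and \<mu>: "\<mu> \<in> Pp p" and e: "0 < e"
  obtains R where "(LINT x|\<mu>. indicator {x. R < norm x} x * (1 + norm x) powr p) < e"
proof -
  note P = PpD[OF \<mu> p]
  interpret prob_space \<mu> by (rule P(1))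
  have nm[measurable]: "(\<lambda>x. norm x) \<in> borel_measurable \<mu>" by (simp add: measurable_cong_sets[OF P(2) refl])
  have "(\<lambda>n. LINT x|\<mu>. indicator {x. real n < norm x} x * (1 + norm x) powr p) \<longlonglongrightarrow> (LINT x|\<mu>. 0)"
  proof (rule integral_dominated_convergence[where w = "\<lambda>x. 2 powr p * (1 powr p + norm x powr p)"])
    show "(\<lambda>x. indicator {x. real n < norm x} x * (1 + norm x) powr p) \<in> borel_measurable \<mu>" for n
    proof (intro borel_measurable_times borel_measurable_indicator)
      show "{x. real n < norm x} \<in> sets \<mu>" unfolding P(2) by measurable
    qed measurable
    show "AE x in \<mu>. (\<lambda>n. indicator {x. real n < norm x} x * (1 + norm x) powr p) \<longlonglongrightarrow> 0"
    proof (rule AE_I2)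
      fix x :: 'a
      obtain k where k: "norm x < real k" using reals_Archimedean2 by blast
      have "\<forall>\<^sub>F n in sequentially. 0 = indicator {x. real n < norm x} x * (1 + norm x) powr p"
        using eventually_ge_at_top[of k] by eventually_elim (use k in auto)
      then show "(\<lambda>n. indicator {x. real n < norm x} x * (1 + norm x) powr p) \<longlonglongrightarrow> 0"
        by (rule Lim_transform_eventually[OF tendsto_const])
    qed
    have "(1 + norm x) powr p \<le> 2 powr p * (1 powr p + norm x powr p)" for x :: 'a
      using p by (intro powr_sum_le) auto
    then show "AE x in \<mu>. norm (indicator {x. real n < norm x} x * (1 + norm x) powr p)
        \<le> 2 powr p * (1 powr p + norm x powr p)" for n
      by (intro AE_I2) (auto simp: indicator_def)
  qed (use P in auto)
  then have "\<forall>\<^sub>F n in sequentially. (LINT x|\<mu>. indicator {x. real n < norm x} x * (1 + norm x) powr p) < e"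
    using e by (intro order_tendstoD(2)[of _ 0]) auto
  then obtain n where "(LINT x|\<mu>. indicator {x. real n < norm x} x * (1 + norm x) powr p) < e"
    by (auto simp: eventually_sequentially)
  then show ?thesis by (rule that)
qed

text \<open>For a positive step \<open>h\<close>, the flow map differs from \<open>x + s h w x\<close> by \<open>h\<close> times three contributions: the
  quadratic error of the flow, the distance of \<open>w\<close> from the average of \<open>u\<close> on the ball of radius \<open>R\<close>, and
  the linear growth of both outside this ball. The radius is fixed first, since the growth bound \<open>e3\<close> does
  not depend on the step; the field \<open>w\<close> and the subsequence come next, and only finitely
  many steps are discarded to make the first contribution small.\<close>

lemma (in CI_solution) one_sided_expansion:
  fixes h :: "nat \<Rightarrow> real"
  assumes \<tau>: "\<tau> \<in> {0<..<T} - N"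
    and Leb: "upper_Lebesgue_point T m \<tau>" "upper_Lebesgue_point T l \<tau>" "upper_Lebesgue_point T L \<tau>"
    and dense: "\<And>xs \<eta>. xs \<in> lists (Q \<times> Q) \<Longrightarrow> 0 < \<eta> \<Longrightarrow>
       \<exists>\<nu>\<in>Pp p. Wasserstein p (\<mu> \<tau>) \<nu> \<le> ennreal \<eta> \<and> upper_Lebesgue_point T (\<sigma> xs \<nu>) \<tau>"
    and Q: "\<And>x e. 0 < e \<Longrightarrow> \<exists>d\<in>Q. dist x d < e"
    and s: "s = 1 \<or> s = -1" and h: "\<And>k. 0 < h k" "h \<longlonglongrightarrow> 0" and \<epsilon>: "0 < \<epsilon>"
  shows "\<exists>w\<in>V \<tau> (\<mu> \<tau>). \<exists>r::nat \<Rightarrow> nat. strict_mono r \<and>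
      (\<forall>k. \<tau> + s * h (r k) \<in> {0..T} \<and>
        Wasserstein p (\<mu> (\<tau> + s * h (r k))) (distr (\<mu> \<tau>) borel (\<lambda>x. x + (s * h (r k)) *\<^sub>R w x)) \<le> ennreal (\<epsilon> * h (r k)))"
proof -
  have \<tau>': "\<tau> \<in> {0..T}" "\<tau> \<in> {0..T} - N" "\<tau> \<in> {0<..<T}" using \<tau> by auto
  note \<mu>\<tau> = \<mu>_Pp[OF \<tau>'(1)]
  have s1: "\<bar>s\<bar> = 1" "s * s = 1" using s by auto
  let ?a = "\<lambda>h. min \<tau> (\<tau> + s * h)" and ?b = "\<lambda>h. max \<tau> (\<tau> + s * h)"
  obtain H \<Phi> where H: "0 < H"
    and HT: "\<And>h. h \<in> {0..H} \<Longrightarrow> \<tau> + s * h \<in> {0..T}"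
    and \<mu>\<Phi>: "\<And>h. h \<in> {0..H} \<Longrightarrow> \<mu> (\<tau> + s * h) = distr (\<mu> \<tau>) borel (\<Phi> h)"
    and \<Phi>c: "\<And>h. h \<in> {0..H} \<Longrightarrow> continuous_on UNIV (\<Phi> h)"
    and est: "\<And>h x. h \<in> {0..H} \<Longrightarrow> norm (\<Phi> h x - x - s *\<^sub>R integral {?a h..?b h} (\<lambda>t. u t x))
       \<le> integral {?a h..?b h} l0 * (integral {?a h..?b h} m0 * (2 * (1 + norm x)))"
    by (rule flow_estimate[OF \<tau>'(3) s]) (rule that)
  have len: "?b h - ?a h = h" "?a h \<le> \<tau>" "\<tau> \<le> ?b h" if "0 < h" for h using that s by auto
  define B where "B = (m \<tau> + 1) * (1 + M)"
  define c where "c = l \<tau> + 1"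
  have m\<tau>: "0 \<le> m \<tau>" and l\<tau>: "0 \<le> l \<tau>" using m_nonneg l_nonneg \<tau>'(1) by auto
  have B: "0 \<le> B" and c: "0 \<le> c" using m\<tau> l\<tau> M by (auto simp: B_def c_def)
  obtain dm where dm: "0 < dm" "\<And>a b. a \<le> \<tau> \<Longrightarrow> \<tau> \<le> b \<Longrightarrow> b - a < dm \<Longrightarrow>
     0 \<le> a \<and> b \<le> T \<and> (LINT t:{a..b}|lebesgue. m t) \<le> (m \<tau> + 1) * (b - a)"
    using upper_Lebesgue_pointD[OF Leb(1), of 1] by auto
  obtain dl where dl: "0 < dl" "\<And>a b. a \<le> \<tau> \<Longrightarrow> \<tau> \<le> b \<Longrightarrow> b - a < dl \<Longrightarrow>
     0 \<le> a \<and> b \<le> T \<and> (LINT t:{a..b}|lebesgue. l t) \<le> (l \<tau> + 1) * (b - a)"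
    using upper_Lebesgue_pointD[OF Leb(2), of 1] by auto
  have m_le: "integral {?a h..?b h} m0 \<le> B * h" if "0 < h" "h < dm" for h
    using dm(2)[OF len(2,3)[OF that(1)]] len(1)[OF that(1)] that(2) M
    by (subst integral0_eq(1)) (auto simp: B_def intro: mult_right_mono[where c = "1 + M", THEN order_trans])
  have l_le: "integral {?a h..?b h} l0 \<le> c * h" if "0 < h" "h < dl" for h
    using dl(2)[OF len(2,3)[OF that(1)]] len(1)[OF that(1)] that(2)
    by (subst integral0_eq(2)) (auto simp: c_def)
  have int_nonneg: "0 \<le> integral {?a h..?b h} m0" "0 \<le> integral {?a h..?b h} l0" for h
    by (intro integral_nonneg integrable0 nonneg0)+
  define J where "J = (LINT x|\<mu> \<tau>. (1 + norm x) powr p)"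
  have J: "0 \<le> J" unfolding J_def by (intro integral_nonneg_AE) auto
  define q where "q = (\<epsilon> / 9) powr p"
  have q: "0 < q" using \<epsilon> by (simp add: q_def)
  define e3 where "e3 = 2 * B"
  have e3: "0 \<le> e3" using B by (simp add: e3_def)
  obtain R where R: "(LINT x|\<mu> \<tau>. indicator {x. R < norm x} x * (1 + norm x) powr p) < q / (e3 powr p + 1)"
    using tail_integral_small[OF p \<mu>\<tau>, of "q / (e3 powr p + 1)"] q by (auto simp: add_nonneg_pos)
  have b3: "e3 powr p * (LINT x|\<mu> \<tau>. indicator {x. R < norm x} x * (1 + norm x) powr p) \<le> q"
  proof -
    have "e3 powr p * (LINT x|\<mu> \<tau>. indicator {x. R < norm x} x * (1 + norm x) powr p) \<le> (e3 powr p + 1) * (q / (e3 powr p + 1))"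
      using R by (intro mult_mono) (auto intro: integral_nonneg_AE)
    also have "\<dots> = q" by (simp add: add_nonneg_pos less_imp_neq[symmetric])
    finally show ?thesis .
  qed
  \<comment> \<open>the quadratic error of the flow is negligible for small times\<close>
  define C1 where "C1 = 2 * c * B"
  have C1: "0 \<le> C1" using B c by (simp add: C1_def)
  \<comment> \<open>below this step size the first contribution is at most \<open>\<epsilon> / 9\<close> in \<open>L\<^sup>p\<close>\<close>
  define d0 where "d0 = (\<epsilon> / 9) / ((C1 + 1) * (J powr (1 / p) + 1))"
  have d0: "0 < d0" unfolding d0_def using \<epsilon> C1 by (intro divide_pos_pos mult_pos_pos add_nonneg_pos) auto
  have b1: "(C1 * h) powr p * J \<le> q" if h: "0 < h" "h < d0" for h
  proof -
    have "(C1 * h) * J powr (1 / p) \<le> ((C1 + 1) * d0) * (J powr (1 / p) + 1)"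
      using h C1 d0 by (intro mult_mono) auto
    also have "\<dots> = d0 * ((C1 + 1) * (J powr (1 / p) + 1))" by (simp add: mult_ac)
    also have "\<dots> = \<epsilon> / 9"
    proof -
      define X where "X = (C1 + 1) * (J powr (1 / p) + 1)"
      have "0 < X" unfolding X_def using C1 by (intro mult_pos_pos add_nonneg_pos) auto
      then show ?thesis unfolding d0_def X_def[symmetric] by simp
    qed
    finally have "((C1 * h) * J powr (1 / p)) powr p \<le> (\<epsilon> / 9) powr p"
      using p C1 h by (intro powr_mono2) auto
    moreover have "((C1 * h) * J powr (1 / p)) powr p = (C1 * h) powr p * J"
      using p C1 h J by (simp add: powr_mult powr_powr)
    ultimately show ?thesis by (simp add: q_def)
  qed
  define D where "D = min H (min dm (min dl d0))"
  have D: "0 < D" using H dm dl d0 by (simp add: D_def)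
  obtain k0 where k0: "\<And>k. k0 \<le> k \<Longrightarrow> h k < D"
    using order_tendstoD(2)[OF h(2) D] by (auto simp: eventually_sequentially)
  define h' where "h' k = h (k + k0)" for k
  have h': "0 < h' k" "h' k < D" for k using h(1) k0 by (auto simp: h'_def)
  have h'0: "h' \<longlonglongrightarrow> 0" unfolding h'_def by (rule LIMSEQ_ignore_initial_segment[OF h(2)])
  have "(\<lambda>k. ?b (h' k) - ?a (h' k)) \<longlonglongrightarrow> 0" using h'0 by (simp only: len(1)[OF h'(1)])
  moreover have "?a (h' k) < ?b (h' k)" for k using len(1)[OF h'(1), of k] h'(1)[of k] by linarith
  ultimately obtain w r where w: "w \<in> V \<tau> (\<mu> \<tau>)" and r: "strict_mono (r :: nat \<Rightarrow> nat)"
    and wr0: "\<forall>k x. norm x \<le> R \<longrightarrow> norm ((1 / (?b (h' (r k)) - ?a (h' (r k)))) *\<^sub>R integral {?a (h' (r k))..?b (h' (r k))} (\<lambda>t. u t x) - w x) \<le> \<epsilon> / 9"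
    using averages_accumulate[where a = "\<lambda>k. ?a (h' k)" and b = "\<lambda>k. ?b (h' k)" and \<delta> = "\<epsilon> / 9" and R = R,
        OF \<tau> Leb dense Q len(2)[OF h'(1)] len(3)[OF h'(1)]] \<epsilon> by auto
  have wr: "norm ((1 / h' (r k)) *\<^sub>R integral {?a (h' (r k))..?b (h' (r k))} (\<lambda>t. u t x) - w x) \<le> \<epsilon> / 9"
    if "norm x \<le> R" for k x
    using wr0 that unfolding len(1)[OF h'(1)] by blast
  have wb: "norm (w x) \<le> B * (1 + norm x)" for x
  proof -
    have "norm (w x) \<le> m \<tau> * (1 + norm x + moment p (\<mu> \<tau>))" by (rule V_growth[OF \<tau>'(2) \<mu>\<tau> w])
    also have "\<dots> \<le> m \<tau> * ((1 + M) * (1 + norm x))"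
      using moment_le[OF \<tau>'(1)] mult_nonneg_nonneg[OF M norm_ge_zero, of x] m\<tau>
      by (intro mult_left_mono) (simp_all add: algebra_simps)
    also have "\<dots> \<le> (m \<tau> + 1) * ((1 + M) * (1 + norm x))" using M by (intro mult_right_mono) auto
    finally show ?thesis by (simp add: B_def mult.assoc)
  qed
  have wc: "continuous_on UNIV w" by (rule lipschitz_on_continuous_on[OF V_lipschitz[OF \<tau>'(2) \<mu>\<tau> w]])
  have final: "Wasserstein p (\<mu> (\<tau> + s * h' (r k))) (distr (\<mu> \<tau>) borel (\<lambda>x. x + (s * h' (r k)) *\<^sub>R w x)) \<le> ennreal (\<epsilon> * h' (r k))"
    (is "Wasserstein p (\<mu> (\<tau> + s * ?h)) _ \<le> _") for k
  proof -
    have hk: "0 < ?h" "?h < H" "?h < dm" "?h < dl" "?h < d0" using h'[of "r k"] by (auto simp: D_def)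
    have hin: "?h \<in> {0..H}" using hk by simp
    have "norm (\<Phi> ?h x - (x + (s * ?h) *\<^sub>R w x))
        \<le> ?h * ((C1 * ?h) * (1 + norm x) + \<epsilon> / 9 + (if norm x \<le> R then 0 else e3 * (1 + norm x)))" for x
    proof -
      let ?U = "integral {?a ?h..?b ?h} (\<lambda>t. u t x)"
      have "\<Phi> ?h x - (x + (s * ?h) *\<^sub>R w x) = (\<Phi> ?h x - x - s *\<^sub>R ?U) + (s * ?h) *\<^sub>R ((1 / ?h) *\<^sub>R ?U - w x)"
        using hk(1) by (simp add: algebra_simps)
      then have "norm (\<Phi> ?h x - (x + (s * ?h) *\<^sub>R w x)) \<le> norm (\<Phi> ?h x - x - s *\<^sub>R ?U) + norm ((s * ?h) *\<^sub>R ((1 / ?h) *\<^sub>R ?U - w x))"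
        by (simp only: norm_triangle_ineq)
      also have "norm ((s * ?h) *\<^sub>R ((1 / ?h) *\<^sub>R ?U - w x)) = ?h * norm ((1 / ?h) *\<^sub>R ?U - w x)"
        using hk(1) s1 by (simp add: abs_mult)
      also have "norm (\<Phi> ?h x - x - s *\<^sub>R ?U) \<le> ?h * ((C1 * ?h) * (1 + norm x))"
      proof -
        have l: "integral {?a ?h..?b ?h} l0 \<le> c * ?h" by (rule l_le[OF hk(1,4)])
        have "integral {?a ?h..?b ?h} m0 * (2 * (1 + norm x)) \<le> (B * ?h) * (2 * (1 + norm x))"
          by (rule mult_right_mono[OF m_le[OF hk(1,3)]]) simp
        moreover have "0 \<le> integral {?a ?h..?b ?h} m0 * (2 * (1 + norm x))"
          by (rule mult_nonneg_nonneg[OF int_nonneg(1)]) simp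
        moreover have "0 \<le> c * ?h" using c hk(1) by simp
        ultimately have "integral {?a ?h..?b ?h} l0 * (integral {?a ?h..?b ?h} m0 * (2 * (1 + norm x)))
            \<le> (c * ?h) * ((B * ?h) * (2 * (1 + norm x)))"
          by (intro mult_mono[OF l])
        also have "\<dots> = ?h * ((C1 * ?h) * (1 + norm x))"
          unfolding C1_def by (simp only: mult_ac)
        finally show ?thesis by (rule order_trans[OF est[OF hin]])
      qed
      also have "?h * norm ((1 / ?h) *\<^sub>R ?U - w x) \<le> ?h * (\<epsilon> / 9 + (if norm x \<le> R then 0 else e3 * (1 + norm x)))"
      proof (intro mult_left_mono)
        show "norm ((1 / ?h) *\<^sub>R ?U - w x) \<le> \<epsilon> / 9 + (if norm x \<le> R then 0 else e3 * (1 + norm x))"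
        proof (cases "norm x \<le> R")
          case True
          then show ?thesis using wr[OF True, of k] by simp
        next
          case False
          have "norm ?U \<le> integral {?a ?h..?b ?h} m0 * (1 + norm x)"
            by (rule integral_dominated(3)[OF u_measurable integrable0(1) u_growth0])
          also have "\<dots> \<le> (B * ?h) * (1 + norm x)" using hk by (intro mult_right_mono m_le) auto
          finally have "norm ((1 / ?h) *\<^sub>R ?U) \<le> B * (1 + norm x)"
            using hk(1) by (simp add: divide_le_eq mult_ac)
          then have "norm ((1 / ?h) *\<^sub>R ?U - w x) \<le> e3 * (1 + norm x)"
            using norm_triangle_ineq4[of "(1 / ?h) *\<^sub>R ?U" "w x"] wb[of x] by (simp add: e3_def)
          then show ?thesis using False \<epsilon> by simp
        qed
      qed (use hk in simp)
      finally show ?thesis by (simp add: algebra_simps)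
    qed
    note bd = this
    have gm: "(\<lambda>x. x + (s * ?h) *\<^sub>R w x) \<in> borel_measurable borel"
      by (intro borel_measurable_continuous_onI continuous_intros wc)
    have fm: "\<Phi> ?h \<in> borel_measurable borel"
      by (rule borel_measurable_continuous_onI[OF \<Phi>c[OF hin]])
    have "0 \<le> ?h" "0 \<le> C1 * ?h" "0 \<le> \<epsilon> / 9" using hk(1) C1 \<epsilon> by simp_all
    from Wasserstein_maps_close[OF p \<mu>\<tau> fm gm bd this e3 \<epsilon> b1[OF hk(1,5), unfolded J_def q_def] order_refl b3[unfolded q_def]]
    have "Wasserstein p (distr (\<mu> \<tau>) borel (\<Phi> ?h)) (distr (\<mu> \<tau>) borel (\<lambda>x. x + (s * ?h) *\<^sub>R w x)) \<le> ennreal (\<epsilon> * ?h)" .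
    then show ?thesis unfolding \<mu>\<Phi>[OF hin] .
  qed
  have "\<tau> + s * h' (r k) \<in> {0..T}" for k using h'[of "r k"] by (intro HT) (auto simp: D_def)
  moreover have "strict_mono (\<lambda>k. r k + k0)" using r by (auto simp: strict_mono_def)
  ultimately show ?thesis
    using final w unfolding h'_def by (intro bexI[of _ w] exI[of _ "\<lambda>k. r k + k0"]) auto
qed

lemma infinitely_often_subsequence:
  assumes "\<exists>\<^sub>\<infinity>n. P n"
  obtains r :: "nat \<Rightarrow> nat" where "strict_mono r" "\<And>k. P (r k)"
proof -
  have inf: "infinite {n. P n}" using assms by (simp add: INFM_iff_infinite)
  show ?thesis
    by (rule that[OF strict_mono_enumerate[OF inf]]) (use enumerate_in_set[OF inf] in auto)
qed

lemma Wasserstein_self: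
  fixes \<mu> :: "'a::euclidean_space measure"
  assumes "1 \<le> p" "sets \<mu> = sets borel"
  shows "Wasserstein p \<mu> \<mu> \<le> ennreal 0"
proof -
  have m: "(\<lambda>x. x) \<in> \<mu> \<rightarrow>\<^sub>M borel" unfolding measurable_cong_sets[OF assms(2) refl] by simp
  have "distr \<mu> borel (\<lambda>x. x) = \<mu>" by (rule distr_id2) (rule assms(2)[symmetric])
  with Wasserstein_distr_le[OF assms(1) m m, of 0] show ?thesis by simp
qed

theorem theorem3p2:
  fixes p T :: real
    and V :: "real \<Rightarrow> ('a::euclidean_space) measure \<Rightarrow> ('a \<Rightarrow> 'a) set"
  assumes "1 \<le> p" and "0 < T"
    and "\<And>t \<mu>. t \<in> {0..T} \<Longrightarrow> \<mu> \<in> Pp p \<Longrightarrow> convex_fields (V t \<mu>)"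
    and "CI p T V"
  shows "\<exists>\<T>. \<T> \<subseteq> {0<..<T} \<and> {0<..<T} - \<T> \<in> null_sets lebesgue \<and>
    (\<forall>\<tau>\<in>\<T>. \<forall>\<mu>\<^sub>\<tau>\<in>Pp p. \<forall>\<mu>. solves_continuity_inclusion p T V \<mu> \<and> \<mu> \<tau> = \<mu>\<^sub>\<tau> \<longrightarrow>
      (\<forall>\<epsilon>>0. \<forall>h::nat \<Rightarrow> real. h \<longlonglongrightarrow> 0 \<longrightarrow>
        (\<exists>v\<in>V \<tau> \<mu>\<^sub>\<tau>. \<exists>r::nat \<Rightarrow> nat. strict_mono r \<and>
          (\<forall>k. \<tau> + h (r k) \<in> {0..T} \<and>
             Wasserstein p (\<mu> (\<tau> + h (r k))) (distr \<mu>\<^sub>\<tau> borel (\<lambda>x. x + h (r k) *\<^sub>R v x))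
               \<le> ennreal (\<epsilon> * \<bar>h (r k)\<bar>)))))"
proof -
  obtain N m l L where "CI_field p T V N m l L" using CI_fieldI[OF assms] by blast
  then interpret CI_field p T V N m l L .
  obtain Q :: "'a set" where Qc: "countable Q" and Qd: "\<And>X. open X \<Longrightarrow> X \<noteq> {} \<Longrightarrow> \<exists>d\<in>Q. d \<in> X"
    using countable_dense_setE by metis
  have Q: "\<exists>d\<in>Q. dist x d < e" if "0 < e" for x e
    using Qd[OF open_ball, of x e] that by auto
  obtain \<T> where \<T>: "\<T> \<subseteq> {0<..<T} - N" "{0<..<T} - \<T> \<in> null_sets lebesgue"
    and Leb: "\<And>\<tau>. \<tau> \<in> \<T> \<Longrightarrow> upper_Lebesgue_point T m \<tau> \<and> upper_Lebesgue_point T l \<tau> \<and> upper_Lebesgue_point T L \<tau>"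
    and dense: "\<And>\<tau> xs \<mu> \<eta>. \<lbrakk>\<tau> \<in> \<T>; xs \<in> lists (Q \<times> Q); \<mu> \<in> Pp p; 0 < \<eta>\<rbrakk> \<Longrightarrow>
       \<exists>\<nu>\<in>Pp p. Wasserstein p \<mu> \<nu> \<le> ennreal \<eta> \<and> upper_Lebesgue_point T (\<sigma> xs \<nu>) \<tau>"
    using good_times[OF Qc] by blast
  have "\<exists>v\<in>V \<tau> (\<mu> \<tau>). \<exists>r::nat \<Rightarrow> nat. strict_mono r \<and>
          (\<forall>k. \<tau> + h (r k) \<in> {0..T} \<and>
             Wasserstein p (\<mu> (\<tau> + h (r k))) (distr (\<mu> \<tau>) borel (\<lambda>x. x + h (r k) *\<^sub>R v x))
               \<le> ennreal (\<epsilon> * \<bar>h (r k)\<bar>))"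
    if \<tau>: "\<tau> \<in> \<T>" and \<mu>\<tau>: "\<mu> \<tau> \<in> Pp p" and sol: "solves_continuity_inclusion p T V \<mu>"
      and \<epsilon>: "0 < \<epsilon>" and h: "h \<longlonglongrightarrow> 0" for \<tau> \<mu> \<epsilon> and h :: "nat \<Rightarrow> real"
  proof -
    obtain g u v M where "CI_solution p T V N m l L \<mu> g u v M" using CI_solutionI[OF sol] by blast
    then interpret S: CI_solution p T V N m l L \<mu> g u v M .
    have \<tau>N: "\<tau> \<in> {0<..<T} - N" and \<tau>T: "\<tau> \<in> {0..T}" using \<T>(1) \<tau> by auto
    have signed: ?thesis if s: "s = 1 \<or> s = -1" and r: "strict_mono r" and pos: "\<And>k. 0 < s * h (r k)"
      for s and r :: "nat \<Rightarrow> nat"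
    proof -
      have ss: "s * (s * x) = x" for x :: real using s by auto
      have "(\<lambda>k. h (r k)) \<longlonglongrightarrow> 0" using LIMSEQ_subseq_LIMSEQ[OF h r] by (simp add: o_def)
      then have lim: "(\<lambda>k. s * h (r k)) \<longlonglongrightarrow> 0" using tendsto_mult_right_zero by blast
      obtain w r' where w: "w \<in> V \<tau> (\<mu> \<tau>)" and r': "strict_mono (r' :: nat \<Rightarrow> nat)"
        and W: "\<And>k. \<tau> + s * (s * h (r (r' k))) \<in> {0..T} \<and>
          Wasserstein p (\<mu> (\<tau> + s * (s * h (r (r' k)))))
            (distr (\<mu> \<tau>) borel (\<lambda>x. x + (s * (s * h (r (r' k)))) *\<^sub>R w x)) \<le> ennreal (\<epsilon> * (s * h (r (r' k))))"
        using S.one_sided_expansion[OF \<tau>N _ _ _ dense[OF \<tau> _ \<mu>\<tau>] Q s pos lim \<epsilon>] Leb[OF \<tau>] by blast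
      have ab: "s * h (r k) = \<bar>h (r k)\<bar>" for k using pos[of k] s by auto
      have "strict_mono (\<lambda>k. r (r' k))" using strict_mono_o[OF r r'] by (simp add: o_def)
      moreover have "\<tau> + h (r (r' k)) \<in> {0..T} \<and>
          Wasserstein p (\<mu> (\<tau> + h (r (r' k)))) (distr (\<mu> \<tau>) borel (\<lambda>x. x + h (r (r' k)) *\<^sub>R w x))
            \<le> ennreal (\<epsilon> * \<bar>h (r (r' k))\<bar>)" for k
        using W[of k] unfolding ss by (simp only: ab)
      ultimately show ?thesis using w by (intro bexI[of _ w] exI[of _ "\<lambda>k. r (r' k)"]) auto
    qed
    \<comment> \<open>one of the three signs occurs infinitely often; for vanishing steps there is nothing to estimate\<close>
    consider "\<exists>\<^sub>\<infinity>n. h n = 0" | "\<exists>\<^sub>\<infinity>n. 0 < h n" | "\<exists>\<^sub>\<infinity>n. h n < 0"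
    proof -
      have "\<exists>\<^sub>\<infinity>n. h n = 0 \<or> 0 < h n \<or> h n < 0"
        by (rule INFM_mono[of "\<lambda>_. True"]) (auto simp: INFM_const)
      then show thesis using that by (auto simp: INFM_disj_distrib)
    qed
    then show ?thesis
    proof cases
      case 1
      then obtain r where r: "strict_mono (r :: nat \<Rightarrow> nat)" "\<And>k. h (r k) = 0"
        by (rule infinitely_often_subsequence) (rule that)
      obtain w where w: "w \<in> V \<tau> (\<mu> \<tau>)" using V_nonempty[OF \<tau>T \<mu>\<tau>] by blast
      have sb: "sets (\<mu> \<tau>) = sets borel" by (rule PpD(2)[OF \<mu>\<tau> p])
      then show ?thesis
        using w r \<tau>T Wasserstein_self[OF p sb]
        by (intro bexI[of _ w] exI[of _ r]) (auto simp: distr_id2)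
    next
      case 2
      then obtain r where r: "strict_mono (r :: nat \<Rightarrow> nat)" "\<And>k. 0 < h (r k)"
        by (rule infinitely_often_subsequence) (rule that)
      then show ?thesis by (intro signed[of 1 r]) auto
    next
      case 3
      then obtain r where r: "strict_mono (r :: nat \<Rightarrow> nat)" "\<And>k. h (r k) < 0"
        by (rule infinitely_often_subsequence) (rule that)
      then show ?thesis by (intro signed[of "-1" r]) auto
    qed
  qed
  then show ?thesis using \<T> by (intro exI[of _ \<T>]) blast
qed

end
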